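(* Let $g:\mathbb{R}\to\mathbb{R}$ be a function of class $C^4$ with $g,g',g''\in L^1(\mathbb{R})$, such that for all $s\in[-1,2]$ the matrices $$\Phi(s)=\begin{pmatrix}g'(s)&g''(s)\\ g''(s)&g^{(3)}(s)\end{pmatrix}\quad\text{and}\quad \Phi'(s)=\begin{pmatrix}g''(s)&g^{(3)}(s)\\ g^{(3)}(s)&g^{(4)}(s)\end{pmatrix}$$ are invertible. For $\lambda>0$ let $\{\tau_{\lambda,i}\}_i$ be the points of a Poisson point process on $\mathbb{R}$ with intensity $\lambda\,ds$, $X_\lambda(t)=\sum_i g(t-\tau_{\lambda,i})$, $Z_\lambda(t)=\frac{1}{\sqrt\lambda}\bigl(X_\lambda(t)-\mathbb{E}(X_\lambda(t))\bigr)$, and $\gamma_\lambda=\#\{i:\tau_{\lambda,i}\in[-1,1]\}$. Then $$C_{Z_\lambda}(\alpha,[0,1]\mid\gamma_\lambda\ge\lambda)\longrightarrow C_B(\alpha,[0,1])=\frac1\pi\left(\frac{m_2}{m_0}\right)^{1/2}e^{-\alpha^2/2m_0}\quad\text{as }\lambda\to+\infty,$$ uniformly in $\alpha\in\mathbb{R}$, where $m_0=\int_{\mathbb{R}}g(s)^2\,ds$ and $m_2=\int_{\mathbb{R}}g'(s)^2\,ds$.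
   Context: For a process $Y$, $N_Y(\alpha,[0,1])=\#\{t\in[0,1]:Y(t)=\alpha\}$, $C_Y(\alpha,[0,1])=\mathbb{E}(N_Y(\alpha,[0,1]))$, and for an event $E$ of positive probability $C_Y(\alpha,[0,1]\mid E)=\mathbb{E}(N_Y(\alpha,[0,1])\mid E)$. $B$ denotes the stationary centered Gaussian process, almost surely and mean square continuously differentiable, with covariance $\mathrm{Cov}(B(t),B(t'))=\int_{\mathbb{R}}g(t-s)g(t'-s)\,ds$. *)

theory Defs
  imports "HOL-Probability.Probability"
begin

(* Cardinality with value \<infinity> on infinite sets (card would give 0). *)
definition ecount :: "'a set \<Rightarrow> ennreal" where
  "ecount A = emeasure (count_space UNIV) A"

definition num_crossings :: "(real \<Rightarrow> 'a \<Rightarrow> real) \<Rightarrow> real \<Rightarrow> real set \<Rightarrow> 'a \<Rightarrow> ennreal" where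
  "num_crossings Y \<alpha> T \<omega> = ecount {t \<in> T. Y t \<omega> = \<alpha>}"

(* The expectation is taken in [0,\<infinity>].  For processes with almost surely continuous paths the number
   of crossings agrees almost everywhere with a measurable function, so the integral is the
   genuine one even if M is not complete. *)
definition mean_crossings :: "'a measure \<Rightarrow> (real \<Rightarrow> 'a \<Rightarrow> real) \<Rightarrow> real \<Rightarrow> real set \<Rightarrow> ennreal" where
  "mean_crossings M Y \<alpha> T = (\<integral>\<^sup>+\<omega>. num_crossings Y \<alpha> T \<omega> \<partial>M)"

(* uniform_measure M E is the conditional probability A \<mapsto> P(A \<inter> E) / P(E). *)
definition cond_mean_crossings ::
    "'a measure \<Rightarrow> 'a set \<Rightarrow> (real \<Rightarrow> 'a \<Rightarrow> real) \<Rightarrow> real \<Rightarrow> real set \<Rightarrow> ennreal" where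
  "cond_mean_crossings M E Y \<alpha> T = mean_crossings (uniform_measure M E) Y \<alpha> T"

definition class_C :: "nat \<Rightarrow> (real \<Rightarrow> real) \<Rightarrow> bool" where
  "class_C k f \<longleftrightarrow> (\<forall>j<k. \<forall>x. (deriv ^^ j) f field_differentiable (at x)) \<and>
     continuous_on UNIV ((deriv ^^ k) f)"

definition Phi :: "(real \<Rightarrow> real) \<Rightarrow> real \<Rightarrow> real^2^2" where
  "Phi g s = vector [vector [deriv g s, (deriv ^^ 2) g s],
                     vector [(deriv ^^ 2) g s, (deriv ^^ 3) g s]]"

definition Phi' :: "(real \<Rightarrow> real) \<Rightarrow> real \<Rightarrow> real^2^2" where
  "Phi' g s = vector [vector [(deriv ^^ 2) g s, (deriv ^^ 3) g s],
                      vector [(deriv ^^ 3) g s, (deriv ^^ 4) g s]]"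

definition num_points :: "(nat \<Rightarrow> 'a \<Rightarrow> real) \<Rightarrow> real set \<Rightarrow> 'a \<Rightarrow> ennreal" where
  "num_points \<tau> A \<omega> = ecount {i. \<tau> i \<omega> \<in> A}"

(* Homogeneous Poisson point process on the real line, its points being enumerated by nat: since the
   intensity has infinite mass, there are almost surely infinitely many points. *)
definition poisson_point_process :: "'a measure \<Rightarrow> real \<Rightarrow> (nat \<Rightarrow> 'a \<Rightarrow> real) \<Rightarrow> bool" where
  "poisson_point_process M lam \<tau> \<longleftrightarrow>
     prob_space M \<and>
     (\<forall>i. \<tau> i \<in> borel_measurable M) \<and>
     (\<forall>A\<in>sets borel. emeasure lborel A < \<infinity> \<longrightarrow>
        (\<forall>k. measure M {\<omega> \<in> space M. num_points \<tau> A \<omega> = of_nat k} =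
           (lam * measure lborel A) ^ k / fact k * exp (- (lam * measure lborel A)))) \<and>
     (\<forall>(n::nat) A. (\<forall>j<n. A j \<in> sets borel) \<and> disjoint_family_on A {..<n} \<longrightarrow>
        prob_space.indep_vars M (\<lambda>_. borel) (\<lambda>j. num_points \<tau> (A j)) {..<n})"

(* The unordered sum infsum is 0 where the family is not absolutely summable; for integrable g this
   is a null event for each t. *)
definition shot_noise :: "(real \<Rightarrow> real) \<Rightarrow> (nat \<Rightarrow> 'a \<Rightarrow> real) \<Rightarrow> real \<Rightarrow> 'a \<Rightarrow> real" where
  "shot_noise g \<tau> t \<omega> = (\<Sum>\<^sub>\<infinity>i. g (t - \<tau> i \<omega>))"

definition normalized_shot_noise ::
    "'a measure \<Rightarrow> real \<Rightarrow> (real \<Rightarrow> real) \<Rightarrow> (nat \<Rightarrow> 'a \<Rightarrow> real) \<Rightarrow> real \<Rightarrow> 'a \<Rightarrow> real" where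
  "normalized_shot_noise M lam g \<tau> t \<omega> =
     1 / sqrt lam * (shot_noise g \<tau> t \<omega> - (LINT \<omega>'|M. shot_noise g \<tau> t \<omega>'))"

(* Degenerate Gaussian laws (point masses) are included. *)
definition gaussian_rv :: "'a measure \<Rightarrow> ('a \<Rightarrow> real) \<Rightarrow> bool" where
  "gaussian_rv M X \<longleftrightarrow> X \<in> borel_measurable M \<and>
     (\<exists>\<mu>. (AE \<omega> in M. X \<omega> = \<mu>) \<or> (\<exists>\<sigma>>0. distributed M lborel X (normal_density \<mu> \<sigma>)))"

definition gaussian_process :: "'a measure \<Rightarrow> (real \<Rightarrow> 'a \<Rightarrow> real) \<Rightarrow> bool" where
  "gaussian_process M Y \<longleftrightarrow>
     (\<forall>T c. finite T \<longrightarrow> gaussian_rv M (\<lambda>\<omega>. \<Sum>t\<in>T. c t * Y t \<omega>))"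

definition centered_process :: "'a measure \<Rightarrow> (real \<Rightarrow> 'a \<Rightarrow> real) \<Rightarrow> bool" where
  "centered_process M Y \<longleftrightarrow> (\<forall>t. integrable M (Y t) \<and> (LINT \<omega>|M. Y t \<omega>) = 0)"

definition stationary_process :: "'a measure \<Rightarrow> (real \<Rightarrow> 'a \<Rightarrow> real) \<Rightarrow> bool" where
  "stationary_process M Y \<longleftrightarrow>
     (\<forall>T h. finite T \<longrightarrow>
        distr M (PiM T (\<lambda>_. borel)) (\<lambda>\<omega>. \<lambda>t\<in>T. Y (t + h) \<omega>) =
        distr M (PiM T (\<lambda>_. borel)) (\<lambda>\<omega>. \<lambda>t\<in>T. Y t \<omega>))"

definition covariance :: "'a measure \<Rightarrow> ('a \<Rightarrow> real) \<Rightarrow> ('a \<Rightarrow> real) \<Rightarrow> real" where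
  "covariance M X Y =
     (LINT \<omega>|M. (X \<omega> - (LINT \<omega>'|M. X \<omega>')) * (Y \<omega> - (LINT \<omega>'|M. Y \<omega>')))"

definition as_C1 :: "'a measure \<Rightarrow> (real \<Rightarrow> 'a \<Rightarrow> real) \<Rightarrow> bool" where
  "as_C1 M Y \<longleftrightarrow> (AE \<omega> in M. (\<lambda>t. Y t \<omega>) C1_differentiable_on UNIV)"

definition square_integrable_rv :: "'a measure \<Rightarrow> ('a \<Rightarrow> real) \<Rightarrow> bool" where
  "square_integrable_rv M X \<longleftrightarrow> X \<in> borel_measurable M \<and> integrable M (\<lambda>\<omega>. (X \<omega>)\<^sup>2)"

(* D is the mean square derivative of Y, and it is mean square continuous. *)
definition mean_square_C1 :: "'a measure \<Rightarrow> (real \<Rightarrow> 'a \<Rightarrow> real) \<Rightarrow> bool" where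
  "mean_square_C1 M Y \<longleftrightarrow>
     (\<forall>t. square_integrable_rv M (Y t)) \<and>
     (\<exists>D. (\<forall>t. square_integrable_rv M (D t)) \<and>
        (\<forall>t. ((\<lambda>h. LINT \<omega>|M. ((Y (t + h) \<omega> - Y t \<omega>) / h - D t \<omega>)\<^sup>2) \<longlongrightarrow> 0) (at 0)) \<and>
        (\<forall>t. ((\<lambda>s. LINT \<omega>|M. (D s \<omega> - D t \<omega>)\<^sup>2) \<longlongrightarrow> 0) (at t)))"

definition limit_gaussian_process ::
    "'a measure \<Rightarrow> (real \<Rightarrow> real) \<Rightarrow> (real \<Rightarrow> 'a \<Rightarrow> real) \<Rightarrow> bool" where
  "limit_gaussian_process M g B \<longleftrightarrow>
     prob_space M \<and> gaussian_process M B \<and> centered_process M B \<and> stationary_process M B \<and>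
     as_C1 M B \<and> mean_square_C1 M B \<and>
     (\<forall>t t'. covariance M (B t) (B t') = (LINT s|lborel. g (t - s) * g (t' - s)))"

(* Uniform convergence of [0,\<infinity>]-valued functions to a real-valued limit: the functions are
   eventually finite everywhere and converge uniformly as real-valued functions. *)
definition uniform_limit_ennreal ::
    "'a set \<Rightarrow> ('i \<Rightarrow> 'a \<Rightarrow> ennreal) \<Rightarrow> ('a \<Rightarrow> ennreal) \<Rightarrow> 'i filter \<Rightarrow> bool" where
  "uniform_limit_ennreal S f l F \<longleftrightarrow>
     (\<forall>x\<in>S. l x < \<infinity>) \<and>
     (\<forall>\<^sub>F n in F. \<forall>x\<in>S. f n x < \<infinity>) \<and>
     uniform_limit S (\<lambda>n x. enn2real (f n x)) (\<lambda>x. enn2real (l x)) F"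

end

theory Submission
  imports Defs
begin

text \<open>
  Let \<open>V = (Y (t + h) - Y t) / h\<close>. The probability that the level \<open>\<alpha>\<close> separates \<open>Y t\<close> from \<open>Y (t + h)\<close> is
  \<open>h\<close> times the average over \<open>\<theta>\<close> in the unit interval of the mean of \<open>\<bar>V\<bar>\<close> against the point mass at \<open>\<alpha>\<close> of
  \<open>Y t + \<theta> * h * V\<close>. After Gaussian smoothing of the point mass, and writing \<open>\<bar>x\<bar>\<close> as a multiple of the integral
  of \<open>(1 - cos (v * x)) / v\<^sup>2\<close> over \<open>v > 0\<close>, this becomes an integral of the characteristic function of the pair
  \<open>(Y t + \<theta> * h * V, V)\<close> at \<open>(u, v)\<close>. If that function decays in \<open>u\<close> and differs from the Gaussian one by at most
  \<open>\<eta>\<close> times a polynomial, interpolation gives Rice's value up to a multiple of \<open>\<eta> powr (1/8)\<close>, for all \<open>\<alpha>\<close> at once.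
  Summing over dyadic intervals controls the expected number of sign changes of \<open>Y - \<alpha>\<close>. Sign changes at level \<open>\<alpha>\<close> bound
  the crossings from below, and half the sign changes at the levels \<open>\<alpha> + \<delta>\<close> and \<open>\<alpha> - \<delta>\<close> bound them from above
  for small \<open>\<delta>\<close>; continuity of Rice's value in \<open>\<alpha>\<close> closes the gap.

  For the limit process \<open>\<eta> = 0\<close>. For the shot noise the Taylor expansion of the characteristic functional of the Poisson
  process gives \<open>\<eta>\<close> of order \<open>1 / sqrt lam\<close>, and the decay comes from the conditioning: given \<open>k\<close> points in \<open>{-1..1}\<close> these
  are independent and uniform, so that the characteristic function is at most the \<open>k\<close>-th power of a normalized oscillatory
  integral, whose phase has no degenerate critical point because \<open>Phi g s\<close> is invertible.
\<close>

section \<open>Oscillatory integrals\<close>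

text \<open>Conditioning is the crux. If \<open>g\<close> has compact support, the unconditioned
  shot noise is constant on the unit interval with positive probability: some level is then hit
  infinitely often, and the characteristic function of \<open>Y t\<close> cannot tend to 0.
  Closeness to the Gaussian characteristic function is lost cubically in \<open>(u, v)\<close>, so
  it is not integrable against du dv / v^2 by itself. Decay handles large \<open>u\<close>, the
  second moment of the slope handles small \<open>v\<close>, and an eighth root of a product of such
  bounds is integrable. Hence the power 1/8, and hence a decay of order 16: its eighth root is of
  order 2, one factor absorbing the growth in \<open>u\<close>, the other being integrated. The
  shape 1 / (1 + c * u^2) ^ 16 survives the conditioning: replacing \<open>u\<close> by
  \<open>u / sqrt lam\<close> and raising to a power proportional to \<open>lam\<close> reproduces
  it by Bernoulli's inequality. Difference quotients stand in for derivatives, so that limit process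
  and shot noise enter one estimate. The Poisson process is specified by counts, hence the passage
  through simple functions to its characteristic functional.\<close>

lemma has_vector_derivative_cis:
  assumes "(F has_real_derivative F') (at x within A)"
  shows "((\<lambda>x. cis (F x)) has_vector_derivative F' *\<^sub>R (\<i> * cis (F x))) (at x within A)"
  using has_derivative_cis[OF assms[unfolded has_field_derivative_def]]
  by (simp add: has_vector_derivative_def mult.commute)

text \<open>Integration by parts: \<open>G\<close> is \<open>cis (F x)\<close> divided by
  \<open>\<i> * F' x\<close>, and its derivative is \<open>cis (F x)\<close> up to an error of
  modulus \<open>\<bar>F'' x\<bar> / (F' x)\<^sup>2\<close>. The two boundary terms give 2 / m, the
  error gives the rest.\<close>

lemma oscillatory_by_parts:
  fixes F F' F'' :: "real \<Rightarrow> real"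
  assumes "p \<le> q"
    and F: "\<And>x. x \<in> {p..q} \<Longrightarrow> (F has_real_derivative F' x) (at x)"
    and F': "\<And>x. x \<in> {p..q} \<Longrightarrow> (F' has_real_derivative F'' x) (at x)"
    and m: "0 < m" "\<And>x. x \<in> {p..q} \<Longrightarrow> m \<le> \<bar>F' x\<bar>"
    and L: "\<And>x. x \<in> {p..q} \<Longrightarrow> \<bar>F'' x\<bar> \<le> L"
  shows "norm (integral {p..q} (\<lambda>x. cis (F x))) \<le> 2 / m + (q - p) * L / m\<^sup>2"
proof -
  define G where "G x = (1 / F' x) *\<^sub>R (- \<i> * cis (F x))" for x
  define G' where "G' x = cis (F x) + (F'' x / (F' x)\<^sup>2) *\<^sub>R (\<i> * cis (F x))" for x
  have nz: "F' x \<noteq> 0" if "x \<in> {p..q}" for x using m(1) m(2)[OF that] by auto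
  have dG: "(G has_vector_derivative G' x) (at x within {p..q})" if x: "x \<in> {p..q}" for x
  proof -
    have 1: "((\<lambda>x. 1 / F' x) has_real_derivative - (F'' x / (F' x)\<^sup>2)) (at x)"
      by (rule derivative_eq_intros F'[OF x] nz[OF x] refl)+ (simp add: power2_eq_square)
    have 2: "((\<lambda>x. - \<i> * cis (F x)) has_vector_derivative - \<i> * (F' x *\<^sub>R (\<i> * cis (F x)))) (at x)"
      by (intro has_vector_derivative_mult_right has_vector_derivative_cis F x)
    have "(G has_vector_derivative ((1 / F' x) *\<^sub>R (- \<i> * (F' x *\<^sub>R (\<i> * cis (F x))))
        + (- (F'' x / (F' x)\<^sup>2)) *\<^sub>R (- \<i> * cis (F x)))) (at x)"
      unfolding G_def[abs_def] by (rule has_vector_derivative_scaleR[OF 1 2])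
    also have "((1 / F' x) *\<^sub>R (- \<i> * (F' x *\<^sub>R (\<i> * cis (F x))))
        + (- (F'' x / (F' x)\<^sup>2)) *\<^sub>R (- \<i> * cis (F x))) = G' x"
      using nz[OF x] by (simp add: G'_def)
    finally show ?thesis by (rule has_vector_derivative_at_within)
  qed
  have hG: "(G' has_integral (G q - G p)) {p..q}"
    by (rule fundamental_theorem_of_calculus[OF assms(1) dG])
  have "continuous_on {p..q} (\<lambda>x. cis (F x))"
    by (intro continuous_intros continuous_at_imp_continuous_on) (use F DERIV_isCont in blast)
  then have "((\<lambda>x. cis (F x)) has_integral (integral {p..q} (\<lambda>x. cis (F x)))) {p..q}"
    using integrable_continuous_real integrable_integral by blast
  from has_integral_diff[OF this hG]
  have h: "((\<lambda>x. cis (F x) - G' x) has_integral (integral {p..q} (\<lambda>x. cis (F x)) - (G q - G p))) (cbox p q)"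
    by simp
  have bd: "norm (cis (F x) - G' x) \<le> L / m\<^sup>2" if x: "x \<in> cbox p q" for x
  proof -
    have x': "x \<in> {p..q}" using x by simp
    have "norm (cis (F x) - G' x) = \<bar>F'' x\<bar> / (F' x)\<^sup>2"
      by (simp add: G'_def norm_mult)
    also have "\<dots> \<le> L / m\<^sup>2"
      using L[OF x'] m(2)[OF x'] m(1) nz[OF x'] power_mono[of m "\<bar>F' x\<bar>" 2] by (intro frac_le) auto
    finally show ?thesis .
  qed
  have "\<bar>F'' p\<bar> \<le> L" using L[of p] assms(1) by simp
  then have "L \<ge> 0" by linarith
  then have "norm (integral {p..q} (\<lambda>x. cis (F x)) - (G q - G p)) \<le> L / m\<^sup>2 * measure lborel (cbox p q)"
    by (intro has_integral_bound[OF _ h bd]) auto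
  then have 1: "norm (integral {p..q} (\<lambda>x. cis (F x)) - (G q - G p)) \<le> (q - p) * L / m\<^sup>2"
    using assms(1) by (simp add: mult.commute)
  have nG: "norm (G x) \<le> 1 / m" if x: "x \<in> {p..q}" for x
    using m(2)[OF x] m(1) by (simp add: G_def norm_mult frac_le)
  have "norm (G q - G p) \<le> 2 / m"
    using nG[of p] nG[of q] assms(1) norm_triangle_ineq4[of "G q" "G p"] by (simp add: field_simps)
  then show ?thesis
    using 1 norm_triangle_sub[of "integral {p..q} (\<lambda>x. cis (F x))" "G q - G p"] by linarith
qed

text \<open>Take for \<open>s\<close> a minimum of \<open>\<bar>f\<bar>\<close>. If
  \<open>f s = 0\<close>, the mean value theorem suffices. Otherwise \<open>f\<close> has no zero,
  so \<open>f x\<close> and \<open>f s\<close> have the same sign and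
  \<open>\<bar>f x - f s\<bar>\<close> is at most \<open>\<bar>f x\<bar>\<close>. Applied to
  \<open>F'\<close>, this turns a lower bound for \<open>\<bar>F''\<bar>\<close> into control of the
  distance to the only possible critical point.\<close>

lemma abs_lower_bound_from_min:
  fixes f f' :: "real \<Rightarrow> real"
  assumes "p \<le> q"
    and f: "\<And>x. x \<in> {p..q} \<Longrightarrow> (f has_real_derivative f' x) (at x)"
    and lb: "\<And>x. x \<in> {p..q} \<Longrightarrow> a \<le> \<bar>f' x\<bar>"
  shows "\<exists>s\<in>{p..q}. \<forall>x\<in>{p..q}. a * \<bar>x - s\<bar> \<le> \<bar>f x\<bar>"
proof -
  have cont: "continuous_on {p..q} f"
    by (intro continuous_at_imp_continuous_on) (use f DERIV_isCont in blast)
  have mvt1: "a * (y - x) \<le> \<bar>f y - f x\<bar>" if xy: "x < y" "x \<in> {p..q}" "y \<in> {p..q}" for x y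
  proof -
    obtain z where z: "z > x" "z < y" "f y - f x = (y - x) * f' z"
      using MVT2[OF xy(1), of f f'] f xy by auto
    then have "\<bar>f y - f x\<bar> = (y - x) * \<bar>f' z\<bar>" using xy by (simp add: abs_mult)
    moreover have "a \<le> \<bar>f' z\<bar>" using lb[of z] z xy by auto
    ultimately show ?thesis using xy by (simp add: mult.commute mult_left_mono)
  qed
  have mvt: "a * \<bar>x - y\<bar> \<le> \<bar>f x - f y\<bar>" if "x \<in> {p..q}" "y \<in> {p..q}" for x y
    using mvt1[of x y] mvt1[of y x] that by (cases x y rule: linorder_cases) (auto simp: abs_minus_commute)
  obtain s where s: "s \<in> {p..q}" "\<forall>x\<in>{p..q}. \<bar>f s\<bar> \<le> \<bar>f x\<bar>"
    using continuous_attains_inf[of "{p..q}" "\<lambda>x. \<bar>f x\<bar>"] assms(1) continuous_on_rabs[OF cont]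
    by auto
  have "a * \<bar>x - s\<bar> \<le> \<bar>f x\<bar>" if x: "x \<in> {p..q}" for x
  proof (cases "f s = 0")
    case True
    then show ?thesis using mvt[OF x s(1)] by simp
  next
    case False
    have same: "f x * f s > 0"
    proof (rule ccontr)
      assume "\<not> f x * f s > 0"
      moreover have "f x \<noteq> 0" using s(2) x False by fastforce
      ultimately have sg: "(f x < 0 \<and> f s > 0) \<or> (f x > 0 \<and> f s < 0)"
        using False by (auto simp: zero_less_mult_iff not_less linorder_neq_iff)
      have "\<exists>z\<in>{p..q}. f z = 0"
      proof -
        have "is_interval {p..q}" by (rule is_interval_cc)
        then have "connected (f ` {p..q})"
          using cont connected_continuous_image is_interval_connected by blast
        then show ?thesis
          using sg x s(1) connected_contains_Icc[of "f ` {p..q}"] 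
          by (smt (verit, ccfv_threshold) atLeastAtMost_iff image_iff subsetD)
      qed
      then show False using s(2) False by fastforce
    qed
    moreover have "\<bar>f s\<bar> \<le> \<bar>f x\<bar>" using s(2) x by blast
    ultimately have "\<bar>f x - f s\<bar> \<le> \<bar>f x\<bar>"
      unfolding zero_less_mult_iff by linarith
    then show ?thesis using mvt[OF x s(1)] by linarith
  qed
  then show ?thesis using s(1) by blast
qed

text \<open>Within distance \<open>r\<close> of \<open>s\<close> the integrand is estimated by 1; on
  the at most two remaining pieces \<open>\<bar>F'\<bar>\<close> is at least \<open>a * r\<close>
  and integration by parts applies.\<close>

lemma oscillatory_one_point:
  fixes F F' F'' :: "real \<Rightarrow> real"
  assumes pq: "p \<le> q" "q - p \<le> 1" and r: "0 < r" and a: "0 < a"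
    and F: "\<And>x. x \<in> {p..q} \<Longrightarrow> (F has_real_derivative F' x) (at x)"
    and F': "\<And>x. x \<in> {p..q} \<Longrightarrow> (F' has_real_derivative F'' x) (at x)"
    and lb: "\<And>x. x \<in> {p..q} \<Longrightarrow> a * \<bar>x - s\<bar> \<le> \<bar>F' x\<bar>"
    and L: "\<And>x. x \<in> {p..q} \<Longrightarrow> \<bar>F'' x\<bar> \<le> L" and s: "s \<in> {p..q}"
  shows "norm (integral {p..q} (\<lambda>x. cis (F x))) \<le> 2 * r + 2 * (2 / (a * r) + L / (a * r)\<^sup>2)"
proof -
  define b where "b = 2 / (a * r) + L / (a * r)\<^sup>2"
  have "\<bar>F'' p\<bar> \<le> L" using L[of p] assms(1) by simp
  then have L0: "L \<ge> 0" by linarith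
  have b0: "0 \<le> b" using L0 a r by (simp add: b_def)
  have cont: "continuous_on {p..q} (\<lambda>x. cis (F x))"
    by (intro continuous_intros continuous_at_imp_continuous_on) (use F DERIV_isCont in blast)
  have int: "(\<lambda>x. cis (F x)) integrable_on {u..v}" if "p \<le> u" "v \<le> q" for u v
    by (rule integrable_continuous_real, rule continuous_on_subset[OF cont]) (use that in auto)
  have far: "norm (integral {u..v} (\<lambda>x. cis (F x))) \<le> b"
    if uv: "u \<le> v" "p \<le> u" "v \<le> q" "\<And>x. x \<in> {u..v} \<Longrightarrow> r \<le> \<bar>x - s\<bar>" for u v
  proof -
    have "norm (integral {u..v} (\<lambda>x. cis (F x))) \<le> 2 / (a * r) + (v - u) * L / (a * r)\<^sup>2"
    proof (rule oscillatory_by_parts[OF uv(1), where F'=F' and F''=F''])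
      show "a * r \<le> \<bar>F' x\<bar>" if "x \<in> {u..v}" for x
      proof -
        have "a * r \<le> a * \<bar>x - s\<bar>" using uv(4)[OF that] a by (intro mult_left_mono) auto
        also have "\<dots> \<le> \<bar>F' x\<bar>" using that uv(2,3) by (intro lb) auto
        finally show ?thesis .
      qed
    qed (use F F' L uv a r in auto)
    also have "\<dots> \<le> b" unfolding b_def
      using uv pq L0 a r mult_right_mono[of "v - u" 1 L] by (intro add_left_mono divide_right_mono) auto
    finally show ?thesis .
  qed
  define u v where "u = max p (s - r)" and "v = min q (s + r)"
  have uv: "p \<le> u" "u \<le> v" "v \<le> q" "v - u \<le> 2 * r" using s r by (auto simp: u_def v_def)
  have mid: "norm (integral {u..v} (\<lambda>x. cis (F x))) \<le> 1 * (v - u)"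
    by (intro integral_bound continuous_on_subset[OF cont]) (use uv in auto)
  have left: "norm (integral {p..u} (\<lambda>x. cis (F x))) \<le> b"
  proof (cases "p < s - r")
    case True
    then show ?thesis using r s by (intro far) (auto simp: u_def)
  next
    case False
    then have "u = p" by (simp add: u_def)
    then show ?thesis using b0 by simp
  qed
  have right: "norm (integral {v..q} (\<lambda>x. cis (F x))) \<le> b"
  proof (cases "s + r < q")
    case True
    then show ?thesis using r s by (intro far) (auto simp: v_def)
  next
    case False
    then have "v = q" by (simp add: v_def)
    then show ?thesis using b0 by simp
  qed
  have "integral {p..q} (\<lambda>x. cis (F x)) = integral {p..u} (\<lambda>x. cis (F x))
      + (integral {u..v} (\<lambda>x. cis (F x)) + integral {v..q} (\<lambda>x. cis (F x)))"
    using Henstock_Kurzweil_Integration.integral_combine[of p u q "\<lambda>x. cis (F x)"] Henstock_Kurzweil_Integration.integral_combine[of u v q "\<lambda>x. cis (F x)"]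
      int uv by auto
  moreover have "norm (integral {p..u} (\<lambda>x. cis (F x))
      + (integral {u..v} (\<lambda>x. cis (F x)) + integral {v..q} (\<lambda>x. cis (F x)))) \<le> b + (2 * r + b)"
    using mid left right uv(4) by (intro norm_triangle_mono) auto
  ultimately show ?thesis by (simp add: b_def)
qed

text \<open>The condition \<open>8 * C * \<delta> \<le> c\<close> keeps the variation of
  \<open>F'\<close> and of \<open>F''\<close> below \<open>c * \<rho> / 8\<close>, so whichever of
  the two is large at \<open>p\<close> stays large on the whole interval. Both cases are cast into
  the same linear lower bound for \<open>\<bar>F'\<bar>\<close>; in the first one
  \<open>s = p\<close> serves because the interval has length at most 1.\<close>

lemma oscillatory_short_interval:
  fixes F F' F'' :: "real \<Rightarrow> real"
  assumes pq: "p \<le> q" "q - p \<le> \<delta>" "\<delta> \<le> 1" and c: "0 < c" "0 \<le> C" "8 * C * \<delta> \<le> c" and \<rho>: "1 \<le> \<rho>"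
    and F: "\<And>x. x \<in> {p..q} \<Longrightarrow> (F has_real_derivative F' x) (at x)"
    and F': "\<And>x. x \<in> {p..q} \<Longrightarrow> (F' has_real_derivative F'' x) (at x)"
    and lb: "\<And>x. x \<in> {p..q} \<Longrightarrow> c * \<rho> \<le> \<bar>F' x\<bar> + \<bar>F'' x\<bar>"
    and L: "\<And>x. x \<in> {p..q} \<Longrightarrow> \<bar>F'' x\<bar> \<le> C * \<rho>"
    and Lip: "\<And>x y. x \<in> {p..q} \<Longrightarrow> y \<in> {p..q} \<Longrightarrow> \<bar>F'' x - F'' y\<bar> \<le> C * \<rho> * \<bar>x - y\<bar>"
  shows "norm (integral {p..q} (\<lambda>x. cis (F x))) \<le> (2 + 16 / c + 32 * C / c\<^sup>2) * \<rho> powr (-1/4)"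
proof -
  have small: "C * \<rho> * \<bar>x - p\<bar> \<le> c * \<rho> / 8" if "x \<in> {p..q}" for x
  proof -
    have "C * \<rho> * \<bar>x - p\<bar> \<le> C * \<rho> * \<delta>" using that pq c \<rho> by (intro mult_left_mono) auto
    also have "\<dots> \<le> c * \<rho> / 8" using c(3) \<rho> mult_right_mono[OF c(3), of \<rho>] by (simp add: mult_ac)
    finally show ?thesis .
  qed
  have LipF': "\<bar>F' x - F' p\<bar> \<le> C * \<rho> * \<bar>x - p\<bar>" if "x \<in> {p..q}" for x
  proof (cases "x = p")
    case False
    then have "p < x" using that by auto
    have "\<exists>z>p. z < x \<and> F' x - F' p = (x - p) * F'' z"
      by (rule MVT2[OF \<open>p < x\<close>]) (use F' that in auto)
    then obtain z where "z > p" "z < x" "F' x - F' p = (x - p) * F'' z" by blast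
    then show ?thesis using L[of z] that by (simp add: abs_mult mult.commute mult_right_mono)
  qed simp
  have "\<exists>s\<in>{p..q}. \<forall>x\<in>{p..q}. (c * \<rho> / 4) * \<bar>x - s\<bar> \<le> \<bar>F' x\<bar>"
  proof (cases "c * \<rho> / 2 \<le> \<bar>F' p\<bar>")
    case True
    have "(c * \<rho> / 4) * \<bar>x - p\<bar> \<le> \<bar>F' x\<bar>" if x: "x \<in> {p..q}" for x
    proof -
      have "(c * \<rho> / 4) * \<bar>x - p\<bar> \<le> (c * \<rho> / 4) * 1"
        using x pq c \<rho> by (intro mult_left_mono) auto
      also have "\<dots> \<le> \<bar>F' x\<bar>" using small[OF x] LipF'[OF x] True c \<rho> mult_pos_pos[of c \<rho>] by linarith
      finally show ?thesis .
    qed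
    then show ?thesis using pq(1) by (intro bexI[of _ p]) auto
  next
    case False
    then have "c * \<rho> / 2 \<le> \<bar>F'' p\<bar>" using lb[of p] pq(1) by auto
    have "c * \<rho> / 4 \<le> \<bar>F'' x\<bar>" if "x \<in> {p..q}" for x
    proof -
      have "\<bar>F'' x - F'' p\<bar> \<le> C * \<rho> * \<bar>x - p\<bar>" using that pq(1) by (intro Lip) auto
      moreover have "0 < c * \<rho>" using c \<rho> by simp
      ultimately show ?thesis
        using small[OF that] \<open>c * \<rho> / 2 \<le> \<bar>F'' p\<bar>\<close> by linarith
    qed
    then show ?thesis using abs_lower_bound_from_min[OF pq(1) F'] by blast
  qed
  then obtain s where s: "s \<in> {p..q}" "\<And>x. x \<in> {p..q} \<Longrightarrow> (c * \<rho> / 4) * \<bar>x - s\<bar> \<le> \<bar>F' x\<bar>" by blast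
  \<comment> \<open>With this radius \<open>\<rho> * r ^ 4 = 1\<close>, so the three error terms
    become multiples of \<open>r\<close>, \<open>r ^ 3\<close> and \<open>r\<^sup>2\<close>, all
    dominated by \<open>r\<close>. Balancing exactly would give the exponent -1/3; the quarter keeps
    all powers integral.\<close>
  define r where "r = \<rho> powr (-1/4)"
  have r: "0 < r" "r \<le> 1" using \<rho> powr_mono[of "-1/4" 0 \<rho>] by (auto simp: r_def)
  have r4: "\<rho> * r ^ 4 = 1"
  proof -
    have "r ^ 4 = \<rho> powr (-1/4 * 4)" unfolding r_def by (subst powr_realpow[symmetric]) (use \<rho> in \<open>auto simp: powr_powr\<close>)
    then show ?thesis using \<rho> by (simp add: powr_minus field_simps)
  qed
  have "norm (integral {p..q} (\<lambda>x. cis (F x))) \<le> 2 * r + 2 * (2 / (c * \<rho> / 4 * r) + C * \<rho> / (c * \<rho> / 4 * r)\<^sup>2)"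
    by (rule oscillatory_one_point[OF pq(1) _ r(1) _ F F' s(2) L s(1)]) (use pq c \<rho> in auto)
  also have "2 / (c * \<rho> / 4 * r) = 8 / c * r ^ 3"
  proof -
    have "1 / (\<rho> * r) = r ^ 3" using r4 r \<rho> by (simp add: field_simps power4_eq_xxxx power3_eq_cube)
    moreover have "2 / (c * \<rho> / 4 * r) = 8 / c * (1 / (\<rho> * r))" by simp
    ultimately show ?thesis by simp
  qed
  also have "C * \<rho> / (c * \<rho> / 4 * r)\<^sup>2 = 16 * C / c\<^sup>2 * r\<^sup>2"
  proof -
    have "1 / (\<rho> * r\<^sup>2) = r\<^sup>2" using r4 r \<rho> by (simp add: field_simps power4_eq_xxxx power2_eq_square)
    moreover have "C * \<rho> / (c * \<rho> / 4 * r)\<^sup>2 = 16 * C / c\<^sup>2 * (1 / (\<rho> * r\<^sup>2))"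
      using \<rho> by (simp add: field_simps power2_eq_square)
    ultimately show ?thesis by simp
  qed
  also have "2 * r + 2 * (8 / c * r ^ 3 + 16 * C / c\<^sup>2 * r\<^sup>2) \<le> 2 * r + 2 * (8 / c * r + 16 * C / c\<^sup>2 * r)"
    using r c power_decreasing[of 1 3 r] power_decreasing[of 1 2 r]
    by (intro add_mono mult_left_mono) auto
  finally show ?thesis unfolding r_def[symmetric] by (simp add: algebra_simps)
qed

text \<open>Here \<open>\<rho>\<close> is the size of the frequency, and \<open>F'\<close>,
  \<open>F''\<close> are never both small compared with it: no critical point is degenerate,
  quantitatively. The length 2 is that of the window \<open>{-1..1}\<close>.\<close>

definition oscillating_phase ::
    "real \<Rightarrow> real \<Rightarrow> real \<Rightarrow> real \<Rightarrow> (real \<Rightarrow> real) \<Rightarrow> (real \<Rightarrow> real) \<Rightarrow> (real \<Rightarrow> real) \<Rightarrow> bool" where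
  "oscillating_phase c C a \<rho> F F' F'' \<longleftrightarrow>
     (\<forall>x\<in>{a..a+2}. (F has_real_derivative F' x) (at x) \<and> (F' has_real_derivative F'' x) (at x) \<and>
        c * \<rho> \<le> \<bar>F' x\<bar> + \<bar>F'' x\<bar> \<and> \<bar>F' x\<bar> \<le> C * \<rho> \<and> \<bar>F'' x\<bar> \<le> C * \<rho> \<and>
        (\<forall>y\<in>{a..a+2}. \<bar>F'' x - F'' y\<bar> \<le> C * \<rho> * \<bar>x - y\<bar>))"

lemma oscillatory_large:
  fixes c C :: real
  assumes c: "0 < c" "0 \<le> C"
  shows "\<exists>K\<ge>0. \<forall>F F' F'' a \<rho>. 1 \<le> \<rho> \<longrightarrow> oscillating_phase c C a \<rho> F F' F'' \<longrightarrow>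
     norm (integral {a..a+2} (\<lambda>x. cis (F x))) \<le> K * \<rho> powr (-1/4)"
proof -
  obtain n :: nat where n: "2 < real n" "16 * C / c < real n"
    using reals_Archimedean2[of "max 2 (16 * C / c)"] by auto
  define \<delta> where "\<delta> = 2 / real n"
  have \<delta>: "0 < \<delta>" "\<delta> \<le> 1" "8 * C * \<delta> \<le> c" "real n * \<delta> = 2"
    using n c by (auto simp: \<delta>_def field_simps)
  define K where "K = 2 + 16 / c + 32 * C / c\<^sup>2"
  have K: "0 \<le> K" using c by (simp add: K_def)
  have main: "norm (integral {a..a+2} (\<lambda>x. cis (F x))) \<le> (real n * K) * \<rho> powr (-1/4)"
    if \<rho>: "1 \<le> \<rho>" and osc: "oscillating_phase c C a \<rho> F F' F''" for F F' F'' a \<rho>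
  proof -
    have *: "(F has_real_derivative F' x) (at x)" "(F' has_real_derivative F'' x) (at x)"
       "c * \<rho> \<le> \<bar>F' x\<bar> + \<bar>F'' x\<bar>" "\<bar>F'' x\<bar> \<le> C * \<rho>"
       "y \<in> {a..a+2} \<Longrightarrow> \<bar>F'' x - F'' y\<bar> \<le> C * \<rho> * \<bar>x - y\<bar>" if "x \<in> {a..a+2}" for x y
      using osc that by (auto simp: oscillating_phase_def)
    have cont: "continuous_on {a..a+2} (\<lambda>x. cis (F x))"
      by (intro continuous_intros continuous_at_imp_continuous_on) (use * DERIV_isCont in blast)
    have "k \<le> n \<Longrightarrow> norm (integral {a..a + real k * \<delta>} (\<lambda>x. cis (F x))) \<le> (real k * K) * \<rho> powr (-1/4)" for k
    proof (induction k)
      case (Suc k)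
      have le: "real k * \<delta> + \<delta> \<le> 2"
      proof -
        have "real (Suc k) * \<delta> \<le> real n * \<delta>" using Suc.prems \<delta>(1) by (intro mult_right_mono) auto
        then show ?thesis using \<delta>(4) by (simp add: algebra_simps)
      qed
      have k0: "0 \<le> real k * \<delta>" using \<delta> by simp
      have "integral {a..a + real (Suc k) * \<delta>} (\<lambda>x. cis (F x)) = integral {a..a + real k * \<delta>} (\<lambda>x. cis (F x))
         + integral {a + real k * \<delta>..a + real (Suc k) * \<delta>} (\<lambda>x. cis (F x))"
      proof (rule Henstock_Kurzweil_Integration.integral_combine[where c="a + real k * \<delta>", symmetric])
        show "(\<lambda>x. cis (F x)) integrable_on {a..a + real (Suc k) * \<delta>}"
          by (rule integrable_continuous_real, rule continuous_on_subset[OF cont])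
             (use k0 le \<delta>(1) in \<open>auto simp: algebra_simps\<close>)
      qed (use k0 le \<delta>(1) in \<open>auto simp: algebra_simps\<close>)
      moreover have sub: "x \<in> {a..a + 2}" if "x \<in> {a + real k * \<delta>..a + real (Suc k) * \<delta>}" for x
      proof -
        have "a + real k * \<delta> \<le> x" "x \<le> a + (real k * \<delta> + \<delta>)" using that by (auto simp: algebra_simps)
        then show ?thesis unfolding atLeastAtMost_iff using k0 le by linarith
      qed
      have "norm (integral {a + real k * \<delta>..a + real (Suc k) * \<delta>} (\<lambda>x. cis (F x))) \<le> K * \<rho> powr (-1/4)"
        unfolding K_def
        by (rule oscillatory_short_interval[where \<delta>=\<delta>, OF _ _ \<delta>(2) c \<delta>(3) \<rho> *])
           (use sub \<delta>(1) in \<open>simp_all add: distrib_right\<close>)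
      moreover have "norm (integral {a..a + real k * \<delta>} (\<lambda>x. cis (F x))) \<le> (real k * K) * \<rho> powr (-1/4)"
        using Suc.IH Suc.prems by simp
      moreover have "real (Suc k) * K * \<rho> powr (-1/4) = (real k * K) * \<rho> powr (-1/4) + K * \<rho> powr (-1/4)"
        by (simp add: algebra_simps)
      ultimately show ?case by (metis norm_triangle_mono)
    qed simp
    from this[of n] show ?thesis using \<delta>(4) by simp
  qed
  show ?thesis
    by (rule exI[of _ "real n * K"], intro conjI allI impI mult_nonneg_nonneg of_nat_0_le_iff K, rule main)
qed

section \<open>Oscillatory integrals at bounded frequency\<close>

lemma cos_le_quadratic:
  fixes y :: real
  assumes "\<bar>y\<bar> \<le> 1"
  shows "cos y \<le> 1 - y\<^sup>2 / 4"
proof -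
  obtain t where t: "cos y = (\<Sum>m<4. cos_coeff m * y ^ m) + cos (t + 1/2 * real (4::nat) * pi) / fact 4 * y ^ 4"
    using Maclaurin_cos_expansion[of y 4] by blast
  have "odd (Suc (Suc (Suc 0)))" by presburger
  then have "(\<Sum>m<4. cos_coeff m * y ^ m) = 1 - y\<^sup>2 / 2"
    by (simp add: cos_coeff_def eval_nat_numeral)
  moreover have "cos (t + 1/2 * real (4::nat) * pi) / fact 4 * y ^ 4 \<le> 1 / 24 * y\<^sup>2"
  proof (rule mult_mono)
    show "cos (t + 1/2 * real (4::nat) * pi) / fact 4 \<le> 1 / 24" by (simp add: fact_numeral)
    show "y ^ 4 \<le> y\<^sup>2" using power_decreasing[of 2 4 "\<bar>y\<bar>"] assms by simp
  qed auto
  ultimately show ?thesis using t zero_le_power2[of y] by linarith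
qed

text \<open>Pairing \<open>x\<close> with \<open>x + d\<close> gives \<open>\<bar>cis (F x) + cis (F (x + d))\<bar> = 2 \<bar>cos ((F (x + d) - F x) / 2)\<bar>\<close>.\<close>
lemma oscillatory_pairing:
  fixes F F' :: "real \<Rightarrow> real"
  assumes d: "0 < d" and m: "0 \<le> m"
    and F: "\<And>x. x \<in> {p..p + 2 * d} \<Longrightarrow> (F has_real_derivative F' x) (at x)"
    and lb: "\<And>x. x \<in> {p..p + 2 * d} \<Longrightarrow> m \<le> \<bar>F' x\<bar>"
    and ub: "\<And>x. x \<in> {p..p + 2 * d} \<Longrightarrow> \<bar>F' x\<bar> * d \<le> 2"
  shows "norm (integral {p..p + 2 * d} (\<lambda>x. cis (F x))) \<le> 2 * d * (1 - (m * d)\<^sup>2 / 16)"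
proof -
  have cont: "continuous_on {p..p + 2 * d} (\<lambda>x. cis (F x))"
    by (intro continuous_intros continuous_at_imp_continuous_on) (use F DERIV_isCont in blast)
  have i0: "(\<lambda>x. cis (F x)) integrable_on {p..p + 2 * d}" by (rule integrable_continuous_real[OF cont])
  have i1: "(\<lambda>x. cis (F x)) integrable_on {p..p + d}" and i2: "(\<lambda>x. cis (F x)) integrable_on {p + d..p + 2 * d}"
    by (rule integrable_continuous_real, rule continuous_on_subset[OF cont], use d in auto)+
  have "((\<lambda>x. cis (F x)) has_integral integral {p + d..p + 2 * d} (\<lambda>x. cis (F x))) {p + d..p + 2 * d}"
    using i2 by (rule integrable_integral)
  from has_integral_affinity[OF this[unfolded cbox_interval[symmetric]], of 1 d]
  have 2: "((\<lambda>x. cis (F (x + d))) has_integral integral {p + d..p + 2 * d} (\<lambda>x. cis (F x))) {p..p + d}"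
    by (simp add: cbox_interval) (simp add: image_def add.commute algebra_simps)
  have 1: "((\<lambda>x. cis (F x)) has_integral integral {p..p + d} (\<lambda>x. cis (F x))) {p..p + d}"
    using i1 by (rule integrable_integral)
  have sum: "((\<lambda>x. cis (F x) + cis (F (x + d))) has_integral integral {p..p + 2 * d} (\<lambda>x. cis (F x))) {p..p + d}"
    using has_integral_add[OF 1 2] Henstock_Kurzweil_Integration.integral_combine[of p "p + d" "p + 2 * d" "\<lambda>x. cis (F x)"] i0 d by simp
  have bd: "norm (cis (F x) + cis (F (x + d))) \<le> 2 * (1 - (m * d)\<^sup>2 / 16)" if x: "x \<in> {p..p + d}" for x
  proof -
    have "\<exists>z>x. z < x + d \<and> F (x + d) - F x = (x + d - x) * F' z"
      by (rule MVT2) (use F x d in auto)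
    then obtain z where z: "x < z" "z < x + d" "F (x + d) - F x = d * F' z" by auto
    define y where "y = (F (x + d) - F x) / 2"
    have ay: "\<bar>y\<bar> = d * \<bar>F' z\<bar> / 2" using z d by (simp add: y_def abs_mult)
    have y1: "\<bar>y\<bar> \<le> 1" using ub[of z] z x d unfolding ay by (auto simp: mult.commute)
    have "m * d / 2 \<le> \<bar>y\<bar>" using lb[of z] z x d unfolding ay by (auto simp: mult.commute mult_left_mono)
    then have ysq: "(m * d / 2)\<^sup>2 \<le> y\<^sup>2" using power_mono[of "m * d / 2" "\<bar>y\<bar>" 2] m d by simp
    have "cis (F x) + cis (F (x + d)) = cis (F x + y) * (cis (- y) + cis y)"
      by (simp add: cis_mult y_def algebra_simps add_divide_distrib[symmetric] diff_divide_distrib[symmetric]) 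
         (simp add: field_simps)
    also have "cis (- y) + cis y = complex_of_real (2 * cos y)" by (simp add: complex_eq_iff)
    finally have "norm (cis (F x) + cis (F (x + d))) = 2 * \<bar>cos y\<bar>" by (simp add: norm_mult)
    also have "\<bar>cos y\<bar> = cos y" using y1 cos_ge_zero[of y] pi_gt3 by simp
    also have "cos y \<le> 1 - y\<^sup>2 / 4" using cos_le_quadratic[OF y1] .
    finally have "norm (cis (F x) + cis (F (x + d))) \<le> 2 * (1 - y\<^sup>2 / 4)" by simp
    also have "\<dots> \<le> 2 * (1 - (m * d)\<^sup>2 / 16)" using ysq by (simp add: power_divide)
    finally show ?thesis .
  qed
  have nonneg: "0 \<le> 2 * (1 - (m * d)\<^sup>2 / 16)" using order_trans[OF norm_ge_zero bd[of p]] d by simp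
  have "norm (integral {p..p + 2 * d} (\<lambda>x. cis (F x))) \<le> 2 * (1 - (m * d)\<^sup>2 / 16) * measure lborel (cbox p (p + d))"
    by (rule has_integral_bound[OF nonneg]) (use sum bd in \<open>auto simp: cbox_interval\<close>)
  then show ?thesis using d by (simp add: algebra_simps)
qed

text \<open>For large \<open>\<rho>\<close> the 16th power turns the exponent -1/4 into -4, which
  beats the factor of order \<open>\<rho>\<^sup>2\<close> and leaves \<open>\<rho>\<close> to the
  power -2 to absorb the constant. For bounded \<open>\<rho>\<close> pairing on a short subinterval
  yields a mean value of modulus at most \<open>1 - \<kappa> * \<rho>\<^sup>2\<close>, and (1 - y) *
  (1 + y) is at most 1. Having the bound 1 on the right, with no constant in front, is what allows
  high powers to be taken later.\<close>

lemma oscillatory_decay: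
  fixes c C :: real
  assumes c: "0 < c" "0 < C"
  shows "\<exists>c'>0. \<forall>F F' F'' a \<rho>. 0 \<le> \<rho> \<longrightarrow> oscillating_phase c C a \<rho> F F' F'' \<longrightarrow>
     (norm (integral {a..a+2} (\<lambda>x. cis (F x))) / 2) ^ 16 * (1 + c' * \<rho>\<^sup>2) \<le> 1"
proof -
  obtain K where K: "0 \<le> K" and large: "\<And>F F' F'' a \<rho>. 1 \<le> \<rho> \<Longrightarrow> oscillating_phase c C a \<rho> F F' F'' \<Longrightarrow>
     norm (integral {a..a+2} (\<lambda>x. cis (F x))) \<le> K * \<rho> powr (-1/4)"
    using oscillatory_large[OF c(1) less_imp_le[OF c(2)]] by blast
  define R where "R = max 1 (2 * (K / 2) ^ 16)"
  \<comment> \<open>The first bound makes an interval of length \<open>2 * d\<close> fit, the second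
    keeps the variation of \<open>F'\<close> on it below \<open>c * \<rho> / 4\<close>, and the
    third gives \<open>\<bar>F'\<bar> * d \<le> 2\<close> for \<open>\<rho> \<le> R\<close>, as the
    pairing requires.\<close>
  define d where "d = min (1/2) (min (c / (8 * C)) (2 / (C * R)))"
  define \<kappa> where "\<kappa> = d * (c * d)\<^sup>2 / 256"
  have R: "1 \<le> R" "2 * (K / 2) ^ 16 \<le> R" by (auto simp: R_def)
  have d: "0 < d" "d \<le> 1/2" "d \<le> c / (8 * C)" "d \<le> 2 / (C * R)"
    using c R by (auto simp: d_def)
  have \<kappa>: "0 < \<kappa>" using d c by (simp add: \<kappa>_def)
  have main: "(norm (integral {a..a+2} (\<lambda>x. cis (F x))) / 2) ^ 16 * (1 + min 1 \<kappa> * \<rho>\<^sup>2) \<le> 1"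
    if \<rho>: "0 \<le> \<rho>" and osc: "oscillating_phase c C a \<rho> F F' F''" for F F' F'' a \<rho>
  proof -
    have H: "(F has_real_derivative F' x) (at x)" "(F' has_real_derivative F'' x) (at x)"
       "c * \<rho> \<le> \<bar>F' x\<bar> + \<bar>F'' x\<bar>" "\<bar>F' x\<bar> \<le> C * \<rho>" "\<bar>F'' x\<bar> \<le> C * \<rho>"
       if "x \<in> {a..a+2}" for x
      using osc that by (auto simp: oscillating_phase_def)
    define N where "N = norm (integral {a..a+2} (\<lambda>x. cis (F x))) / 2"
    have N0: "0 \<le> N" by (simp add: N_def)
    have cont: "continuous_on {a..a+2} (\<lambda>x. cis (F x))"
      by (intro continuous_intros continuous_at_imp_continuous_on) (use H DERIV_isCont in blast)
    show ?thesis
    proof (cases "\<rho> \<le> R")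
      case False
      then have \<rho>1: "1 \<le> \<rho>" using R by linarith
      have "N \<le> K / 2 * \<rho> powr (-1/4)"
        using large[OF \<rho>1 osc] unfolding N_def by simp
      then have "N ^ 16 \<le> (K / 2 * \<rho> powr (-1/4)) ^ 16" using N0 by (rule power_mono)
      also have "\<dots> = (K / 2) ^ 16 / \<rho> ^ 4"
      proof -
        have "(\<rho> powr (-1/4)) ^ 16 = \<rho> powr (-1/4 * real (16::nat))"
          using \<rho>1 by (subst powr_realpow[symmetric]) (auto simp: powr_powr)
        also have "\<dots> = inverse (\<rho> powr real (4::nat))" by (simp add: powr_minus[symmetric])
        also have "\<dots> = inverse (\<rho> ^ 4)" using \<rho>1 by (subst powr_realpow) auto
        finally show ?thesis by (simp only: power_mult_distrib divide_inverse)
      qed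
      finally have *: "N ^ 16 \<le> (K / 2) ^ 16 / \<rho> ^ 4" .
      have "min 1 \<kappa> * \<rho>\<^sup>2 \<le> 1 * \<rho>\<^sup>2" by (intro mult_right_mono) auto
      moreover have "1 \<le> \<rho>\<^sup>2" using \<rho>1 by simp
      ultimately have "1 + min 1 \<kappa> * \<rho>\<^sup>2 \<le> 2 * \<rho>\<^sup>2" by linarith
      then have "N ^ 16 * (1 + min 1 \<kappa> * \<rho>\<^sup>2) \<le> (K / 2) ^ 16 / \<rho> ^ 4 * (2 * \<rho>\<^sup>2)"
        using * \<kappa> K by (intro mult_mono) auto
      also have "\<dots> = 2 * (K / 2) ^ 16 / \<rho>\<^sup>2" using \<rho>1 by (simp add: field_simps power4_eq_xxxx power2_eq_square)
      also have "\<dots> \<le> 1"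
      proof -
        have "2 * (K / 2) ^ 16 \<le> \<rho> * 1" using False R(2) by linarith
        also have "\<dots> \<le> \<rho> * \<rho>" using \<rho>1 by (intro mult_left_mono) auto
        finally show ?thesis using \<rho>1 by (simp add: power2_eq_square)
      qed
      finally show ?thesis unfolding N_def .
    next
      case True
      \<comment> \<open>Were \<open>\<bar>F'\<bar>\<close> below \<open>c * \<rho> / 2\<close>
        throughout, \<open>\<bar>F''\<bar>\<close> would exceed it throughout, while the mean value
        theorem on an interval of length 2 produces a point where it does not.\<close>
      have "\<exists>s\<in>{a..a+2}. c * \<rho> / 2 \<le> \<bar>F' s\<bar>"
      proof (rule ccontr)
        assume "\<not> ?thesis"
        then have less: "\<bar>F' s\<bar> < c * \<rho> / 2" if "s \<in> {a..a+2}" for s using that by force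
        have "\<exists>z>a. z < a + 2 \<and> F' (a + 2) - F' a = (a + 2 - a) * F'' z"
          by (rule MVT2) (use H in auto)
        then obtain z where z: "a < z" "z < a + 2" "F' (a + 2) - F' a = 2 * F'' z" by auto
        show False using less[of a] less[of "a + 2"] less[of z] H(3)[of z] z by (auto simp: abs_if split: if_splits)
      qed
      then obtain s where s: "s \<in> {a..a+2}" "c * \<rho> / 2 \<le> \<bar>F' s\<bar>" by blast
      define p where "p = min s (a + 2 - 2 * d)"
      have p: "a \<le> p" "p \<le> s" "s \<le> p + 2 * d" "p + 2 * d \<le> a + 2" using s d by (auto simp: p_def)
      have Cd: "C * (2 * d) \<le> c / 4" using d(3) c by (simp add: field_simps)
      have lb: "c * \<rho> / 4 \<le> \<bar>F' x\<bar>" if x: "x \<in> {p..p + 2 * d}" for x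
      proof -
        have "\<bar>F' x - F' s\<bar> \<le> C * \<rho> * \<bar>x - s\<bar>"
          using field_differentiable_bound[of "{a..a+2}" F' F'' "C * \<rho>" x s] H(2,5) x p s
          by (auto intro: has_field_derivative_at_within)
        also have "\<dots> \<le> C * \<rho> * (2 * d)" using x p c \<rho> by (intro mult_left_mono) auto
        also have "\<dots> \<le> c * \<rho> / 4" using mult_right_mono[OF Cd \<rho>] by (simp add: mult_ac)
        finally show ?thesis using s(2) by linarith
      qed
      have ub: "\<bar>F' x\<bar> * d \<le> 2" if x: "x \<in> {p..p + 2 * d}" for x
      proof -
        have "\<bar>F' x\<bar> * d \<le> (C * R) * d"
          using order_trans[OF H(4)[of x] mult_left_mono[OF True, of C]] x p d(1) c by (intro mult_right_mono) auto
        also have "\<dots> \<le> 2" using d(4) c R by (simp add: field_simps)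
        finally show ?thesis .
      qed
      have J: "norm (integral {p..p + 2 * d} (\<lambda>x. cis (F x))) \<le> 2 * d * (1 - (c * \<rho> / 4 * d)\<^sup>2 / 16)"
        by (rule oscillatory_pairing[OF d(1) _ _ lb ub]) (use H p c \<rho> in auto)
      have left: "norm (integral {a..p} (\<lambda>x. cis (F x))) \<le> 1 * (p - a)"
        by (intro integral_bound continuous_on_subset[OF cont]) (use p d in auto)
      have right: "norm (integral {p + 2 * d..a + 2} (\<lambda>x. cis (F x))) \<le> 1 * (a + 2 - (p + 2 * d))"
        by (intro integral_bound continuous_on_subset[OF cont]) (use p d in auto)
      have int: "(\<lambda>x. cis (F x)) integrable_on {u..v}" if "a \<le> u" "v \<le> a + 2" for u v
        by (rule integrable_continuous_real, rule continuous_on_subset[OF cont]) (use that in auto)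
      have "integral {a..a + 2} (\<lambda>x. cis (F x)) = integral {a..p} (\<lambda>x. cis (F x))
          + (integral {p..p + 2 * d} (\<lambda>x. cis (F x)) + integral {p + 2 * d..a + 2} (\<lambda>x. cis (F x)))"
        using Henstock_Kurzweil_Integration.integral_combine[of a p "a + 2" "\<lambda>x. cis (F x)"]
          Henstock_Kurzweil_Integration.integral_combine[of p "p + 2 * d" "a + 2" "\<lambda>x. cis (F x)"]
          int p d by auto
      then have "2 * N \<le> (p - a) + (2 * d * (1 - (c * \<rho> / 4 * d)\<^sup>2 / 16) + (a + 2 - (p + 2 * d)))"
        unfolding N_def using norm_triangle_mono[OF left norm_triangle_mono[OF J right]] by simp
      then have N1: "N \<le> 1 - \<kappa> * \<rho>\<^sup>2"
        by (simp add: \<kappa>_def algebra_simps power2_eq_square)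
      have "0 \<le> \<kappa> * \<rho>\<^sup>2" using \<kappa> by simp
      then have "N \<le> 1" using N1 by linarith
      then have "N ^ 16 \<le> N" using power_decreasing[of 1 16 N] N0 by simp
      then have "N ^ 16 * (1 + min 1 \<kappa> * \<rho>\<^sup>2) \<le> (1 - \<kappa> * \<rho>\<^sup>2) * (1 + \<kappa> * \<rho>\<^sup>2)"
        using N1 N0 \<kappa> by (intro mult_mono add_left_mono mult_right_mono) auto
      also have "\<dots> = 1 - (\<kappa> * \<rho>\<^sup>2)\<^sup>2" by (simp add: algebra_simps power2_eq_square)
      also have "\<dots> \<le> 1" by simp
      finally show ?thesis unfolding N_def .
    qed
  qed
  have pos: "0 < min 1 \<kappa>" using \<kappa> by simp
  show ?thesis
    by (rule exI[of _ "min 1 \<kappa>"], intro conjI allI impI pos, rule main)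
qed

section \<open>Crossing probabilities by Fourier inversion\<close>

lemma Fubini_lborel:
  fixes f :: "'a \<Rightarrow> real \<Rightarrow> real"
  assumes "sigma_finite_measure M"
    and f[measurable]: "(\<lambda>(\<omega>, x). f \<omega> x) \<in> borel_measurable (M \<Otimes>\<^sub>M lborel)"
    and int: "\<And>\<omega>. \<omega> \<in> space M \<Longrightarrow> integrable lborel (f \<omega>)"
    and abs: "integrable M (\<lambda>\<omega>. LINT x|lborel. \<bar>f \<omega> x\<bar>)"
  shows "(LINT \<omega>|M. LINT x|lborel. f \<omega> x) = (LINT x|lborel. LINT \<omega>|M. f \<omega> x)"
    and "integrable lborel (\<lambda>x. LINT \<omega>|M. f \<omega> x)"
    and "integrable M (\<lambda>\<omega>. LINT x|lborel. f \<omega> x)"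
proof -
  interpret sigma_finite_measure M by fact
  interpret pair_sigma_finite M lborel ..
  have "integrable (M \<Otimes>\<^sub>M lborel) (\<lambda>(\<omega>, x). f \<omega> x)"
    by (rule Fubini_integrable) (use int abs in auto)
  then show "(LINT \<omega>|M. LINT x|lborel. f \<omega> x) = (LINT x|lborel. LINT \<omega>|M. f \<omega> x)"
    and "integrable lborel (\<lambda>x. LINT \<omega>|M. f \<omega> x)"
    and "integrable M (\<lambda>\<omega>. LINT x|lborel. f \<omega> x)"
    using Fubini_integral[of f] integrable_snd[of f] integrable_fst[of f] by auto
qed

text \<open>The exponents are 12/8 - 2 and 3/8 - 2: the powers of \<open>v\<close> that
  \<open>interpolation_bound\<close> leaves after an eighth root and division by
  \<open>v\<^sup>2\<close>.\<close>

definition power_weight :: "real \<Rightarrow> real" where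
  "power_weight v = (if v \<le> 0 then 0 else if v \<le> 1 then v powr (-1/2) else v powr (-13/8))"

lemma power_weight_nonneg [simp]: "0 \<le> power_weight v"
  by (simp add: power_weight_def)

lemma power_weight_measurable [measurable]: "power_weight \<in> borel_measurable borel"
  unfolding power_weight_def[abs_def] by measurable

lemma integrable_power_weight: "integrable lborel power_weight"
proof -
  have "((\<lambda>x. x powr (-1/2)) has_integral 2) {0..1::real}"
    using has_integral_powr_from_0[of "-1/2" 1] by simp
  then have "((\<lambda>x. if x \<in> {0..1} then power_weight x else 0) has_integral 2) UNIV"
    unfolding has_integral_restrict_UNIV
    by (rule has_integral_spike[where S="{0}", rotated -1]) (auto simp: power_weight_def)
  moreover have "((\<lambda>x. x powr (-13/8)) has_integral (8/5)) {1::real..}"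
    using has_integral_powr_to_inf[of "-13/8" 1] by simp
  then have "((\<lambda>x. if x \<in> {1..} then power_weight x else 0) has_integral (8/5)) UNIV"
    unfolding has_integral_restrict_UNIV
    by (rule has_integral_spike[where S="{1}", rotated -1]) (auto simp: power_weight_def)
  ultimately have "((\<lambda>x. (if x \<in> {0..1} then power_weight x else 0) + (if x \<in> {1..} then power_weight x else 0))
      has_integral (2 + 8/5)) UNIV"
    by (rule has_integral_add)
  then have "(power_weight has_integral (2 + 8/5)) UNIV"
    by (rule has_integral_spike[where S="{1}", rotated -1]) (auto simp: power_weight_def)
  then have "(\<integral>\<^sup>+x. ennreal (power_weight x) \<partial>lborel) = ennreal (2 + 8/5)"
    by (intro nn_integral_has_integral_lborel) auto
  then show ?thesis by (intro integrableI_nonneg) auto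
qed

section \<open>The absolute value as an integral of cosines\<close>

definition cos_kernel :: "real \<Rightarrow> real \<Rightarrow> real" where
  "cos_kernel x v = (if v \<le> 0 then 0 else (1 - cos (v * x)) / v\<^sup>2)"

lemma cos_kernel_nonneg [simp]: "0 \<le> cos_kernel x v"
  by (simp add: cos_kernel_def)

lemma cos_kernel_measurable [measurable]:
  assumes [measurable]: "f \<in> borel_measurable M" "g \<in> borel_measurable M"
  shows "(\<lambda>\<omega>. cos_kernel (f \<omega>) (g \<omega>)) \<in> borel_measurable M"
  unfolding cos_kernel_def[abs_def] by measurable

lemma one_minus_cos_le: "1 - cos x \<le> x\<^sup>2 / 2" for x :: real
proof -
  have "1 - cos x = 2 * (sin (x / 2))\<^sup>2" using cos_double_sin[of "x / 2"] by simp
  moreover have "(sin (x / 2))\<^sup>2 \<le> (x / 2)\<^sup>2"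
    using abs_sin_x_le_abs_x[of "x/2"] unfolding abs_le_square_iff .
  ultimately show ?thesis by (simp add: power_divide)
qed

lemma cos_kernel_one_le: "cos_kernel 1 v \<le> 2 * power_weight v"
proof -
  consider "v \<le> 0" | "0 < v" "v \<le> 1" | "1 < v" by linarith
  then show ?thesis
  proof cases
    case 2
    have "(1 - cos v) / v\<^sup>2 \<le> (v\<^sup>2 / 2) / v\<^sup>2" using one_minus_cos_le by (intro divide_right_mono) auto
    also have "\<dots> \<le> 1" using 2 by simp
    also have "1 \<le> v powr (-1/2)" using 2 powr_mono'[of "-1/2" 0 v] by simp
    finally have "(1 - cos v) / v\<^sup>2 \<le> 2 * v powr (-1/2)" by (smt (verit) powr_ge_zero)
    then show ?thesis using 2 by (simp add: cos_kernel_def power_weight_def)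
  next
    case 3
    have "(1 - cos v) / v\<^sup>2 \<le> 2 / v\<^sup>2"
      using cos_ge_minus_one[of v] by (intro divide_right_mono zero_le_power2) linarith
    also have "\<dots> = 2 * v powr (-2)" using 3 by (simp add: powr_minus divide_inverse)
    also have "\<dots> \<le> 2 * v powr (-13/8)" using 3 by (intro mult_left_mono powr_mono) auto
    finally show ?thesis using 3 by (simp add: cos_kernel_def power_weight_def)
  qed (simp add: cos_kernel_def power_weight_def)
qed

text \<open>This is pi / 2. The actual and the Gaussian absolute moments are both expressed through
  it, so their comparison sees only its sign and its size in the error constant.\<close>

definition abs_const :: real where "abs_const = (LINT v|lborel. cos_kernel 1 v)"

lemma integrable_cos_kernel_one: "integrable lborel (cos_kernel 1)"
  by (rule Bochner_Integration.integrable_bound[where f="\<lambda>v. 2 * power_weight v"])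
     (use cos_kernel_one_le in \<open>auto intro!: integrable_power_weight\<close>)

lemma abs_const_pos: "0 < abs_const"
proof -
  have "abs_const \<noteq> 0"
  proof
    assume "abs_const = 0"
    then have "AE v in lborel. cos_kernel 1 v = 0"
      unfolding abs_const_def by (subst (asm) integral_nonneg_eq_0_iff_AE) (auto intro: integrable_cos_kernel_one)
    moreover have "cos_kernel 1 v \<noteq> 0" if v: "v \<in> {0<..<1}" for v
    proof -
      have "cos v < 1" using v cos_monotone_0_pi[of 0 v] pi_gt3 by simp
      then show ?thesis using v by (simp add: cos_kernel_def)
    qed
    ultimately have "AE v in lborel. v \<notin> {0<..<1::real}" by (auto elim!: eventually_mono)
    then have "emeasure lborel {0<..<1::real} = 0" by (subst (asm) AE_iff_measurable[of "{0<..<1}"]) auto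
    then show False by simp
  qed
  moreover have "0 \<le> abs_const" unfolding abs_const_def by (rule integral_nonneg_AE) simp
  ultimately show ?thesis by simp
qed

lemma integral_cos_kernel: "integrable lborel (cos_kernel x)" "(LINT v|lborel. cos_kernel x v) = abs_const * \<bar>x\<bar>"
proof -
  have "integrable lborel (cos_kernel x) \<and> (LINT v|lborel. cos_kernel x v) = abs_const * \<bar>x\<bar>"
  proof (cases "x = 0")
    case True
    then have "cos_kernel x = (\<lambda>v. 0)" by (auto simp: cos_kernel_def)
    then show ?thesis using True by simp
  next
    case False
    have *: "cos_kernel x v = x\<^sup>2 * cos_kernel 1 (0 + \<bar>x\<bar> * v)" for v
      using False cos_abs_real[of "v * x"] by (auto simp: cos_kernel_def abs_mult power_mult_distrib mult.commute zero_less_mult_iff mult_le_0_iff)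
    have "integrable lborel (\<lambda>v. cos_kernel 1 (0 + \<bar>x\<bar> * v))"
      using False lborel_integrable_real_affine[OF integrable_cos_kernel_one, of "\<bar>x\<bar>" 0] by simp
    moreover have e1: "abs_const = \<bar>x\<bar> * (LINT v|lborel. cos_kernel 1 (0 + \<bar>x\<bar> * v))"
      unfolding abs_const_def using False lborel_integral_real_affine[of "\<bar>x\<bar>" "cos_kernel 1" 0] by simp
    have e2: "x\<^sup>2 = \<bar>x\<bar> * \<bar>x\<bar>" by (simp add: power2_eq_square)
    have "x\<^sup>2 * (LINT v|lborel. cos_kernel 1 (0 + \<bar>x\<bar> * v)) = abs_const * \<bar>x\<bar>"
      unfolding e2 e1 by (simp only: mult_ac)
    ultimately show ?thesis unfolding * by simp
  qed
  then show "integrable lborel (cos_kernel x)" "(LINT v|lborel. cos_kernel x v) = abs_const * \<bar>x\<bar>" by auto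
qed

section \<open>Gaussian smoothing and Fourier inversion\<close>

lemma integrable_gauss:
  assumes "0 < s"
  shows "integrable lborel (\<lambda>u::real. exp (- (s\<^sup>2 * u\<^sup>2) / 2))"
proof -
  have "integrable lborel (\<lambda>u. sqrt (2 * pi * (1 / s)\<^sup>2) * normal_density 0 (1 / s) u)"
    using assms by (intro integrable_mult_right integrable_normal_density) simp
  also have "(\<lambda>u. sqrt (2 * pi * (1 / s)\<^sup>2) * normal_density 0 (1 / s) u) = (\<lambda>u. exp (- (s\<^sup>2 * u\<^sup>2) / 2))"
    using assms by (auto simp: normal_density_def power_divide)
  finally show ?thesis .
qed

lemma integral_std_normal_cos: "(LINT x|lborel. std_normal_density x * cos (t * x)) = exp (- t\<^sup>2 / 2)"
proof -
  have "complex_of_real (exp (- t\<^sup>2 / 2)) = (CLINT x|density lborel std_normal_density. iexp (t * x))"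
    using char_std_normal_distribution by (simp add: char_def fun_eq_iff)
  also have "\<dots> = (CLINT x|lborel. std_normal_density x *\<^sub>R iexp (t * x))"
    by (subst integral_density) auto
  finally have "exp (- t\<^sup>2 / 2) = Re (CLINT x|lborel. std_normal_density x *\<^sub>R iexp (t * x))"
    by (metis Re_complex_of_real)
  also have "\<dots> = (LINT x|lborel. Re (std_normal_density x *\<^sub>R iexp (t * x)))"
    by (rule integral_Re[symmetric], rule Bochner_Integration.integrable_bound[OF integrable_normal_density[of 1 0]]) auto
  also have "\<dots> = (LINT x|lborel. std_normal_density x * cos (t * x))"
    by (simp add: Re_exp)
  finally show ?thesis by simp
qed

text \<open>The Gaussian is its own Fourier transform: this is the characteristic function of the
  standard normal law at \<open>y / s\<close>, after the substitution x = s * u.\<close>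

lemma normal_density_Fourier:
  assumes s: "0 < s"
  shows "normal_density 0 s y = (LINT u|lborel. exp (- (s\<^sup>2 * u\<^sup>2) / 2) * cos (u * y)) / (2 * pi)"
proof -
  have "exp (- (y / s)\<^sup>2 / 2) = (LINT x|lborel. std_normal_density x * cos (y / s * x))"
    by (rule integral_std_normal_cos[symmetric])
  also have "\<dots> = s * (LINT u|lborel. std_normal_density (0 + s * u) * cos (y / s * (0 + s * u)))"
    using s by (subst lborel_integral_real_affine[where c=s and t=0]) auto
  also have "(\<lambda>u. std_normal_density (0 + s * u) * cos (y / s * (0 + s * u))) =
      (\<lambda>u. (1 / sqrt (2 * pi)) * (exp (- (s\<^sup>2 * u\<^sup>2) / 2) * cos (u * y)))"
    using s by (auto simp: std_normal_density_def power_mult_distrib mult.commute)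
  also have "(LINT u|lborel. (1 / sqrt (2 * pi)) * (exp (- (s\<^sup>2 * u\<^sup>2) / 2) * cos (u * y)))
      = (1 / sqrt (2 * pi)) * (LINT u|lborel. exp (- (s\<^sup>2 * u\<^sup>2) / 2) * cos (u * y))"
    by (rule integral_mult_right_zero)
  finally have *: "exp (- (y / s)\<^sup>2 / 2) = s / sqrt (2 * pi) * (LINT u|lborel. exp (- (s\<^sup>2 * u\<^sup>2) / 2) * cos (u * y))"
    by simp
  have "normal_density 0 s y = 1 / (sqrt (2 * pi) * s) * exp (- (y / s)\<^sup>2 / 2)"
    using s by (simp add: normal_density_def real_sqrt_mult power_divide)
  then show ?thesis unfolding * using s by (simp add: field_simps real_sqrt_mult[symmetric])
qed

context prob_space
begin

text \<open>The factor \<open>exp (- (s\<^sup>2 * u\<^sup>2) / 2)\<close> makes the double integral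
  absolutely convergent whatever the law of \<open>Y\<close>, so no density has to exist. The weight
  \<open>W\<close> will be \<open>1 - cos (v * V \<omega>)\<close>, or 1.\<close>

lemma expectation_normal_density_Fourier:
  fixes Y W :: "'a \<Rightarrow> real"
  assumes [measurable]: "Y \<in> borel_measurable M" "W \<in> borel_measurable M" and W: "\<And>\<omega>. \<bar>W \<omega>\<bar> \<le> b" and s: "0 < s"
  shows "expectation (\<lambda>\<omega>. normal_density 0 s (Y \<omega> - \<alpha>) * W \<omega>)
       = (LINT u|lborel. exp (- (s\<^sup>2 * u\<^sup>2) / 2) * expectation (\<lambda>\<omega>. cos (u * (Y \<omega> - \<alpha>)) * W \<omega>)) / (2 * pi)" (is ?A)
    and "integrable lborel (\<lambda>u. exp (- (s\<^sup>2 * u\<^sup>2) / 2) * expectation (\<lambda>\<omega>. cos (u * (Y \<omega> - \<alpha>)) * W \<omega>))" (is ?B)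
proof -
  have b: "0 \<le> b" using W[of undefined] by linarith
  let ?f = "\<lambda>\<omega> u. exp (- (s\<^sup>2 * u\<^sup>2) / 2) * (cos (u * (Y \<omega> - \<alpha>)) * W \<omega>)"
  have bd: "\<bar>?f \<omega> u\<bar> \<le> b * exp (- (s\<^sup>2 * u\<^sup>2) / 2)" for \<omega> u
  proof -
    have "\<bar>cos (u * (Y \<omega> - \<alpha>))\<bar> * \<bar>W \<omega>\<bar> \<le> 1 * b" by (intro mult_mono W) auto
    then show ?thesis by (simp add: abs_mult mult.commute mult_left_mono)
  qed
  have int: "integrable lborel (?f \<omega>)" for \<omega>
    by (rule Bochner_Integration.integrable_bound[where f="\<lambda>u. b * exp (- (s\<^sup>2 * u\<^sup>2) / 2)"])
       (use bd b integrable_gauss[OF s] in auto)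
  have abs: "integrable M (\<lambda>\<omega>. LINT u|lborel. \<bar>?f \<omega> u\<bar>)"
  proof (rule integrable_const_bound[where B="LINT u|lborel. b * exp (- (s\<^sup>2 * u\<^sup>2) / 2)"])
    show "AE \<omega> in M. norm (LINT u|lborel. \<bar>?f \<omega> u\<bar>) \<le> (LINT u|lborel. b * exp (- (s\<^sup>2 * u\<^sup>2) / 2))"
    proof (rule AE_I2)
      fix \<omega>
      have "(LINT u|lborel. \<bar>?f \<omega> u\<bar>) \<le> (LINT u|lborel. b * exp (- (s\<^sup>2 * u\<^sup>2) / 2))"
        by (intro integral_mono integrable_abs int bd integrable_mult_right integrable_gauss s)
      then show "norm (LINT u|lborel. \<bar>?f \<omega> u\<bar>) \<le> (LINT u|lborel. b * exp (- (s\<^sup>2 * u\<^sup>2) / 2))" by simp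
    qed
  qed simp
  note F = Fubini_lborel[OF sigma_finite_measure_axioms, of ?f, OF _ int abs]
  have eq: "(LINT u|lborel. ?f \<omega> u) = 2 * pi * (normal_density 0 s (Y \<omega> - \<alpha>) * W \<omega>)" for \<omega>
    unfolding normal_density_Fourier[OF s] by (simp add: mult.assoc[symmetric])
  have "2 * pi * expectation (\<lambda>\<omega>. normal_density 0 s (Y \<omega> - \<alpha>) * W \<omega>)
      = (LINT u|lborel. exp (- (s\<^sup>2 * u\<^sup>2) / 2) * expectation (\<lambda>\<omega>. cos (u * (Y \<omega> - \<alpha>)) * W \<omega>))"
    using F(1) unfolding eq by simp
  then show ?A by (simp add: field_simps)
  show ?B using F(2) by simp
qed

lemma expectation_abs_kernel:
  fixes V W :: "'a \<Rightarrow> real"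
  assumes [measurable]: "V \<in> borel_measurable M" "W \<in> borel_measurable M" and W: "\<And>\<omega>. \<bar>W \<omega>\<bar> \<le> b"
    and V: "integrable M V"
  shows "expectation (\<lambda>\<omega>. \<bar>V \<omega>\<bar> * W \<omega>) = (LINT v|lborel. expectation (\<lambda>\<omega>. cos_kernel (V \<omega>) v * W \<omega>)) / abs_const" (is ?A)
    and "integrable lborel (\<lambda>v. expectation (\<lambda>\<omega>. cos_kernel (V \<omega>) v * W \<omega>))" (is ?B)
proof -
  let ?f = "\<lambda>\<omega> v. cos_kernel (V \<omega>) v * W \<omega>"
  have int: "integrable lborel (?f \<omega>)" for \<omega> by (intro integrable_mult_left integral_cos_kernel)
  have "(LINT v|lborel. \<bar>?f \<omega> v\<bar>) = abs_const * (\<bar>V \<omega>\<bar> * \<bar>W \<omega>\<bar>)" for \<omega>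
    by (simp add: abs_mult integral_cos_kernel)
  moreover have "integrable M (\<lambda>\<omega>. abs_const * (\<bar>V \<omega>\<bar> * \<bar>W \<omega>\<bar>))"
  proof (rule integrable_mult_right, rule Bochner_Integration.integrable_bound[where f="\<lambda>\<omega>. b * \<bar>V \<omega>\<bar>"])
    have "0 \<le> b" using W[of undefined] by linarith
    then show "AE \<omega> in M. norm (\<bar>V \<omega>\<bar> * \<bar>W \<omega>\<bar>) \<le> norm (b * \<bar>V \<omega>\<bar>)"
      using W by (auto simp: abs_mult mult.commute[of b] intro!: mult_left_mono)
  qed (use V in auto)
  ultimately have abs: "integrable M (\<lambda>\<omega>. LINT v|lborel. \<bar>?f \<omega> v\<bar>)" by simp
  note F = Fubini_lborel[OF sigma_finite_measure_axioms, of ?f, OF _ int abs]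
  have eq: "(LINT v|lborel. ?f \<omega> v) = abs_const * (\<bar>V \<omega>\<bar> * W \<omega>)" for \<omega>
    by (simp add: integral_cos_kernel)
  have "abs_const * expectation (\<lambda>\<omega>. \<bar>V \<omega>\<bar> * W \<omega>) = (LINT v|lborel. expectation (\<lambda>\<omega>. cos_kernel (V \<omega>) v * W \<omega>))"
    using F(1) unfolding eq by simp
  then show ?A using abs_const_pos by (simp add: field_simps)
  show ?B using F(2) by simp
qed

end

text \<open>The left side is the mean of \<open>\<bar>V\<bar>\<close> for a centered normal
  \<open>V\<close> of variance \<open>m\<close>, so this is \<open>expectation_abs_kernel\<close>
  with \<open>W\<close> equal to 1.\<close>

lemma abs_moment_kernel:
  assumes "0 < m"
  shows "sqrt (2 * m / pi) = (LINT v|lborel. (if v \<le> 0 then 0 else (1 - exp (- (m * v\<^sup>2) / 2)) / v\<^sup>2)) / abs_const"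
    and "integrable lborel (\<lambda>v. if v \<le> 0 then 0 else (1 - exp (- (m * v\<^sup>2) / 2)) / v\<^sup>2)"
proof -
  interpret N: real_distribution std_normal_distribution by (rule real_dist_normal_dist)
  let ?V = "\<lambda>x::real. sqrt m * x"
  have ker: "N.expectation (\<lambda>x. cos_kernel (?V x) v * 1) = (if v \<le> 0 then 0 else (1 - exp (- (m * v\<^sup>2) / 2)) / v\<^sup>2)" for v
  proof (cases "v \<le> 0")
    case False
    have int: "integrable std_normal_distribution (\<lambda>x. cos (v * ?V x))"
      by (rule N.integrable_const_bound[where B=1]) auto
    have "N.expectation (\<lambda>x. cos (v * ?V x)) = (LINT x|lborel. std_normal_density x * cos ((v * sqrt m) * x))"
      by (subst integral_density) (auto simp: mult_ac)
    also have "\<dots> = exp (- (m * v\<^sup>2) / 2)"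
      unfolding integral_std_normal_cos using assms by (simp add: power_mult_distrib mult.commute)
    finally have "N.expectation (\<lambda>x. 1 - cos (v * ?V x)) = 1 - exp (- (m * v\<^sup>2) / 2)"
      using int N.prob_space by (subst Bochner_Integration.integral_diff) auto
    then show ?thesis using False by (simp add: cos_kernel_def[abs_def])
  qed (simp add: cos_kernel_def)
  have V1: "integrable std_normal_distribution (\<lambda>x. ?V x)"
    using integrable_std_normal_distribution_moment[of 1] by simp
  have "N.expectation (\<lambda>x. \<bar>?V x\<bar> * 1) = sqrt m * N.expectation (\<lambda>x. \<bar>x\<bar>)"
    using assms by (simp add: abs_mult)
  also have "N.expectation (\<lambda>x. \<bar>x\<bar>) = sqrt (2 / pi)"
    using std_normal_distribution_odd_moments_abs[of 0] by simp
  finally have "N.expectation (\<lambda>x. \<bar>?V x\<bar> * 1) = sqrt (2 * m / pi)"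
    by (simp add: real_sqrt_mult[symmetric])
  with N.expectation_abs_kernel[of ?V "\<lambda>_. 1" 1] V1
  show "sqrt (2 * m / pi) = (LINT v|lborel. (if v \<le> 0 then 0 else (1 - exp (- (m * v\<^sup>2) / 2)) / v\<^sup>2)) / abs_const"
    and "integrable lborel (\<lambda>v. if v \<le> 0 then 0 else (1 - exp (- (m * v\<^sup>2) / 2)) / v\<^sup>2)"
    unfolding ker by auto
qed

section \<open>Interpolation between decay, second moment and closeness\<close>

lemma power_powr: "0 < y \<Longrightarrow> (y ^ n) powr a = y powr (real n * a)" for y :: real
  by (subst powr_realpow[symmetric]) (auto simp: powr_powr)

text \<open>A weighted geometric mean of the three bounds on \<open>x\<close>; the weights leave a positive power of \<open>\<eta>\<close> and a
  function that is integrable in \<open>u\<close> and in \<open>v\<close>, at \<open>0\<close> as well as at infinity.\<close>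
lemma interpolation_bound:
  fixes x u v c K \<eta> :: real
  assumes v: "0 < v" and c: "0 < c" and K: "0 \<le> K" and \<eta>: "0 \<le> \<eta>" and x: "0 \<le> x"
    and xD: "x \<le> 4 / (1 + c * u\<^sup>2) ^ 16" and xK: "x \<le> K * v\<^sup>2" and x\<eta>: "x \<le> 2 * \<eta> * (1 + \<bar>u\<bar> + v) ^ 3"
  shows "x / v\<^sup>2 \<le> (8 * K ^ 6 + 2 * 4 ^ 7) powr (1/8) * (3 + 1 / c) * \<eta> powr (1/8) / (1 + c * u\<^sup>2) * power_weight v"
proof -
  define L where "L = 8 * K ^ 6 + 2 * 4 ^ 7"
  define d where "d = 1 + c * u\<^sup>2"
  have d: "1 \<le> d" using c by (simp add: d_def)
  \<comment> \<open>For \<open>v \<le> 1\<close> the bounds by decay, closeness and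
    \<open>K * v\<^sup>2\<close> get the weights 1/8, 1/8 and 6/8, whence \<open>v\<close> to the
    power 12 in \<open>x ^ 8\<close>. For \<open>v > 1\<close> the quadratic bound is useless; decay
    and closeness get 7/8 and 1/8, and the cubic factor of the latter leaves
    \<open>v ^ 3\<close>.\<close>
  define p where "p = (if v \<le> 1 then 12 else 3 :: nat)"
  have L: "0 < L" using K by (simp add: L_def add_nonneg_pos)
  have x8: "x ^ 8 \<le> L * \<eta> / d ^ 16 * (2 + \<bar>u\<bar>) ^ 3 * v ^ p"
  proof (cases "v \<le> 1")
    case True
    have 1: "x \<le> 2 * \<eta> * (2 + \<bar>u\<bar>) ^ 3"
      using True v \<eta> by (intro order_trans[OF x\<eta>] mult_left_mono power_mono) auto
    have "x ^ 8 = x * x * x ^ 6" by (simp add: eval_nat_numeral)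
    also have "\<dots> \<le> (4 / d ^ 16) * (2 * \<eta> * (2 + \<bar>u\<bar>) ^ 3) * (K * v\<^sup>2) ^ 6"
      using xD 1 xK x d \<eta> unfolding d_def[symmetric] by (intro mult_mono power_mono mult_nonneg_nonneg) auto
    also have "\<dots> = (8 * K ^ 6) * (\<eta> / d ^ 16 * (2 + \<bar>u\<bar>) ^ 3 * v ^ 12)"
      by (simp add: power_mult_distrib power_mult[symmetric])
    also have "\<dots> \<le> L * (\<eta> / d ^ 16 * (2 + \<bar>u\<bar>) ^ 3 * v ^ 12)"
      using \<eta> d v by (intro mult_right_mono) (auto simp: L_def)
    finally show ?thesis using True by (simp add: p_def)
  next
    case False
    have "1 + \<bar>u\<bar> + v \<le> (2 + \<bar>u\<bar>) * v"
    proof -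
      have "(1 + \<bar>u\<bar>) * 1 \<le> (1 + \<bar>u\<bar>) * v" using False by (intro mult_left_mono) auto
      then show ?thesis by (simp add: algebra_simps)
    qed
    then have "2 * \<eta> * (1 + \<bar>u\<bar> + v) ^ 3 \<le> 2 * \<eta> * ((2 + \<bar>u\<bar>) * v) ^ 3"
      using \<eta> v by (intro mult_left_mono power_mono) auto
    then have 1: "x \<le> 2 * \<eta> * ((2 + \<bar>u\<bar>) * v) ^ 3" using x\<eta> by linarith
    have "x ^ 7 \<le> (4 / d ^ 16) ^ 7" using xD x unfolding d_def[symmetric] by (rule power_mono)
    also have "\<dots> = 4 ^ 7 / d ^ (16 * 7)" unfolding power_divide power_mult[symmetric] by simp
    also have "\<dots> \<le> 4 ^ 7 / d ^ 16" using d by (intro divide_left_mono power_increasing) auto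
    finally have 2: "x ^ 7 \<le> 4 ^ 7 / d ^ 16" .
    have "x ^ 8 = x ^ 7 * x" by (simp add: eval_nat_numeral)
    also have "\<dots> \<le> (4 ^ 7 / d ^ 16) * (2 * \<eta> * ((2 + \<bar>u\<bar>) * v) ^ 3)"
      using 1 2 x d by (intro mult_mono) auto
    also have "\<dots> = (2 * 4 ^ 7) * (\<eta> / d ^ 16 * (2 + \<bar>u\<bar>) ^ 3 * v ^ 3)"
      by (simp add: power_mult_distrib)
    also have "\<dots> \<le> L * (\<eta> / d ^ 16 * (2 + \<bar>u\<bar>) ^ 3 * v ^ 3)"
      using \<eta> d v K by (intro mult_right_mono) (auto simp: L_def)
    finally show ?thesis using False by (simp add: p_def)
  qed
  have "x = (x ^ 8) powr (1/8)"
    using x power_powr[of x 8 "1/8"] by (cases "x = 0") auto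
  also have "\<dots> \<le> (L * \<eta> / d ^ 16 * (2 + \<bar>u\<bar>) ^ 3 * v ^ p) powr (1/8)"
    using x8 x by (intro powr_mono2) auto
  also have "\<dots> = L powr (1/8) * \<eta> powr (1/8) / (d ^ 16) powr (1/8) * ((2 + \<bar>u\<bar>) ^ 3) powr (1/8) * (v ^ p) powr (1/8)"
    using L \<eta> d v by (simp add: powr_mult powr_divide)
  \<comment> \<open>This is where the order 16 of the decay is spent: one factor \<open>d\<close>
    absorbs \<open>2 + \<bar>u\<bar>\<close>, the other one is the integrable Cauchy weight.\<close>
  also have "(d ^ 16) powr (1/8) = d\<^sup>2"
    using d power_powr[of d 16 "1/8"] by simp
  also have "((2 + \<bar>u\<bar>) ^ 3) powr (1/8) \<le> 2 + \<bar>u\<bar>"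
    using powr_mono[of "3/8" 1 "2 + \<bar>u\<bar>"] power_powr[of "2 + \<bar>u\<bar>" 3 "1/8"] by simp
  finally have "x \<le> L powr (1/8) * \<eta> powr (1/8) / d\<^sup>2 * (2 + \<bar>u\<bar>) * (v ^ p) powr (1/8)"
    using v by (simp add: mult_left_mono mult_right_mono divide_right_mono)
  also have "(v ^ p) powr (1/8) = power_weight v * v\<^sup>2"
  proof (cases "v \<le> 1")
    case True
    have "v powr (12 * (1/8)) = v powr (-1/2) * v powr 2" unfolding powr_add[symmetric] by simp
    then show ?thesis using True v power_powr[of v 12 "1/8"] by (simp add: p_def power_weight_def)
  next
    case False
    have "v powr (3 * (1/8)) = v powr (-13/8) * v powr 2" unfolding powr_add[symmetric] by simp
    then show ?thesis using False v power_powr[of v 3 "1/8"] by (simp add: p_def power_weight_def)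
  qed
  finally have 1: "x / v\<^sup>2 \<le> L powr (1/8) * \<eta> powr (1/8) * ((2 + \<bar>u\<bar>) / d\<^sup>2) * power_weight v"
    using v by (subst pos_divide_le_eq) (auto simp: mult_ac)
  have "\<bar>u\<bar> \<le> 1 + u\<^sup>2"
  proof (cases "\<bar>u\<bar> \<le> 1")
    case False
    then have "\<bar>u\<bar> * 1 \<le> \<bar>u\<bar> * \<bar>u\<bar>" by (intro mult_left_mono) auto
    then show ?thesis by (simp add: power2_eq_square)
  qed (auto intro: order_trans)
  moreover have "3 + u\<^sup>2 \<le> (3 + 1 / c) * d"
    using c by (simp add: d_def field_simps)
  ultimately have "2 + \<bar>u\<bar> \<le> (3 + 1 / c) * d" by linarith
  then have "(2 + \<bar>u\<bar>) / d\<^sup>2 \<le> (3 + 1 / c) * d / d\<^sup>2" by (intro divide_right_mono) auto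
  also have "\<dots> = (3 + 1 / c) / d" using d by (simp add: power2_eq_square)
  finally have "L powr (1/8) * \<eta> powr (1/8) * ((2 + \<bar>u\<bar>) / d\<^sup>2) * power_weight v
     \<le> L powr (1/8) * \<eta> powr (1/8) * ((3 + 1 / c) / d) * power_weight v"
    by (intro mult_right_mono mult_left_mono) auto
  with 1 show ?thesis unfolding L_def d_def by (simp add: mult_ac)
qed

lemma integrable_cauchy:
  assumes "0 < c"
  shows "integrable lborel (\<lambda>u::real. 1 / (1 + c * u\<^sup>2))"
proof -
  have "integrable lborel (\<lambda>x::real. inverse (1 + x^2))"
    using integrable_inverse_1_plus_square by (simp add: set_integrable_def einterval_def)
  from lborel_integrable_real_affine[OF this, of "sqrt c" 0] show ?thesis
    using assms by (simp add: power_mult_distrib divide_inverse)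
qed

text \<open>The constant of \<open>interpolation_bound\<close>, times the integrals of its two
  weights, over \<open>2 * pi\<close> from Fourier inversion and \<open>abs_const\<close> from the
  cosine representation.\<close>

definition rice_const :: "real \<Rightarrow> real \<Rightarrow> real" where
  "rice_const c K = (8 * K ^ 6 + 2 * 4 ^ 7) powr (1/8) * (3 + 1 / c) * (LINT u|lborel. 1 / (1 + c * u\<^sup>2))
     * (LINT v|lborel. power_weight v) / (2 * pi * abs_const)"

lemma (in prob_space) integrable_cis:
  assumes [measurable]: "X \<in> borel_measurable M"
  shows "integrable M (\<lambda>\<omega>. cis (X \<omega>))"
  by (rule integrable_const_bound[where B=1]) (auto simp: cis_conv_exp)

lemma (in prob_space) expectation_cos_cis:
  assumes [measurable]: "X \<in> borel_measurable M"
  shows "expectation (\<lambda>\<omega>. cos (X \<omega> - a)) = Re (cis (- a) * (CLINT \<omega>|M. cis (X \<omega>)))"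
proof -
  have "cis (- a) * (CLINT \<omega>|M. cis (X \<omega>)) = (CLINT \<omega>|M. cis (X \<omega> - a))"
    by (simp add: cis_mult flip: integral_mult_right_zero)
  also have "Re \<dots> = expectation (\<lambda>\<omega>. Re (cis (X \<omega> - a)))"
    by (rule integral_Re[symmetric]) (simp add: integrable_cis)
  finally show ?thesis by simp
qed

text \<open>Both sides are written as double integrals over \<open>u\<close> and \<open>v\<close>,
  with \<open>q\<close> and \<open>q0\<close> carrying the difference between the actual and the
  Gaussian law. The product of cosines in \<open>q\<close> is a combination of the characteristic
  function at \<open>(u, 0)\<close>, \<open>(u, v)\<close> and \<open>(u, - v)\<close>, so
  \<open>D\<close> and \<open>close\<close> apply to it. The resulting error depends neither on
  \<open>\<alpha>\<close> nor on the smoothing width \<open>s\<close>.\<close>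

lemma (in prob_space) crossing_compare:
  fixes Y V :: "'a \<Rightarrow> real"
  assumes Y[measurable]: "Y \<in> borel_measurable M" and V[measurable]: "V \<in> borel_measurable M"
    and V2: "integrable M (\<lambda>\<omega>. (V \<omega>)\<^sup>2)" "expectation (\<lambda>\<omega>. (V \<omega>)\<^sup>2) \<le> K"
    and m: "0 < m0" "0 < m2" "m2 \<le> K" and c: "0 < c" and \<eta>: "0 \<le> \<eta>" and s: "0 < s"
    and D: "\<And>u v. norm (CLINT \<omega>|M. cis (u * Y \<omega> + v * V \<omega>)) \<le> 1 / (1 + c * u\<^sup>2) ^ 16"
    and D0: "\<And>u. exp (- (m0 * u\<^sup>2) / 2) \<le> 1 / (1 + c * u\<^sup>2) ^ 16"
    and close: "\<And>u v. norm ((CLINT \<omega>|M. cis (u * Y \<omega> + v * V \<omega>)) - exp (- (m0 * u\<^sup>2 + m2 * v\<^sup>2) / 2))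
        \<le> \<eta> * (1 + \<bar>u\<bar> + \<bar>v\<bar>) ^ 3"
  shows "\<bar>expectation (\<lambda>\<omega>. \<bar>V \<omega>\<bar> * normal_density 0 s (Y \<omega> - \<alpha>))
     - sqrt (2 * m2 / pi) * normal_density 0 (sqrt (m0 + s\<^sup>2)) \<alpha>\<bar> \<le> rice_const c K * \<eta> powr (1/8)"
proof -
  define \<psi> where "\<psi> u v = (CLINT \<omega>|M. cis (u * Y \<omega> + v * V \<omega>))" for u v
  define \<psi>0 where "\<psi>0 u v = exp (- (m0 * u\<^sup>2 + m2 * v\<^sup>2) / 2)" for u v
  define q where "q u v = expectation (\<lambda>\<omega>. cos (u * (Y \<omega> - \<alpha>)) * (1 - cos (v * V \<omega>)))" for u v
  define q0 where "q0 u v = cos (u * \<alpha>) * exp (- (m0 * u\<^sup>2) / 2) * (1 - exp (- (m2 * v\<^sup>2) / 2))" for u v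
  define A where "A v = expectation (\<lambda>\<omega>. cos_kernel (V \<omega>) v * normal_density 0 s (Y \<omega> - \<alpha>))" for v
  \<comment> \<open>Smoothing a normal law of variance \<open>m0\<close> adds
    \<open>s\<^sup>2\<close> to its variance.\<close>
  define s' where "s' = sqrt (m0 + s\<^sup>2)"
  define g where "g v = (if v \<le> 0 then 0 else (1 - exp (- (m2 * v\<^sup>2) / 2)) / v\<^sup>2)" for v
  define L where "L = (8 * K ^ 6 + 2 * 4 ^ 7) powr (1/8) * (3 + 1 / c) * \<eta> powr (1/8)"
  define J where "J = (LINT u|lborel. 1 / (1 + c * u\<^sup>2))"
  have s': "0 < s'" "s'\<^sup>2 = m0 + s\<^sup>2" using m s by (auto simp: s'_def add_pos_pos)
  have K0: "0 \<le> K" using m by simp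
  have L0: "0 \<le> L" using c by (simp add: L_def)
  have V1: "integrable M V" by (rule square_integrable_imp_integrable[OF V V2(1)])
  have icos: "integrable M (\<lambda>\<omega>. cos (X \<omega>))" if [measurable]: "X \<in> borel_measurable M" for X :: "'a \<Rightarrow> real"
    by (rule integrable_const_bound[where B=1]) auto
  have qeq: "q u v = Re (cis (- (u * \<alpha>)) * (\<psi> u 0 - \<psi> u v / 2 - \<psi> u (- v) / 2))" for u v
  proof -
    have pt: "cos (u * (Y \<omega> - \<alpha>)) * (1 - cos (v * V \<omega>)) = cos ((u * Y \<omega> + 0 * V \<omega>) - u * \<alpha>)
        - cos ((u * Y \<omega> + v * V \<omega>) - u * \<alpha>) / 2 - cos ((u * Y \<omega> + (- v) * V \<omega>) - u * \<alpha>) / 2" for \<omega>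
    proof -
      have "cos ((u * Y \<omega> + v * V \<omega>) - u * \<alpha>) + cos ((u * Y \<omega> + (- v) * V \<omega>) - u * \<alpha>) =
          cos (u * (Y \<omega> - \<alpha>) + v * V \<omega>) + cos (u * (Y \<omega> - \<alpha>) - v * V \<omega>)"
        by (simp add: algebra_simps)
      also have "\<dots> = 2 * cos (u * (Y \<omega> - \<alpha>)) * cos (v * V \<omega>)"
        by (simp add: cos_add cos_diff)
      finally show ?thesis by (simp add: algebra_simps)
    qed
    have "q u v = expectation (\<lambda>\<omega>. cos ((u * Y \<omega> + 0 * V \<omega>) - u * \<alpha>))
        - expectation (\<lambda>\<omega>. cos ((u * Y \<omega> + v * V \<omega>) - u * \<alpha>)) / 2
        - expectation (\<lambda>\<omega>. cos ((u * Y \<omega> + (- v) * V \<omega>) - u * \<alpha>)) / 2"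
      unfolding q_def pt by (subst Bochner_Integration.integral_diff Bochner_Integration.integral_diff
         integral_divide_zero | (intro Bochner_Integration.integrable_diff integrable_divide_zero icos, measurable))+
    also have "\<dots> = Re (cis (- (u * \<alpha>)) * \<psi> u 0) - Re (cis (- (u * \<alpha>)) * \<psi> u v) / 2 - Re (cis (- (u * \<alpha>)) * \<psi> u (- v)) / 2"
      unfolding \<psi>_def by (subst (1 2 3) expectation_cos_cis) auto
    also have "\<dots> = Re (cis (- (u * \<alpha>)) * (\<psi> u 0 - \<psi> u v / 2 - \<psi> u (- v) / 2))"
      by (simp add: algebra_simps)
    finally show ?thesis .
  qed
  have q0eq: "q0 u v = Re (cis (- (u * \<alpha>)) * (complex_of_real (\<psi>0 u 0) - complex_of_real (\<psi>0 u v) / 2 - complex_of_real (\<psi>0 u (- v)) / 2))" for u v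
  proof -
    have "\<psi>0 u v = exp (- (m0 * u\<^sup>2) / 2) * exp (- (m2 * v\<^sup>2) / 2)" for u v
      by (simp add: \<psi>0_def exp_add[symmetric] add_divide_distrib diff_divide_distrib)
    then show ?thesis by (simp add: q0_def algebra_simps)
  qed
  have one_cos: "\<bar>1 - cos b\<bar> \<le> 2" for b :: real
    using cos_ge_minus_one[of b] cos_le_one[of b] by linarith
  have cos_prod: "\<bar>cos a * (1 - cos b)\<bar> \<le> 2" for a b :: real
    using mult_mono[OF abs_cos_le_one[of a] one_cos[of b]] by (simp add: abs_mult)
  have e01: "\<bar>1 - exp (- (m2 * v\<^sup>2) / 2)\<bar> = 1 - exp (- (m2 * v\<^sup>2) / 2)" for v
    using m mult_nonneg_nonneg[of m2 "v\<^sup>2"] by simp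
  have norm_Re: "\<bar>Re (cis a * z)\<bar> \<le> norm z" for a z
    using abs_Re_le_cmod[of "cis a * z"] by (simp add: norm_mult)
  have key: "\<bar>q u v - q0 u v\<bar> / v\<^sup>2 \<le> L * (1 / (1 + c * u\<^sup>2)) * power_weight v" if v: "0 < v" for u v
  proof -
    have "\<bar>q u v - q0 u v\<bar> / v\<^sup>2 \<le> (8 * K ^ 6 + 2 * 4 ^ 7) powr (1/8) * (3 + 1 / c) * \<eta> powr (1/8) / (1 + c * u\<^sup>2) * power_weight v"
    \<comment> \<open>The three bounds come, in turn, from the decay of both characteristic
      functions, from \<open>1 - cos x \<le> x\<^sup>2 / 2\<close> together with the second moments,
      and from the closeness hypothesis.\<close>
    proof (rule interpolation_bound[OF v c K0 \<eta>])
      have "\<bar>q u v\<bar> \<le> norm (\<psi> u 0 - \<psi> u v / 2 - \<psi> u (- v) / 2)" unfolding qeq by (rule norm_Re)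
      also have "\<dots> \<le> norm (\<psi> u 0) + norm (\<psi> u v / 2) + norm (\<psi> u (- v) / 2)"
        by (meson norm_triangle_ineq4 add_right_mono order_trans)
      also have "\<dots> \<le> 2 / (1 + c * u\<^sup>2) ^ 16"
        using D[of u 0] D[of u v] D[of u "- v"] by (simp add: \<psi>_def norm_divide)
      finally have 1: "\<bar>q u v\<bar> \<le> 2 / (1 + c * u\<^sup>2) ^ 16" .
      have "\<bar>q0 u v\<bar> \<le> 1 * exp (- (m0 * u\<^sup>2) / 2) * 1"
        unfolding q0_def abs_mult e01 using m by (intro mult_mono) auto
      then have 2: "\<bar>q0 u v\<bar> \<le> 1 / (1 + c * u\<^sup>2) ^ 16" using D0[of u] by linarith
      have "0 \<le> 1 / (1 + c * u\<^sup>2) ^ 16" using c by simp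
      with 1 2 show "\<bar>q u v - q0 u v\<bar> \<le> 4 / (1 + c * u\<^sup>2) ^ 16" by (simp add: field_simps)
    next
      have "\<bar>q u v\<bar> \<le> expectation (\<lambda>\<omega>. \<bar>cos (u * (Y \<omega> - \<alpha>)) * (1 - cos (v * V \<omega>))\<bar>)"
        unfolding q_def by (rule integral_abs_bound)
      also have "\<dots> \<le> expectation (\<lambda>\<omega>. v\<^sup>2 / 2 * (V \<omega>)\<^sup>2)"
      proof (rule integral_mono)
        show "integrable M (\<lambda>\<omega>. \<bar>cos (u * (Y \<omega> - \<alpha>)) * (1 - cos (v * V \<omega>))\<bar>)"
          by (rule integrable_const_bound[where B=2]) (use cos_prod in auto)
        show "\<bar>cos (u * (Y \<omega> - \<alpha>)) * (1 - cos (v * V \<omega>))\<bar> \<le> v\<^sup>2 / 2 * (V \<omega>)\<^sup>2" for \<omega>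
        proof -
          have "\<bar>cos (u * (Y \<omega> - \<alpha>)) * (1 - cos (v * V \<omega>))\<bar> \<le> 1 * (1 - cos (v * V \<omega>))"
            unfolding abs_mult by (intro mult_mono) auto
          also have "\<dots> \<le> (v * V \<omega>)\<^sup>2 / 2" using one_minus_cos_le[of "v * V \<omega>"] by simp
          finally show ?thesis by (simp add: power_mult_distrib)
        qed
      qed (use V2 in auto)
      also have "\<dots> \<le> v\<^sup>2 / 2 * K" using V2(2) by (simp add: mult_left_mono)
      finally have 1: "\<bar>q u v\<bar> \<le> v\<^sup>2 / 2 * K" .
      have "\<bar>q0 u v\<bar> \<le> 1 * 1 * (1 - exp (- (m2 * v\<^sup>2) / 2))"
        unfolding q0_def abs_mult e01 using m by (intro mult_mono) auto
      also have "\<dots> \<le> m2 * v\<^sup>2 / 2" using exp_ge_add_one_self[of "- (m2 * v\<^sup>2) / 2"] by simp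
      also have "\<dots> \<le> v\<^sup>2 / 2 * K" using m(3) mult_right_mono[OF m(3), of "v\<^sup>2"] by (simp add: mult.commute)
      finally have "\<bar>q0 u v\<bar> \<le> v\<^sup>2 / 2 * K" .
      with 1 show "\<bar>q u v - q0 u v\<bar> \<le> K * v\<^sup>2" by (simp add: mult.commute)
    next
      have "q u v - q0 u v = Re (cis (- (u * \<alpha>)) * ((\<psi> u 0 - \<psi>0 u 0) - (\<psi> u v - \<psi>0 u v) / 2 - (\<psi> u (- v) - \<psi>0 u (- v)) / 2))"
        unfolding qeq q0eq by (simp add: algebra_simps diff_divide_distrib)
      also have "\<bar>\<dots>\<bar> \<le> norm ((\<psi> u 0 - \<psi>0 u 0) - (\<psi> u v - \<psi>0 u v) / 2 - (\<psi> u (- v) - \<psi>0 u (- v)) / 2)" by (rule norm_Re)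
      also have "\<dots> \<le> norm (\<psi> u 0 - \<psi>0 u 0) + norm ((\<psi> u v - \<psi>0 u v) / 2) + norm ((\<psi> u (- v) - \<psi>0 u (- v)) / 2)"
        by (meson norm_triangle_ineq4 add_right_mono order_trans)
      also have "\<dots> \<le> \<eta> * (1 + \<bar>u\<bar> + v) ^ 3 + \<eta> * (1 + \<bar>u\<bar> + v) ^ 3 / 2 + \<eta> * (1 + \<bar>u\<bar> + v) ^ 3 / 2"
      proof (intro add_mono)
        have "norm (\<psi> u 0 - \<psi>0 u 0) \<le> \<eta> * (1 + \<bar>u\<bar> + \<bar>0\<bar>) ^ 3" unfolding \<psi>_def \<psi>0_def by (rule close)
        also have "\<dots> \<le> \<eta> * (1 + \<bar>u\<bar> + v) ^ 3" using v \<eta> by (intro mult_left_mono power_mono) auto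
        finally show "norm (\<psi> u 0 - \<psi>0 u 0) \<le> \<eta> * (1 + \<bar>u\<bar> + v) ^ 3" .
        show "norm ((\<psi> u v - \<psi>0 u v) / 2) \<le> \<eta> * (1 + \<bar>u\<bar> + v) ^ 3 / 2"
          using close[of u v] v by (simp add: \<psi>_def \<psi>0_def norm_divide)
        show "norm ((\<psi> u (- v) - \<psi>0 u (- v)) / 2) \<le> \<eta> * (1 + \<bar>u\<bar> + v) ^ 3 / 2"
          using close[of u "- v"] v by (simp add: \<psi>_def \<psi>0_def norm_divide)
      qed
      finally show "\<bar>q u v - q0 u v\<bar> \<le> 2 * \<eta> * (1 + \<bar>u\<bar> + v) ^ 3" by simp
    qed simp
    then show ?thesis by (simp add: L_def)
  qed
  have nds: "\<bar>normal_density 0 s x\<bar> \<le> 1 / sqrt (2 * pi * s\<^sup>2)" for x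
    unfolding normal_density_def by (auto simp: abs_mult intro!: divide_right_mono)
  have Adiff: "\<bar>A v - g v * normal_density 0 s' \<alpha>\<bar> \<le> L * J / (2 * pi) * power_weight v" for v
  proof (cases "v \<le> 0")
    case True
    then show ?thesis by (simp add: A_def g_def cos_kernel_def power_weight_def)
  next
    case False
    then have v: "0 < v" by simp
    have "A v = expectation (\<lambda>\<omega>. normal_density 0 s (Y \<omega> - \<alpha>) * (1 - cos (v * V \<omega>))) / v\<^sup>2"
      using v by (simp add: A_def cos_kernel_def mult.commute)
    also have "expectation (\<lambda>\<omega>. normal_density 0 s (Y \<omega> - \<alpha>) * (1 - cos (v * V \<omega>)))
       = (LINT u|lborel. exp (- (s\<^sup>2 * u\<^sup>2) / 2) * q u v) / (2 * pi)"
      unfolding q_def by (rule expectation_normal_density_Fourier(1)[where b=2]) (use s one_cos in auto)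
    finally have Av: "A v = (LINT u|lborel. exp (- (s\<^sup>2 * u\<^sup>2) / 2) * q u v) / (2 * pi) / v\<^sup>2" .
    have iq: "integrable lborel (\<lambda>u. exp (- (s\<^sup>2 * u\<^sup>2) / 2) * q u v)"
      unfolding q_def by (rule expectation_normal_density_Fourier(2)[where b=2]) (use s one_cos in auto)
    have eq0: "exp (- (s'\<^sup>2 * u\<^sup>2) / 2) * cos (u * \<alpha>) * (1 - exp (- (m2 * v\<^sup>2) / 2)) = exp (- (s\<^sup>2 * u\<^sup>2) / 2) * q0 u v" for u
    proof -
      have "exp (- (s'\<^sup>2 * u\<^sup>2) / 2) = exp (- (s\<^sup>2 * u\<^sup>2) / 2) * exp (- (m0 * u\<^sup>2) / 2)"
        unfolding s'(2) exp_add[symmetric] by (simp add: algebra_simps add_divide_distrib diff_divide_distrib)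
      then show ?thesis by (simp add: q0_def)
    qed
    have iq0: "integrable lborel (\<lambda>u. exp (- (s\<^sup>2 * u\<^sup>2) / 2) * q0 u v)"
      unfolding eq0[symmetric]
      by (intro integrable_mult_left Bochner_Integration.integrable_bound[OF integrable_gauss[OF s'(1)]]) (auto simp: abs_mult mult_left_le)
    have "g v * normal_density 0 s' \<alpha> = (LINT u|lborel. exp (- (s\<^sup>2 * u\<^sup>2) / 2) * q0 u v) / (2 * pi) / v\<^sup>2"
      using v unfolding g_def normal_density_Fourier[OF s'(1)] eq0[symmetric] by (simp add: mult.commute)
    then have "A v - g v * normal_density 0 s' \<alpha>
       = (LINT u|lborel. exp (- (s\<^sup>2 * u\<^sup>2) / 2) * q u v - exp (- (s\<^sup>2 * u\<^sup>2) / 2) * q0 u v) / (2 * pi) / v\<^sup>2"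
      unfolding Av Bochner_Integration.integral_diff[OF iq iq0] by (simp add: diff_divide_distrib)
    then have "\<bar>A v - g v * normal_density 0 s' \<alpha>\<bar> = \<bar>LINT u|lborel. exp (- (s\<^sup>2 * u\<^sup>2) / 2) * q u v - exp (- (s\<^sup>2 * u\<^sup>2) / 2) * q0 u v\<bar> / (2 * pi) / v\<^sup>2"
      by simp
    also have "\<dots> \<le> (LINT u|lborel. (L * power_weight v * v\<^sup>2) * (1 / (1 + c * u\<^sup>2))) / (2 * pi) / v\<^sup>2"
    proof (intro divide_right_mono order_trans[OF integral_abs_bound] integral_mono)
      show "integrable lborel (\<lambda>u. (L * power_weight v * v\<^sup>2) * (1 / (1 + c * u\<^sup>2)))"
        by (intro integrable_mult_right integrable_cauchy c)
      show "integrable lborel (\<lambda>u. \<bar>exp (- (s\<^sup>2 * u\<^sup>2) / 2) * q u v - exp (- (s\<^sup>2 * u\<^sup>2) / 2) * q0 u v\<bar>)"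
        by (intro integrable_abs Bochner_Integration.integrable_diff iq iq0)
      fix u :: real
      have "\<bar>exp (- (s\<^sup>2 * u\<^sup>2) / 2) * q u v - exp (- (s\<^sup>2 * u\<^sup>2) / 2) * q0 u v\<bar> = exp (- (s\<^sup>2 * u\<^sup>2) / 2) * \<bar>q u v - q0 u v\<bar>"
        by (simp add: abs_mult flip: right_diff_distrib)
      also have "\<dots> \<le> 1 * \<bar>q u v - q0 u v\<bar>" by (intro mult_right_mono) auto
      also have "\<dots> \<le> (L * power_weight v * v\<^sup>2) * (1 / (1 + c * u\<^sup>2))"
        using key[OF v, of u] v by (simp add: pos_divide_le_eq mult_ac)
      finally show "\<bar>exp (- (s\<^sup>2 * u\<^sup>2) / 2) * q u v - exp (- (s\<^sup>2 * u\<^sup>2) / 2) * q0 u v\<bar> \<le> (L * power_weight v * v\<^sup>2) * (1 / (1 + c * u\<^sup>2))" .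
    qed auto
    also have "\<dots> = L * J / (2 * pi) * power_weight v"
      unfolding integral_mult_right_zero J_def[symmetric] using v by simp
    finally show ?thesis .
  qed
  have EA: "expectation (\<lambda>\<omega>. \<bar>V \<omega>\<bar> * normal_density 0 s (Y \<omega> - \<alpha>)) = (LINT v|lborel. A v) / abs_const"
    unfolding A_def by (rule expectation_abs_kernel(1)[OF V _ nds V1]) simp
  have iA: "integrable lborel A"
    unfolding A_def[abs_def] by (rule expectation_abs_kernel(2)[OF V _ nds V1]) simp
  have E0: "sqrt (2 * m2 / pi) * normal_density 0 s' \<alpha> = (LINT v|lborel. g v * normal_density 0 s' \<alpha>) / abs_const"
    and ig: "integrable lborel (\<lambda>v. g v * normal_density 0 s' \<alpha>)"
    using abs_moment_kernel[OF m(2)] by (auto simp: g_def[abs_def])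
  have "expectation (\<lambda>\<omega>. \<bar>V \<omega>\<bar> * normal_density 0 s (Y \<omega> - \<alpha>)) - sqrt (2 * m2 / pi) * normal_density 0 s' \<alpha>
     = (LINT v|lborel. A v - g v * normal_density 0 s' \<alpha>) / abs_const"
    unfolding EA E0 Bochner_Integration.integral_diff[OF iA ig] by (simp add: diff_divide_distrib)
  also have "\<bar>\<dots>\<bar> = \<bar>LINT v|lborel. A v - g v * normal_density 0 s' \<alpha>\<bar> / abs_const"
    using abs_const_pos by simp
  also have "\<dots> \<le> (LINT v|lborel. L * J / (2 * pi) * power_weight v) / abs_const"
    using abs_const_pos
    by (intro divide_right_mono order_trans[OF integral_abs_bound] integral_mono integrable_abs
        Bochner_Integration.integrable_diff iA ig Adiff integrable_mult_right integrable_power_weight) auto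
  also have "\<dots> = rice_const c K * \<eta> powr (1/8)"
    by (simp add: rice_const_def L_def J_def)
  finally show ?thesis unfolding s'_def .
qed

section \<open>From smoothed averages to crossing probabilities\<close>

definition crosses :: "real \<Rightarrow> real \<Rightarrow> real \<Rightarrow> bool" where
  "crosses a b x \<longleftrightarrow> (a < x \<and> x < b) \<or> (b < x \<and> x < a)"

lemma measurable_crosses [measurable]:
  assumes [measurable]: "f \<in> borel_measurable M" "g \<in> borel_measurable M" "k \<in> borel_measurable M"
  shows "Measurable.pred M (\<lambda>\<omega>. crosses (f \<omega>) (g \<omega>) (k \<omega>))"
  unfolding crosses_def by measurable

text \<open>Substitute x = a + \<theta> * (b - a): the interval between \<open>a\<close> and
  \<open>b\<close> becomes the unit interval whichever end is larger. The Jacobian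
  \<open>\<bar>b - a\<bar>\<close> is the origin of the absolute slope in Rice's formula.\<close>

lemma crossing_smoothing_affine:
  "(LINT x|lborel. of_bool (crosses a b x) * normal_density 0 s (x - \<alpha>))
     = \<bar>b - a\<bar> * (LINT \<theta>|lborel. indicator {0<..<1} (\<theta>::real) * normal_density 0 s (a + \<theta> * (b - a) - \<alpha>))"
proof (cases "a = b")
  case False
  have "crosses a b (a + (b - a) * \<theta>) \<longleftrightarrow> \<theta> \<in> {0<..<1}" for \<theta>
  proof -
    have "a < a + (b - a) * \<theta> \<longleftrightarrow> 0 < (b - a) * \<theta>" "a + (b - a) * \<theta> < a \<longleftrightarrow> (b - a) * \<theta> < 0"
      "a + (b - a) * \<theta> < b \<longleftrightarrow> (b - a) * \<theta> < (b - a) * 1" "b < a + (b - a) * \<theta> \<longleftrightarrow> (b - a) * 1 < (b - a) * \<theta>"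
      by auto
    moreover have "(b - a) * \<theta> < (b - a) * 1 \<longleftrightarrow> (if a < b then \<theta> < 1 else 1 < \<theta>)"
      "(b - a) * 1 < (b - a) * \<theta> \<longleftrightarrow> (if a < b then 1 < \<theta> else \<theta> < 1)"
      using False unfolding mult_less_cancel_left by auto
    moreover have "0 < (b - a) * \<theta> \<longleftrightarrow> (if a < b then 0 < \<theta> else \<theta> < 0)"
      "(b - a) * \<theta> < 0 \<longleftrightarrow> (if a < b then \<theta> < 0 else 0 < \<theta>)"
      using False unfolding zero_less_mult_iff mult_less_0_iff by auto
    ultimately show ?thesis unfolding crosses_def by auto
  qed
  then have "of_bool (crosses a b (a + (b - a) * \<theta>)) = (indicator {0<..<1} \<theta> :: real)" for \<theta>
    by simp
  then show ?thesis
    using False by (subst lborel_integral_real_affine[where c="b - a" and t=a]) (auto simp: mult.commute)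
next
  case True
  then have "\<not> crosses a b x" for x by (auto simp: crosses_def)
  then show ?thesis using True by simp
qed

text \<open>After rescaling about \<open>\<alpha>\<close> the smoothing is against a fixed normal
  density. Since \<open>\<alpha>\<close> is neither end point, the integrand at each
  \<open>y\<close> is eventually constant in \<open>n\<close>.\<close>

lemma crossing_smoothing_limit:
  fixes s :: "nat \<Rightarrow> real"
  assumes s: "\<And>n. 0 < s n" "s \<longlonglongrightarrow> 0" and ab: "a \<noteq> \<alpha>" "b \<noteq> \<alpha>"
  shows "(\<lambda>n. LINT x|lborel. of_bool (crosses a b x) * normal_density 0 (s n) (x - \<alpha>)) \<longlonglongrightarrow> of_bool (crosses a b \<alpha>)"
proof -
  have eq: "(LINT x|lborel. of_bool (crosses a b x) * normal_density 0 (s n) (x - \<alpha>))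
     = (LINT y|lborel. of_bool (crosses a b (\<alpha> + s n * y)) * std_normal_density y)" for n
  proof -
    have *: "s n * normal_density 0 (s n) (s n * y) = std_normal_density y" for y
      using s(1)[of n] by (simp add: normal_density_def std_normal_density_def power_mult_distrib real_sqrt_mult)
    show ?thesis
      using s(1)[of n]
      by (subst lborel_integral_real_affine[where c="s n" and t=\<alpha>])
         (auto simp flip: * integral_mult_right_zero simp: mult_ac)
  qed
  have "(\<lambda>n. LINT y|lborel. of_bool (crosses a b (\<alpha> + s n * y)) * std_normal_density y)
      \<longlonglongrightarrow> (LINT y|lborel. of_bool (crosses a b \<alpha>) * std_normal_density y)"
  proof (rule integral_dominated_convergence[where w=std_normal_density])
    show "AE y in lborel. (\<lambda>n. of_bool (crosses a b (\<alpha> + s n * y)) * std_normal_density y)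
        \<longlonglongrightarrow> of_bool (crosses a b \<alpha>) * std_normal_density y"
    proof (rule AE_I2, rule tendsto_eventually)
      fix y
      have lim: "(\<lambda>n. \<alpha> + s n * y) \<longlonglongrightarrow> \<alpha>"
        using tendsto_add[OF tendsto_const[of \<alpha>] tendsto_mult_left[OF s(2), of y]] by (simp add: mult.commute)
      have "\<forall>\<^sub>F n in sequentially. (a < \<alpha> + s n * y \<longleftrightarrow> a < \<alpha>) \<and> (\<alpha> + s n * y < a \<longleftrightarrow> \<alpha> < a)" if "a \<noteq> \<alpha>" for a
        using that order_tendstoD[OF lim, of a] by (cases a \<alpha> rule: linorder_cases) (auto elim!: eventually_mono)
      from this[OF ab(1)] this[OF ab(2)]
      show "\<forall>\<^sub>F n in sequentially. of_bool (crosses a b (\<alpha> + s n * y)) * std_normal_density y = of_bool (crosses a b \<alpha>) * std_normal_density y"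
        by eventually_elim (auto simp: crosses_def)
    qed
  qed (auto simp: crosses_def)
  then show ?thesis unfolding eq by simp
qed

text \<open>At fixed width \<open>s\<close> Fubini averages the bound over \<theta> in the unit
  interval; dominated convergence then removes the smoothing. The same \<open>\<epsilon>\<close>
  must serve for all \<theta> and \<open>s\<close>, because both are integrated or sent to a limit.
  Null probability of hitting \<open>\<alpha>\<close> at the ends makes the limit the indicator of a
  crossing.\<close>

lemma (in prob_space) crossing_probability:
  fixes A B :: "'a \<Rightarrow> real"
  assumes [measurable]: "A \<in> borel_measurable M" "B \<in> borel_measurable M"
    and h: "0 < h" and V: "integrable M (\<lambda>\<omega>. (B \<omega> - A \<omega>) / h)"
    and bound: "\<And>\<theta> s. 0 < \<theta> \<Longrightarrow> \<theta> < 1 \<Longrightarrow> 0 < s \<Longrightarrow>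
       \<bar>expectation (\<lambda>\<omega>. \<bar>(B \<omega> - A \<omega>) / h\<bar> * normal_density 0 s (A \<omega> + \<theta> * (B \<omega> - A \<omega>) - \<alpha>)) - R s\<bar> \<le> \<epsilon>"
    and R: "(R \<longlongrightarrow> R0) (at_right 0)"
    and ne: "AE \<omega> in M. A \<omega> \<noteq> \<alpha>" "AE \<omega> in M. B \<omega> \<noteq> \<alpha>"
  shows "\<bar>prob {\<omega> \<in> space M. crosses (A \<omega>) (B \<omega>) \<alpha>} - h * R0\<bar> \<le> h * \<epsilon>"
proof -
  define s where "s n = inverse (real (Suc n))" for n
  have s: "0 < s n" for n by (simp add: s_def)
  have s0: "s \<longlonglongrightarrow> 0" unfolding s_def by (rule LIMSEQ_inverse_real_of_nat)
  define \<Phi> where "\<Phi> n \<omega> = (LINT x|lborel. of_bool (crosses (A \<omega>) (B \<omega>) x) * normal_density 0 (s n) (x - \<alpha>))" for n \<omega>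
  have [measurable]: "\<Phi> n \<in> borel_measurable M" for n unfolding \<Phi>_def[abs_def] by measurable
  have nd1: "integrable lborel (\<lambda>x. normal_density 0 (s n) (x - \<alpha>))" "(LINT x|lborel. normal_density 0 (s n) (x - \<alpha>)) = 1" for n
  proof -
    have "normal_density 0 (s n) (x - \<alpha>) = normal_density \<alpha> (s n) x" for x by (simp add: normal_density_def)
    then show "integrable lborel (\<lambda>x. normal_density 0 (s n) (x - \<alpha>))" "(LINT x|lborel. normal_density 0 (s n) (x - \<alpha>)) = 1"
      using s[of n] by auto
  qed
  have \<Phi>01: "\<bar>\<Phi> n \<omega>\<bar> \<le> 1" for n \<omega>
  proof -
    have "\<bar>\<Phi> n \<omega>\<bar> \<le> (LINT x|lborel. \<bar>of_bool (crosses (A \<omega>) (B \<omega>) x) * normal_density 0 (s n) (x - \<alpha>)\<bar>)"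
      unfolding \<Phi>_def by (rule integral_abs_bound)
    also have "\<dots> \<le> (LINT x|lborel. normal_density 0 (s n) (x - \<alpha>))"
    proof (rule integral_mono[OF integrable_abs nd1(1)])
      show "integrable lborel (\<lambda>x. of_bool (crosses (A \<omega>) (B \<omega>) x) * normal_density 0 (s n) (x - \<alpha>))"
        by (rule Bochner_Integration.integrable_bound[OF nd1(1)[of n]]) (auto simp: abs_mult)
    qed auto
    finally show ?thesis using nd1(2) by simp
  qed
  have "(\<lambda>n. expectation (\<Phi> n)) \<longlonglongrightarrow> expectation (\<lambda>\<omega>. of_bool (crosses (A \<omega>) (B \<omega>) \<alpha>))"
  proof (rule integral_dominated_convergence[where w="\<lambda>_. 1"])
    show "AE \<omega> in M. (\<lambda>n. \<Phi> n \<omega>) \<longlonglongrightarrow> of_bool (crosses (A \<omega>) (B \<omega>) \<alpha>)"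
      using ne unfolding \<Phi>_def by eventually_elim (rule crossing_smoothing_limit[OF s s0])
  qed (use \<Phi>01 in auto)
  also have "expectation (\<lambda>\<omega>. of_bool (crosses (A \<omega>) (B \<omega>) \<alpha>)) = expectation (indicator {\<omega> \<in> space M. crosses (A \<omega>) (B \<omega>) \<alpha>})"
    by (rule Bochner_Integration.integral_cong) auto
  also have "\<dots> = prob {\<omega> \<in> space M. crosses (A \<omega>) (B \<omega>) \<alpha>}" by simp
  finally have lim: "(\<lambda>n. expectation (\<Phi> n)) \<longlonglongrightarrow> prob {\<omega> \<in> space M. crosses (A \<omega>) (B \<omega>) \<alpha>}" .
  have bd: "\<bar>expectation (\<Phi> n) - h * R (s n)\<bar> \<le> h * \<epsilon>" for n
  proof -
    let ?b = "1 / sqrt (2 * pi * (s n)\<^sup>2)"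
    let ?f = "\<lambda>\<omega> \<theta>. indicator {0<..<1} \<theta> * (\<bar>(B \<omega> - A \<omega>) / h\<bar> * normal_density 0 (s n) (A \<omega> + \<theta> * (B \<omega> - A \<omega>) - \<alpha>))"
    have nds: "\<bar>normal_density 0 (s n) x\<bar> \<le> ?b" for x
      unfolding normal_density_def by (auto simp: abs_mult intro!: divide_right_mono)
    have ind: "integrable lborel (\<lambda>\<theta>::real. indicator {0<..<1} \<theta> * (C::real))" for C
      by (intro integrable_mult_left integrable_real_indicator) auto
    have fb: "\<bar>?f \<omega> \<theta>\<bar> \<le> indicator {0<..<1} \<theta> * (\<bar>(B \<omega> - A \<omega>) / h\<bar> * ?b)" for \<omega> \<theta>
    proof -
      have "\<bar>?f \<omega> \<theta>\<bar> = indicator {0<..<1} \<theta> * (\<bar>(B \<omega> - A \<omega>) / h\<bar> * \<bar>normal_density 0 (s n) (A \<omega> + \<theta> * (B \<omega> - A \<omega>) - \<alpha>)\<bar>)"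
        by (simp add: abs_mult)
      also have "\<dots> \<le> indicator {0<..<1} \<theta> * (\<bar>(B \<omega> - A \<omega>) / h\<bar> * ?b)"
        by (intro mult_left_mono nds) auto
      finally show ?thesis .
    qed
    have i1: "integrable lborel (?f \<omega>)" if "\<omega> \<in> space M" for \<omega>
      by (rule Bochner_Integration.integrable_bound[OF ind[of "\<bar>(B \<omega> - A \<omega>) / h\<bar> * ?b"]])
         (use fb in \<open>auto intro!: order_trans[OF fb]\<close>)
    have i2: "integrable M (\<lambda>\<omega>. LINT \<theta>|lborel. \<bar>?f \<omega> \<theta>\<bar>)"
    proof (rule Bochner_Integration.integrable_bound[where f="\<lambda>\<omega>. \<bar>(B \<omega> - A \<omega>) / h\<bar> * ?b"])
      show "AE \<omega> in M. norm (LINT \<theta>|lborel. \<bar>?f \<omega> \<theta>\<bar>) \<le> norm (\<bar>(B \<omega> - A \<omega>) / h\<bar> * ?b)"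
      proof (rule AE_I2)
        fix \<omega> assume w: "\<omega> \<in> space M"
        have "(LINT \<theta>|lborel. \<bar>?f \<omega> \<theta>\<bar>) \<le> (LINT \<theta>|lborel. indicator {0<..<1} (\<theta>::real) * (\<bar>(B \<omega> - A \<omega>) / h\<bar> * ?b))"
        proof (rule integral_mono)
          show "integrable lborel (\<lambda>\<theta>. \<bar>?f \<omega> \<theta>\<bar>)" by (rule integrable_abs[OF i1[OF w]])
          show "integrable lborel (\<lambda>\<theta>::real. indicator {0<..<1} \<theta> * (\<bar>(B \<omega> - A \<omega>) / h\<bar> * ?b))" by (rule ind)
          show "\<bar>?f \<omega> \<theta>\<bar> \<le> indicator {0<..<1} \<theta> * (\<bar>(B \<omega> - A \<omega>) / h\<bar> * ?b)" for \<theta> by (rule fb)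
        qed
        then show "norm (LINT \<theta>|lborel. \<bar>?f \<omega> \<theta>\<bar>) \<le> norm (\<bar>(B \<omega> - A \<omega>) / h\<bar> * ?b)" by simp
      qed
      show "integrable M (\<lambda>\<omega>. \<bar>(B \<omega> - A \<omega>) / h\<bar> * ?b)"
        by (intro integrable_mult_left integrable_abs V)
    qed auto
    note F = Fubini_lborel[OF sigma_finite_measure_axioms, of ?f, OF _ i1 i2]
    have F1: "(LINT \<omega>|M. LINT \<theta>|lborel. ?f \<omega> \<theta>) = (LINT \<theta>|lborel. expectation (\<lambda>\<omega>. ?f \<omega> \<theta>))"
      by (rule F(1)) simp
    have \<Phi>f: "\<Phi> n \<omega> = h * (LINT \<theta>|lborel. ?f \<omega> \<theta>)" for \<omega>
    proof -
      have "(LINT \<theta>|lborel. ?f \<omega> \<theta>) = (LINT \<theta>|lborel. \<bar>(B \<omega> - A \<omega>) / h\<bar> * (indicator {0<..<1} \<theta> * normal_density 0 (s n) (A \<omega> + \<theta> * (B \<omega> - A \<omega>) - \<alpha>)))"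
        by (simp add: mult_ac)
      also have "\<dots> = \<bar>B \<omega> - A \<omega>\<bar> / h * (LINT \<theta>|lborel. indicator {0<..<1} (\<theta>::real) * normal_density 0 (s n) (A \<omega> + \<theta> * (B \<omega> - A \<omega>) - \<alpha>))"
        using h by (simp add: abs_divide)
      finally show ?thesis unfolding \<Phi>_def crossing_smoothing_affine using h by simp
    qed
    have "expectation (\<Phi> n) = h * (LINT \<theta>|lborel. expectation (\<lambda>\<omega>. ?f \<omega> \<theta>))"
      unfolding \<Phi>f integral_mult_right_zero F1 ..
    moreover have "R (s n) = (LINT \<theta>|lborel. indicator {0<..<1} (\<theta>::real) * R (s n))" by simp
    ultimately have "expectation (\<Phi> n) - h * R (s n) = h * (LINT \<theta>|lborel. expectation (\<lambda>\<omega>. ?f \<omega> \<theta>) - indicator {0<..<1} \<theta> * R (s n))"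
      using F(2) ind[of "R (s n)"] by (subst Bochner_Integration.integral_diff) (auto simp: algebra_simps)
    then have "\<bar>expectation (\<Phi> n) - h * R (s n)\<bar> = h * \<bar>LINT \<theta>|lborel. expectation (\<lambda>\<omega>. ?f \<omega> \<theta>) - indicator {0<..<1} \<theta> * R (s n)\<bar>"
      using h by (simp add: abs_mult)
    also have "\<dots> \<le> h * (LINT \<theta>|lborel. indicator {0<..<1} (\<theta>::real) * \<epsilon>)"
    proof (rule mult_left_mono[OF order_trans[OF integral_abs_bound integral_mono]])
      show "integrable lborel (\<lambda>\<theta>. \<bar>expectation (\<lambda>\<omega>. ?f \<omega> \<theta>) - indicator {0<..<1} \<theta> * R (s n)\<bar>)"
        by (rule integrable_abs, rule Bochner_Integration.integrable_diff[OF _ ind], rule F(2)) simp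
      show "integrable lborel (\<lambda>\<theta>::real. indicator {0<..<1} \<theta> * \<epsilon>)" by (rule ind)
      fix \<theta> :: real
      show "\<bar>expectation (\<lambda>\<omega>. ?f \<omega> \<theta>) - indicator {0<..<1} \<theta> * R (s n)\<bar> \<le> indicator {0<..<1} \<theta> * \<epsilon>"
      proof (cases "\<theta> \<in> {0<..<1}")
        case True
        then show ?thesis using bound[of \<theta> "s n"] s[of n] by simp
      qed simp
    qed (use h in auto)
    also have "\<dots> = h * \<epsilon>" by simp
    finally show ?thesis .
  qed
  have "(\<lambda>n. R (s n)) \<longlonglongrightarrow> R0"
    using s s[THEN less_imp_neq, THEN not_sym] by (intro filterlim_compose[OF R]) (auto simp: filterlim_at s0)
  then have "(\<lambda>n. \<bar>expectation (\<Phi> n) - h * R (s n)\<bar>) \<longlonglongrightarrow> \<bar>prob {\<omega> \<in> space M. crosses (A \<omega>) (B \<omega>) \<alpha>} - h * R0\<bar>"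
    by (intro tendsto_rabs tendsto_diff lim tendsto_mult_left)
  then show ?thesis by (rule LIMSEQ_le_const2) (use bd in auto)
qed

text \<open>The indicator of \<open>Y \<omega> = \<alpha>\<close> is at most
  \<open>sqrt (2 * pi) * s\<close> times the smoothed density of width \<open>s\<close>. Integrable
  decay bounds the mean of the latter by a constant independent of \<open>s\<close>, and
  \<open>s\<close> tends to 0.\<close>

lemma (in prob_space) no_atom:
  fixes Y :: "'a \<Rightarrow> real"
  assumes Y[measurable]: "Y \<in> borel_measurable M" and c: "0 < c"
    and D: "\<And>u. norm (CLINT \<omega>|M. cis (u * Y \<omega>)) \<le> 1 / (1 + c * u\<^sup>2)"
  shows "AE \<omega> in M. Y \<omega> \<noteq> \<alpha>"
proof -
  define K where "K = (LINT u|lborel. 1 / (1 + c * u\<^sup>2)) / (2 * pi)"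
  have bd: "prob {\<omega> \<in> space M. Y \<omega> = \<alpha>} \<le> K * sqrt (2 * pi) * s" if s: "0 < s" for s
  proof -
    have "prob {\<omega> \<in> space M. Y \<omega> = \<alpha>} = expectation (indicator {\<omega> \<in> space M. Y \<omega> = \<alpha>})" by simp
    also have "\<dots> \<le> expectation (\<lambda>\<omega>. sqrt (2 * pi) * s * (normal_density 0 s (Y \<omega> - \<alpha>) * 1))"
    proof (rule integral_mono)
      show "integrable M (\<lambda>\<omega>. sqrt (2 * pi) * s * (normal_density 0 s (Y \<omega> - \<alpha>) * 1))"
      proof (intro integrable_mult_right integrable_const_bound[where B="1 / sqrt (2 * pi * s\<^sup>2)"])
        show "AE \<omega> in M. norm (normal_density 0 s (Y \<omega> - \<alpha>) * 1) \<le> 1 / sqrt (2 * pi * s\<^sup>2)"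
          unfolding normal_density_def by (auto simp: abs_mult intro!: divide_right_mono)
      qed auto
      show "indicator {\<omega> \<in> space M. Y \<omega> = \<alpha>} \<omega> \<le> sqrt (2 * pi) * s * (normal_density 0 s (Y \<omega> - \<alpha>) * 1)" for \<omega>
        using s by (auto simp: indicator_def normal_density_def real_sqrt_mult)
      show "integrable M (indicat_real {\<omega> \<in> space M. Y \<omega> = \<alpha>})"
        by (rule integrable_const_bound[where B=1]) auto
    qed
    also have "\<dots> = sqrt (2 * pi) * s * expectation (\<lambda>\<omega>. normal_density 0 s (Y \<omega> - \<alpha>) * 1)" by simp
    also have "expectation (\<lambda>\<omega>. normal_density 0 s (Y \<omega> - \<alpha>) * 1)
        = (LINT u|lborel. exp (- (s\<^sup>2 * u\<^sup>2) / 2) * expectation (\<lambda>\<omega>. cos (u * (Y \<omega> - \<alpha>)) * 1)) / (2 * pi)"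
      by (rule expectation_normal_density_Fourier(1)[where b=1]) (use s in auto)
    also have "\<dots> \<le> K" unfolding K_def
    proof (intro divide_right_mono integral_mono integrable_cauchy c)
      show "integrable lborel (\<lambda>u. exp (- (s\<^sup>2 * u\<^sup>2) / 2) * expectation (\<lambda>\<omega>. cos (u * (Y \<omega> - \<alpha>)) * 1))"
        by (rule expectation_normal_density_Fourier(2)[where b=1]) (use s in auto)
      fix u :: real
      have "expectation (\<lambda>\<omega>. cos (u * (Y \<omega> - \<alpha>)) * 1) = Re (cis (- (u * \<alpha>)) * (CLINT \<omega>|M. cis (u * Y \<omega>)))"
        using expectation_cos_cis[of "\<lambda>\<omega>. u * Y \<omega>" "u * \<alpha>"] by (simp add: algebra_simps)
      also have "\<bar>\<dots>\<bar> \<le> 1 / (1 + c * u\<^sup>2)"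
        using abs_Re_le_cmod[of "cis (- (u * \<alpha>)) * (CLINT \<omega>|M. cis (u * Y \<omega>))"] D[of u] by (simp add: norm_mult)
      finally have "\<bar>expectation (\<lambda>\<omega>. cos (u * (Y \<omega> - \<alpha>)) * 1)\<bar> \<le> 1 / (1 + c * u\<^sup>2)" .
      then have "exp (- (s\<^sup>2 * u\<^sup>2) / 2) * \<bar>expectation (\<lambda>\<omega>. cos (u * (Y \<omega> - \<alpha>)) * 1)\<bar> \<le> 1 * (1 / (1 + c * u\<^sup>2))"
        by (intro mult_mono) auto
      then have "exp (- (s\<^sup>2 * u\<^sup>2) / 2) * \<bar>expectation (\<lambda>\<omega>. cos (u * (Y \<omega> - \<alpha>)) * 1)\<bar> \<le> 1 / (1 + c * u\<^sup>2)"
        by simp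
      then show "exp (- (s\<^sup>2 * u\<^sup>2) / 2) * expectation (\<lambda>\<omega>. cos (u * (Y \<omega> - \<alpha>)) * 1) \<le> 1 / (1 + c * u\<^sup>2)"
        by (rule order_trans[OF mult_left_mono[OF abs_ge_self], rotated]) auto
    qed auto
    finally show ?thesis using s by (simp add: mult_ac mult_left_mono)
  qed
  have "((\<lambda>s. K * sqrt (2 * pi) * s) \<longlongrightarrow> K * sqrt (2 * pi) * 0) (at_right 0)"
    by (intro tendsto_intros)
  then have "prob {\<omega> \<in> space M. Y \<omega> = \<alpha>} \<le> K * sqrt (2 * pi) * 0"
    by (rule tendsto_lowerbound) (auto simp: eventually_at_right_less intro!: eventually_at_rightI[of 0 1] bd)
  then have "prob {\<omega> \<in> space M. Y \<omega> = \<alpha>} = 0" by (simp add: measure_le_0_iff)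
  then show ?thesis by (subst prob_Collect_eq_0[symmetric]) auto
qed

section \<open>Crossings and dyadic sign changes\<close>

definition dyadic :: "nat \<Rightarrow> nat \<Rightarrow> real" where
  "dyadic n k = real k / 2 ^ n"

definition sign_changes :: "(real \<Rightarrow> real) \<Rightarrow> nat \<Rightarrow> real \<Rightarrow> nat" where
  "sign_changes y n x = card {k. k < 2 ^ n \<and> crosses (y (dyadic n k)) (y (dyadic n (Suc k))) x}"

lemma dyadic_le_iff [simp]: "dyadic n k \<le> dyadic n l \<longleftrightarrow> k \<le> l"
  by (simp add: dyadic_def divide_le_cancel)

lemma dyadic_less_iff [simp]: "dyadic n k < dyadic n l \<longleftrightarrow> k < l"
  by (simp add: dyadic_def divide_less_cancel)

lemma dyadic_nonneg [simp]: "0 \<le> dyadic n k"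
  by (simp add: dyadic_def)

lemma dyadic_le_one: "dyadic n k \<le> 1 \<longleftrightarrow> k \<le> 2 ^ n"
  by (simp add: dyadic_def)

lemma dyadic_refine: "n \<le> m \<Longrightarrow> dyadic n k = dyadic m (k * 2 ^ (m - n))"
  by (simp add: dyadic_def field_simps flip: power_add)

lemma dyadic_between:
  assumes "0 \<le> p" "p < q"
  obtains n k where "p < dyadic n k" "dyadic n k < q"
proof -
  obtain n where n: "1 / (q - p) < 2 ^ n" using real_arch_pow[of 2 "1 / (q - p)"] by auto
  define k where "k = Suc (nat \<lfloor>p * 2 ^ n\<rfloor>)"
  have k: "real k = of_int \<lfloor>p * 2 ^ n\<rfloor> + 1" using assms by (simp add: k_def)
  have "p * 2 ^ n < real k" unfolding k by linarith
  moreover have "real k \<le> p * 2 ^ n + 1" unfolding k by linarith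
  moreover have "p * 2 ^ n + 1 < q * 2 ^ n" using n assms by (simp add: field_simps)
  ultimately show ?thesis by (intro that[of n k]) (auto simp: dyadic_def field_simps)
qed

text \<open>The intermediate value theorem gives a zero in each crossed interval. Since
  \<open>crosses\<close> is strict at both ends, these zeros lie in disjoint open intervals and are
  distinct.\<close>

lemma sign_changes_le_ecount:
  assumes y: "continuous_on {0..1} y"
  shows "ennreal (real (sign_changes y n x)) \<le> ecount {t \<in> {0..1}. y t = x}"
proof -
  define S where "S = {k. k < 2 ^ n \<and> crosses (y (dyadic n k)) (y (dyadic n (Suc k))) x}"
  have finS: "finite S" by (simp add: S_def)
  have "\<exists>z. dyadic n k < z \<and> z < dyadic n (Suc k) \<and> y z = x" if k: "k \<in> S" for k
  proof -
    have sub: "{dyadic n k..dyadic n (Suc k)} \<subseteq> {0..1}"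
      using k dyadic_le_one[of n "Suc k"] order_trans[OF dyadic_nonneg[of n k]] by (auto simp: S_def)
    have cont: "continuous_on {dyadic n k..dyadic n (Suc k)} y" by (rule continuous_on_subset[OF y sub])
    have le: "dyadic n k \<le> dyadic n (Suc k)" by simp
    consider "y (dyadic n k) < x" "x < y (dyadic n (Suc k))" | "y (dyadic n (Suc k)) < x" "x < y (dyadic n k)"
      using k by (auto simp: S_def crosses_def)
    then obtain z where z: "dyadic n k \<le> z" "z \<le> dyadic n (Suc k)" "y z = x"
    proof cases
      case 1 then show ?thesis using IVT'[of y "dyadic n k" x "dyadic n (Suc k)"] cont le that by auto
    next
      case 2 then show ?thesis using IVT2'[of y "dyadic n (Suc k)" x "dyadic n k"] cont le that by auto
    qed
    moreover have "z \<noteq> dyadic n k" "z \<noteq> dyadic n (Suc k)" using z k by (auto simp: S_def crosses_def)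
    ultimately show ?thesis by (intro exI[of _ z]) auto
  qed
  then obtain z where z: "\<And>k. k \<in> S \<Longrightarrow> dyadic n k < z k \<and> z k < dyadic n (Suc k) \<and> y (z k) = x"
    by metis
  have ltz: "z k < z l" if "k \<in> S" "l \<in> S" "k < l" for k l
  proof -
    have "dyadic n (Suc k) \<le> dyadic n l" using that by simp
    then show ?thesis using z[OF that(1)] z[OF that(2)] by linarith
  qed
  have inj: "inj_on z S"
    by (rule linorder_inj_onI) (use ltz in force)+
  have sub: "z ` S \<subseteq> {t \<in> {0..1}. y t = x}"
  proof
    fix t assume "t \<in> z ` S"
    then obtain k where k: "k \<in> S" "t = z k" by auto
    have "0 \<le> dyadic n k" "dyadic n (Suc k) \<le> 1" using k by (auto simp: S_def dyadic_le_one)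
    then have "0 \<le> z k" "z k \<le> 1" using z[OF k(1)] by linarith+
    then show "t \<in> {t \<in> {0..1}. y t = x}" using z[OF k(1)] k(2) by auto
  qed
  have "ennreal (real (card S)) = ecount (z ` S)"
    using finS inj by (simp add: ecount_def emeasure_count_space card_image ennreal_of_nat_eq_real_of_nat)
  also have "\<dots> \<le> ecount {t \<in> {0..1}. y t = x}"
    unfolding ecount_def by (rule emeasure_mono[OF sub]) simp
  finally show ?thesis by (simp add: sign_changes_def S_def)
qed

text \<open>At each zero of \<open>y - \<alpha>\<close>, even a tangential one, the path enters and leaves a thin band about \<open>\<alpha>\<close>, so every
  zero contributes two changes.\<close>
definition band_changes :: "(real \<Rightarrow> real) \<Rightarrow> real \<Rightarrow> real \<Rightarrow> nat \<Rightarrow> nat \<Rightarrow> nat" where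
  "band_changes y \<alpha> \<delta> n m = card {k. k < m \<and> (\<bar>y (dyadic n k) - \<alpha>\<bar> < \<delta>) \<noteq> (\<bar>y (dyadic n (Suc k)) - \<alpha>\<bar> < \<delta>)}"

text \<open>As no dyadic value lies on the edge of the band, a pair of neighbours of which exactly
  one is inside the band is strictly separated by one of its edges.\<close>

lemma band_changes_le:
  assumes ne: "\<And>k. k \<le> 2 ^ n \<Longrightarrow> y (dyadic n k) \<noteq> \<alpha> + \<delta> \<and> y (dyadic n k) \<noteq> \<alpha> - \<delta>"
  shows "band_changes y \<alpha> \<delta> n (2 ^ n) \<le> sign_changes y n (\<alpha> + \<delta>) + sign_changes y n (\<alpha> - \<delta>)"
proof -
  let ?S = "\<lambda>x. {k. k < 2 ^ n \<and> crosses (y (dyadic n k)) (y (dyadic n (Suc k))) x}"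
  have "{k. k < 2 ^ n \<and> (\<bar>y (dyadic n k) - \<alpha>\<bar> < \<delta>) \<noteq> (\<bar>y (dyadic n (Suc k)) - \<alpha>\<bar> < \<delta>)} \<subseteq> ?S (\<alpha> + \<delta>) \<union> ?S (\<alpha> - \<delta>)"
  proof
    fix k assume "k \<in> {k. k < 2 ^ n \<and> (\<bar>y (dyadic n k) - \<alpha>\<bar> < \<delta>) \<noteq> (\<bar>y (dyadic n (Suc k)) - \<alpha>\<bar> < \<delta>)}"
    then have k: "k < 2 ^ n" and ch: "(\<bar>y (dyadic n k) - \<alpha>\<bar> < \<delta>) \<noteq> (\<bar>y (dyadic n (Suc k)) - \<alpha>\<bar> < \<delta>)" by auto
    have "crosses (y (dyadic n k)) (y (dyadic n (Suc k))) (\<alpha> + \<delta>) \<or> crosses (y (dyadic n k)) (y (dyadic n (Suc k))) (\<alpha> - \<delta>)"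
      using ch ne[of k] ne[of "Suc k"] k unfolding crosses_def by linarith
    with k show "k \<in> ?S (\<alpha> + \<delta>) \<union> ?S (\<alpha> - \<delta>)" by auto
  qed
  then have "band_changes y \<alpha> \<delta> n (2 ^ n) \<le> card (?S (\<alpha> + \<delta>) \<union> ?S (\<alpha> - \<delta>))"
    unfolding band_changes_def by (intro card_mono) auto
  also have "\<dots> \<le> sign_changes y n (\<alpha> + \<delta>) + sign_changes y n (\<alpha> - \<delta>)"
    unfolding sign_changes_def by (rule card_Un_le)
  finally show ?thesis .
qed

lemma change_between:
  fixes P :: "nat \<Rightarrow> bool"
  assumes "a < b" "P a \<noteq> P b"
  obtains k where "a \<le> k" "k < b" "P k \<noteq> P (Suc k)"
proof -
  have "a \<le> b \<Longrightarrow> (\<forall>k. a \<le> k \<longrightarrow> k < b \<longrightarrow> P k = P (Suc k)) \<Longrightarrow> P a = P b" for b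
    by (induction rule: dec_induct) auto
  then show ?thesis using assms that by (metis less_imp_le)
qed

text \<open>Induction on the largest zero \<open>z\<close>. A dyadic point \<open>?d\<close>
  separates it from the smaller zeros, and \<open>y\<close> differs from \<open>\<alpha>\<close> at
  \<open>?d\<close> and at the right end \<open>?D\<close>. A band thinner than these two
  differences is left at \<open>?d\<close> and at \<open>?D\<close>, but contains the value at a
  dyadic \<open>?e\<close> close to \<open>z\<close>; this gives two changes beyond
  \<open>?d\<close>, in addition to those that the induction hypothesis finds before
  \<open>?d\<close>. The right end is generalized so that it can move to \<open>?d\<close>.\<close>

lemma band_changes_lower:
  fixes y :: "real \<Rightarrow> real"
  assumes y: "continuous_on {0..1} y" and ne: "\<And>n k. k \<le> 2 ^ n \<Longrightarrow> y (dyadic n k) \<noteq> \<alpha>"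
    and "finite Z" "Z \<subseteq> {0<..<dyadic N K}" "\<And>z. z \<in> Z \<Longrightarrow> y z = \<alpha>" "K \<le> 2 ^ N"
  shows "\<exists>\<delta>0>0. \<forall>\<delta>. 0 < \<delta> \<and> \<delta> < \<delta>0 \<longrightarrow> (\<exists>n0\<ge>N. \<forall>n\<ge>n0. 2 * card Z \<le> band_changes y \<alpha> \<delta> n (K * 2 ^ (n - N)))"
  using assms(3-)
proof (induction Z arbitrary: N K rule: finite_linorder_max_induct)
  case empty
  then show ?case by (intro exI[of _ 1]) auto
next
  case (insert z A)
  let ?D = "dyadic N K"
  have z: "0 < z" "z < ?D" "y z = \<alpha>" and D1: "?D \<le> 1" using insert.prems by (auto simp: dyadic_le_one)
  define p where "p = Max (insert 0 A)"
  have p: "0 \<le> p" "p < z" "\<And>a. a \<in> A \<Longrightarrow> a \<le> p"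
    using insert.hyps z by (auto simp: p_def)
  obtain N1 K1 where d: "p < dyadic N1 K1" "dyadic N1 K1 < z" by (rule dyadic_between[OF p(1,2)])
  let ?d = "dyadic N1 K1"
  have K1: "K1 \<le> 2 ^ N1" using d z D1 dyadic_le_one[of N1 K1] by linarith
  have A: "A \<subseteq> {0<..<?d}" using insert.prems(1) p(3) d by force
  obtain \<delta>1 where \<delta>1: "0 < \<delta>1" "\<And>\<delta>. 0 < \<delta> \<Longrightarrow> \<delta> < \<delta>1 \<Longrightarrow>
      \<exists>n0\<ge>N1. \<forall>n\<ge>n0. 2 * card A \<le> band_changes y \<alpha> \<delta> n (K1 * 2 ^ (n - N1))"
    using insert.IH[OF A _ K1] insert.prems(2) by blast
  define \<delta>0 where "\<delta>0 = min \<delta>1 (min \<bar>y ?d - \<alpha>\<bar> \<bar>y ?D - \<alpha>\<bar>)"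
  have "0 < \<delta>0" using \<delta>1 ne[OF K1] ne[OF insert.prems(3)] by (simp add: \<delta>0_def)
  moreover have "\<exists>n0\<ge>N. \<forall>n\<ge>n0. 2 * card (insert z A) \<le> band_changes y \<alpha> \<delta> n (K * 2 ^ (n - N))"
    if \<delta>: "0 < \<delta>" "\<delta> < \<delta>0" for \<delta>
  proof -
    obtain n1 where n1: "n1 \<ge> N1" "\<And>n. n \<ge> n1 \<Longrightarrow> 2 * card A \<le> band_changes y \<alpha> \<delta> n (K1 * 2 ^ (n - N1))"
      using \<delta>1(2)[of \<delta>] \<delta> by (auto simp: \<delta>0_def)
    have z01: "z \<in> {0..1}" using z(1,2) D1 by simp
    obtain r where r: "0 < r" "\<And>t. t \<in> {0..1} \<Longrightarrow> \<bar>t - z\<bar> < r \<Longrightarrow> \<bar>y t - \<alpha>\<bar> < \<delta>"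
      using y[unfolded continuous_on_iff, rule_format, OF z01 \<delta>(1)] z(3) by (auto simp: dist_real_def)
    have "0 \<le> max ?d (z - r)" "max ?d (z - r) < z" using d r by (auto simp: le_max_iff_disj)
    then obtain N2 K2 where e: "max ?d (z - r) < dyadic N2 K2" "dyadic N2 K2 < z" by (rule dyadic_between)
    let ?e = "dyadic N2 K2"
    have ey: "\<bar>y ?e - \<alpha>\<bar> < \<delta>" using r(2)[of ?e] e z01 by auto
    define n0 where "n0 = max (max n1 N) N2"
    have "2 * card (insert z A) \<le> band_changes y \<alpha> \<delta> n (K * 2 ^ (n - N))" if n: "n \<ge> n0" for n
    proof -
      \<comment> \<open>The three dyadic points belong to different levels; at a common level
        \<open>n\<close> they become indices that can be compared.\<close>
      define kd ke kD where "kd = K1 * 2 ^ (n - N1)" and "ke = K2 * 2 ^ (n - N2)" and "kD = K * 2 ^ (n - N)"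
      have eqs: "?d = dyadic n kd" "?e = dyadic n ke" "?D = dyadic n kD"
        using n n1(1) by (auto simp: kd_def ke_def kD_def n0_def intro!: dyadic_refine)
      have "dyadic n kd < dyadic n ke" "dyadic n ke < dyadic n kD" using e z unfolding eqs[symmetric] by auto
      then have lt: "kd < ke" "ke < kD" by simp_all
      define P where "P k = (\<bar>y (dyadic n k) - \<alpha>\<bar> < \<delta>)" for k
      have P: "\<not> P kd" "P ke" "\<not> P kD" using ey \<delta> unfolding P_def eqs[symmetric] by (auto simp: \<delta>0_def)
      obtain k1 where k1: "kd \<le> k1" "k1 < ke" "P k1 \<noteq> P (Suc k1)" using change_between[of kd ke P] lt P by metis
      obtain k2 where k2: "ke \<le> k2" "k2 < kD" "P k2 \<noteq> P (Suc k2)" using change_between[of ke kD P] lt P by metis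
      have "2 * card (insert z A) = 2 * card A + 2" using insert.hyps by (subst card_insert_disjoint) auto
      also have "\<dots> \<le> card {k. k < kd \<and> P k \<noteq> P (Suc k)} + 2"
        using n1(2)[of n] n by (simp add: band_changes_def P_def kd_def n0_def)
      also have "\<dots> = card (insert k1 (insert k2 {k. k < kd \<and> P k \<noteq> P (Suc k)}))"
        using k1 k2 lt by simp
      also have "\<dots> \<le> card {k. k < kD \<and> P k \<noteq> P (Suc k)}"
        using k1 k2 lt by (intro card_mono) auto
      finally show ?thesis by (simp add: band_changes_def P_def kD_def)
    qed
    then show ?thesis by (intro exI[of _ n0]) (auto simp: n0_def)
  qed
  ultimately show ?case by blast
qed

lemma zeros_le_sign_changes:
  fixes y :: "real \<Rightarrow> real"
  assumes y: "continuous_on {0..1} y" and ne: "\<And>n k. k \<le> 2 ^ n \<Longrightarrow> y (dyadic n k) \<noteq> \<alpha>"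
    and Z: "finite Z" "Z \<subseteq> {t \<in> {0..1}. y t = \<alpha>}"
  shows "\<exists>\<delta>0>0. \<forall>\<delta>. 0 < \<delta> \<and> \<delta> < \<delta>0 \<and> (\<forall>n k. k \<le> 2 ^ n \<longrightarrow> y (dyadic n k) \<noteq> \<alpha> + \<delta> \<and> y (dyadic n k) \<noteq> \<alpha> - \<delta>) \<longrightarrow>
     (\<exists>n0. \<forall>n\<ge>n0. 2 * card Z \<le> sign_changes y n (\<alpha> + \<delta>) + sign_changes y n (\<alpha> - \<delta>))"
proof -
  have "y 0 \<noteq> \<alpha>" "y 1 \<noteq> \<alpha>" using ne[of 0 0] ne[of 1 0] by (auto simp: dyadic_def)
  then have "Z \<subseteq> {0<..<dyadic 0 1}" using Z(2) by (force simp: dyadic_def order_less_le)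
  from band_changes_lower[OF y ne Z(1) this] Z(2) obtain \<delta>0 where \<delta>0: "\<delta>0 > 0"
    "\<And>\<delta>. 0 < \<delta> \<Longrightarrow> \<delta> < \<delta>0 \<Longrightarrow> \<exists>n0. \<forall>n\<ge>n0. 2 * card Z \<le> band_changes y \<alpha> \<delta> n (2 ^ n)"
    by auto blast
  then show ?thesis
    by (intro exI[of _ \<delta>0] conjI allI impI) (meson band_changes_le order_trans)+
qed

lemma ecount_le:
  assumes "\<And>Z. finite Z \<Longrightarrow> Z \<subseteq> A \<Longrightarrow> ennreal (real (card Z)) \<le> x"
  shows "ecount A \<le> x"
proof (cases "finite A")
  case True
  then show ?thesis using assms[OF True] by (simp add: ecount_def emeasure_count_space ennreal_of_nat_eq_real_of_nat)
next
  case False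
  have "x = \<top>"
  proof (rule ccontr)
    assume "x \<noteq> \<top>"
    then obtain n where n: "x < of_nat n" using ennreal_Ex_less_of_nat[of x] by (auto simp: less_top)
    obtain Z where Z: "Z \<subseteq> A" "finite Z" "card Z = n" using infinite_arbitrarily_large[OF False] by metis
    show False using assms[OF Z(2,1)] n Z(3) by (simp add: ennreal_of_nat_eq_real_of_nat)
  qed
  then show ?thesis by simp
qed

section \<open>Rice's value and the expected number of crossings\<close>

lemma sign_changes_eq_sum:
  "real (sign_changes y n x) = (\<Sum>k<2 ^ n. of_bool (crosses (y (dyadic n k)) (y (dyadic n (Suc k))) x))"
  by (simp add: sign_changes_def sum.If_cases of_bool_def Int_def lessThan_def)

text \<open>Rice's formula for a Gaussian value of variance \<open>m0\<close> and an independent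
  Gaussian slope of variance \<open>m2\<close>: mean absolute slope times the density of the
  value.\<close>

definition rice :: "real \<Rightarrow> real \<Rightarrow> real \<Rightarrow> real" where
  "rice m0 m2 \<alpha> = sqrt (2 * m2 / pi) * normal_density 0 (sqrt m0) \<alpha>"

lemma rice_eq:
  assumes "0 < m0" "0 < m2"
  shows "rice m0 m2 \<alpha> = 1 / pi * sqrt (m2 / m0) * exp (- (\<alpha>\<^sup>2 / (2 * m0)))"
proof -
  have "sqrt (2 * m2 / pi) / sqrt (2 * pi * m0) = sqrt ((2 * m2 / pi) / (2 * pi * m0))"
    by (rule real_sqrt_divide[symmetric])
  also have "(2 * m2 / pi) / (2 * pi * m0) = (1 / pi)\<^sup>2 * (m2 / m0)" by (simp add: power2_eq_square)
  also have "sqrt \<dots> = 1 / pi * sqrt (m2 / m0)" unfolding real_sqrt_mult by simp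
  finally have *: "sqrt (2 * m2 / pi) / sqrt (2 * pi * m0) = 1 / pi * sqrt (m2 / m0)" .
  have "rice m0 m2 \<alpha> = sqrt (2 * m2 / pi) / sqrt (2 * pi * m0) * exp (- (\<alpha>\<^sup>2 / (2 * m0)))"
    using assms by (simp add: rice_def normal_density_def)
  then show ?thesis unfolding * .
qed

lemma tendsto_rice:
  assumes "(f \<longlongrightarrow> \<alpha>) F" "0 < m0"
  shows "((\<lambda>x. rice m0 m2 (f x)) \<longlongrightarrow> rice m0 m2 \<alpha>) F"
  unfolding rice_def normal_density_def by (intro tendsto_intros assms(1)) (use assms(2) in auto)

context prob_space
begin

text \<open>The lower bound holds already at each dyadic level. For the upper bound Fatou's lemma is
  applied twice, to the level \<open>n\<close> at a fixed band width \<open>\<delta> j\<close> and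
  then to \<open>j\<close>; this order is forced because the level from which a band is resolved
  depends on its width. The count of crossings itself is only compared with measurable
  functions.\<close>

lemma mean_crossings_bounds:
  fixes Y :: "real \<Rightarrow> 'a \<Rightarrow> real"
  assumes cont: "AE \<omega> in M. continuous_on {0..1} (\<lambda>t. Y t \<omega>)"
    and Y[measurable]: "\<And>t. Y t \<in> borel_measurable M"
    and ne: "\<And>t x. t \<in> {0..1} \<Longrightarrow> AE \<omega> in M. Y t \<omega> \<noteq> x"
    and F: "\<And>n x. n \<ge> n0 \<Longrightarrow> \<bar>(\<Sum>k<2 ^ n. prob {\<omega> \<in> space M. crosses (Y (dyadic n k) \<omega>) (Y (dyadic n (Suc k)) \<omega>) x}) - R x\<bar> \<le> e n"
    and e: "e \<longlonglongrightarrow> \<epsilon>" and R: "isCont R \<alpha>"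
  shows "ennreal (R \<alpha> - \<epsilon>) \<le> mean_crossings M Y \<alpha> {0..1}"
    and "mean_crossings M Y \<alpha> {0..1} \<le> ennreal (R \<alpha> + \<epsilon>)"
proof -
  define G where "G n x = (\<Sum>k<2 ^ n. prob {\<omega> \<in> space M. crosses (Y (dyadic n k) \<omega>) (Y (dyadic n (Suc k)) \<omega>) x})" for n x
  define S where "S n x \<omega> = real (sign_changes (\<lambda>t. Y t \<omega>) n x)" for n x \<omega>
  have S_meas[measurable]: "S n x \<in> borel_measurable M" for n x
    unfolding S_def[abs_def] sign_changes_eq_sum by measurable
  have S0: "0 \<le> S n x \<omega>" for n x \<omega> by (simp add: S_def)
  have ES: "(\<integral>\<^sup>+\<omega>. ennreal (S n x \<omega>) \<partial>M) = ennreal (G n x)" for n x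
  proof -
    have "(\<integral>\<^sup>+\<omega>. ennreal (S n x \<omega>) \<partial>M) = (\<integral>\<^sup>+\<omega>. (\<Sum>k<2 ^ n. indicator {\<omega> \<in> space M. crosses (Y (dyadic n k) \<omega>) (Y (dyadic n (Suc k)) \<omega>) x} \<omega>) \<partial>M)"
    proof (rule nn_integral_cong)
      fix \<omega> assume \<omega>: "\<omega> \<in> space M"
      have "ennreal (S n x \<omega>) = (\<Sum>k<2 ^ n. ennreal (of_bool (crosses (Y (dyadic n k) \<omega>) (Y (dyadic n (Suc k)) \<omega>) x)))"
        unfolding S_def sign_changes_eq_sum by (rule sum_ennreal[symmetric]) simp
      also have "\<dots> = (\<Sum>k<2 ^ n. indicator {\<omega> \<in> space M. crosses (Y (dyadic n k) \<omega>) (Y (dyadic n (Suc k)) \<omega>) x} \<omega>)"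
        using \<omega> by (intro sum.cong) auto
      finally show "ennreal (S n x \<omega>) = \<dots>" .
    qed
    also have "\<dots> = ennreal (G n x)"
      unfolding G_def by (simp add: nn_integral_sum emeasure_eq_measure sum_ennreal)
    finally show ?thesis .
  qed
  show "ennreal (R \<alpha> - \<epsilon>) \<le> mean_crossings M Y \<alpha> {0..1}"
  proof (rule LIMSEQ_le_const2)
    show "(\<lambda>n. ennreal (R \<alpha> - e n)) \<longlonglongrightarrow> ennreal (R \<alpha> - \<epsilon>)" by (intro tendsto_ennrealI tendsto_intros e)
    have "ennreal (R \<alpha> - e n) \<le> mean_crossings M Y \<alpha> {0..1}" if "n \<ge> n0" for n
    proof -
      have "ennreal (R \<alpha> - e n) \<le> ennreal (G n \<alpha>)"
        using F[OF that, of \<alpha>] by (intro ennreal_leI) (simp add: G_def)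
      also have "\<dots> \<le> mean_crossings M Y \<alpha> {0..1}"
        unfolding ES[symmetric] mean_crossings_def
        by (rule nn_integral_mono_AE, use cont in eventually_elim) (unfold S_def num_crossings_def, rule sign_changes_le_ecount)
      finally show ?thesis .
    qed
    then show "\<exists>N. \<forall>n\<ge>N. ennreal (R \<alpha> - e n) \<le> mean_crossings M Y \<alpha> {0..1}" by blast
  qed
  define \<delta> where "\<delta> j = inverse (real (Suc j))" for j
  have \<delta>: "0 < \<delta> j" for j by (simp add: \<delta>_def)
  have \<delta>0: "\<delta> \<longlonglongrightarrow> 0" unfolding \<delta>_def by (rule LIMSEQ_inverse_real_of_nat)
  \<comment> \<open>The division by 2 reflects that every zero accounts for two changes.\<close>
  define L where "L j \<omega> = liminf (\<lambda>n. ennreal ((S n (\<alpha> + \<delta> j) \<omega> + S n (\<alpha> - \<delta> j) \<omega>) / 2))" for j \<omega>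
  have [measurable]: "L j \<in> borel_measurable M" for j unfolding L_def[abs_def] by measurable
  have half: "ennreal ((a + b) / 2) = ennreal (1/2) * (ennreal a + ennreal b)" if "0 \<le> a" "0 \<le> b" for a b :: real
  proof -
    have "ennreal (1/2) * (ennreal a + ennreal b) = ennreal (1/2 * (a + b))"
      using that by (simp only: ennreal_plus ennreal_mult add_nonneg_nonneg)
    then show ?thesis by simp
  qed
  have EL: "(\<integral>\<^sup>+\<omega>. L j \<omega> \<partial>M) \<le> ennreal ((R (\<alpha> + \<delta> j) + R (\<alpha> - \<delta> j)) / 2 + \<epsilon>)" for j
  proof -
    have "(\<integral>\<^sup>+\<omega>. L j \<omega> \<partial>M) \<le> liminf (\<lambda>n. \<integral>\<^sup>+\<omega>. ennreal ((S n (\<alpha> + \<delta> j) \<omega> + S n (\<alpha> - \<delta> j) \<omega>) / 2) \<partial>M)"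
      unfolding L_def by (rule nn_integral_liminf) simp
    also have "\<dots> \<le> liminf (\<lambda>n. ennreal ((R (\<alpha> + \<delta> j) + R (\<alpha> - \<delta> j)) / 2 + e n))"
    proof (rule Liminf_mono, rule eventually_mono[OF eventually_ge_at_top[of n0]])
      fix n assume n: "n0 \<le> n"
      have "(\<integral>\<^sup>+\<omega>. ennreal ((S n (\<alpha> + \<delta> j) \<omega> + S n (\<alpha> - \<delta> j) \<omega>) / 2) \<partial>M)
        = (\<integral>\<^sup>+\<omega>. ennreal (1/2) * (ennreal (S n (\<alpha> + \<delta> j) \<omega>) + ennreal (S n (\<alpha> - \<delta> j) \<omega>)) \<partial>M)"
        unfolding half[OF S0 S0] ..
      also have "\<dots> = ennreal (1/2) * (ennreal (G n (\<alpha> + \<delta> j)) + ennreal (G n (\<alpha> - \<delta> j)))"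
        by (subst nn_integral_cmult nn_integral_add; measurable)+ (simp add: ES)
      also have "\<dots> = ennreal ((G n (\<alpha> + \<delta> j) + G n (\<alpha> - \<delta> j)) / 2)"
        by (rule half[symmetric]) (auto simp: G_def intro: sum_nonneg)
      also have "\<dots> \<le> ennreal ((R (\<alpha> + \<delta> j) + R (\<alpha> - \<delta> j)) / 2 + e n)"
        using F[OF n, of "\<alpha> + \<delta> j"] F[OF n, of "\<alpha> - \<delta> j"] unfolding G_def[symmetric]
        by (intro ennreal_leI) (simp add: field_simps)
      finally show "(\<integral>\<^sup>+\<omega>. ennreal ((S n (\<alpha> + \<delta> j) \<omega> + S n (\<alpha> - \<delta> j) \<omega>) / 2) \<partial>M) \<le> \<dots>" .
    qed
    also have "\<dots> = ennreal ((R (\<alpha> + \<delta> j) + R (\<alpha> - \<delta> j)) / 2 + \<epsilon>)"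
      by (intro lim_imp_Liminf tendsto_ennrealI tendsto_intros e) simp
    finally show ?thesis .
  qed
  have "mean_crossings M Y \<alpha> {0..1} \<le> (\<integral>\<^sup>+\<omega>. liminf (\<lambda>j. L j \<omega>) \<partial>M)"
    unfolding mean_crossings_def
  proof (rule nn_integral_mono_AE)
    \<comment> \<open>Only countably many dyadic times and, through the sequence
      \<open>\<delta>\<close>, countably many levels occur, so the exceptional null sets can be
      united.\<close>
    have AEd: "AE \<omega> in M. \<forall>n k. k \<le> 2 ^ n \<longrightarrow> Y (dyadic n k) \<omega> \<noteq> x" for x
      unfolding AE_all_countable using ne by (auto simp: dyadic_le_one)
    have AEj: "AE \<omega> in M. \<forall>j n k. k \<le> 2 ^ n \<longrightarrow> Y (dyadic n k) \<omega> \<noteq> \<alpha> + \<delta> j"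
      "AE \<omega> in M. \<forall>j n k. k \<le> 2 ^ n \<longrightarrow> Y (dyadic n k) \<omega> \<noteq> \<alpha> - \<delta> j"
      using AEd by (subst AE_all_countable, blast)+
    show "AE \<omega> in M. num_crossings Y \<alpha> {0..1} \<omega> \<le> liminf (\<lambda>j. L j \<omega>)"
      using cont AEd[of \<alpha>] AEj
    proof eventually_elim
      case (elim \<omega>)
      show ?case unfolding num_crossings_def
      proof (rule ecount_le)
        fix Z assume Z: "finite Z" "Z \<subseteq> {t \<in> {0..1}. Y t \<omega> = \<alpha>}"
        obtain \<delta>1 where \<delta>1: "\<delta>1 > 0" "\<And>\<delta>. 0 < \<delta> \<Longrightarrow> \<delta> < \<delta>1 \<Longrightarrow>
           (\<forall>n k. k \<le> 2 ^ n \<longrightarrow> Y (dyadic n k) \<omega> \<noteq> \<alpha> + \<delta> \<and> Y (dyadic n k) \<omega> \<noteq> \<alpha> - \<delta>) \<Longrightarrow>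
           (\<exists>n0. \<forall>n\<ge>n0. 2 * card Z \<le> sign_changes (\<lambda>t. Y t \<omega>) n (\<alpha> + \<delta>) + sign_changes (\<lambda>t. Y t \<omega>) n (\<alpha> - \<delta>))"
          using zeros_le_sign_changes[OF elim(1) _ Z] elim(2) by blast
        have "\<forall>\<^sub>F j in sequentially. \<delta> j < \<delta>1" using order_tendstoD(2)[OF \<delta>0 \<delta>1(1)] .
        then show "ennreal (real (card Z)) \<le> liminf (\<lambda>j. L j \<omega>)"
        proof (intro Liminf_bounded, eventually_elim)
          case (elim j)
          obtain n1 where n1: "\<And>n. n \<ge> n1 \<Longrightarrow> 2 * card Z \<le> sign_changes (\<lambda>t. Y t \<omega>) n (\<alpha> + \<delta> j) + sign_changes (\<lambda>t. Y t \<omega>) n (\<alpha> - \<delta> j)"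
            using \<delta>1(2)[OF \<delta> \<open>\<delta> j < \<delta>1\<close>] \<open>\<forall>j n k. k \<le> 2 ^ n \<longrightarrow> Y (dyadic n k) \<omega> \<noteq> \<alpha> + \<delta> j\<close>
              \<open>\<forall>j n k. k \<le> 2 ^ n \<longrightarrow> Y (dyadic n k) \<omega> \<noteq> \<alpha> - \<delta> j\<close> by blast
          show ?case unfolding L_def
          proof (rule Liminf_bounded, rule eventually_mono[OF eventually_ge_at_top[of n1]])
            fix n assume "n1 \<le> n"
            from of_nat_mono[OF n1[OF this], where 'a=real] show "ennreal (real (card Z)) \<le> ennreal ((S n (\<alpha> + \<delta> j) \<omega> + S n (\<alpha> - \<delta> j) \<omega>) / 2)"
              unfolding S_def by (intro ennreal_leI) simp
          qed
        qed
      qed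
    qed
  qed
  also have "\<dots> \<le> liminf (\<lambda>j. \<integral>\<^sup>+\<omega>. L j \<omega> \<partial>M)" by (rule nn_integral_liminf) simp
  also have "\<dots> \<le> liminf (\<lambda>j. ennreal ((R (\<alpha> + \<delta> j) + R (\<alpha> - \<delta> j)) / 2 + \<epsilon>))"
    by (rule Liminf_mono) (use EL in auto)
  also have "\<dots> = ennreal ((R \<alpha> + R \<alpha>) / 2 + \<epsilon>)"
  proof (intro lim_imp_Liminf tendsto_ennrealI tendsto_intros)
    have "(\<lambda>j. \<alpha> + \<delta> j) \<longlonglongrightarrow> \<alpha>" "(\<lambda>j. \<alpha> - \<delta> j) \<longlonglongrightarrow> \<alpha>"
      using tendsto_add[OF tendsto_const[of \<alpha>] \<delta>0] tendsto_diff[OF tendsto_const[of \<alpha>] \<delta>0] by auto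
    then show "(\<lambda>j. R (\<alpha> + \<delta> j)) \<longlonglongrightarrow> R \<alpha>" "(\<lambda>j. R (\<alpha> - \<delta> j)) \<longlonglongrightarrow> R \<alpha>"
      by (auto intro: isCont_tendsto_compose[OF R])
  qed auto
  also have "(R \<alpha> + R \<alpha>) / 2 = R \<alpha>" by simp
  finally show "mean_crossings M Y \<alpha> {0..1} \<le> ennreal (R \<alpha> + \<epsilon>)" .
qed

text \<open>The term \<open>L * h\<close> in the closeness bound is the price of a secant slope in
  place of a derivative and disappears as the dyadic mesh is refined; \<open>\<eta>\<close> is the
  distance from the Gaussian law and remains. Each of the 2^n intervals contributes an error
  proportional to its length, so the errors do not accumulate.\<close>

theorem mean_crossings_near_rice:
  fixes Y :: "real \<Rightarrow> 'a \<Rightarrow> real"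
  assumes cont: "AE \<omega> in M. continuous_on {0..1} (\<lambda>t. Y t \<omega>)"
    and Y[measurable]: "\<And>t. Y t \<in> borel_measurable M"
    and m: "0 < m0" "0 < m2" "m2 \<le> K" and c: "0 < c" and \<eta>: "0 \<le> \<eta>" and L: "0 \<le> L" and h0: "0 < h0" "h0 \<le> 1"
    and D0: "\<And>u. exp (- (m0 * u\<^sup>2) / 2) \<le> 1 / (1 + c * u\<^sup>2) ^ 16"
    and V: "\<And>t h. 0 \<le> t \<Longrightarrow> 0 < h \<Longrightarrow> h \<le> h0 \<Longrightarrow> t + h \<le> 1 \<Longrightarrow> integrable M (\<lambda>\<omega>. ((Y (t + h) \<omega> - Y t \<omega>) / h)\<^sup>2)"
      "\<And>t h. 0 \<le> t \<Longrightarrow> 0 < h \<Longrightarrow> h \<le> h0 \<Longrightarrow> t + h \<le> 1 \<Longrightarrow> expectation (\<lambda>\<omega>. ((Y (t + h) \<omega> - Y t \<omega>) / h)\<^sup>2) \<le> K"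
    and D: "\<And>t h \<theta> u v. 0 \<le> t \<Longrightarrow> 0 < h \<Longrightarrow> h \<le> h0 \<Longrightarrow> t + h \<le> 1 \<Longrightarrow> 0 \<le> \<theta> \<Longrightarrow> \<theta> \<le> 1 \<Longrightarrow>
       norm (CLINT \<omega>|M. cis (u * (Y t \<omega> + \<theta> * (Y (t + h) \<omega> - Y t \<omega>)) + v * ((Y (t + h) \<omega> - Y t \<omega>) / h))) \<le> 1 / (1 + c * u\<^sup>2) ^ 16"
    and close: "\<And>t h \<theta> u v. 0 \<le> t \<Longrightarrow> 0 < h \<Longrightarrow> h \<le> h0 \<Longrightarrow> t + h \<le> 1 \<Longrightarrow> 0 \<le> \<theta> \<Longrightarrow> \<theta> \<le> 1 \<Longrightarrow>
       norm ((CLINT \<omega>|M. cis (u * (Y t \<omega> + \<theta> * (Y (t + h) \<omega> - Y t \<omega>)) + v * ((Y (t + h) \<omega> - Y t \<omega>) / h)))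
         - exp (- (m0 * u\<^sup>2 + m2 * v\<^sup>2) / 2)) \<le> (\<eta> + L * h) * (1 + \<bar>u\<bar> + \<bar>v\<bar>) ^ 3"
  shows "ennreal (rice m0 m2 \<alpha> - rice_const c K * \<eta> powr (1/8)) \<le> mean_crossings M Y \<alpha> {0..1}"
    and "mean_crossings M Y \<alpha> {0..1} \<le> ennreal (rice m0 m2 \<alpha> + rice_const c K * \<eta> powr (1/8))"
proof -
  have D1: "1 / (1 + c * u\<^sup>2) ^ 16 \<le> 1 / (1 + c * u\<^sup>2)" for u
  proof -
    have "1 \<le> 1 + c * u\<^sup>2" using c by simp
    then show ?thesis using power_increasing[of 1 16 "1 + c * u\<^sup>2"] by (intro frac_le) auto
  qed
  have ne: "AE \<omega> in M. Y t \<omega> \<noteq> x" if t: "t \<in> {0..1}" for t x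
  proof (rule no_atom[OF _ c])
    fix u
    show "norm (CLINT \<omega>|M. cis (u * Y t \<omega>)) \<le> 1 / (1 + c * u\<^sup>2)"
    proof (cases "t < 1")
      case True
      \<comment> \<open>The law of \<open>Y t\<close> alone is the case \<open>\<theta> = 0\<close>,
        \<open>v = 0\<close> of a step to the right.\<close>
      then have "norm (CLINT \<omega>|M. cis (u * (Y t \<omega> + 0 * (Y (t + min h0 (1 - t)) \<omega> - Y t \<omega>)) + 0 * ((Y (t + min h0 (1 - t)) \<omega> - Y t \<omega>) / min h0 (1 - t)))) \<le> 1 / (1 + c * u\<^sup>2) ^ 16"
        using t h0 by (intro D) auto
      then show ?thesis using D1[of u] by simp
    next
      case False
      \<comment> \<open>At the right end there is no room for a step; the point is reached instead
        with \<open>\<theta> = 1\<close> from \<open>1 - h0\<close>.\<close>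
      then have t1: "t = 1 - h0 + h0" using t by simp
      have "norm (CLINT \<omega>|M. cis (u * (Y (1 - h0) \<omega> + 1 * (Y (1 - h0 + h0) \<omega> - Y (1 - h0) \<omega>)) + 0 * ((Y (1 - h0 + h0) \<omega> - Y (1 - h0) \<omega>) / h0))) \<le> 1 / (1 + c * u\<^sup>2) ^ 16"
        using h0 by (intro D) auto
      then show ?thesis using D1[of u] t1 by simp
    qed
  qed simp
  obtain n0 where n0: "1 / h0 < 2 ^ n0" using real_arch_pow[of 2 "1 / h0"] by auto
  define e where "e n = rice_const c K * (\<eta> + L * (1 / 2 ^ n)) powr (1/8)" for n
  have F: "\<bar>(\<Sum>k<2 ^ n. prob {\<omega> \<in> space M. crosses (Y (dyadic n k) \<omega>) (Y (dyadic n (Suc k)) \<omega>) x}) - rice m0 m2 x\<bar> \<le> e n"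
    if n: "n \<ge> n0" for n x
  proof -
    define h where "h = 1 / (2::real) ^ n"
    have "(2::real) ^ n0 \<le> 2 ^ n" using n by (rule power_increasing) simp
    then have "1 / h0 \<le> 2 ^ n" using n0 by linarith
    then have h: "0 < h" "h \<le> h0" using h0 by (auto simp: h_def field_simps)
    have pk: "\<bar>prob {\<omega> \<in> space M. crosses (Y (dyadic n k) \<omega>) (Y (dyadic n (Suc k)) \<omega>) x} - h * rice m0 m2 x\<bar> \<le> h * e n"
      if k: "k < 2 ^ n" for k
    proof -
      define t where "t = dyadic n k"
      have th: "dyadic n (Suc k) = t + h" by (simp add: t_def h_def dyadic_def add_divide_distrib)
      have t: "0 \<le> t" "t + h \<le> 1" "t \<in> {0..1}" "t + h \<in> {0..1}"
        using dyadic_le_one[of n "Suc k"] dyadic_le_one[of n k] k h unfolding th t_def[symmetric] by (auto simp: t_def)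
      show ?thesis unfolding th t_def[symmetric]
      proof (rule crossing_probability[OF _ _ h(1), where R="\<lambda>s. sqrt (2 * m2 / pi) * normal_density 0 (sqrt (m0 + s\<^sup>2)) x"])
        show "integrable M (\<lambda>\<omega>. (Y (t + h) \<omega> - Y t \<omega>) / h)"
          by (rule square_integrable_imp_integrable[OF _ V(1)]) (use t h in auto)
        show "AE \<omega> in M. Y t \<omega> \<noteq> x" "AE \<omega> in M. Y (t + h) \<omega> \<noteq> x" using ne t by auto
        have "((\<lambda>s. sqrt (2 * m2 / pi) * normal_density 0 (sqrt (m0 + s\<^sup>2)) x) \<longlongrightarrow> sqrt (2 * m2 / pi) * normal_density 0 (sqrt (m0 + 0\<^sup>2)) x) (at_right 0)"
          unfolding normal_density_def by (intro tendsto_intros) (use m in auto)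
        then show "((\<lambda>s. sqrt (2 * m2 / pi) * normal_density 0 (sqrt (m0 + s\<^sup>2)) x) \<longlongrightarrow> rice m0 m2 x) (at_right 0)"
          by (simp add: rice_def)
        fix \<theta> s :: real assume \<theta>: "0 < \<theta>" "\<theta> < 1" and s: "0 < s"
        show "\<bar>expectation (\<lambda>\<omega>. \<bar>(Y (t + h) \<omega> - Y t \<omega>) / h\<bar> * normal_density 0 s (Y t \<omega> + \<theta> * (Y (t + h) \<omega> - Y t \<omega>) - x))
            - sqrt (2 * m2 / pi) * normal_density 0 (sqrt (m0 + s\<^sup>2)) x\<bar> \<le> e n"
          unfolding e_def h_def[symmetric]
          by (rule crossing_compare[OF _ _ _ _ m c _ s _ D0]) (use V D close \<eta> L t h \<theta> in auto)
      qed auto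
    qed
    have "(\<Sum>k<2 ^ n. prob {\<omega> \<in> space M. crosses (Y (dyadic n k) \<omega>) (Y (dyadic n (Suc k)) \<omega>) x}) - rice m0 m2 x
       = (\<Sum>k<2 ^ n. prob {\<omega> \<in> space M. crosses (Y (dyadic n k) \<omega>) (Y (dyadic n (Suc k)) \<omega>) x} - h * rice m0 m2 x)"
      by (simp add: sum_subtractf h_def)
    then have "\<bar>(\<Sum>k<2 ^ n. prob {\<omega> \<in> space M. crosses (Y (dyadic n k) \<omega>) (Y (dyadic n (Suc k)) \<omega>) x}) - rice m0 m2 x\<bar>
       \<le> (\<Sum>k<(2::nat) ^ n. h * e n)"
      using pk by (simp only:) (rule order_trans[OF sum_abs sum_mono], simp)
    then show ?thesis by (simp add: h_def)
  qed
  have "(\<lambda>n. L * (1 / 2 ^ n)) \<longlonglongrightarrow> L * 0"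
    by (intro tendsto_mult_left LIMSEQ_divide_realpow_zero) simp
  then have "(\<lambda>n. \<eta> + L * (1 / 2 ^ n)) \<longlonglongrightarrow> \<eta>"
    using tendsto_add[OF tendsto_const[of \<eta>]] by fastforce
  then have e: "e \<longlonglongrightarrow> rice_const c K * \<eta> powr (1/8)"
    unfolding e_def[abs_def] by (intro tendsto_mult_left tendsto_powr2 tendsto_const) (use \<eta> L in auto)
  have R: "isCont (rice m0 m2) \<alpha>"
    unfolding isCont_def using tendsto_rice[OF tendsto_ident_at m(1)] by blast
  show "ennreal (rice m0 m2 \<alpha> - rice_const c K * \<eta> powr (1/8)) \<le> mean_crossings M Y \<alpha> {0..1}"
    and "mean_crossings M Y \<alpha> {0..1} \<le> ennreal (rice m0 m2 \<alpha> + rice_const c K * \<eta> powr (1/8))"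
    using mean_crossings_bounds[OF cont Y ne F e R] by auto
qed

end

lemma norm_cis_diff_le: "norm (cis a - cis b) \<le> \<bar>a - b\<bar>"
proof -
  have "cis a - cis b = cis b * (cis (a - b) - 1)" by (simp add: cis_mult algebra_simps)
  then have "norm (cis a - cis b) = norm (iexp (a - b) - (\<Sum>k\<le>0. (\<i> * (a - b)) ^ k / fact k))"
    by (simp add: norm_mult cis_conv_exp)
  also have "\<dots> \<le> \<bar>a - b\<bar> ^ Suc 0 / fact (Suc 0)" by (rule iexp_approx1)
  finally show ?thesis by simp
qed

section \<open>Sums over the points of a Poisson process\<close>

text \<open>Both sides take the value 0 when the family is not absolutely summable, so the identity
  holds without conditions. It makes Fubini and dominated convergence available for sums over the
  points.\<close>

lemma infsum_eq_integral_count_space: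
  fixes f :: "nat \<Rightarrow> real"
  shows "(\<Sum>\<^sub>\<infinity>i. f i) = (\<integral>i. f i \<partial>count_space UNIV)"
proof (cases "integrable (count_space UNIV) f")
  case True
  then have "Infinite_Set_Sum.abs_summable_on f UNIV"
    unfolding abs_summable_on_def .
  then show ?thesis using infsetsum_infsum[of f UNIV] by (simp add: infsetsum_def del: abs_summable_equivalent)
next
  case False
  then have "\<not> Infinite_Sum.abs_summable_on f UNIV"
    unfolding abs_summable_equivalent abs_summable_on_def .
  then have "\<not> f summable_on UNIV" using summable_on_iff_abs_summable_on_real by blast
  then show ?thesis using False by (simp add: infsum_not_exists not_integrable_integral_eq)
qed

locale poisson_points =
  fixes M :: "'a measure" and lam :: real and \<tau> :: "nat \<Rightarrow> 'a \<Rightarrow> real"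
  assumes ppp: "poisson_point_process M lam \<tau>" and lam: "0 < lam"

sublocale poisson_points \<subseteq> prob_space M
  using ppp by (simp add: poisson_point_process_def)

context poisson_points
begin

definition point_sum :: "(real \<Rightarrow> real) \<Rightarrow> 'a \<Rightarrow> real" where
  "point_sum f \<omega> = (\<integral>i. f (\<tau> i \<omega>) \<partial>count_space UNIV)"

lemma \<tau>_measurable [measurable]: "\<tau> i \<in> borel_measurable M"
  using ppp by (simp add: poisson_point_process_def)

lemma pair_measurable:
  assumes [measurable]: "f \<in> borel_measurable borel"
  shows "(\<lambda>(i, \<omega>). f (\<tau> i \<omega>)) \<in> borel_measurable (count_space UNIV \<Otimes>\<^sub>M M)"
  by (rule measurable_pair_measure_countable1) auto

lemma \<tau>_pair_measurable [measurable]: "(\<lambda>(i, \<omega>). \<tau> i \<omega>) \<in> measurable (count_space UNIV \<Otimes>\<^sub>M M) borel"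
  by (rule measurable_pair_measure_countable1) auto

sublocale cs: pair_sigma_finite "count_space (UNIV :: nat set)" M
  by (intro pair_sigma_finite.intro sigma_finite_measure_count_space sigma_finite_measure_axioms)

lemma point_sum_measurable [measurable]:
  assumes [measurable]: "f \<in> borel_measurable borel"
  shows "point_sum f \<in> borel_measurable M"
proof -
  have "(\<lambda>(\<omega>, i). f (\<tau> i \<omega>)) \<in> borel_measurable (M \<Otimes>\<^sub>M count_space UNIV)"
    using measurable_compose[OF measurable_pair_swap' pair_measurable[OF assms]] by (simp add: split_beta')
  then show ?thesis unfolding point_sum_def[abs_def] by (rule cs.M1.borel_measurable_lebesgue_integral)
qed

lemma num_points_eq_nn_integral: "num_points \<tau> A \<omega> = (\<integral>\<^sup>+i. indicator A (\<tau> i \<omega>) \<partial>count_space UNIV)"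
proof -
  have "num_points \<tau> A \<omega> = (\<integral>\<^sup>+i. indicator {i. \<tau> i \<omega> \<in> A} i \<partial>count_space UNIV)"
    by (simp add: num_points_def ecount_def)
  also have "\<dots> = (\<integral>\<^sup>+i. indicator A (\<tau> i \<omega>) \<partial>count_space UNIV)"
    by (intro nn_integral_cong) (auto simp: indicator_def)
  finally show ?thesis .
qed

lemma num_points_measurable [measurable]:
  assumes [measurable]: "A \<in> sets borel"
  shows "num_points \<tau> A \<in> borel_measurable M"
  unfolding num_points_eq_nn_integral[abs_def] nn_integral_count_space_nat by measurable

lemma num_points_prob:
  assumes "A \<in> sets borel" "emeasure lborel A < \<infinity>"
  shows "prob {\<omega> \<in> space M. num_points \<tau> A \<omega> = of_nat k}
     = (lam * measure lborel A) ^ k / fact k * exp (- (lam * measure lborel A))"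
  using ppp assms by (simp add: poisson_point_process_def)

text \<open>The definition prescribes the probabilities of the finite counts; they add up to 1,
  which leaves probability 0 for infinitely many points.\<close>

lemma AE_num_points_nat:
  assumes A[measurable]: "A \<in> sets borel" and fin: "emeasure lborel A < \<infinity>"
  shows "AE \<omega> in M. \<exists>k. num_points \<tau> A \<omega> = of_nat k"
proof -
  let ?x = "lam * measure lborel A"
  let ?E = "\<lambda>k. {\<omega> \<in> space M. num_points \<tau> A \<omega> = of_nat k}"
  have "(\<lambda>k. prob (?E k)) sums prob (\<Union>k. ?E k)"
    by (rule finite_measure_UNION) (auto simp: disjoint_family_on_def)
  moreover have "(\<lambda>k. prob (?E k)) sums 1"
  proof -
    have "(\<lambda>k. ?x ^ k / fact k * exp (- ?x)) sums (exp ?x * exp (- ?x))"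
      using exp_converges[of ?x] by (intro sums_mult2) (simp add: divide_inverse mult.commute)
    then show ?thesis by (simp add: num_points_prob[OF A fin] exp_minus)
  qed
  ultimately have "prob (\<Union>k. ?E k) = 1" by (rule sums_unique2)
  then have "AE \<omega> in M. \<omega> \<in> (\<Union>k. ?E k)" by (subst prob_eq_1[symmetric]) auto
  then show ?thesis by (auto elim!: eventually_mono)
qed

lemma expectation_num_points_finite:
  assumes A[measurable]: "A \<in> sets borel" and fin: "emeasure lborel A < \<infinity>"
  shows "(\<integral>\<^sup>+\<omega>. num_points \<tau> A \<omega> \<partial>M) = ennreal lam * emeasure lborel A"
proof -
  let ?x = "lam * measure lborel A"
  let ?E = "\<lambda>k. {\<omega> \<in> space M. num_points \<tau> A \<omega> = of_nat k}"
  have x0: "0 \<le> ?x" using lam by simp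
  have "(\<integral>\<^sup>+\<omega>. num_points \<tau> A \<omega> \<partial>M) = (\<integral>\<^sup>+\<omega>. (\<Sum>k. of_nat k * indicator (?E k) \<omega>) \<partial>M)"
  proof (rule nn_integral_cong_AE, use AE_num_points_nat[OF A fin] AE_space in eventually_elim)
    case (elim \<omega>)
    then obtain k where k: "num_points \<tau> A \<omega> = of_nat k" by blast
    have "(\<Sum>l. of_nat l * indicator (?E l) \<omega>) = (\<Sum>l\<in>{k}. of_nat l * indicator (?E l) \<omega> :: ennreal)"
      using k by (intro suminf_finite) (auto simp: indicator_def)
    then show ?case using k elim by simp
  qed
  also have "\<dots> = (\<Sum>k. of_nat k * emeasure M (?E k))"
    by (subst nn_integral_suminf) (auto simp: nn_integral_cmult)
  also have "\<dots> = (\<Sum>k. ennreal (real k * (?x ^ k / fact k * exp (- ?x))))"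
    unfolding emeasure_eq_measure num_points_prob[OF A fin] 
    unfolding ennreal_of_nat_eq_real_of_nat
    using x0 by (intro suminf_cong ennreal_mult[symmetric]) auto
  also have "\<dots> = ennreal ?x"
  proof -
    have "(\<lambda>k. ?x * exp (- ?x) * (?x ^ k / fact k)) sums (?x * exp (- ?x) * exp ?x)"
      using exp_converges[of ?x] by (intro sums_mult) (simp add: divide_inverse mult.commute)
    then have "(\<lambda>k. real (Suc k) * (?x ^ Suc k / fact (Suc k) * exp (- ?x))) sums ?x"
      by (simp add: exp_minus field_simps del: of_nat_Suc)
    then have "(\<lambda>k. real k * (?x ^ k / fact k * exp (- ?x))) sums (?x + real 0 * (?x ^ 0 / fact 0 * exp (- ?x)))"
      by (rule sums_Suc)
    then show ?thesis using x0 by (intro suminf_ennreal_eq) auto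
  qed
  also have "\<dots> = ennreal lam * emeasure lborel A"
    using fin lam by (simp add: ennreal_mult emeasure_eq_ennreal_measure less_top)
  finally show ?thesis .
qed

text \<open>The mean measure of the process as an image measure, so that Campbell's formula becomes
  a change of variables combined with Fubini.\<close>

definition intensity :: "real measure" where
  "intensity = distr (count_space UNIV \<Otimes>\<^sub>M M) borel (\<lambda>(i, \<omega>). \<tau> i \<omega>)"

lemma nn_integral_intensity:
  assumes [measurable]: "f \<in> borel_measurable borel"
  shows "(\<integral>\<^sup>+x. f x \<partial>intensity) = (\<integral>\<^sup>+\<omega>. (\<integral>\<^sup>+i. f (\<tau> i \<omega>) \<partial>count_space UNIV) \<partial>M)"
proof -
  have "(\<integral>\<^sup>+x. f x \<partial>intensity) = (\<integral>\<^sup>+z. (case z of (i, \<omega>) \<Rightarrow> f (\<tau> i \<omega>)) \<partial>(count_space UNIV \<Otimes>\<^sub>M M))"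
    unfolding intensity_def by (subst nn_integral_distr) (auto simp: split_beta')
  also have "\<dots> = (\<integral>\<^sup>+\<omega>. (\<integral>\<^sup>+i. f (\<tau> i \<omega>) \<partial>count_space UNIV) \<partial>M)"
    by (subst cs.nn_integral_snd[symmetric]) (auto intro!: measurable_pair_measure_countable1)
  finally show ?thesis .
qed

lemma emeasure_intensity:
  assumes A[measurable]: "A \<in> sets borel"
  shows "emeasure intensity A = (\<integral>\<^sup>+\<omega>. num_points \<tau> A \<omega> \<partial>M)"
  using nn_integral_intensity[of "indicator A"] assms
  by (simp add: num_points_eq_nn_integral intensity_def)

lemma intensity_eq: "intensity = density lborel (\<lambda>_. ennreal lam)"
proof (rule measure_eqI)
  show "sets intensity = sets (density lborel (\<lambda>_. ennreal lam))" by (simp add: intensity_def)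
  fix A assume "A \<in> sets intensity"
  then have A[measurable]: "A \<in> sets borel" by (simp add: intensity_def)
  define B where "B n = A \<inter> {- real n..real n}" for n :: nat
  have B: "range B \<subseteq> sets borel" "incseq B" "(\<Union>n. B n) = A"
  proof -
    show "(\<Union>n. B n) = A"
    proof safe
      fix x assume "x \<in> A"
      obtain n :: nat where "\<bar>x\<bar> \<le> real n" using real_arch_simple by blast
      then show "x \<in> (\<Union>n. B n)" using \<open>x \<in> A\<close> by (auto simp: B_def intro!: exI[of _ n])
    qed (simp add: B_def)
  qed (auto simp: B_def incseq_def)
  have "emeasure lborel (B n) < \<infinity>" for n
    by (rule le_less_trans[OF emeasure_mono[of _ "{- real n..real n}"]]) (auto simp: B_def)
  then have eq: "emeasure intensity (B n) = emeasure (density lborel (\<lambda>_. ennreal lam)) (B n)" for n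
    using B(1) by (simp add: emeasure_intensity expectation_num_points_finite range_subsetD emeasure_density nn_integral_cmult_indicator)
  have "emeasure intensity A = (SUP n. emeasure intensity (B n))"
    using SUP_emeasure_incseq[of B intensity] B by (simp add: intensity_def)
  also have "\<dots> = (SUP n. emeasure (density lborel (\<lambda>_. ennreal lam)) (B n))" by (simp only: eq)
  also have "\<dots> = emeasure (density lborel (\<lambda>_. ennreal lam)) A"
    using SUP_emeasure_incseq[of B "density lborel (\<lambda>_. ennreal lam)"] B by simp
  finally show "emeasure intensity A = emeasure (density lborel (\<lambda>_. ennreal lam)) A" .
qed

lemma nn_integral_point_sum:
  assumes [measurable]: "f \<in> borel_measurable borel"
  shows "(\<integral>\<^sup>+\<omega>. (\<integral>\<^sup>+i. f (\<tau> i \<omega>) \<partial>count_space UNIV) \<partial>M) = ennreal lam * (\<integral>\<^sup>+x. f x \<partial>lborel)"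
  unfolding nn_integral_intensity[symmetric, OF assms] intensity_eq
  by (simp add: nn_integral_density nn_integral_cmult)

lemma AE_integrable_points:
  fixes f :: "real \<Rightarrow> real"
  assumes f: "integrable lborel f"
  shows "AE \<omega> in M. integrable (count_space UNIV) (\<lambda>i. f (\<tau> i \<omega>))"
proof -
  have [measurable]: "f \<in> borel_measurable borel" using borel_measurable_integrable[OF f] by simp
  have "(\<integral>\<^sup>+\<omega>. (\<integral>\<^sup>+i. ennreal \<bar>f (\<tau> i \<omega>)\<bar> \<partial>count_space UNIV) \<partial>M) \<noteq> \<infinity>"
    using f by (subst nn_integral_point_sum) (auto simp: integrable_iff_bounded ennreal_mult_eq_top_iff)
  then have "AE \<omega> in M. (\<integral>\<^sup>+i. ennreal \<bar>f (\<tau> i \<omega>)\<bar> \<partial>count_space UNIV) \<noteq> \<infinity>"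
    by (intro nn_integral_noteq_infinite) (auto simp: nn_integral_count_space_nat)
  then show ?thesis
    by eventually_elim (auto simp: integrable_iff_bounded less_top)
qed

text \<open>Campbell's formula. The last bound makes \<open>point_sum\<close> a Lipschitz map
  between the two L1 spaces, which carries the approximation by simple functions.\<close>

lemma expectation_point_sum:
  assumes f: "integrable lborel f"
  shows "integrable M (point_sum f)" "expectation (point_sum f) = lam * (LINT x|lborel. f x)"
    "expectation (\<lambda>\<omega>. \<bar>point_sum f \<omega>\<bar>) \<le> lam * (LINT x|lborel. \<bar>f x\<bar>)"
proof -
  have [measurable]: "f \<in> borel_measurable borel" using borel_measurable_integrable[OF f] by simp
  have int: "integrable (count_space UNIV \<Otimes>\<^sub>M M) (\<lambda>(i, \<omega>). f (\<tau> i \<omega>))"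
  proof (rule integrableI_bounded)
    show "(\<integral>\<^sup>+z. ennreal (norm (case z of (i, \<omega>) \<Rightarrow> f (\<tau> i \<omega>))) \<partial>(count_space UNIV \<Otimes>\<^sub>M M)) < \<infinity>"
    proof -
      have "(\<integral>\<^sup>+z. ennreal (norm (case z of (i, \<omega>) \<Rightarrow> f (\<tau> i \<omega>))) \<partial>(count_space UNIV \<Otimes>\<^sub>M M))
          = (\<integral>\<^sup>+x. ennreal \<bar>f x\<bar> \<partial>intensity)"
        unfolding intensity_def by (subst nn_integral_distr) (auto simp: split_beta')
      also have "\<dots> < \<infinity>"
        using f by (simp add: intensity_eq nn_integral_density nn_integral_cmult integrable_iff_bounded ennreal_mult_less_top)
      finally show ?thesis .
    qed
  qed (rule pair_measurable, simp)
  show i: "integrable M (point_sum f)"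
    using cs.integrable_snd[of "\<lambda>i \<omega>. f (\<tau> i \<omega>)"] int by (simp add: point_sum_def[abs_def])
  have ieq: "(\<integral>x. h x \<partial>intensity) = lam * (LINT x|lborel. h x)" if "integrable lborel h" for h :: "real \<Rightarrow> real"
    unfolding intensity_eq using lam that by (subst integral_density) auto
  have "expectation (point_sum f) = (\<integral>z. (case z of (i, \<omega>) \<Rightarrow> f (\<tau> i \<omega>)) \<partial>(count_space UNIV \<Otimes>\<^sub>M M))"
    using cs.integral_snd[of "\<lambda>i \<omega>. f (\<tau> i \<omega>)"] int by (simp add: point_sum_def[abs_def])
  also have "\<dots> = (\<integral>x. f x \<partial>intensity)"
    unfolding intensity_def by (subst integral_distr) (auto simp: split_beta')
  finally show "expectation (point_sum f) = lam * (LINT x|lborel. f x)" using ieq[OF f] by simp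
  have "ennreal (expectation (\<lambda>\<omega>. \<bar>point_sum f \<omega>\<bar>)) = (\<integral>\<^sup>+\<omega>. ennreal \<bar>point_sum f \<omega>\<bar> \<partial>M)"
    using i by (intro nn_integral_eq_integral[symmetric]) auto
  also have "\<dots> \<le> (\<integral>\<^sup>+\<omega>. (\<integral>\<^sup>+i. ennreal \<bar>f (\<tau> i \<omega>)\<bar> \<partial>count_space UNIV) \<partial>M)"
    by (rule nn_integral_mono_AE, use AE_integrable_points[OF f] in eventually_elim)
       (simp only: point_sum_def real_norm_def[symmetric] integral_norm_bound_ennreal)
  also have "\<dots> = ennreal lam * (\<integral>\<^sup>+x. ennreal \<bar>f x\<bar> \<partial>lborel)" by (rule nn_integral_point_sum) simp
  also have "\<dots> = ennreal (lam * (LINT x|lborel. \<bar>f x\<bar>))"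
    using f lam by (subst nn_integral_eq_integral) (auto simp: ennreal_mult)
  finally show "expectation (\<lambda>\<omega>. \<bar>point_sum f \<omega>\<bar>) \<le> lam * (LINT x|lborel. \<bar>f x\<bar>)"
    using lam by (simp add: ennreal_le_iff)
qed

lemma AE_point_sum_add:
  assumes "integrable lborel f" "integrable lborel g"
  shows "AE \<omega> in M. point_sum (\<lambda>x. a * f x + b * g x) \<omega> = a * point_sum f \<omega> + b * point_sum g \<omega>"
  using AE_integrable_points[OF assms(1)] AE_integrable_points[OF assms(2)]
  by eventually_elim (simp add: point_sum_def)

text \<open>An expectation is split according to the value of the count. It is used with
  \<open>\<phi>\<close> a character, to obtain a Fourier series in the count, and with
  \<open>\<phi>\<close> the indicator of a threshold; absolute summability is for the uniqueness of
  Fourier coefficients.\<close>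

lemma expectation_num_points_fun:
  fixes \<phi> :: "ennreal \<Rightarrow> complex" and X :: "'a \<Rightarrow> complex"
  assumes A[measurable]: "A \<in> sets borel" and fin: "emeasure lborel A < \<infinity>"
    and \<phi>: "\<And>k. norm (\<phi> (of_nat k)) \<le> 1" and [measurable]: "\<phi> \<in> borel_measurable borel"
    and [measurable]: "X \<in> borel_measurable M" and X: "\<And>\<omega>. norm (X \<omega>) \<le> 1"
  shows "(\<lambda>k. (CLINT \<omega>|M. indicator {\<omega> \<in> space M. num_points \<tau> A \<omega> = of_nat k} \<omega> *\<^sub>R X \<omega>) * \<phi> (of_nat k))
    sums (CLINT \<omega>|M. X \<omega> * \<phi> (num_points \<tau> A \<omega>))"
    and "summable (\<lambda>k. norm (CLINT \<omega>|M. indicator {\<omega> \<in> space M. num_points \<tau> A \<omega> = of_nat k} \<omega> *\<^sub>R X \<omega>))"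
proof -
  let ?E = "\<lambda>k. {\<omega> \<in> space M. num_points \<tau> A \<omega> = of_nat k}"
  let ?f = "\<lambda>k \<omega>. indicator (?E k) \<omega> *\<^sub>R X \<omega> * \<phi> (of_nat k)"
  have nX: "norm (X \<omega>) * norm (\<phi> (of_nat k)) \<le> 1" for k \<omega>
    using mult_mono[OF X[of \<omega>] \<phi>[of k]] by simp
  have nf: "norm (?f k \<omega>) \<le> indicator (?E k) \<omega>" for k \<omega>
    using nX[of \<omega> k] by (auto simp: indicator_def norm_mult)
  have intf: "integrable M (?f k)" for k
    by (rule integrable_const_bound[where B=1]) (use nf in \<open>auto simp: indicator_def norm_mult nX\<close>)
  have sumE: "summable (\<lambda>k. prob (?E k))"
    by (rule sums_summable[OF finite_measure_UNION]) (auto simp: disjoint_family_on_def)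
  have bound: "LINT \<omega>|M. norm (indicator (?E k) \<omega> *\<^sub>R Z \<omega>) \<le> prob (?E k)"
    if [measurable]: "Z \<in> borel_measurable M" and Z: "\<And>\<omega>. norm (Z \<omega>) \<le> 1" for k and Z :: "'a \<Rightarrow> complex"
  proof -
    have "LINT \<omega>|M. norm (indicator (?E k) \<omega> *\<^sub>R Z \<omega>) \<le> (LINT \<omega>|M. indicator (?E k) \<omega>)"
      by (rule integral_mono) (use Z in \<open>auto simp: indicator_def intro!: integrable_const_bound[where B=1]\<close>)
    then show ?thesis by simp
  qed
  have eq: "(CLINT \<omega>|M. X \<omega> * \<phi> (num_points \<tau> A \<omega>)) = (CLINT \<omega>|M. (\<Sum>k. ?f k \<omega>))"
  proof (rule integral_cong_AE)
    show "AE \<omega> in M. X \<omega> * \<phi> (num_points \<tau> A \<omega>) = (\<Sum>k. ?f k \<omega>)"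
      using AE_num_points_nat[OF A fin] AE_space
    proof eventually_elim
      case (elim \<omega>)
      then obtain k where k: "num_points \<tau> A \<omega> = of_nat k" by blast
      have "(\<Sum>l. ?f l \<omega>) = (\<Sum>l\<in>{k}. ?f l \<omega>)"
        using k by (intro suminf_finite) (auto simp: indicator_def)
      then show ?case using k elim by simp
    qed
  qed measurable
  have "AE \<omega> in M. summable (\<lambda>k. norm (?f k \<omega>))"
    using AE_num_points_nat[OF A fin]
  proof eventually_elim
    case (elim \<omega>)
    then obtain k where k: "num_points \<tau> A \<omega> = of_nat k" by blast
    show ?case by (rule summable_finite[of "{k}"]) (use k in \<open>auto simp: indicator_def\<close>)
  qed
  moreover have "summable (\<lambda>k. LINT \<omega>|M. norm (?f k \<omega>))"
  proof (rule summable_comparison_test_ev[OF _ sumE], intro always_eventually allI)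
    fix k
    have "(LINT \<omega>|M. norm (?f k \<omega>)) \<le> prob (?E k)"
      using bound[of "\<lambda>\<omega>. X \<omega> * \<phi> (of_nat k)" k] nX by (simp add: norm_mult mult.assoc)
    then show "norm (LINT \<omega>|M. norm (?f k \<omega>)) \<le> prob (?E k)" by simp
  qed
  ultimately have "(\<lambda>k. CLINT \<omega>|M. ?f k \<omega>) sums (CLINT \<omega>|M. X \<omega> * \<phi> (num_points \<tau> A \<omega>))"
    unfolding eq by (rule sums_integral[OF intf])
  then show "(\<lambda>k. (CLINT \<omega>|M. indicator (?E k) \<omega> *\<^sub>R X \<omega>) * \<phi> (of_nat k)) sums (CLINT \<omega>|M. X \<omega> * \<phi> (num_points \<tau> A \<omega>))"
    by (simp only: integral_mult_left_zero)
  show "summable (\<lambda>k. norm (CLINT \<omega>|M. indicator (?E k) \<omega> *\<^sub>R X \<omega>))"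
  proof (rule summable_comparison_test_ev[OF _ sumE], intro always_eventually allI)
    fix k
    have "norm (CLINT \<omega>|M. indicator (?E k) \<omega> *\<^sub>R X \<omega>) \<le> (LINT \<omega>|M. norm (indicator (?E k) \<omega> *\<^sub>R X \<omega>))"
      by (rule integral_norm_bound)
    also have "\<dots> \<le> prob (?E k)" by (rule bound) (use X in auto)
    finally show "norm (norm (CLINT \<omega>|M. indicator (?E k) \<omega> *\<^sub>R X \<omega>)) \<le> prob (?E k)" by simp
  qed
qed

lemma char_num_points:
  assumes A[measurable]: "A \<in> sets borel" and fin: "emeasure lborel A < \<infinity>"
  shows "(CLINT \<omega>|M. cis (y * enn2real (num_points \<tau> A \<omega>))) = exp (lam * measure lborel A * (cis y - 1))"
proof -
  let ?x = "lam * measure lborel A"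
  have "(\<lambda>k. (CLINT \<omega>|M. indicator {\<omega> \<in> space M. num_points \<tau> A \<omega> = of_nat k} \<omega> *\<^sub>R 1) * cis (y * enn2real (of_nat k)))
     sums (CLINT \<omega>|M. 1 * cis (y * enn2real (num_points \<tau> A \<omega>)))"
    by (rule expectation_num_points_fun(1)[OF A fin, where \<phi>="\<lambda>n. cis (y * enn2real n)" and X="\<lambda>_. 1"]) (auto simp: cis_conv_exp)
  moreover have "(CLINT \<omega>|M. indicator {\<omega> \<in> space M. num_points \<tau> A \<omega> = of_nat k} \<omega> *\<^sub>R 1)
      = complex_of_real (prob {\<omega> \<in> space M. num_points \<tau> A \<omega> = of_nat k})" for k
    by (subst integral_scaleR_left) (auto simp: scaleR_conv_of_real intro!: integrable_const_bound[where B=1])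
  ultimately have "(CLINT \<omega>|M. cis (y * enn2real (num_points \<tau> A \<omega>)))
      = (\<Sum>k. prob {\<omega> \<in> space M. num_points \<tau> A \<omega> = of_nat k} *\<^sub>R cis (y * enn2real (of_nat k)))"
    by (simp add: sums_iff scaleR_conv_of_real)
  also have "\<dots> = (\<Sum>k. exp (- ?x) * ((?x * cis y) ^ k /\<^sub>R fact k))"
    unfolding num_points_prob[OF A fin]
  proof (intro suminf_cong)
    fix k
    have "cis (y * enn2real (of_nat k)) = cis y ^ k"
    proof -
      have "enn2real (of_nat k) = real k" by (simp add: ennreal_of_nat_eq_real_of_nat)
      then show ?thesis by (simp only: Complex.DeMoivre mult.commute[of y])
    qed
    then show "(?x ^ k / fact k * exp (- ?x)) *\<^sub>R cis (y * enn2real (of_nat k)) = exp (- ?x) * ((?x * cis y) ^ k /\<^sub>R fact k)"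
      by (simp add: scaleR_conv_of_real power_mult_distrib exp_of_real divide_inverse mult_ac)
  qed
  also have "\<dots> = exp (- ?x) * exp (?x * cis y)"
    by (rule sums_unique[symmetric], rule sums_mult, rule exp_converges)
  also have "\<dots> = exp (?x * (cis y - 1))"
    by (simp add: exp_of_real[symmetric] exp_add[symmetric] algebra_simps)
  finally show ?thesis by simp
qed

text \<open>The level sets of \<open>f\<close> for its nonzero values are disjoint and of finite
  measure, so the counts on them are independent Poisson variables and the characteristic function
  is a product.\<close>

lemma char_point_sum_simple:
  assumes "Bochner_Integration.simple_bochner_integrable lborel f"
  shows "(CLINT \<omega>|M. cis (point_sum f \<omega>)) = exp (lam * (CLINT x|lborel. cis (f x) - 1))"
proof -
  have sf: "simple_function lborel f"
    by (rule Bochner_Integration.simple_bochner_integrable.cases[OF assms])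
  have fin0: "emeasure lborel {x. f x \<noteq> 0} \<noteq> \<infinity>"
    by (rule Bochner_Integration.simple_bochner_integrable.cases[OF assms]) simp
  define Y where "Y = f ` UNIV - {0}"
  define A where "A y = f -` {y}" for y
  have finY: "finite Y" using simple_functionD(1)[OF sf] by (simp add: Y_def)
  have A[measurable]: "A y \<in> sets borel" for y using simple_functionD(2)[OF sf, of "{y}"] by (simp add: A_def)
  have [measurable]: "f \<in> borel_measurable borel" using borel_measurable_simple_function[OF sf] by simp
  have finA: "emeasure lborel (A y) < \<infinity>" if "y \<in> Y" for y
    by (rule le_less_trans[OF emeasure_mono[of _ "{x. f x \<noteq> 0}"]]) (use that fin0 in \<open>auto simp: A_def Y_def less_top\<close>)
  \<comment> \<open>The zero set of \<open>f\<close>, of infinite measure, is left out of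
    \<open>Y\<close>; hence the condition \<open>h 0 = 0\<close>, which holds for the identity and
    for \<open>cis y - 1\<close>.\<close>
  have feq: "h (f x) = (\<Sum>y\<in>Y. indicator (A y) x *\<^sub>R h y)" if "h 0 = 0" for h :: "real \<Rightarrow> 'z::real_vector" and x
  proof (cases "f x = 0")
    case True
    then show ?thesis using that by (auto simp: A_def Y_def indicator_def intro!: sum.neutral[symmetric])
  next
    case False
    have "(\<Sum>y\<in>Y. indicator (A y) x *\<^sub>R h y) = (\<Sum>y\<in>{f x}. indicator (A y) x *\<^sub>R h y)"
      using False finY by (intro sum.mono_neutral_right) (auto simp: A_def Y_def indicator_def)
    then show ?thesis by (simp add: A_def)
  qed
  have ps: "AE \<omega> in M. point_sum f \<omega> = (\<Sum>y\<in>Y. y * enn2real (num_points \<tau> (A y) \<omega>))"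
  proof -
    have "AE \<omega> in M. \<forall>y\<in>Y. num_points \<tau> (A y) \<omega> \<noteq> \<infinity>"
      using finY
    proof (rule AE_finite_allI)
      fix y assume "y \<in> Y"
      show "AE \<omega> in M. num_points \<tau> (A y) \<omega> \<noteq> \<infinity>"
        using AE_num_points_nat[OF A finA[OF \<open>y \<in> Y\<close>]] by eventually_elim auto
    qed
    then show ?thesis
    proof eventually_elim
      case (elim \<omega>)
      have e: "emeasure (count_space UNIV) {i. \<tau> i \<omega> \<in> A y} \<noteq> \<infinity>" if "y \<in> Y" for y
        using elim that by (auto simp: num_points_def ecount_def)
      have "point_sum f \<omega> = (\<integral>i. (\<Sum>y\<in>Y. indicator {i. \<tau> i \<omega> \<in> A y} i *\<^sub>R y) \<partial>count_space UNIV)"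
        unfolding point_sum_def by (intro Bochner_Integration.integral_cong) (auto simp: feq[of "\<lambda>y. y"] indicator_def intro!: sum.cong)
      also have "\<dots> = (\<Sum>y\<in>Y. (\<integral>i. indicator {i. \<tau> i \<omega> \<in> A y} i *\<^sub>R y \<partial>count_space UNIV))"
        using e by (intro Bochner_Integration.integral_sum) (auto simp: less_top intro!: integrable_mult_left integrable_real_indicator)
      also have "\<dots> = (\<Sum>y\<in>Y. y * enn2real (num_points \<tau> (A y) \<omega>))"
        by (intro sum.cong) (auto simp: num_points_def ecount_def measure_def)
      finally show ?case .
    qed
  qed
  obtain h where h: "bij_betw h {..<card Y} Y" using ex_bij_betw_nat_finite[OF finY] by (auto simp: atLeast0LessThan)
  have disj: "disjoint_family_on (\<lambda>j. A (h j)) {..<card Y}"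
    using bij_betw_imp_inj_on[OF h] by (auto simp: disjoint_family_on_def A_def inj_on_def)
  have "indep_vars (\<lambda>_. borel) (\<lambda>j. num_points \<tau> (A (h j))) {..<card Y}"
    using ppp disj A by (simp add: poisson_point_process_def)
  then have ind: "indep_vars (\<lambda>_. borel) (\<lambda>j \<omega>. cis (h j * enn2real (num_points \<tau> (A (h j)) \<omega>))) {..<card Y}"
    by (rule indep_vars_compose2) (simp add: cis_conv_exp)
  have "(CLINT \<omega>|M. cis (point_sum f \<omega>)) = (CLINT \<omega>|M. (\<Prod>j<card Y. cis (h j * enn2real (num_points \<tau> (A (h j)) \<omega>))))"
  proof (rule integral_cong_AE)
    show "AE \<omega> in M. cis (point_sum f \<omega>) = (\<Prod>j<card Y. cis (h j * enn2real (num_points \<tau> (A (h j)) \<omega>)))"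
      using ps
    proof eventually_elim
      case (elim \<omega>)
      have "cis (point_sum f \<omega>) = (\<Prod>y\<in>Y. cis (y * enn2real (num_points \<tau> (A y) \<omega>)))"
        unfolding elim cis_conv_exp using finY by (simp add: sum_distrib_left exp_sum)
      then show ?case by (simp add: prod.reindex_bij_betw[OF h, of "\<lambda>y. cis (y * enn2real (num_points \<tau> (A y) \<omega>))"])
    qed
  qed (auto simp: cis_conv_exp)
  also have "\<dots> = (\<Prod>j<card Y. CLINT \<omega>|M. cis (h j * enn2real (num_points \<tau> (A (h j)) \<omega>)))"
    by (rule indep_vars_lebesgue_integral[OF _ ind]) (auto intro!: integrable_const_bound[where B=1] simp: cis_conv_exp)
  also have "\<dots> = (\<Prod>j<card Y. exp (lam * measure lborel (A (h j)) * (cis (h j) - 1)))"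
    using bij_betwE[OF h] by (intro prod.cong refl char_num_points A finA) auto
  also have "\<dots> = (\<Prod>y\<in>Y. exp (lam * measure lborel (A y) * (cis y - 1)))"
    by (rule prod.reindex_bij_betw[OF h])
  also have "\<dots> = exp (lam * (\<Sum>y\<in>Y. measure lborel (A y) * (cis y - 1)))"
    using finY by (simp add: exp_sum sum_distrib_left mult.assoc)
  also have "(\<Sum>y\<in>Y. measure lborel (A y) * (cis y - 1)) = (CLINT x|lborel. (\<Sum>y\<in>Y. indicator (A y) x *\<^sub>R (cis y - 1)))"
    using finA by (subst Bochner_Integration.integral_sum) (auto simp: scaleR_conv_of_real intro!: sum.cong)
  also have "\<dots> = (CLINT x|lborel. cis (f x) - 1)"
    by (intro Bochner_Integration.integral_cong refl) (simp add: feq[of "\<lambda>y. cis y - 1"])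
  finally show ?thesis .
qed

end

section \<open>Exponential estimates and uniqueness of Fourier coefficients\<close>

lemma norm_exp_diff_le:
  fixes z w :: complex
  assumes "Re z \<le> 0" "Re w \<le> 0"
  shows "norm (exp z - exp w) \<le> norm (z - w)"
proof -
  have "norm (exp z - exp w) \<le> 1 * norm (z - w)"
  proof (rule field_differentiable_bound[where S="{z. Re z \<le> 0}" and f'=exp])
    show "convex {z. Re z \<le> 0}" by (rule convex_halfspace_Re_le)
    show "(exp has_field_derivative exp z) (at z within {z. Re z \<le> 0})" for z :: complex
      by (rule DERIV_subset[OF DERIV_exp]) simp
  qed (use assms in auto)
  then show ?thesis by simp
qed

lemma integral_le_zero:
  fixes f :: "'z \<Rightarrow> real"
  assumes "\<And>x. f x \<le> 0"
  shows "(LINT x|N. f x) \<le> 0"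
  using integral_nonneg_AE[of "\<lambda>x. - f x" N] assms by simp

lemma norm_cis_minus_one_le: "norm (cis a - 1) \<le> \<bar>a\<bar>"
  using norm_cis_diff_le[of a 0] by simp

lemma norm_cis_taylor1: "norm (cis a - 1 - \<i> * a) \<le> a\<^sup>2 / 2"
proof -
  have "norm (cis a - 1 - \<i> * a) = norm (iexp a - (\<Sum>k\<le>1. (\<i> * a) ^ k / fact k))"
    by (simp add: cis_conv_exp algebra_simps)
  also have "\<dots> \<le> \<bar>a\<bar> ^ Suc 1 / fact (Suc 1)" by (rule iexp_approx1)
  finally show ?thesis by (simp add: power2_eq_square)
qed

lemma norm_cis_taylor2: "norm (cis a - 1 - \<i> * a + a\<^sup>2 / 2) \<le> \<bar>a\<bar> ^ 3 / 6"
proof -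
  have "(\<i> * complex_of_real a)\<^sup>2 = - (complex_of_real a)\<^sup>2" by (simp add: power_mult_distrib)
  then have eq: "(\<Sum>k\<le>2. (\<i> * a) ^ k / fact k) = 1 + \<i> * a - a\<^sup>2 / 2"
    by (simp add: numeral_2_eq_2)
  have "norm (cis a - 1 - \<i> * a + a\<^sup>2 / 2) = norm (iexp a - (\<Sum>k\<le>2. (\<i> * a) ^ k / fact k))"
    unfolding eq by (simp add: cis_conv_exp algebra_simps)
  also have "\<dots> \<le> \<bar>a\<bar> ^ Suc 2 / fact (Suc 2)" by (rule iexp_approx1)
  finally show ?thesis by (simp add: eval_nat_numeral)
qed

lemma integral_cis_period:
  fixes n :: int
  shows "(CLINT w|lborel. indicator {0..2 * pi} w *\<^sub>R cis (w * real_of_int n)) = (if n = 0 then 2 * pi else 0)"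
proof (cases "n = 0")
  case True
  then show ?thesis by (simp add: scaleR_conv_of_real)
next
  case False
  define F where "F w = (- \<i> / of_int n) * cis (w * real_of_int n)" for w
  have "(CLINT w|lborel. indicator {0..2 * pi} w *\<^sub>R cis (w * real_of_int n)) = F (2 * pi) - F 0"
  proof (rule integral_FTC_Icc)
    fix x :: real
    have "((\<lambda>w. cis (w * real_of_int n)) has_vector_derivative real_of_int n *\<^sub>R (\<i> * cis (x * real_of_int n))) (at x within {0..2 * pi})"
      by (rule has_vector_derivative_cis) (auto intro!: derivative_eq_intros)
    from has_vector_derivative_mult_right[OF this, of "- \<i> / of_int n"]
    show "(F has_vector_derivative cis (x * real_of_int n)) (at x within {0..2 * pi})"
      unfolding F_def using False by (simp add: scaleR_conv_of_real field_simps)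
  qed (auto intro!: continuous_intros)
  also have "F (2 * pi) = F 0"
    using cis_multiple_2pi[of "of_int n"] by (simp add: F_def)
  finally show ?thesis using False by simp
qed

text \<open>Multiply by \<open>cis (- (w * real j))\<close> and integrate over a period; absolute
  summability of the coefficients permits integration term by term.\<close>

lemma trigonometric_series_unique:
  fixes d :: "nat \<Rightarrow> complex"
  assumes d: "summable (\<lambda>k. norm (d k))" and 0: "\<And>w. (\<lambda>k. d k * cis (w * real k)) sums 0"
  shows "d j = 0"
proof -
  let ?f = "\<lambda>k w. indicator {0..2 * pi} w *\<^sub>R (d k * cis (w * real k) * cis (- (w * real j)))"
  have i01: "integrable lborel (\<lambda>w. indicator {0..2 * pi} w *\<^sub>R c)" for c :: complex
    by (intro integrable_scaleR_left integrable_real_indicator) auto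
  have nf: "norm (?f k w) = indicator {0..2 * pi} w * norm (d k)" for k w by (simp add: norm_mult)
  have intf: "integrable lborel (?f k)" for k
    by (rule Bochner_Integration.integrable_bound[OF i01[of "d k"]]) (auto simp: norm_mult cis_conv_exp)
  have "(\<lambda>k. CLINT w|lborel. ?f k w) sums (CLINT w|lborel. (\<Sum>k. ?f k w))"
  proof (rule sums_integral[OF intf])
    show "AE w in lborel. summable (\<lambda>k. norm (?f k w))"
      unfolding nf by (intro AE_I2 summable_mult d)
    have "(LINT w|lborel. norm (?f k w)) = 2 * pi * norm (d k)" for k
      unfolding nf by simp
    then show "summable (\<lambda>k. LINT w|lborel. norm (?f k w))" using summable_mult[OF d, of "2 * pi"] by simp
  qed
  also have "(\<lambda>w. \<Sum>k. ?f k w) = (\<lambda>w. 0)"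
  proof
    fix w
    have "(\<lambda>k. ?f k w) sums (indicator {0..2 * pi} w *\<^sub>R (0 * cis (- (w * real j))))"
      by (intro sums_scaleR_right sums_mult2 0)
    then show "(\<Sum>k. ?f k w) = 0" by (simp add: sums_iff)
  qed
  also have "(\<lambda>k. CLINT w|lborel. ?f k w) = (\<lambda>k. if k = j then 2 * pi * d j else 0)"
  proof
    fix k
    have "?f k w = d k * (indicator {0..2 * pi} w *\<^sub>R cis (w * of_int (int k - int j)))" for w
      by (simp add: cis_mult algebra_simps)
    then have "(CLINT w|lborel. ?f k w) = d k * (CLINT w|lborel. indicator {0..2 * pi} w *\<^sub>R cis (w * of_int (int k - int j)))"
      by (simp only: integral_mult_right_zero)
    also have "\<dots> = (if k = j then 2 * pi * d j else 0)"
      by (subst integral_cis_period) (auto simp: mult.commute)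
    finally show "(CLINT w|lborel. ?f k w) = \<dots>" .
  qed
  finally have "(\<lambda>k. if k = j then 2 * pi * d j else 0) sums 0" by simp
  moreover have "(\<lambda>k. if k = j then 2 * pi * d j else 0) sums (2 * pi * d j)" by (rule sums_single)
  ultimately have "2 * pi * d j = 0" using sums_unique2 by blast
  then show ?thesis by simp
qed

section \<open>The characteristic functional and its consequences\<close>

context poisson_points
begin

lemma integrable_cis_minus_one:
  fixes f :: "'z \<Rightarrow> real"
  assumes "integrable N f"
  shows "integrable N (\<lambda>x. cis (f x) - 1)"
proof -
  have [measurable]: "f \<in> borel_measurable N" using assms by simp
  show ?thesis
  proof (rule Bochner_Integration.integrable_bound[OF assms])
    show "(\<lambda>x. cis (f x) - 1) \<in> borel_measurable N" by (auto simp: cis_conv_exp)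
  qed (simp add: norm_cis_minus_one_le)
qed

text \<open>Both sides are continuous in \<open>f\<close> for the L1 norm: the left one because
  \<open>cis\<close> is Lipschitz and \<open>point_sum\<close> is controlled by Campbell's bound,
  the exponent on the right again because \<open>cis\<close> is Lipschitz. Simple functions are
  dense.\<close>

theorem char_point_sum:
  assumes f: "integrable lborel f"
  shows "(CLINT \<omega>|M. cis (point_sum f \<omega>)) = exp (lam * (CLINT x|lborel. cis (f x) - 1))"
proof -
  obtain I where I: "has_bochner_integral lborel f I" using f by (auto simp: integrable.simps)
  obtain s :: "nat \<Rightarrow> real \<Rightarrow> real" where s: "\<And>i. Bochner_Integration.simple_bochner_integrable lborel (s i)"
    and lim: "(\<lambda>i. \<integral>\<^sup>+x. norm (f x - s i x) \<partial>lborel) \<longlonglongrightarrow> 0"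
    by (rule has_bochner_integral.cases[OF I]) (rule that)
  have si: "integrable lborel (s i)" for i
    using has_bochner_integral_simple_bochner_integrable[OF s[of i]] by (auto simp: integrable.simps)
  have [measurable]: "f \<in> borel_measurable borel" "s i \<in> borel_measurable borel" for i
    using borel_measurable_integrable[OF f] borel_measurable_integrable[OF si] by auto
  define e where "e i = (LINT x|lborel. \<bar>f x - s i x\<bar>)" for i
  have fs: "integrable lborel (\<lambda>x. f x - s i x)" for i using f si by simp
  have "(\<integral>\<^sup>+x. norm (f x - s i x) \<partial>lborel) = ennreal (e i)" for i
    unfolding e_def using fs[of i] by (subst nn_integral_eq_integral) auto
  with lim have "(\<lambda>i. ennreal (e i)) \<longlonglongrightarrow> ennreal 0" by simp
  then have e: "e \<longlonglongrightarrow> 0" by (subst (asm) tendsto_ennreal_iff) (auto simp: e_def)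
  have L: "(\<lambda>i. CLINT \<omega>|M. cis (point_sum (s i) \<omega>)) \<longlonglongrightarrow> (CLINT \<omega>|M. cis (point_sum f \<omega>))"
  proof (rule LIM_zero_cancel, rule tendsto_norm_zero_cancel, rule tendsto_sandwich[OF _ _ tendsto_const])
    show "(\<lambda>i. lam * e i) \<longlonglongrightarrow> 0" using tendsto_mult_left[OF e, of lam] by simp
    show "\<forall>\<^sub>F i in sequentially. norm ((CLINT \<omega>|M. cis (point_sum (s i) \<omega>)) - (CLINT \<omega>|M. cis (point_sum f \<omega>))) \<le> lam * e i"
    proof (intro always_eventually allI)
      fix i
      have "norm ((CLINT \<omega>|M. cis (point_sum (s i) \<omega>)) - (CLINT \<omega>|M. cis (point_sum f \<omega>)))
          = norm (CLINT \<omega>|M. cis (point_sum (s i) \<omega>) - cis (point_sum f \<omega>))"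
        by (subst Bochner_Integration.integral_diff) (auto intro: integrable_cis)
      also have "\<dots> \<le> (LINT \<omega>|M. norm (cis (point_sum (s i) \<omega>) - cis (point_sum f \<omega>)))"
        by (rule integral_norm_bound)
      also have "\<dots> \<le> (LINT \<omega>|M. \<bar>point_sum (\<lambda>x. f x - s i x) \<omega>\<bar>)"
      proof (rule integral_mono_AE)
        show "integrable M (\<lambda>\<omega>. norm (cis (point_sum (s i) \<omega>) - cis (point_sum f \<omega>)))"
          by (intro integrable_norm Bochner_Integration.integrable_diff integrable_cis) auto
        show "integrable M (\<lambda>\<omega>. \<bar>point_sum (\<lambda>x. f x - s i x) \<omega>\<bar>)"
          by (intro integrable_abs expectation_point_sum(1) fs)
        show "AE \<omega> in M. norm (cis (point_sum (s i) \<omega>) - cis (point_sum f \<omega>)) \<le> \<bar>point_sum (\<lambda>x. f x - s i x) \<omega>\<bar>"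
          using AE_point_sum_add[OF f si[of i], of 1 "-1"]
        proof eventually_elim
          case (elim \<omega>)
          then show ?case using norm_cis_diff_le[of "point_sum (s i) \<omega>" "point_sum f \<omega>"] by (simp add: abs_minus_commute)
        qed
      qed
      also have "\<dots> \<le> lam * e i" unfolding e_def by (rule expectation_point_sum(3)[OF fs])
      finally show "norm ((CLINT \<omega>|M. cis (point_sum (s i) \<omega>)) - (CLINT \<omega>|M. cis (point_sum f \<omega>))) \<le> lam * e i" .
    qed
  qed auto
  have R: "(\<lambda>i. CLINT x|lborel. cis (s i x) - 1) \<longlonglongrightarrow> (CLINT x|lborel. cis (f x) - 1)"
  proof (rule LIM_zero_cancel, rule tendsto_norm_zero_cancel, rule tendsto_sandwich[OF _ _ tendsto_const e])
    show "\<forall>\<^sub>F i in sequentially. norm ((CLINT x|lborel. cis (s i x) - 1) - (CLINT x|lborel. cis (f x) - 1)) \<le> e i"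
    proof (intro always_eventually allI)
      fix i
      have "norm ((CLINT x|lborel. cis (s i x) - 1) - (CLINT x|lborel. cis (f x) - 1)) = norm (CLINT x|lborel. (cis (s i x) - 1) - (cis (f x) - 1))"
        by (subst Bochner_Integration.integral_diff[OF integrable_cis_minus_one[OF si] integrable_cis_minus_one[OF f]]) (rule refl)
      also have "\<dots> \<le> (LINT x|lborel. norm ((cis (s i x) - 1) - (cis (f x) - 1)))" by (rule integral_norm_bound)
      also have "\<dots> \<le> e i" unfolding e_def
      proof (rule integral_mono)
        show "integrable lborel (\<lambda>x. norm ((cis (s i x) - 1) - (cis (f x) - 1)))"
          by (intro integrable_norm Bochner_Integration.integrable_diff integrable_cis_minus_one f si)
        show "integrable lborel (\<lambda>x. \<bar>f x - s i x\<bar>)" by (intro integrable_abs fs)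
        show "norm ((cis (s i x) - 1) - (cis (f x) - 1)) \<le> \<bar>f x - s i x\<bar>" for x
          using norm_cis_diff_le[of "s i x" "f x"] by (simp add: abs_minus_commute)
      qed
      finally show "norm ((CLINT x|lborel. cis (s i x) - 1) - (CLINT x|lborel. cis (f x) - 1)) \<le> e i" .
    qed
  qed auto
  have "(\<lambda>i. exp (lam * (CLINT x|lborel. cis (s i x) - 1))) \<longlonglongrightarrow> exp (lam * (CLINT x|lborel. cis (f x) - 1))"
    by (intro tendsto_intros R)
  with L show ?thesis unfolding char_point_sum_simple[OF s] using LIMSEQ_unique by blast
qed

lemma char_centered_point_sum:
  assumes f: "integrable lborel f"
  shows "(CLINT \<omega>|M. cis (point_sum f \<omega> - lam * (LINT x|lborel. f x))) = exp (lam * (CLINT x|lborel. cis (f x) - 1 - \<i> * f x))"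
proof -
  have "(CLINT \<omega>|M. cis (point_sum f \<omega> - lam * (LINT x|lborel. f x))) = (CLINT \<omega>|M. cis (point_sum f \<omega>) * cis (- (lam * (LINT x|lborel. f x))))"
    by (simp add: cis_mult)
  also have "\<dots> = exp (lam * (CLINT x|lborel. cis (f x) - 1)) * cis (- (lam * (LINT x|lborel. f x)))"
    unfolding integral_mult_left_zero char_point_sum[OF f] ..
  also have "\<dots> = exp (lam * ((CLINT x|lborel. cis (f x) - 1) - \<i> * (LINT x|lborel. f x)))"
    by (simp add: cis_conv_exp exp_add[symmetric] algebra_simps)
  also have "(CLINT x|lborel. cis (f x) - 1) - \<i> * (LINT x|lborel. f x) = (CLINT x|lborel. cis (f x) - 1 - \<i> * f x)"
    using f integrable_cis_minus_one[OF f] by (subst Bochner_Integration.integral_diff[of lborel "\<lambda>x. cis (f x) - 1"]) auto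
  finally show ?thesis .
qed

text \<open>The second moment is read off the characteristic function near 0: \<open>q n\<close> has
  mean at most \<open>lam\<close> times the integral of \<open>(f x)\<^sup>2\<close> by a
  second-order Taylor bound in the exponent, and it converges to the squared deviation as the
  frequency \<open>h n\<close> tends to 0. Fatou's lemma gives integrability and the bound
  together.\<close>

lemma second_moment_point_sum:
  assumes f: "integrable lborel f" and f2: "integrable lborel (\<lambda>x. (f x)\<^sup>2)"
  shows "integrable M (\<lambda>\<omega>. (point_sum f \<omega> - lam * (LINT x|lborel. f x))\<^sup>2)"
    and "expectation (\<lambda>\<omega>. (point_sum f \<omega> - lam * (LINT x|lborel. f x))\<^sup>2) \<le> lam * (LINT x|lborel. (f x)\<^sup>2)"
proof -
  have [measurable]: "f \<in> borel_measurable borel" using borel_measurable_integrable[OF f] by simp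
  define D where "D \<omega> = point_sum f \<omega> - lam * (LINT x|lborel. f x)" for \<omega>
  have [measurable]: "D \<in> borel_measurable M" unfolding D_def[abs_def] by measurable
  define h where "h n = inverse (real (Suc n))" for n
  have h: "0 < h n" for n by (simp add: h_def)
  have h0: "h \<longlonglongrightarrow> 0" unfolding h_def by (rule LIMSEQ_inverse_real_of_nat)
  define q where "q n \<omega> = 2 * (1 - cos (h n * D \<omega>)) / (h n)\<^sup>2" for n \<omega>
  have q0: "0 \<le> q n \<omega>" for n \<omega> by (simp add: q_def)
  have [measurable]: "q n \<in> borel_measurable M" for n unfolding q_def[abs_def] by measurable
  have Eq: "(\<integral>\<^sup>+\<omega>. ennreal (q n \<omega>) \<partial>M) \<le> ennreal (lam * (LINT x|lborel. (f x)\<^sup>2))" for n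
  proof -
    have icos: "integrable M (\<lambda>\<omega>. cos (h n * D \<omega>))" by (rule integrable_const_bound[where B=1]) auto
    have iq: "integrable M (q n)" unfolding q_def using icos by simp
    have fh: "integrable lborel (\<lambda>x. h n * f x)" using f by simp
    let ?z = "lam * (CLINT x|lborel. cis (h n * f x) - 1 - \<i> * (h n * f x))"
    have i2: "integrable lborel (\<lambda>x. (h n)\<^sup>2 / 2 * (f x)\<^sup>2)" using f2 by simp
    have i1: "integrable lborel (\<lambda>x. cis (h n * f x) - 1 - \<i> * (h n * f x))"
      by (rule Bochner_Integration.integrable_diff[OF integrable_cis_minus_one[OF fh]]) (use f in auto)
    have nz: "norm ?z \<le> lam * ((h n)\<^sup>2 / 2 * (LINT x|lborel. (f x)\<^sup>2))"
    proof -
      have "norm (CLINT x|lborel. cis (h n * f x) - 1 - \<i> * (h n * f x)) \<le> (LINT x|lborel. norm (cis (h n * f x) - 1 - \<i> * (h n * f x)))"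
        by (rule integral_norm_bound)
      also have "\<dots> \<le> (LINT x|lborel. (h n)\<^sup>2 / 2 * (f x)\<^sup>2)"
      proof (rule integral_mono[OF integrable_norm[OF i1] i2])
        show "norm (cis (h n * f x) - 1 - \<i> * (h n * f x)) \<le> (h n)\<^sup>2 / 2 * (f x)\<^sup>2" for x
          using norm_cis_taylor1[of "h n * f x"] by (simp add: power_mult_distrib)
      qed
      also have "\<dots> = (h n)\<^sup>2 / 2 * (LINT x|lborel. (f x)\<^sup>2)" by (rule integral_mult_right_zero)
      finally show ?thesis using lam by (simp add: norm_mult mult_left_mono)
    qed
    have Rez: "Re ?z \<le> 0"
    proof -
      have "Re (CLINT x|lborel. cis (h n * f x) - 1 - \<i> * (h n * f x)) = (LINT x|lborel. cos (h n * f x) - 1)"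
        using integral_Re[OF i1] by simp
      also have "\<dots> \<le> 0" by (rule integral_le_zero) simp
      finally show ?thesis using lam by (simp add: mult_nonneg_nonpos)
    qed
    have "expectation (\<lambda>\<omega>. cos (h n * D \<omega>)) = Re (CLINT \<omega>|M. cis (h n * D \<omega>))"
      by (subst integral_Re[symmetric]) (auto intro: integrable_cis)
    also have "(CLINT \<omega>|M. cis (h n * D \<omega>)) = (CLINT \<omega>|M. cis (point_sum (\<lambda>x. h n * f x) \<omega> - lam * (LINT x|lborel. h n * f x)))"
      by (intro Bochner_Integration.integral_cong refl) (simp add: D_def point_sum_def algebra_simps)
    also have "\<dots> = exp ?z" by (rule char_centered_point_sum[OF fh])
    finally have ec: "expectation (\<lambda>\<omega>. cos (h n * D \<omega>)) = Re (exp ?z)" .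
    have "expectation (q n) = 2 * (1 - Re (exp ?z)) / (h n)\<^sup>2"
      unfolding q_def ec[symmetric] using icos prob_space by simp
    also have "1 - Re (exp ?z) \<le> norm (exp 0 - exp ?z)"
      using complex_Re_le_cmod[of "exp 0 - exp ?z"] by simp
    also have "\<dots> \<le> norm ?z" using norm_exp_diff_le[of 0 ?z] Rez by simp
    also note nz
    finally have "expectation (q n) \<le> 2 * (lam * ((h n)\<^sup>2 / 2 * (LINT x|lborel. (f x)\<^sup>2))) / (h n)\<^sup>2"
      by (simp add: divide_right_mono)
    also have "\<dots> = lam * (LINT x|lborel. (f x)\<^sup>2)" using h[of n] by simp
    finally show ?thesis using iq q0 by (subst nn_integral_eq_integral) (auto intro: ennreal_leI)
  qed
  have lim: "(\<lambda>n. q n \<omega>) \<longlonglongrightarrow> (D \<omega>)\<^sup>2" for \<omega>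
  proof -
    have "((\<lambda>x. sin (x * (D \<omega> / 2))) has_real_derivative D \<omega> / 2) (at 0)"
      by (auto intro!: derivative_eq_intros)
    then have "((\<lambda>x. sin (x * (D \<omega> / 2)) / x) \<longlongrightarrow> D \<omega> / 2) (at 0)"
      by (simp add: DERIV_def)
    then have "(\<lambda>n. sin (h n * (D \<omega> / 2)) / h n) \<longlonglongrightarrow> D \<omega> / 2"
      by (rule filterlim_compose) (use h[THEN less_imp_neq, THEN not_sym] in \<open>auto simp: filterlim_at h0\<close>)
    then have "(\<lambda>n. 4 * (sin (h n * (D \<omega> / 2)) / h n)\<^sup>2) \<longlonglongrightarrow> 4 * (D \<omega> / 2)\<^sup>2"
      by (rule tendsto_mult_left[OF tendsto_power])
    moreover have "4 * (sin (h n * (D \<omega> / 2)) / h n)\<^sup>2 = q n \<omega>" for n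
      using cos_double_sin[of "h n * (D \<omega> / 2)"] by (simp add: q_def power_divide)
    ultimately show ?thesis by (simp add: power_divide)
  qed
  have "(\<integral>\<^sup>+\<omega>. ennreal ((D \<omega>)\<^sup>2) \<partial>M) = (\<integral>\<^sup>+\<omega>. liminf (\<lambda>n. ennreal (q n \<omega>)) \<partial>M)"
    by (intro nn_integral_cong lim_imp_Liminf[symmetric] tendsto_ennrealI lim) simp
  also have "\<dots> \<le> liminf (\<lambda>n. \<integral>\<^sup>+\<omega>. ennreal (q n \<omega>) \<partial>M)" by (rule nn_integral_liminf) simp
  also have "\<dots> \<le> liminf (\<lambda>n::nat. ennreal (lam * (LINT x|lborel. (f x)\<^sup>2)))"
    by (rule Liminf_mono) (use Eq in auto)
  also have "\<dots> = ennreal (lam * (LINT x|lborel. (f x)\<^sup>2))" by (simp add: Liminf_const)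
  finally have le: "(\<integral>\<^sup>+\<omega>. ennreal ((D \<omega>)\<^sup>2) \<partial>M) \<le> ennreal (lam * (LINT x|lborel. (f x)\<^sup>2))" .
  have int: "integrable M (\<lambda>\<omega>. (D \<omega>)\<^sup>2)"
    by (rule integrableI_nonneg) (use le in \<open>auto intro: le_less_trans\<close>)
  then show "integrable M (\<lambda>\<omega>. (point_sum f \<omega> - lam * (LINT x|lborel. f x))\<^sup>2)" by (simp add: D_def)
  have "0 \<le> lam * (LINT x|lborel. (f x)\<^sup>2)" using lam by simp
  with le int show "expectation (\<lambda>\<omega>. (point_sum f \<omega> - lam * (LINT x|lborel. f x))\<^sup>2) \<le> lam * (LINT x|lborel. (f x)\<^sup>2)"
    by (subst (asm) nn_integral_eq_integral) (auto simp: D_def)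
qed

text \<open>Adding \<open>w * indicator {-1..1}\<close> to \<open>f\<close> multiplies the contribution of the event that there are \<open>k\<close> points in
  \<open>{-1..1}\<close> by \<open>cis (w * k)\<close>; comparing Fourier coefficients in \<open>w\<close> isolates that event.\<close>
lemma char_point_sum_given_count:
  assumes f: "integrable lborel f"
  shows "norm (CLINT \<omega>|M. indicator {\<omega> \<in> space M. num_points \<tau> {-1..1} \<omega> = of_nat k} \<omega> *\<^sub>R cis (point_sum f \<omega>))
    \<le> prob {\<omega> \<in> space M. num_points \<tau> {-1..1} \<omega> = of_nat k}
       * (norm (CLINT x|lborel. indicator {-1..1} x *\<^sub>R cis (f x)) / 2) ^ k"
proof -
  have [measurable]: "f \<in> borel_measurable borel" using borel_measurable_integrable[OF f] by simp
  let ?I = "{-1..1::real}"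
  let ?E = "\<lambda>k. {\<omega> \<in> space M. num_points \<tau> ?I \<omega> = of_nat k}"
  define c where "c k = (CLINT \<omega>|M. indicator (?E k) \<omega> *\<^sub>R cis (point_sum f \<omega>))" for k
  define a where "a = (CLINT x|lborel. indicator (- ?I) x *\<^sub>R (cis (f x) - 1))"
  define b where "b = (CLINT x|lborel. indicator ?I x *\<^sub>R cis (f x))"
  \<comment> \<open>These are the coefficients of exp (lam * (a + b * cis w - 2)) as a power series
    in \<open>cis w\<close>. Here \<open>b\<close> collects the window and \<open>a\<close> its
    complement; 2 is the length of the window.\<close>
  define e where "e k = exp (lam * (a - 2)) * ((lam * b) ^ k /\<^sub>R fact k)" for k
  have I: "?I \<in> sets borel" "emeasure lborel ?I < \<infinity>" by auto
  have iI: "integrable lborel (indicator ?I :: real \<Rightarrow> real)" by (intro integrable_real_indicator) auto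
  have ia: "integrable lborel (\<lambda>x. indicator (- ?I) x *\<^sub>R (cis (f x) - 1))"
    by (rule integrable_mult_indicator[OF _ integrable_cis_minus_one[OF f]]) simp
  have ib: "integrable lborel (\<lambda>x. indicator ?I x *\<^sub>R cis (f x))"
    by (rule Bochner_Integration.integrable_bound[OF iI]) (auto simp: cis_conv_exp)
  have i1: "integrable lborel (\<lambda>x. indicator ?I x *\<^sub>R (1::complex))"
    by (rule Bochner_Integration.integrable_bound[OF iI]) auto
  have csum: "(\<lambda>k. c k * cis (w * real k)) sums (CLINT \<omega>|M. cis (point_sum f \<omega>) * cis (w * enn2real (num_points \<tau> ?I \<omega>)))"
    and cabs: "summable (\<lambda>k. norm (c k))" for w
  proof -
    have "(\<lambda>k. c k * cis (w * enn2real (of_nat k))) sums (CLINT \<omega>|M. cis (point_sum f \<omega>) * cis (w * enn2real (num_points \<tau> ?I \<omega>)))"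
      unfolding c_def
      by (rule expectation_num_points_fun(1)[OF I, where \<phi>="\<lambda>n. cis (w * enn2real n)"]) (auto simp: cis_conv_exp)
    then show "(\<lambda>k. c k * cis (w * real k)) sums (CLINT \<omega>|M. cis (point_sum f \<omega>) * cis (w * enn2real (num_points \<tau> ?I \<omega>)))"
      by (simp add: ennreal_of_nat_eq_real_of_nat)
    show "summable (\<lambda>k. norm (c k))"
      unfolding c_def by (rule expectation_num_points_fun(2)[OF I, where \<phi>="\<lambda>_. 1"]) (auto simp: cis_conv_exp)
  qed
  have esum: "(\<lambda>k. e k * cis (w * real k)) sums (CLINT \<omega>|M. cis (point_sum f \<omega>) * cis (w * enn2real (num_points \<tau> ?I \<omega>)))" for w
  proof -
    let ?g = "\<lambda>x. 1 * f x + w * indicator ?I x"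
    have g: "integrable lborel ?g" using f iI by simp
    have "AE \<omega> in M. cis (point_sum f \<omega>) * cis (w * enn2real (num_points \<tau> ?I \<omega>)) = cis (point_sum ?g \<omega>)"
      using AE_point_sum_add[OF f iI, of 1 w]
    proof eventually_elim
      case (elim \<omega>)
      have "point_sum (indicator ?I) \<omega> = (LINT i|count_space UNIV. indicator {i. \<tau> i \<omega> \<in> ?I} i)"
        unfolding point_sum_def by (intro Bochner_Integration.integral_cong) (auto simp: indicator_def)
      then have "point_sum (indicator ?I) \<omega> = enn2real (num_points \<tau> ?I \<omega>)"
        by (simp add: num_points_def ecount_def measure_def)
      then show ?case using elim by (simp add: cis_mult)
    qed
    then have "(CLINT \<omega>|M. cis (point_sum f \<omega>) * cis (w * enn2real (num_points \<tau> ?I \<omega>))) = (CLINT \<omega>|M. cis (point_sum ?g \<omega>))"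
      by (intro integral_cong_AE) (auto simp: cis_conv_exp)
    also have "\<dots> = exp (lam * (CLINT x|lborel. cis (?g x) - 1))" by (rule char_point_sum[OF g])
    also have "(CLINT x|lborel. cis (?g x) - 1) = (CLINT x|lborel. indicator (- ?I) x *\<^sub>R (cis (f x) - 1)
        + (cis w * (indicator ?I x *\<^sub>R cis (f x)) - indicator ?I x *\<^sub>R 1))"
      by (intro Bochner_Integration.integral_cong) (auto simp: indicator_def cis_mult add.commute)
    also have "\<dots> = a + (cis w * b - 2)"
      using ia ib i1 by (simp add: a_def b_def scaleR_conv_of_real)
    also have "exp (lam * (a + (cis w * b - 2))) = exp (lam * (a - 2)) * exp (lam * b * cis w)"
      by (simp add: exp_add[symmetric] algebra_simps)
    finally have eq: "(CLINT \<omega>|M. cis (point_sum f \<omega>) * cis (w * enn2real (num_points \<tau> ?I \<omega>))) = exp (lam * (a - 2)) * exp (lam * b * cis w)" .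
    have "(\<lambda>k. exp (lam * (a - 2)) * ((lam * b * cis w) ^ k /\<^sub>R fact k)) sums (exp (lam * (a - 2)) * exp (lam * b * cis w))"
      by (intro sums_mult exp_converges)
    moreover have "exp (lam * (a - 2)) * ((lam * b * cis w) ^ k /\<^sub>R fact k) = e k * cis (w * real k)" for k
    proof -
      have "cis (w * real k) = cis w ^ k" by (simp only: Complex.DeMoivre mult.commute[of w])
      then show ?thesis by (simp add: e_def power_mult_distrib)
    qed
    ultimately show ?thesis unfolding eq by simp
  qed
  have eabs: "summable (\<lambda>k. norm (e k))"
    unfolding e_def norm_mult by (intro summable_mult summable_norm_exp)
  have "c k - e k = 0"
  proof (rule trigonometric_series_unique)
    have "summable (\<lambda>k. norm (c k) + norm (e k))" by (intro summable_add cabs eabs)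
    then show "summable (\<lambda>k. norm (c k - e k))"
      by (rule summable_comparison_test_ev[rotated]) (auto intro!: always_eventually norm_triangle_ineq4)
    show "(\<lambda>k. (c k - e k) * cis (w * real k)) sums 0" for w
      using sums_diff[OF csum[of w] esum[of w]] by (simp add: left_diff_distrib)
  qed
  then have "norm (c k) = norm (e k)" by simp
  also have "\<dots> = exp (lam * (Re a - 2)) * ((lam * norm b) ^ k / fact k)"
    using lam by (simp add: e_def norm_mult norm_power divide_inverse mult.commute)
  \<comment> \<open>Since \<open>Re a \<le> 0\<close>, the points outside the window can only
    decrease the modulus. What remains is the Poisson probability of \<open>k\<close> points times
    the \<open>k\<close>-th power of the normalized window integral.\<close>
  also have "\<dots> \<le> exp (lam * (0 - 2)) * ((lam * norm b) ^ k / fact k)"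
  proof -
    have "Re a = (LINT x|lborel. indicator (- ?I) x * (cos (f x) - 1))"
      unfolding a_def using integral_Re[OF ia] by simp
    also have "\<dots> \<le> 0" by (rule integral_le_zero) (simp add: indicator_def)
    finally show ?thesis
      using lam by (intro mult_right_mono exp_le_cancel_iff[THEN iffD2] mult_left_mono) auto
  qed
  also have "\<dots> = prob (?E k) * (norm b / 2) ^ k"
    using num_points_prob[OF I, of k] by (simp add: power_mult_distrib power_divide mult_ac)
  finally show ?thesis by (simp add: c_def b_def)
qed

section \<open>Conditioning on many points in the window\<close>

definition many_points :: "'a set" where
  "many_points = {\<omega> \<in> space M. num_points \<tau> {-1..1} \<omega> \<ge> ennreal lam}"

lemma many_points_sets [measurable]: "many_points \<in> sets M"
  unfolding many_points_def by measurable

text \<open>Sum the bounds for exactly \<open>k\<close> points over all integers \<open>k\<close>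
  that are at least \<open>lam\<close>. The hypothesis on \<open>K\<close>, made for the ceiling of
  \<open>lam\<close>, gives \<open>K \<le> k\<close> for each of them, and powers of
  \<open>q \<le> 1\<close> decrease.\<close>

lemma char_point_sum_many_points:
  assumes f: "integrable lborel f" and K: "real K < lam + 1"
  shows "norm (CLINT \<omega>|M. indicator many_points \<omega> *\<^sub>R cis (point_sum f \<omega>))
    \<le> prob many_points * (norm (CLINT x|lborel. indicator {-1..1} x *\<^sub>R cis (f x)) / 2) ^ K"
proof -
  have [measurable]: "f \<in> borel_measurable borel" using borel_measurable_integrable[OF f] by simp
  let ?I = "{-1..1::real}"
  let ?E = "\<lambda>k. {\<omega> \<in> space M. num_points \<tau> ?I \<omega> = of_nat k}"
  define q where "q = norm (CLINT x|lborel. indicator ?I x *\<^sub>R cis (f x)) / 2"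
  have I: "?I \<in> sets borel" "emeasure lborel ?I < \<infinity>" by auto
  have iI: "integrable lborel (indicator ?I :: real \<Rightarrow> real)" by (intro integrable_real_indicator) auto
  have q: "0 \<le> q" "q \<le> 1"
  proof -
    have "norm (CLINT x|lborel. indicator ?I x *\<^sub>R cis (f x)) \<le> (LINT x|lborel. norm (indicator ?I x *\<^sub>R cis (f x)))"
      by (rule integral_norm_bound)
    also have "\<dots> = 2" by simp
    finally show "q \<le> 1" by (simp add: q_def)
  qed (simp add: q_def)
  define \<phi> :: "ennreal \<Rightarrow> complex" where "\<phi> n = of_bool (ennreal lam \<le> n)" for n
  have [measurable]: "\<phi> \<in> borel_measurable borel" unfolding \<phi>_def[abs_def] by measurable
  have \<phi>1: "norm (\<phi> (of_nat k)) \<le> 1" for k by (simp add: \<phi>_def)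
  have ind: "X \<omega> * \<phi> (num_points \<tau> ?I \<omega>) = indicator many_points \<omega> *\<^sub>R X \<omega>" if "\<omega> \<in> space M" for \<omega> and X :: "'a \<Rightarrow> complex"
    using that by (simp add: \<phi>_def many_points_def indicator_def)
  have \<phi>k: "\<phi> (of_nat k) = of_bool (lam \<le> real k)" for k
    by (simp add: \<phi>_def ennreal_of_nat_eq_real_of_nat ennreal_le_iff)
  have s1: "(\<lambda>k. (CLINT \<omega>|M. indicator (?E k) \<omega> *\<^sub>R cis (point_sum f \<omega>)) * \<phi> (of_nat k)) sums
     (CLINT \<omega>|M. indicator many_points \<omega> *\<^sub>R cis (point_sum f \<omega>))"
  proof -
    have "(CLINT \<omega>|M. cis (point_sum f \<omega>) * \<phi> (num_points \<tau> ?I \<omega>)) = (CLINT \<omega>|M. indicator many_points \<omega> *\<^sub>R cis (point_sum f \<omega>))"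
      by (rule Bochner_Integration.integral_cong[OF refl ind])
    moreover have "(\<lambda>k. (CLINT \<omega>|M. indicator (?E k) \<omega> *\<^sub>R cis (point_sum f \<omega>)) * \<phi> (of_nat k)) sums
        (CLINT \<omega>|M. cis (point_sum f \<omega>) * \<phi> (num_points \<tau> ?I \<omega>))"
      by (rule expectation_num_points_fun(1)[OF I, where \<phi>=\<phi>]) (use \<phi>1 in \<open>auto simp: cis_conv_exp\<close>)
    ultimately show ?thesis by simp
  qed
  have s2: "(\<lambda>k. prob (?E k) * of_bool (lam \<le> real k)) sums prob many_points"
  proof -
    have one: "(CLINT \<omega>|M. indicator S \<omega> *\<^sub>R 1) = complex_of_real (prob S)" if "S \<in> sets M" for S
      using that by (subst integral_scaleR_left) (auto simp: scaleR_conv_of_real intro!: integrable_const_bound[where B=1])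
    have "(\<lambda>k. (CLINT \<omega>|M. indicator (?E k) \<omega> *\<^sub>R 1) * \<phi> (of_nat k)) sums (CLINT \<omega>|M. 1 * \<phi> (num_points \<tau> ?I \<omega>))"
      by (rule expectation_num_points_fun(1)[OF I, where \<phi>=\<phi> and X="\<lambda>\<omega>. 1"]) (use \<phi>1 in auto)
    moreover have "(CLINT \<omega>|M. 1 * \<phi> (num_points \<tau> ?I \<omega>)) = (CLINT \<omega>|M. indicator many_points \<omega> *\<^sub>R 1)"
      by (rule Bochner_Integration.integral_cong[OF refl ind])
    moreover have "complex_of_real (of_bool b) = of_bool b" for b by (cases b) auto
    ultimately have "(\<lambda>k. complex_of_real (prob (?E k) * of_bool (lam \<le> real k))) sums complex_of_real (prob many_points)"
      by (simp add: one \<phi>k)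
    then show ?thesis by (simp only: sums_of_real_iff)
  qed
  have bd: "norm ((CLINT \<omega>|M. indicator (?E k) \<omega> *\<^sub>R cis (point_sum f \<omega>)) * \<phi> (of_nat k)) \<le> q ^ K * (prob (?E k) * of_bool (lam \<le> real k))" for k
  proof (cases "lam \<le> real k")
    case True
    have "K \<le> k" using K True by linarith
    have "norm (CLINT \<omega>|M. indicator (?E k) \<omega> *\<^sub>R cis (point_sum f \<omega>)) \<le> prob (?E k) * q ^ k"
      unfolding q_def by (rule char_point_sum_given_count[OF f])
    also have "\<dots> \<le> prob (?E k) * q ^ K" using q \<open>K \<le> k\<close> by (intro mult_left_mono power_decreasing) auto
    finally show ?thesis using True by (simp add: \<phi>k mult.commute)
  qed (simp add: \<phi>k)
  have "norm (CLINT \<omega>|M. indicator many_points \<omega> *\<^sub>R cis (point_sum f \<omega>)) \<le> q ^ K * prob many_points"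
    unfolding sums_unique[OF s1] sums_unique[OF sums_mult[OF s2, of "q ^ K"]]
    by (rule norm_suminf_le[OF bd]) (rule sums_summable[OF sums_mult[OF s2]])
  then show ?thesis by (simp add: q_def mult.commute)
qed

text \<open>Chebyshev's inequality: the window has length 2, so the count has mean
  \<open>2 * lam\<close> and variance at most \<open>2 * lam\<close>, and outside the event it falls
  short of its mean by at least \<open>lam\<close>.\<close>

lemma prob_many_points: "1 - prob many_points \<le> 2 / lam"
proof -
  let ?I = "{-1..1::real}"
  have iI: "integrable lborel (indicator ?I :: real \<Rightarrow> real)" by (intro integrable_real_indicator) auto
  have iI2: "(\<lambda>x. (indicator ?I x :: real)\<^sup>2) = indicator ?I" by (auto simp: indicator_def)
  define D where "D \<omega> = point_sum (indicator ?I) \<omega> - lam * 2" for \<omega>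
  have D2: "integrable M (\<lambda>\<omega>. (D \<omega>)\<^sup>2)" "expectation (\<lambda>\<omega>. (D \<omega>)\<^sup>2) \<le> lam * 2"
    using second_moment_point_sum[OF iI] iI unfolding iI2 by (auto simp: D_def)
  have "AE \<omega> in M. \<omega> \<in> space M - many_points \<longrightarrow> lam\<^sup>2 \<le> (D \<omega>)\<^sup>2"
    using AE_num_points_nat[of ?I]
  proof (rule eventually_mono)
    fix \<omega> assume "\<exists>k. num_points \<tau> ?I \<omega> = of_nat k"
    then obtain k where k: "num_points \<tau> ?I \<omega> = of_nat k" by blast
    have "point_sum (indicator ?I) \<omega> = (LINT i|count_space UNIV. indicator {i. \<tau> i \<omega> \<in> ?I} i)"
      unfolding point_sum_def by (intro Bochner_Integration.integral_cong) (auto simp: indicator_def)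
    then have "point_sum (indicator ?I) \<omega> = enn2real (num_points \<tau> ?I \<omega>)"
      by (simp add: num_points_def ecount_def measure_def)
    then have pk: "point_sum (indicator ?I) \<omega> = real k" using k by (simp add: ennreal_of_nat_eq_real_of_nat)
    show "\<omega> \<in> space M - many_points \<longrightarrow> lam\<^sup>2 \<le> (D \<omega>)\<^sup>2"
    proof
      assume "\<omega> \<in> space M - many_points"
      then have "real k < lam" using k lam by (auto simp: many_points_def ennreal_of_nat_eq_real_of_nat ennreal_le_iff)
      then have "lam \<le> \<bar>D \<omega>\<bar>" unfolding D_def pk by linarith
      then show "lam\<^sup>2 \<le> (D \<omega>)\<^sup>2" using lam abs_le_square_iff[of lam "D \<omega>"] by simp
    qed
  qed auto
  then have "AE \<omega> in M. lam\<^sup>2 * indicator (space M - many_points) \<omega> \<le> (D \<omega>)\<^sup>2"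
    by eventually_elim (auto simp: indicator_def)
  moreover have "integrable M (\<lambda>\<omega>. lam\<^sup>2 * indicator (space M - many_points) \<omega>)"
    by (intro integrable_mult_right integrable_const_bound[where B=1]) auto
  ultimately have "expectation (\<lambda>\<omega>. lam\<^sup>2 * indicator (space M - many_points) \<omega>) \<le> expectation (\<lambda>\<omega>. (D \<omega>)\<^sup>2)"
    by (intro integral_mono_AE D2)
  then have "lam\<^sup>2 * prob (space M - many_points) \<le> lam * 2" using D2(2) by simp
  then have "lam * prob (space M - many_points) \<le> 2" using lam by (simp add: power2_eq_square)
  then have "prob (space M - many_points) \<le> 2 / lam" using lam by (simp add: field_simps)
  then show ?thesis by (simp add: prob_compl)
qed

text \<open>On the half plane of nonpositive real part \<open>exp\<close> is Lipschitz with constant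
  1, so it is enough to compare exponents. Their difference is \<open>lam\<close> times a
  third-order Taylor remainder in \<open>f x / sqrt lam\<close>, hence of order 1 / sqrt
  lam.\<close>

lemma char_point_sum_normal:
  assumes f: "integrable lborel f" and f2: "integrable lborel (\<lambda>x. (f x)\<^sup>2)" and f3: "integrable lborel (\<lambda>x. \<bar>f x\<bar> ^ 3)"
  shows "norm ((CLINT \<omega>|M. cis (point_sum (\<lambda>x. f x / sqrt lam) \<omega> - lam * (LINT x|lborel. f x / sqrt lam))) - exp (- (LINT x|lborel. (f x)\<^sup>2) / 2))
    \<le> (LINT x|lborel. \<bar>f x\<bar> ^ 3) / (6 * sqrt lam)"
proof -
  let ?g = "\<lambda>x. f x / sqrt lam"
  have g: "integrable lborel ?g" using f by simp
  have g2: "integrable lborel (\<lambda>x. (?g x)\<^sup>2)" using f2 by (simp add: power_divide)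
  have g3: "integrable lborel (\<lambda>x. \<bar>?g x\<bar> ^ 3)" using f3 by (simp add: power_divide)
  let ?z = "lam * (CLINT x|lborel. cis (?g x) - 1 - \<i> * ?g x)"
  let ?w = "complex_of_real (- (LINT x|lborel. (f x)\<^sup>2) / 2)"
  have i1: "integrable lborel (\<lambda>x. cis (?g x) - 1 - \<i> * ?g x)"
    by (intro Bochner_Integration.integrable_diff[OF integrable_cis_minus_one[OF g]] integrable_mult_right integrable_of_real g)
  have i2: "integrable lborel (\<lambda>x. complex_of_real ((?g x)\<^sup>2 / 2))"
    by (intro integrable_of_real integrable_divide_zero g2)
  have Rez: "Re ?z \<le> 0"
  proof -
    have "Re (CLINT x|lborel. cis (?g x) - 1 - \<i> * ?g x) = (LINT x|lborel. cos (?g x) - 1)"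
      using integral_Re[OF i1] by simp
    also have "\<dots> \<le> 0" by (rule integral_le_zero) simp
    finally show ?thesis using lam by (simp add: mult_nonneg_nonpos)
  qed
  have "?w = - (lam * complex_of_real (LINT x|lborel. (?g x)\<^sup>2 / 2))"
    using lam by (simp add: power_divide)
  then have zw: "?z - ?w = lam * (CLINT x|lborel. cis (?g x) - 1 - \<i> * ?g x + complex_of_real ((?g x)\<^sup>2 / 2))"
    by (simp only: Bochner_Integration.integral_add[OF i1 i2] integral_complex_of_real distrib_left diff_minus_eq_add)
  have "(CLINT \<omega>|M. cis (point_sum ?g \<omega> - lam * (LINT x|lborel. ?g x))) = exp ?z" by (rule char_centered_point_sum[OF g])
  then have "norm ((CLINT \<omega>|M. cis (point_sum ?g \<omega> - lam * (LINT x|lborel. ?g x))) - exp (- (LINT x|lborel. (f x)\<^sup>2) / 2)) = norm (exp ?z - exp ?w)"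
    by (simp only: exp_of_real)
  also have "\<dots> \<le> norm (?z - ?w)" by (rule norm_exp_diff_le[OF Rez]) simp
  also have "\<dots> = lam * norm (CLINT x|lborel. cis (?g x) - 1 - \<i> * ?g x + complex_of_real ((?g x)\<^sup>2 / 2))"
    unfolding zw using lam by (simp add: norm_mult)
  also have "\<dots> \<le> lam * (LINT x|lborel. \<bar>?g x\<bar> ^ 3 / 6)"
  proof (intro mult_left_mono order_trans[OF integral_norm_bound] integral_mono)
    show "integrable lborel (\<lambda>x. norm (cis (?g x) - 1 - \<i> * ?g x + complex_of_real ((?g x)\<^sup>2 / 2)))"
      by (rule integrable_norm[OF Bochner_Integration.integrable_add[OF i1 i2]])
    show "norm (cis (?g x) - 1 - \<i> * ?g x + complex_of_real ((?g x)\<^sup>2 / 2)) \<le> \<bar>?g x\<bar> ^ 3 / 6" for x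
      using norm_cis_taylor2[of "?g x"] by simp
  qed (use g3 lam in auto)
  also have "\<dots> = (LINT x|lborel. \<bar>f x\<bar> ^ 3) / (6 * sqrt lam)"
  proof -
    have "(LINT x|lborel. \<bar>?g x\<bar> ^ 3 / 6) = (LINT x|lborel. \<bar>f x\<bar> ^ 3) / (6 * sqrt lam ^ 3)"
      using lam by (simp add: power_divide)
    moreover have "sqrt lam ^ 3 = lam * sqrt lam" using lam by (simp add: power3_eq_cube)
    ultimately show ?thesis using lam by simp
  qed
  finally show ?thesis .
qed

end

section \<open>The kernel of the increments\<close>

lemma continuous_on_UNIV_deriv:
  fixes f f' :: "real \<Rightarrow> real"
  assumes "\<And>x. (f has_real_derivative f' x) (at x)"
  shows "continuous_on UNIV f"
  using assms by (intro continuous_at_imp_continuous_on ballI) (rule DERIV_isCont)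

lemma deriv_diff_le_window:
  fixes f f' :: "real \<Rightarrow> real"
  assumes f: "\<And>x. (f has_real_derivative f' x) (at x)" and f': "continuous_on UNIV f'"
    and yz: "y \<in> {x..x + h}" "z \<in> {x..x + h}"
  shows "\<bar>f y - f z\<bar> \<le> (LINT r|lborel. indicator {x..x + h} r * \<bar>f' r\<bar>)"
proof -
  have int: "integrable lborel (\<lambda>r. indicator {a..b} r * k r)" if "continuous_on UNIV k" for a b and k :: "real \<Rightarrow> real"
    using borel_integrable_atLeastAtMost'[of a b k] continuous_on_subset[OF that] by (simp add: set_integrable_def)
  have *: "\<bar>f b - f a\<bar> \<le> (LINT r|lborel. indicator {x..x + h} r * \<bar>f' r\<bar>)" if ab: "a \<le> b" "x \<le> a" "b \<le> x + h" for a b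
  proof -
    have "(LINT r|lborel. indicator {a..b} r *\<^sub>R f' r) = f b - f a"
      by (rule integral_FTC_Icc[OF ab(1)])
         (use f in \<open>auto simp: has_real_derivative_iff_has_vector_derivative[symmetric] intro: has_field_derivative_at_within continuous_on_subset[OF f']\<close>)
    then have "\<bar>f b - f a\<bar> \<le> (LINT r|lborel. \<bar>indicator {a..b} r * f' r\<bar>)"
      using integral_abs_bound[of lborel "\<lambda>r. indicator {a..b} r * f' r"] by simp
    also have "\<dots> \<le> (LINT r|lborel. indicator {x..x + h} r * \<bar>f' r\<bar>)"
      using ab by (intro integral_mono integrable_abs int f' continuous_on_rabs) (auto simp: indicator_def)
    finally show ?thesis .
  qed
  show ?thesis using *[of y z] *[of z y] yz by (cases "y \<le> z") (auto simp: abs_minus_commute)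
qed

lemma nn_integral_window:
  assumes [measurable]: "k \<in> borel_measurable borel" and h: "0 \<le> h"
  shows "(\<integral>\<^sup>+x. (\<integral>\<^sup>+r. indicator {x..x + h} r * k r \<partial>lborel) \<partial>lborel) = ennreal h * (\<integral>\<^sup>+r. k r \<partial>lborel)"
proof -
  have "(\<integral>\<^sup>+x. (\<integral>\<^sup>+r. indicator {x..x + h} r * k r \<partial>lborel) \<partial>lborel) = (\<integral>\<^sup>+r. (\<integral>\<^sup>+x. indicator {x..x + h} r * k r \<partial>lborel) \<partial>lborel)"
  proof (rule lborel_pair.Fubini'[symmetric])
    have "(\<lambda>(x, r). indicator {x..x + h} r * k r) = (\<lambda>(x, r). (if x \<le> r \<and> r \<le> x + h then 1 else 0) * k r :: ennreal)"
      by (auto simp: indicator_def)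
    then show "(\<lambda>(x, r). indicator {x..x + h} r * k r) \<in> borel_measurable (lborel \<Otimes>\<^sub>M lborel)" by simp
  qed
  also have "\<dots> = (\<integral>\<^sup>+r. (\<integral>\<^sup>+x. indicator {r - h..r} x * k r \<partial>lborel) \<partial>lborel)"
    by (intro nn_integral_cong) (auto simp: indicator_def)
  also have "\<dots> = (\<integral>\<^sup>+r. ennreal h * k r \<partial>lborel)"
    using h by (intro nn_integral_cong) (simp add: nn_integral_multc)
  also have "\<dots> = ennreal h * (\<integral>\<^sup>+r. k r \<partial>lborel)" by (simp add: nn_integral_cmult)
  finally show ?thesis .
qed

text \<open>By Fubini every \<open>r\<close> belongs to windows whose left ends fill an interval of
  length \<open>h\<close>. Integrability of a derivative thus passes to pointwise quantities such as
  increments and local suprema.\<close>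

lemma integral_le_window:
  fixes f k :: "real \<Rightarrow> real"
  assumes [measurable]: "f \<in> borel_measurable borel" and k: "integrable lborel k" and h: "0 \<le> h"
    and le: "\<And>x. \<bar>f x\<bar> \<le> (LINT r|lborel. indicator {x..x + h} r * \<bar>k r\<bar>)"
  shows "integrable lborel f" "(LINT x|lborel. \<bar>f x\<bar>) \<le> h * (LINT x|lborel. \<bar>k x\<bar>)"
proof -
  have [measurable]: "k \<in> borel_measurable borel" using borel_measurable_integrable[OF k] by simp
  have w: "ennreal (LINT r|lborel. indicator {x..x + h} r * \<bar>k r\<bar>) = (\<integral>\<^sup>+r. indicator {x..x + h} r * ennreal \<bar>k r\<bar> \<partial>lborel)" for x
  proof -
    have i: "integrable lborel (\<lambda>r. indicator {x..x + h} r * \<bar>k r\<bar>)"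
      using integrable_mult_indicator[OF _ integrable_abs[OF k], of "{x..x + h}"] by simp
    have "ennreal (LINT r|lborel. indicator {x..x + h} r * \<bar>k r\<bar>) = (\<integral>\<^sup>+r. ennreal (indicator {x..x + h} r * \<bar>k r\<bar>) \<partial>lborel)"
      by (rule nn_integral_eq_integral[symmetric, OF i]) simp
    also have "\<dots> = (\<integral>\<^sup>+r. indicator {x..x + h} r * ennreal \<bar>k r\<bar> \<partial>lborel)"
      by (intro nn_integral_cong) (auto simp: indicator_def)
    finally show ?thesis .
  qed
  have "(\<integral>\<^sup>+x. ennreal \<bar>f x\<bar> \<partial>lborel) \<le> (\<integral>\<^sup>+x. (\<integral>\<^sup>+r. indicator {x..x + h} r * ennreal \<bar>k r\<bar> \<partial>lborel) \<partial>lborel)"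
    unfolding w[symmetric] by (intro nn_integral_mono ennreal_leI le)
  also have "\<dots> = ennreal h * (\<integral>\<^sup>+r. ennreal \<bar>k r\<bar> \<partial>lborel)" by (rule nn_integral_window[OF _ h]) simp
  also have "\<dots> = ennreal (h * (LINT x|lborel. \<bar>k x\<bar>))"
    using h nn_integral_eq_integral[OF integrable_abs[OF k]] by (simp add: ennreal_mult)
  finally have le': "(\<integral>\<^sup>+x. ennreal \<bar>f x\<bar> \<partial>lborel) \<le> ennreal (h * (LINT x|lborel. \<bar>k x\<bar>))" .
  show f: "integrable lborel f" by (rule integrableI_bounded) (use le' in \<open>auto intro: le_less_trans\<close>)
  show "(LINT x|lborel. \<bar>f x\<bar>) \<le> h * (LINT x|lborel. \<bar>k x\<bar>)"
    using le' nn_integral_eq_integral[OF integrable_abs[OF f]] h by (simp add: ennreal_le_iff)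
qed

text \<open>Average the inequality \<open>\<bar>f y\<bar> \<le> \<bar>f z\<bar> + \<bar>f y - f
  z\<bar>\<close> over \<open>z\<close> in the unit window. The bound is the same for all
  \<open>y\<close> in the window, which later supplies one dominating function for all times at
  once.\<close>

lemma bounded_by_window:
  fixes f f' :: "real \<Rightarrow> real"
  assumes f: "\<And>x. (f has_real_derivative f' x) (at x)" and f': "continuous_on UNIV f'"
    and int: "integrable lborel f" and y: "y \<in> {x..x + 1}"
  shows "\<bar>f y\<bar> \<le> (LINT r|lborel. indicator {x..x + 1} r * (\<bar>f r\<bar> + \<bar>f' r\<bar>))"
proof -
  have cf: "continuous_on UNIV f" by (rule continuous_on_UNIV_deriv[OF f])
  have ii: "integrable lborel (\<lambda>r. indicator {a..b} r * k r)" if "continuous_on UNIV k" for a b and k :: "real \<Rightarrow> real"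
    using borel_integrable_atLeastAtMost'[of a b k] continuous_on_subset[OF that] by (simp add: set_integrable_def)
  let ?C = "LINT r|lborel. indicator {x..x + 1} r * \<bar>f' r\<bar>"
  have "\<bar>f y\<bar> = (LINT z|lborel. indicator {x..x + 1} z * \<bar>f y\<bar>)" by simp
  also have "\<dots> \<le> (LINT z|lborel. indicator {x..x + 1} z * (\<bar>f z\<bar> + ?C))"
  proof (intro integral_mono ii continuous_intros cf)
    fix z
    show "indicator {x..x + 1} z * \<bar>f y\<bar> \<le> indicator {x..x + 1} z * (\<bar>f z\<bar> + ?C)"
      using deriv_diff_le_window[OF f f' y, of z] by (auto simp: indicator_def)
  qed
  also have "\<dots> = (LINT z|lborel. indicator {x..x + 1} z * \<bar>f z\<bar>) + ?C"
    using ii[of "\<lambda>r. \<bar>f r\<bar>"] ii[of "\<lambda>r. ?C"] cf by (simp add: distrib_left continuous_on_rabs)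
  also have "\<dots> = (LINT r|lborel. indicator {x..x + 1} r * (\<bar>f r\<bar> + \<bar>f' r\<bar>))"
    using ii[of "\<lambda>r. \<bar>f r\<bar>"] ii[of "\<lambda>r. \<bar>f' r\<bar>"] cf f' by (simp add: distrib_left continuous_on_rabs)
  finally show ?thesis .
qed

lemma bounded_by_L1:
  fixes f f' :: "real \<Rightarrow> real"
  assumes f: "\<And>x. (f has_real_derivative f' x) (at x)" and f': "continuous_on UNIV f'"
    and int: "integrable lborel f" "integrable lborel f'"
  shows "\<bar>f y\<bar> \<le> (LINT r|lborel. \<bar>f r\<bar>) + (LINT r|lborel. \<bar>f' r\<bar>)"
proof -
  have i: "integrable lborel (\<lambda>r. \<bar>f r\<bar> + \<bar>f' r\<bar>)" using int by simp
  have "\<bar>f y\<bar> \<le> (LINT r|lborel. indicator {y..y + 1} r * (\<bar>f r\<bar> + \<bar>f' r\<bar>))"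
    by (rule bounded_by_window[OF f f' int(1)]) simp
  also have "\<dots> \<le> (LINT r|lborel. \<bar>f r\<bar> + \<bar>f' r\<bar>)"
    using integrable_mult_indicator[OF _ i, of "{y..y + 1}"]
    by (intro integral_mono i) (auto simp: indicator_def)
  also have "\<dots> = (LINT r|lborel. \<bar>f r\<bar>) + (LINT r|lborel. \<bar>f' r\<bar>)" using int by simp
  finally show ?thesis .
qed

lemma L1_increment:
  fixes f f' :: "real \<Rightarrow> real"
  assumes f: "\<And>x. (f has_real_derivative f' x) (at x)" and f': "continuous_on UNIV f'"
    and int: "integrable lborel f'" and h: "0 \<le> h"
  shows "(LINT x|lborel. \<bar>f (x + h) - f x\<bar>) \<le> h * (LINT x|lborel. \<bar>f' x\<bar>)"
proof -
  have cf: "continuous_on UNIV f" by (rule continuous_on_UNIV_deriv[OF f])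
  have [measurable]: "f \<in> borel_measurable borel" using cf by (rule borel_measurable_continuous_onI)
  show ?thesis
    by (rule integral_le_window(2)[OF _ int h deriv_diff_le_window[OF f f']]) (use h in auto)
qed

lemma L1_difference_quotient:
  fixes f f' f'' :: "real \<Rightarrow> real"
  assumes f: "\<And>x. (f has_real_derivative f' x) (at x)" and f': "\<And>x. (f' has_real_derivative f'' x) (at x)"
    and f'': "continuous_on UNIV f''" and int: "integrable lborel f''" and h: "0 < h"
  shows "integrable lborel (\<lambda>x. (f (x + h) - f x) / h - f' x)"
    and "(LINT x|lborel. \<bar>(f (x + h) - f x) / h - f' x\<bar>) \<le> h * (LINT x|lborel. \<bar>f'' x\<bar>)"
proof -
  have cf: "continuous_on UNIV f" "continuous_on UNIV f'" by (rule continuous_on_UNIV_deriv[OF f], rule continuous_on_UNIV_deriv[OF f'])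
  have [measurable]: "f \<in> borel_measurable borel" "f' \<in> borel_measurable borel" using cf by (auto intro: borel_measurable_continuous_onI)
  have le: "\<bar>(f (x + h) - f x) / h - f' x\<bar> \<le> (LINT r|lborel. indicator {x..x + h} r * \<bar>f'' r\<bar>)" for x
  proof -
    have "\<exists>z>x. z < x + h \<and> f (x + h) - f x = (x + h - x) * f' z" by (rule MVT2) (use h f in auto)
    then obtain z where z: "x < z" "z < x + h" "f (x + h) - f x = h * f' z" by auto
    have "(f (x + h) - f x) / h = f' z" using z h by simp
    then show ?thesis using deriv_diff_le_window[OF f' f'', of z x h x] z h by simp
  qed
  show "integrable lborel (\<lambda>x. (f (x + h) - f x) / h - f' x)"
    by (rule integral_le_window(1)[OF _ int less_imp_le[OF h] le]) measurable
  show "(LINT x|lborel. \<bar>(f (x + h) - f x) / h - f' x\<bar>) \<le> h * (LINT x|lborel. \<bar>f'' x\<bar>)"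
    by (rule integral_le_window(2)[OF _ int less_imp_le[OF h] le]) measurable
qed

lemma integrable_shift:
  fixes f :: "real \<Rightarrow> real"
  assumes "integrable lborel f"
  shows "integrable lborel (\<lambda>x. f (x + c))" "(LINT x|lborel. f (x + c)) = (LINT x|lborel. f x)"
  using lborel_integrable_real_affine[OF assms, of 1 c] lborel_integral_real_affine[of 1 f c] by (simp_all add: add.commute)

lemma integrable_reflect:
  fixes f :: "real \<Rightarrow> real"
  assumes "integrable lborel f"
  shows "integrable lborel (\<lambda>x. f (c - x))" "(LINT x|lborel. f (c - x)) = (LINT x|lborel. f x)"
  using lborel_integrable_real_affine[OF assms, of "-1" c] lborel_integral_real_affine[of "-1" f c] by simp_all

text \<open>By translation invariance a difference quotient of \<open>f\<close> has integral 0, and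
  it differs from \<open>f'\<close> by at most \<open>h\<close> times the norm of \<open>f''\<close>
  in L1.\<close>

lemma integral_deriv_zero:
  fixes f f' f'' :: "real \<Rightarrow> real"
  assumes f: "\<And>x. (f has_real_derivative f' x) (at x)" and f': "\<And>x. (f' has_real_derivative f'' x) (at x)"
    and f'': "continuous_on UNIV f''" and int: "integrable lborel f" "integrable lborel f'" "integrable lborel f''"
  shows "(LINT x|lborel. f' x) = 0"
proof -
  have "\<bar>LINT x|lborel. f' x\<bar> \<le> h * (LINT x|lborel. \<bar>f'' x\<bar>)" if h: "0 < h" for h
  proof -
    have q: "integrable lborel (\<lambda>x. (f (x + h) - f x) / h)" using integrable_shift[OF int(1)] int by simp
    have "(LINT x|lborel. (f (x + h) - f x) / h) = 0" using integrable_shift[OF int(1)] int by simp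
    then have "(LINT x|lborel. (f (x + h) - f x) / h - f' x) = - (LINT x|lborel. f' x)"
      using Bochner_Integration.integral_diff[OF q int(2)] by simp
    then have "\<bar>LINT x|lborel. f' x\<bar> \<le> (LINT x|lborel. \<bar>(f (x + h) - f x) / h - f' x\<bar>)"
      using integral_abs_bound[of lborel "\<lambda>x. (f (x + h) - f x) / h - f' x"] by simp
    also have "\<dots> \<le> h * (LINT x|lborel. \<bar>f'' x\<bar>)" by (rule L1_difference_quotient(2)[OF f f' f'' int(3) h])
    finally show ?thesis .
  qed
  moreover have "((\<lambda>h. h * (LINT x|lborel. \<bar>f'' x\<bar>)) \<longlongrightarrow> 0 * (LINT x|lborel. \<bar>f'' x\<bar>)) (at_right 0)"
    by (intro tendsto_intros)
  ultimately have "\<bar>LINT x|lborel. f' x\<bar> \<le> 0 * (LINT x|lborel. \<bar>f'' x\<bar>)"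
    by (intro tendsto_lowerbound) (auto intro!: eventually_at_rightI[of 0 1])
  then show ?thesis by simp
qed

text \<open>The last assumption is the determinant of \<open>Phi g s\<close>. The interval
  \<open>{-1..2}\<close> is the range of t - s for times t in the unit interval and points s in the
  window \<open>{-1..1}\<close>.\<close>

locale smooth_kernel =
  fixes g g1 g2 g3 g4 :: "real \<Rightarrow> real"
  assumes d0: "\<And>x. (g has_real_derivative g1 x) (at x)" and d1: "\<And>x. (g1 has_real_derivative g2 x) (at x)"
    and d2: "\<And>x. (g2 has_real_derivative g3 x) (at x)" and d3: "\<And>x. (g3 has_real_derivative g4 x) (at x)"
    and c4: "continuous_on UNIV g4"
    and int0: "integrable lborel g" and int1: "integrable lborel g1" and int2: "integrable lborel g2"
    and det: "\<And>s. s \<in> {-1..2} \<Longrightarrow> g1 s * g3 s - (g2 s)\<^sup>2 \<noteq> 0"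
begin

lemma cont: "continuous_on UNIV g" "continuous_on UNIV g1" "continuous_on UNIV g2" "continuous_on UNIV g3"
  by (rule continuous_on_UNIV_deriv[OF d0] continuous_on_UNIV_deriv[OF d1] continuous_on_UNIV_deriv[OF d2] continuous_on_UNIV_deriv[OF d3])+

lemma kernel_measurable [measurable]: "g \<in> borel_measurable borel" "g1 \<in> borel_measurable borel" "g2 \<in> borel_measurable borel"
  using cont by (auto intro: borel_measurable_continuous_onI)

definition L where "L = (LINT x|lborel. \<bar>g x\<bar>) + (LINT x|lborel. \<bar>g1 x\<bar>) + (LINT x|lborel. \<bar>g2 x\<bar>)"

lemma L_bounds: "(LINT x|lborel. \<bar>g x\<bar>) \<le> L" "(LINT x|lborel. \<bar>g1 x\<bar>) \<le> L" "(LINT x|lborel. \<bar>g2 x\<bar>) \<le> L" "0 \<le> L"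
  "\<bar>g x\<bar> \<le> L" "\<bar>g1 x\<bar> \<le> L"
proof -
  have n: "0 \<le> (LINT x|lborel. \<bar>k x\<bar>)" for k :: "real \<Rightarrow> real" by (rule integral_nonneg_AE) simp
  show "(LINT x|lborel. \<bar>g x\<bar>) \<le> L" "(LINT x|lborel. \<bar>g1 x\<bar>) \<le> L" "(LINT x|lborel. \<bar>g2 x\<bar>) \<le> L" "0 \<le> L"
    using n[of g] n[of g1] n[of g2] by (simp_all add: L_def)
  show "\<bar>g x\<bar> \<le> L" using bounded_by_L1[OF d0 cont(2) int0 int1, of x] n[of g2] unfolding L_def by linarith
  show "\<bar>g1 x\<bar> \<le> L" using bounded_by_L1[OF d1 cont(3) int1 int2, of x] n[of g] unfolding L_def by linarith
qed

definition m0 where "m0 = (LINT s|lborel. (g s)\<^sup>2)"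
definition m2 where "m2 = (LINT s|lborel. (g1 s)\<^sup>2)"

lemma integrable_bounded_mult:
  fixes a b :: "real \<Rightarrow> real"
  assumes a: "integrable lborel a" and [measurable]: "b \<in> borel_measurable borel" and b: "\<And>x. \<bar>b x\<bar> \<le> C"
  shows "integrable lborel (\<lambda>x. a x * b x)" "(LINT x|lborel. \<bar>a x * b x\<bar>) \<le> C * (LINT x|lborel. \<bar>a x\<bar>)"
proof -
  have [measurable]: "a \<in> borel_measurable borel" using borel_measurable_integrable[OF a] by simp
  have C: "0 \<le> C" using b[of 0] by linarith
  have le: "\<bar>a x * b x\<bar> \<le> C * \<bar>a x\<bar>" for x
    using mult_left_mono[OF b[of x], of "\<bar>a x\<bar>"] by (simp add: abs_mult mult.commute)
  have iC: "integrable lborel (\<lambda>x. C * \<bar>a x\<bar>)" using a by simp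
  show i: "integrable lborel (\<lambda>x. a x * b x)"
    by (rule Bochner_Integration.integrable_bound[OF iC]) (use le C in auto)
  have "(LINT x|lborel. \<bar>a x * b x\<bar>) \<le> (LINT x|lborel. C * \<bar>a x\<bar>)"
    by (intro integral_mono integrable_abs i iC le)
  then show "(LINT x|lborel. \<bar>a x * b x\<bar>) \<le> C * (LINT x|lborel. \<bar>a x\<bar>)" by simp
qed

lemma integrable_squares: "integrable lborel (\<lambda>x. (g x)\<^sup>2)" "integrable lborel (\<lambda>x. (g1 x)\<^sup>2)" "integrable lborel (\<lambda>x. g x * g1 x)"
  unfolding power2_eq_square
  by (rule integrable_bounded_mult(1)[OF int0 _ L_bounds(5)], measurable)
     (rule integrable_bounded_mult(1)[OF int1 _ L_bounds(6)], measurable,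
      rule integrable_bounded_mult(1)[OF int0 _ L_bounds(6)], measurable)

text \<open>Twice the integrand is the derivative of the square of \<open>g\<close>.
  Probabilistically, value and slope of the limit process at one time are uncorrelated, which
  removes the cross term from the energy.\<close>

lemma integral_g_g1: "(LINT x|lborel. g x * g1 x) = 0"
proof -
  have "(LINT x|lborel. 2 * (g x * g1 x)) = 0"
  proof (rule integral_deriv_zero)
    show "((\<lambda>x. (g x)\<^sup>2) has_real_derivative 2 * (g x * g1 x)) (at x)" for x
      by (auto intro!: derivative_eq_intros d0)
    show "((\<lambda>x. 2 * (g x * g1 x)) has_real_derivative 2 * (g1 x * g1 x + g2 x * g x)) (at x)" for x
      by (auto intro!: derivative_eq_intros d0 d1)
    show "continuous_on UNIV (\<lambda>x. 2 * (g1 x * g1 x + g2 x * g x))" by (intro continuous_intros cont)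
    show "integrable lborel (\<lambda>x. 2 * (g1 x * g1 x + g2 x * g x))"
      using integrable_squares(2) integrable_bounded_mult(1)[OF int2 _ L_bounds(5)] by (simp add: power2_eq_square)
  qed (use integrable_squares in auto)
  then show ?thesis by simp
qed

text \<open>A vanishing moment would make \<open>g\<close> or \<open>g1\<close> vanish identically,
  together with all its derivatives, against the determinant condition at 0.\<close>

lemma moments_pos: "0 < m0" "0 < m2"
proof -
  have zero: "k x = 0" if k: "continuous_on UNIV k" and i: "integrable lborel (\<lambda>x. (k x)\<^sup>2)" and z: "(LINT s|lborel. (k s)\<^sup>2) = 0" for k :: "real \<Rightarrow> real" and x
  proof (rule ccontr)
    assume nz: "k x \<noteq> 0"
    have "AE s in lborel. (k s)\<^sup>2 = 0" using z by (subst (asm) integral_nonneg_eq_0_iff_AE[OF i]) auto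
    then have ae: "AE s in lborel. s \<notin> {s. k s \<noteq> 0}" by (auto elim!: eventually_mono)
    have op: "open {s. k s \<noteq> 0}" by (rule open_Collect_neq) (use k in \<open>auto intro: continuous_intros\<close>)
    then have "{s. k s \<noteq> 0} \<in> null_sets lborel" using ae by (subst AE_iff_null_sets) auto
    moreover have "negligible {s. k s \<noteq> 0}" using calculation by (simp add: negligible_iff_null_sets null_sets_completionI)
    ultimately show False using open_not_negligible[OF op] nz by blast
  qed
  have const0: "k' y = 0" if "\<And>x. (k has_real_derivative k' x) (at x)" "\<And>x. k x = 0" for k k' :: "real \<Rightarrow> real" and y
  proof -
    have "((\<lambda>_. 0) has_real_derivative k' y) (at y)" using that(1)[of y] that(2) by (metis (no_types, lifting) ext)
    then show ?thesis using DERIV_const DERIV_unique by blast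
  qed
  have "m2 \<noteq> 0"
  proof
    assume "m2 = 0"
    then have z1: "g1 x = 0" for x using zero[OF cont(2) integrable_squares(2)] by (simp add: m2_def)
    have z2: "g2 x = 0" for x by (rule const0[OF d1 z1])
    show False using det[of 0] z1 z2 by simp
  qed
  moreover have "m0 \<noteq> 0"
  proof
    assume "m0 = 0"
    then have z0: "g x = 0" for x using zero[OF cont(1) integrable_squares(1)] by (simp add: m0_def)
    have z1: "g1 x = 0" for x by (rule const0[OF d0 z0])
    have z2: "g2 x = 0" for x by (rule const0[OF d1 z1])
    show False using det[of 0] z1 z2 by simp
  qed
  moreover have "0 \<le> m0" "0 \<le> m2" unfolding m0_def m2_def by (auto intro: integral_nonneg_AE)
  ultimately show "0 < m0" "0 < m2" by auto
qed

text \<open>The kernel of \<open>u * (Y t + \<theta> * (Y (t + h) - Y t)) + v * ((Y (t + h) - Y t) / h)\<close> when \<open>Y\<close> has kernel \<open>g\<close>.\<close>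
definition phase :: "real \<Rightarrow> real \<Rightarrow> real \<Rightarrow> real \<Rightarrow> real \<Rightarrow> real \<Rightarrow> real" where
  "phase t h \<theta> u v s = (u * (1 - \<theta>) - v / h) * g (t - s) + (u * \<theta> + v / h) * g (t + h - s)"

lemma phase_measurable [measurable]: "phase t h \<theta> u v \<in> borel_measurable borel"
  unfolding phase_def[abs_def] by measurable

lemma phase_alt: "phase t h \<theta> u v s = u * g (t - s) + (v + u * \<theta> * h) * ((g (t - s + h) - g (t - s)) / h)" if "h \<noteq> 0"
proof -
  have "t + h - s = t - s + h" by simp
  then show ?thesis unfolding phase_def using that by (simp add: field_simps)
qed

lemma phase_integrable: "integrable lborel (phase t h \<theta> u v)" "(LINT s|lborel. phase t h \<theta> u v s) = u * (LINT s|lborel. g s)"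
  unfolding phase_def[abs_def] using integrable_reflect[OF int0] by (auto simp: algebra_simps)

text \<open>The apparent singularity in \<open>h\<close> cancels: the phase is \<open>u\<close>
  times a convex combination of two values of \<open>g\<close> plus \<open>v\<close> times a
  difference quotient, and the latter is bounded by \<open>L\<close> pointwise and in L1.\<close>

lemma phase_bounds:
  assumes h: "0 < h" and \<theta>: "0 \<le> \<theta>" "\<theta> \<le> 1"
  shows "\<bar>phase t h \<theta> u v s\<bar> \<le> (\<bar>u\<bar> + \<bar>v\<bar>) * L"
    and "(LINT s|lborel. \<bar>phase t h \<theta> u v s\<bar>) \<le> (\<bar>u\<bar> + \<bar>v\<bar>) * L"
proof -
  have split: "phase t h \<theta> u v s = u * ((1 - \<theta>) * g (t - s) + \<theta> * g (t + h - s)) + v * ((g (t - s + h) - g (t - s)) / h)" for s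
  proof -
    have "t + h - s = t - s + h" by simp
    then show ?thesis unfolding phase_def using h by (simp add: field_simps)
  qed
  have q: "\<bar>(g (x + h) - g x) / h\<bar> \<le> L" for x
  proof -
    have "\<exists>z>x. z < x + h \<and> g (x + h) - g x = (x + h - x) * g1 z" by (rule MVT2) (use h d0 in auto)
    then obtain z where "g (x + h) - g x = h * g1 z" by auto
    then show ?thesis using h L_bounds(6)[of z] by simp
  qed
  have conv: "\<bar>(1 - \<theta>) * a + \<theta> * b\<bar> \<le> (1 - \<theta>) * \<bar>a\<bar> + \<theta> * \<bar>b\<bar>" for a b
    using \<theta> abs_triangle_ineq[of "(1 - \<theta>) * a" "\<theta> * b"] by (simp add: abs_mult)
  have pt: "\<bar>phase t h \<theta> u v s\<bar> \<le> \<bar>u\<bar> * ((1 - \<theta>) * \<bar>g (t - s)\<bar> + \<theta> * \<bar>g (t + h - s)\<bar>) + \<bar>v\<bar> * \<bar>(g (t - s + h) - g (t - s)) / h\<bar>" for s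
    unfolding split
    by (rule order_trans[OF abs_triangle_ineq], unfold abs_mult[of u] abs_mult[of v]) (intro add_mono mult_left_mono conv order_refl; simp)
  show "\<bar>phase t h \<theta> u v s\<bar> \<le> (\<bar>u\<bar> + \<bar>v\<bar>) * L"
  proof -
    have "(1 - \<theta>) * \<bar>g (t - s)\<bar> + \<theta> * \<bar>g (t + h - s)\<bar> \<le> (1 - \<theta>) * L + \<theta> * L"
      using \<theta> by (intro add_mono mult_left_mono L_bounds) auto
    also have "\<dots> = L" by (simp add: algebra_simps)
    finally have "\<bar>u\<bar> * ((1 - \<theta>) * \<bar>g (t - s)\<bar> + \<theta> * \<bar>g (t + h - s)\<bar>) + \<bar>v\<bar> * \<bar>(g (t - s + h) - g (t - s)) / h\<bar> \<le> \<bar>u\<bar> * L + \<bar>v\<bar> * L"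
      by (intro add_mono mult_left_mono q) auto
    then show ?thesis using pt[of s] by (simp add: algebra_simps)
  qed
  have i0: "integrable lborel (\<lambda>s. \<bar>g (c - s)\<bar>)" "(LINT s|lborel. \<bar>g (c - s)\<bar>) \<le> L" for c
    using integrable_reflect[OF integrable_abs[OF int0], of c] L_bounds(1) by auto
  have iq: "integrable lborel (\<lambda>x. (g (x + h) - g x) / h)" using integrable_shift[OF int0] int0 by simp
  have q1: "(LINT x|lborel. \<bar>(g (x + h) - g x) / h\<bar>) \<le> L"
  proof -
    have "(LINT x|lborel. \<bar>(g (x + h) - g x) / h\<bar>) = (LINT x|lborel. \<bar>g (x + h) - g x\<bar>) / h" using h by (simp add: abs_divide)
    also have "\<dots> \<le> (LINT x|lborel. \<bar>g1 x\<bar>)"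
      using L1_increment[OF d0 cont(2) int1, of h] h by (simp add: pos_divide_le_eq mult.commute)
    finally show ?thesis using L_bounds(2) by simp
  qed
  have i1: "integrable lborel (\<lambda>s. \<bar>(g (t - s + h) - g (t - s)) / h\<bar>)" "(LINT s|lborel. \<bar>(g (t - s + h) - g (t - s)) / h\<bar>) \<le> L"
    using integrable_reflect[OF integrable_abs[OF iq], of t] q1 by auto
  have "(LINT s|lborel. \<bar>phase t h \<theta> u v s\<bar>) \<le> (LINT s|lborel. \<bar>u\<bar> * ((1 - \<theta>) * \<bar>g (t - s)\<bar> + \<theta> * \<bar>g (t + h - s)\<bar>) + \<bar>v\<bar> * \<bar>(g (t - s + h) - g (t - s)) / h\<bar>)"
    by (intro integral_mono integrable_abs phase_integrable pt Bochner_Integration.integrable_add integrable_mult_right i0 i1)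
  also have "\<dots> = \<bar>u\<bar> * ((1 - \<theta>) * (LINT s|lborel. \<bar>g (t - s)\<bar>) + \<theta> * (LINT s|lborel. \<bar>g (t + h - s)\<bar>)) + \<bar>v\<bar> * (LINT s|lborel. \<bar>(g (t - s + h) - g (t - s)) / h\<bar>)"
    using i0(1)[of t] i0(1)[of "t + h"] i1(1)
    by (simp del: abs_divide)
  also have "\<dots> \<le> \<bar>u\<bar> * ((1 - \<theta>) * L + \<theta> * L) + \<bar>v\<bar> * L"
    using \<theta> by (intro add_mono mult_left_mono i0 i1) auto
  also have "\<dots> = (\<bar>u\<bar> + \<bar>v\<bar>) * L" by (simp add: algebra_simps)
  finally show "(LINT s|lborel. \<bar>phase t h \<theta> u v s\<bar>) \<le> (\<bar>u\<bar> + \<bar>v\<bar>) * L" .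
qed

lemma phase_powers:
  assumes h: "0 < h" and \<theta>: "0 \<le> \<theta>" "\<theta> \<le> 1"
  shows "integrable lborel (\<lambda>s. (phase t h \<theta> u v s)\<^sup>2)" "(LINT s|lborel. (phase t h \<theta> u v s)\<^sup>2) \<le> ((\<bar>u\<bar> + \<bar>v\<bar>) * L)\<^sup>2"
    and "integrable lborel (\<lambda>s. \<bar>phase t h \<theta> u v s\<bar> ^ 3)" "(LINT s|lborel. \<bar>phase t h \<theta> u v s\<bar> ^ 3) \<le> ((\<bar>u\<bar> + \<bar>v\<bar>) * L) ^ 3"
proof -
  let ?f = "phase t h \<theta> u v" and ?C = "(\<bar>u\<bar> + \<bar>v\<bar>) * L"
  note b = phase_bounds[OF h \<theta>]
  have C: "0 \<le> ?C" using L_bounds(4) by simp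
  note sq = integrable_bounded_mult[OF phase_integrable(1)[of t h \<theta> u v] phase_measurable b(1)]
  show i2: "integrable lborel (\<lambda>s. (?f s)\<^sup>2)" using sq(1) by (simp add: power2_eq_square)
  have "(LINT s|lborel. (?f s)\<^sup>2) = (LINT s|lborel. \<bar>?f s * ?f s\<bar>)" by (simp add: power2_eq_square)
  also have "\<dots> \<le> ?C * (LINT s|lborel. \<bar>?f s\<bar>)" by (rule sq(2))
  also have "\<dots> \<le> ?C * ?C" by (rule mult_left_mono[OF b(2) C])
  finally show le2: "(LINT s|lborel. (?f s)\<^sup>2) \<le> ?C\<^sup>2" by (simp add: power2_eq_square)
  have eq3: "\<bar>?f s\<bar> ^ 3 = (?f s)\<^sup>2 * \<bar>?f s\<bar>" for s by (simp add: power3_eq_cube power2_eq_square flip: abs_mult)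
  have b': "\<bar>\<bar>?f s\<bar>\<bar> \<le> ?C" for s using b(1) by simp
  have am: "(\<lambda>s. \<bar>?f s\<bar>) \<in> borel_measurable borel" by measurable
  note cu = integrable_bounded_mult[OF i2 am b']
  show "integrable lborel (\<lambda>s. \<bar>?f s\<bar> ^ 3)" unfolding eq3 by (rule cu(1))
  have "(LINT s|lborel. \<bar>?f s\<bar> ^ 3) = (LINT s|lborel. \<bar>(?f s)\<^sup>2 * \<bar>?f s\<bar>\<bar>)" unfolding eq3 by (simp add: abs_mult)
  also have "\<dots> \<le> ?C * (LINT s|lborel. \<bar>(?f s)\<^sup>2\<bar>)" by (rule cu(2))
  also have "\<dots> \<le> ?C * ?C\<^sup>2" using mult_left_mono[OF le2 C] by simp
  finally show "(LINT s|lborel. \<bar>?f s\<bar> ^ 3) \<le> ?C ^ 3" by (simp add: power3_eq_cube power2_eq_square)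
qed

text \<open>The function \<open>f0\<close> is the limit of the phase as \<open>h\<close> tends to 0,
  and its energy is exactly the Gaussian quadratic form. The difference of squares factors into a
  sum, bounded uniformly, and a difference, of order \<open>h\<close> in L1.\<close>

lemma phase_energy:
  assumes h: "0 < h" and \<theta>: "0 \<le> \<theta>" "\<theta> \<le> 1"
  shows "\<bar>(LINT s|lborel. (phase t h \<theta> u v s)\<^sup>2) - (m0 * u\<^sup>2 + m2 * v\<^sup>2)\<bar> \<le> 2 * L\<^sup>2 * h * (\<bar>u\<bar> + \<bar>v\<bar>)\<^sup>2"
proof -
  let ?f = "phase t h \<theta> u v"
  define f0 where "f0 s = u * g (t - s) + v * g1 (t - s)" for s
  have [measurable]: "f0 \<in> borel_measurable borel" unfolding f0_def[abs_def] by measurable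
  have f0b: "\<bar>f0 s\<bar> \<le> (\<bar>u\<bar> + \<bar>v\<bar>) * L" for s
  proof -
    have "\<bar>f0 s\<bar> \<le> \<bar>u\<bar> * \<bar>g (t - s)\<bar> + \<bar>v\<bar> * \<bar>g1 (t - s)\<bar>"
      unfolding f0_def using abs_triangle_ineq[of "u * g (t - s)" "v * g1 (t - s)"] by (simp add: abs_mult)
    also have "\<dots> \<le> \<bar>u\<bar> * L + \<bar>v\<bar> * L" by (intro add_mono mult_left_mono L_bounds) auto
    finally show ?thesis by (simp add: algebra_simps)
  qed
  have f0i: "integrable lborel f0" unfolding f0_def[abs_def] using integrable_reflect[OF int0] integrable_reflect[OF int1] by simp
  have f0sq: "(LINT s|lborel. (f0 s)\<^sup>2) = m0 * u\<^sup>2 + m2 * v\<^sup>2" and f0sqi: "integrable lborel (\<lambda>s. (f0 s)\<^sup>2)"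
  proof -
    have eq: "(u * g x + v * g1 x)\<^sup>2 = u\<^sup>2 * (g x)\<^sup>2 + (2 * u * v) * (g x * g1 x) + v\<^sup>2 * (g1 x)\<^sup>2" for x
      by (simp add: power2_eq_square algebra_simps)
    have i: "integrable lborel (\<lambda>x. (u * g x + v * g1 x)\<^sup>2)" unfolding eq using integrable_squares by simp
    have "(LINT x|lborel. (u * g x + v * g1 x)\<^sup>2) = m0 * u\<^sup>2 + m2 * v\<^sup>2"
      unfolding eq using integrable_squares integral_g_g1 by (simp add: m0_def m2_def mult.commute)
    then show "(LINT s|lborel. (f0 s)\<^sup>2) = m0 * u\<^sup>2 + m2 * v\<^sup>2" "integrable lborel (\<lambda>s. (f0 s)\<^sup>2)"
      using integrable_reflect[OF i, of t] by (auto simp: f0_def)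
  qed
  have diff: "?f s - f0 s = u * \<theta> * (g (t - s + h) - g (t - s)) + v * ((g (t - s + h) - g (t - s)) / h - g1 (t - s))" for s
  proof -
    have "t + h - s = t - s + h" by simp
    then show ?thesis unfolding phase_def f0_def using h by (simp add: field_simps)
  qed
  have ia: "integrable lborel (\<lambda>x. g (x + h) - g x)" using integrable_shift[OF int0] int0 by simp
  have a: "(LINT x|lborel. \<bar>g (x + h) - g x\<bar>) \<le> h * L"
    using L1_increment[OF d0 cont(2) int1, of h] h mult_left_mono[OF L_bounds(2), of h] by linarith
  note ib = L1_difference_quotient(1)[OF d0 d1 cont(3) int2 h]
  have b: "(LINT x|lborel. \<bar>(g (x + h) - g x) / h - g1 x\<bar>) \<le> h * L"
    using L1_difference_quotient(2)[OF d0 d1 cont(3) int2 h] h mult_left_mono[OF L_bounds(3), of h] by linarith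
  have d1': "(LINT s|lborel. \<bar>?f s - f0 s\<bar>) \<le> (\<bar>u\<bar> + \<bar>v\<bar>) * (h * L)"
  proof -
    let ?a = "\<lambda>s. \<bar>g (t - s + h) - g (t - s)\<bar>" and ?b = "\<lambda>s. \<bar>(g (t - s + h) - g (t - s)) / h - g1 (t - s)\<bar>"
    have ia': "integrable lborel ?a" "(LINT s|lborel. ?a s) \<le> h * L" using integrable_reflect[OF integrable_abs[OF ia], of t] a by auto
    have ib': "integrable lborel ?b" "(LINT s|lborel. ?b s) \<le> h * L" using integrable_reflect[OF integrable_abs[OF ib], of t] b by auto
    have le: "\<bar>?f s - f0 s\<bar> \<le> \<bar>u\<bar> * ?a s + \<bar>v\<bar> * ?b s" for s
    proof -
      have "\<bar>?f s - f0 s\<bar> \<le> \<bar>u\<bar> * \<theta> * ?a s + \<bar>v\<bar> * ?b s"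
        unfolding diff using abs_triangle_ineq[of "u * \<theta> * (g (t - s + h) - g (t - s))" "v * ((g (t - s + h) - g (t - s)) / h - g1 (t - s))"] \<theta>
        by (simp add: abs_mult)
      also have "\<bar>u\<bar> * \<theta> * ?a s \<le> \<bar>u\<bar> * 1 * ?a s" using \<theta> by (intro mult_right_mono mult_left_mono) auto
      finally show ?thesis by simp
    qed
    have "(LINT s|lborel. \<bar>?f s - f0 s\<bar>) \<le> (LINT s|lborel. \<bar>u\<bar> * ?a s + \<bar>v\<bar> * ?b s)"
      by (intro integral_mono le integrable_abs Bochner_Integration.integrable_diff Bochner_Integration.integrable_add integrable_mult_right phase_integrable f0i ia' ib')
    also have "\<dots> = \<bar>u\<bar> * (LINT s|lborel. ?a s) + \<bar>v\<bar> * (LINT s|lborel. ?b s)"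
      using ia'(1) ib'(1) by (simp only: Bochner_Integration.integral_add integrable_mult_right integral_mult_right_zero)
    also have "\<dots> \<le> \<bar>u\<bar> * (h * L) + \<bar>v\<bar> * (h * L)" by (intro add_mono mult_left_mono ia' ib') auto
    finally show ?thesis by (simp add: algebra_simps)
  qed
  have sumb: "\<bar>?f s + f0 s\<bar> \<le> 2 * ((\<bar>u\<bar> + \<bar>v\<bar>) * L)" for s
    using phase_bounds(1)[OF h \<theta>, of t u v s] f0b[of s] by linarith
  have idf: "integrable lborel (\<lambda>s. ?f s - f0 s)" by (intro Bochner_Integration.integrable_diff phase_integrable f0i)
  have "(LINT s|lborel. (?f s)\<^sup>2) - (m0 * u\<^sup>2 + m2 * v\<^sup>2) = (LINT s|lborel. (?f s - f0 s) * (?f s + f0 s))"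
    unfolding f0sq[symmetric]
    by (subst Bochner_Integration.integral_diff[symmetric]) (use phase_powers(1)[OF h \<theta>, of t u v] f0sqi in \<open>auto simp: power2_eq_square algebra_simps\<close>)
  then have "\<bar>(LINT s|lborel. (?f s)\<^sup>2) - (m0 * u\<^sup>2 + m2 * v\<^sup>2)\<bar> \<le> (LINT s|lborel. \<bar>(?f s - f0 s) * (?f s + f0 s)\<bar>)"
    using integral_abs_bound by metis
  also have "\<dots> \<le> 2 * ((\<bar>u\<bar> + \<bar>v\<bar>) * L) * (LINT s|lborel. \<bar>?f s - f0 s\<bar>)"
    by (rule integrable_bounded_mult(2)[OF idf _ sumb]) measurable
  also have "\<dots> \<le> 2 * ((\<bar>u\<bar> + \<bar>v\<bar>) * L) * ((\<bar>u\<bar> + \<bar>v\<bar>) * (h * L))"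
    using L_bounds(4) by (intro mult_left_mono d1') auto
  also have "\<dots> \<le> 2 * L\<^sup>2 * h * (\<bar>u\<bar> + \<bar>v\<bar>)\<^sup>2"
    using h by (simp add: power2_eq_square mult_ac)
  finally show ?thesis .
qed

section \<open>Decay of the window integral\<close>

lemma kernel_bounds:
  obtains C d where "0 < C" "0 < d"
    "\<And>s. s \<in> {-1..2} \<Longrightarrow> \<bar>g1 s\<bar> \<le> C \<and> \<bar>g2 s\<bar> \<le> C \<and> \<bar>g3 s\<bar> \<le> C \<and> \<bar>g4 s\<bar> \<le> C"
    "\<And>s. s \<in> {-1..2} \<Longrightarrow> d \<le> \<bar>g1 s * g3 s - (g2 s)\<^sup>2\<bar>"
proof -
  have cont': "continuous_on {-1..2} k" if "continuous_on UNIV k" for k :: "real \<Rightarrow> real" using that continuous_on_subset by blast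
  have "continuous_on {-1..2} (\<lambda>s. \<bar>g1 s\<bar> + \<bar>g2 s\<bar> + \<bar>g3 s\<bar> + \<bar>g4 s\<bar>)"
    by (intro continuous_intros cont' cont c4)
  then obtain x where x: "\<forall>s\<in>{-1..2}. \<bar>g1 s\<bar> + \<bar>g2 s\<bar> + \<bar>g3 s\<bar> + \<bar>g4 s\<bar> \<le> \<bar>g1 x\<bar> + \<bar>g2 x\<bar> + \<bar>g3 x\<bar> + \<bar>g4 x\<bar>"
    using continuous_attains_sup[of "{-1..2::real}" "\<lambda>s. \<bar>g1 s\<bar> + \<bar>g2 s\<bar> + \<bar>g3 s\<bar> + \<bar>g4 s\<bar>"] by auto
  have "continuous_on {-1..2} (\<lambda>s. \<bar>g1 s * g3 s - (g2 s)\<^sup>2\<bar>)"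
    by (intro continuous_intros cont' cont c4)
  then obtain y where y: "y \<in> {-1..2}" "\<forall>s\<in>{-1..2}. \<bar>g1 y * g3 y - (g2 y)\<^sup>2\<bar> \<le> \<bar>g1 s * g3 s - (g2 s)\<^sup>2\<bar>"
    using continuous_attains_inf[of "{-1..2::real}" "\<lambda>s. \<bar>g1 s * g3 s - (g2 s)\<^sup>2\<bar>"] by auto
  show ?thesis
  proof (rule that)
    show "0 < 1 + (\<bar>g1 x\<bar> + \<bar>g2 x\<bar> + \<bar>g3 x\<bar> + \<bar>g4 x\<bar>)" by simp
    show "0 < \<bar>g1 y * g3 y - (g2 y)\<^sup>2\<bar>" using det[OF y(1)] by simp
    show "\<bar>g1 s\<bar> \<le> 1 + (\<bar>g1 x\<bar> + \<bar>g2 x\<bar> + \<bar>g3 x\<bar> + \<bar>g4 x\<bar>) \<and> \<bar>g2 s\<bar> \<le> 1 + (\<bar>g1 x\<bar> + \<bar>g2 x\<bar> + \<bar>g3 x\<bar> + \<bar>g4 x\<bar>)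
       \<and> \<bar>g3 s\<bar> \<le> 1 + (\<bar>g1 x\<bar> + \<bar>g2 x\<bar> + \<bar>g3 x\<bar> + \<bar>g4 x\<bar>) \<and> \<bar>g4 s\<bar> \<le> 1 + (\<bar>g1 x\<bar> + \<bar>g2 x\<bar> + \<bar>g3 x\<bar> + \<bar>g4 x\<bar>)" if "s \<in> {-1..2}" for s
    proof -
      have *: "a \<le> 1 + m \<and> b \<le> 1 + m \<and> c \<le> 1 + m \<and> d \<le> 1 + m"
        if "a + b + c + d \<le> m" "0 \<le> a" "0 \<le> b" "0 \<le> c" "0 \<le> d" for a b c d m :: real
        using that by linarith
      show ?thesis by (rule *[OF x[rule_format, OF that]]) simp_all
    qed
  qed (use y in auto)
qed

text \<open>As a function of x = t - s the phase is \<open>u * g x\<close> plus \<open>w\<close>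
  times a difference quotient of \<open>g\<close>. For small \<open>h\<close> its first two
  derivatives are close to \<open>w1\<close> and \<open>w2\<close>, the image of
  \<open>(u, w)\<close> under \<open>Phi g x\<close>. Invertibility, uniform by compactness, keeps
  them from being small together, so \<open>oscillatory_decay\<close> applies with frequency
  \<open>\<bar>u\<bar> + \<bar>w\<bar>\<close>.\<close>

lemma window_decay:
  "\<exists>c'>0. \<exists>h0>0. h0 \<le> 1 \<and> (\<forall>t h \<theta> u v. 0 \<le> t \<longrightarrow> 0 < h \<longrightarrow> h \<le> h0 \<longrightarrow> t + h \<le> 1 \<longrightarrow>
     (norm (CLINT s|lborel. indicator {-1..1} s *\<^sub>R cis (phase t h \<theta> u v s)) / 2) ^ 16 * (1 + c' * u\<^sup>2) \<le> 1)"
proof -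
  obtain C d where C: "0 < C" and d: "0 < d"
    and gC: "\<And>s. s \<in> {-1..2} \<Longrightarrow> \<bar>g1 s\<bar> \<le> C \<and> \<bar>g2 s\<bar> \<le> C \<and> \<bar>g3 s\<bar> \<le> C \<and> \<bar>g4 s\<bar> \<le> C"
    and gd: "\<And>s. s \<in> {-1..2} \<Longrightarrow> d \<le> \<bar>g1 s * g3 s - (g2 s)\<^sup>2\<bar>" by (rule kernel_bounds) (rule that)
  \<comment> \<open>Cramer's rule gives
    \<open>2 * c * \<rho> \<le> \<bar>w1\<bar> + \<bar>w2\<bar>\<close> with this \<open>c\<close>.
    The choice of \<open>h0\<close> below makes \<open>C * h \<le> c / 2\<close>, so that replacing
    derivatives by difference quotients costs \<open>c * \<rho> / 2\<close> in each component and
    leaves \<open>c * \<rho>\<close>.\<close>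
  define c where "c = d / (4 * C)"
  define h0 where "h0 = min 1 (d / (8 * C\<^sup>2))"
  have c: "0 < c" using C d by (simp add: c_def)
  have h0: "0 < h0" "h0 \<le> 1" "h0 \<le> d / (8 * C\<^sup>2)" using C d by (auto simp: h0_def)
  obtain c' where c': "0 < c'" and osc: "\<And>F F' F'' a \<rho>. 0 \<le> \<rho> \<Longrightarrow> oscillating_phase c C a \<rho> F F' F'' \<Longrightarrow>
     (norm (integral {a..a+2} (\<lambda>x. cis (F x))) / 2) ^ 16 * (1 + c' * \<rho>\<^sup>2) \<le> 1"
    using oscillatory_decay[OF c C] by blast
  have "(norm (CLINT s|lborel. indicator {-1..1} s *\<^sub>R cis (phase t h \<theta> u v s)) / 2) ^ 16 * (1 + c' * u\<^sup>2) \<le> 1"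
    if t: "0 \<le> t" and h: "0 < h" "h \<le> h0" "t + h \<le> 1" for t h \<theta> u v
  proof -
    \<comment> \<open>The interpolation parameter \<theta> is absorbed into the slope frequency,
      which makes the estimate uniform in it.\<close>
    define w where "w = v + u * \<theta> * h"
    define \<rho> where "\<rho> = \<bar>u\<bar> + \<bar>w\<bar>"
    define F where "F x = u * g x + w * ((g (x + h) - g x) / h)" for x
    define F' where "F' x = u * g1 x + w * ((g1 (x + h) - g1 x) / h)" for x
    define F'' where "F'' x = u * g2 x + w * ((g2 (x + h) - g2 x) / h)" for x
    have \<rho>: "0 \<le> \<rho>" "\<bar>u\<bar> \<le> \<rho>" "\<bar>w\<bar> \<le> \<rho>" by (auto simp: \<rho>_def)
    have shift: "((\<lambda>x. k (x + h)) has_real_derivative k' (x + h)) (at x)" if "\<And>x. (k has_real_derivative k' x) (at x)" for k k' x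
      using that[of "x + h"] by (simp only: DERIV_shift)
    have quot: "((\<lambda>x. u * k x + w * ((k (x + h) - k x) / h)) has_real_derivative u * k' x + w * ((k' (x + h) - k' x) / h)) (at x)"
      if "\<And>x. (k has_real_derivative k' x) (at x)" for k k' x
      using that shift[of k k', OF that] h by (auto intro!: derivative_eq_intros)
    have mv: "\<exists>z\<in>{x..x + h}. (k (x + h) - k x) / h = k' z" if "\<And>x. (k has_real_derivative k' x) (at x)" for k k' x
    proof -
      have "\<exists>z>x. z < x + h \<and> k (x + h) - k x = (x + h - x) * k' z" by (rule MVT2) (use h that in auto)
      then obtain z where "x < z" "z < x + h" "k (x + h) - k x = h * k' z" by auto
      then show ?thesis using h by (intro bexI[of _ z]) auto
    qed
    have lip: "\<bar>k x - k y\<bar> \<le> C * \<bar>x - y\<bar>" if "\<And>x. (k has_real_derivative k' x) (at x)" "\<And>s. s \<in> {-1..2} \<Longrightarrow> \<bar>k' s\<bar> \<le> C" "x \<in> {-1..2}" "y \<in> {-1..2}" for k k' x y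
      using field_differentiable_bound[of "{-1..2}" k k' C x y] that by (auto intro: has_field_derivative_at_within)
    have bd: "\<bar>u * a + w * b\<bar> \<le> C * \<rho>" if "\<bar>a\<bar> \<le> C" "\<bar>b\<bar> \<le> C" for a b
    proof -
      have "\<bar>u * a + w * b\<bar> \<le> \<bar>u\<bar> * \<bar>a\<bar> + \<bar>w\<bar> * \<bar>b\<bar>" using abs_triangle_ineq[of "u * a" "w * b"] by (simp add: abs_mult)
      also have "\<dots> \<le> \<bar>u\<bar> * C + \<bar>w\<bar> * C" using that by (intro add_mono mult_left_mono) auto
      finally show ?thesis by (simp add: \<rho>_def algebra_simps)
    qed
    have "oscillating_phase c C (t - 1) \<rho> F F' F''"
      unfolding oscillating_phase_def
    proof (intro ballI conjI)
      fix x assume x: "x \<in> {t - 1..t - 1 + 2}"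
      have in1: "x \<in> {-1..2}" "x + h \<in> {-1..2}" "\<And>z. z \<in> {x..x + h} \<Longrightarrow> z \<in> {-1..2}" using x t h by auto
      show "(F has_real_derivative F' x) (at x)" unfolding F_def F'_def by (rule quot[OF d0])
      show "(F' has_real_derivative F'' x) (at x)" unfolding F''_def F'_def by (rule quot[OF d1])
      obtain z1 where z1: "z1 \<in> {x..x + h}" "(g1 (x + h) - g1 x) / h = g2 z1" using mv[OF d1] by blast
      obtain z2 where z2: "z2 \<in> {x..x + h}" "(g2 (x + h) - g2 x) / h = g3 z2" using mv[OF d2] by blast
      have F'e: "F' x = u * g1 x + w * g2 z1" and F''e: "F'' x = u * g2 x + w * g3 z2" using z1 z2 by (simp_all add: F'_def F''_def)
      show "\<bar>F' x\<bar> \<le> C * \<rho>" unfolding F'e using gC[OF in1(1)] gC[OF in1(3)[OF z1(1)]] by (intro bd) auto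
      show "\<bar>F'' x\<bar> \<le> C * \<rho>" unfolding F''e using gC[OF in1(1)] gC[OF in1(3)[OF z2(1)]] by (intro bd) auto
      show "\<bar>F'' x - F'' y\<bar> \<le> C * \<rho> * \<bar>x - y\<bar>" if y: "y \<in> {t - 1..t - 1 + 2}" for y
      proof -
        have "\<bar>F'' x - F'' y\<bar> \<le> C * \<rho> * norm (x - y)"
          unfolding real_norm_def[symmetric]
        proof (rule field_differentiable_bound[of "{t - 1..t - 1 + 2}"])
          fix z assume z: "z \<in> {t - 1..t - 1 + 2}"
          show "(F'' has_field_derivative u * g3 z + w * ((g3 (z + h) - g3 z) / h)) (at z within {t - 1..t - 1 + 2})"
            unfolding F''_def by (rule has_field_derivative_at_within[OF quot[OF d2]])
          obtain z3 where z3: "z3 \<in> {z..z + h}" "(g3 (z + h) - g3 z) / h = g4 z3" using mv[OF d3] by blast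
          have "z \<in> {-1..2}" "z3 \<in> {-1..2}" using z z3(1) t h by auto
          then show "norm (u * g3 z + w * ((g3 (z + h) - g3 z) / h)) \<le> C * \<rho>"
            unfolding z3(2) real_norm_def using gC by (intro bd) auto
        qed (use x y in auto)
        then show ?thesis by simp
      qed
      define w1 w2 where "w1 = u * g1 x + w * g2 x" and "w2 = u * g2 x + w * g3 x"
      let ?det = "g1 x * g3 x - (g2 x)\<^sup>2"
      \<comment> \<open>Cramer's rule for the system with matrix \<open>Phi g x\<close>.\<close>
      have "u * ?det = g3 x * w1 - g2 x * w2" "w * ?det = g1 x * w2 - g2 x * w1"
        by (simp_all add: w1_def w2_def algebra_simps power2_eq_square)
      then have "\<bar>u\<bar> * \<bar>?det\<bar> \<le> C * (\<bar>w1\<bar> + \<bar>w2\<bar>)" "\<bar>w\<bar> * \<bar>?det\<bar> \<le> C * (\<bar>w1\<bar> + \<bar>w2\<bar>)"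
      proof -
        have *: "\<bar>a * p - b * q\<bar> \<le> C * (\<bar>p\<bar> + \<bar>q\<bar>)" if "\<bar>a\<bar> \<le> C" "\<bar>b\<bar> \<le> C" for a b p q :: real
        proof -
          have "\<bar>a * p - b * q\<bar> \<le> \<bar>a\<bar> * \<bar>p\<bar> + \<bar>b\<bar> * \<bar>q\<bar>" using abs_triangle_ineq4[of "a * p" "b * q"] by (simp add: abs_mult)
          also have "\<dots> \<le> C * \<bar>p\<bar> + C * \<bar>q\<bar>" using that by (intro add_mono mult_right_mono) auto
          finally show ?thesis by (simp add: algebra_simps)
        qed
        assume e: "u * ?det = g3 x * w1 - g2 x * w2" "w * ?det = g1 x * w2 - g2 x * w1"
        show "\<bar>u\<bar> * \<bar>?det\<bar> \<le> C * (\<bar>w1\<bar> + \<bar>w2\<bar>)" unfolding abs_mult[symmetric] e using gC[OF in1(1)] by (intro *) auto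
        show "\<bar>w\<bar> * \<bar>?det\<bar> \<le> C * (\<bar>w1\<bar> + \<bar>w2\<bar>)" unfolding abs_mult[symmetric] e using gC[OF in1(1)] *[of "g1 x" "g2 x" w2 w1] by (simp add: add.commute)
      qed
      then have "\<rho> * \<bar>?det\<bar> \<le> 2 * C * (\<bar>w1\<bar> + \<bar>w2\<bar>)" by (simp add: \<rho>_def algebra_simps)
      moreover have "\<rho> * d \<le> \<rho> * \<bar>?det\<bar>" using gd[OF in1(1)] \<rho> by (intro mult_left_mono) auto
      ultimately have "\<rho> * d \<le> 2 * C * (\<bar>w1\<bar> + \<bar>w2\<bar>)" by linarith
      then have lower: "2 * c * \<rho> \<le> \<bar>w1\<bar> + \<bar>w2\<bar>" using C by (simp add: c_def field_simps)
      have e1: "\<bar>F' x - w1\<bar> \<le> \<rho> * (C * h)"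
      proof -
        have "\<bar>F' x - w1\<bar> = \<bar>w\<bar> * \<bar>g2 z1 - g2 x\<bar>" unfolding F'e w1_def by (simp add: abs_mult flip: right_diff_distrib)
        also have "\<dots> \<le> \<rho> * (C * \<bar>z1 - x\<bar>)" using gC \<rho> in1 z1 by (intro mult_mono lip[OF d2]) auto
        also have "\<dots> \<le> \<rho> * (C * h)" using z1(1) \<rho> C by (intro mult_left_mono) auto
        finally show ?thesis .
      qed
      have e2: "\<bar>F'' x - w2\<bar> \<le> \<rho> * (C * h)"
      proof -
        have "\<bar>F'' x - w2\<bar> = \<bar>w\<bar> * \<bar>g3 z2 - g3 x\<bar>" unfolding F''e w2_def by (simp add: abs_mult flip: right_diff_distrib)
        also have "\<dots> \<le> \<rho> * (C * \<bar>z2 - x\<bar>)" using gC \<rho> in1 z2 by (intro mult_mono lip[OF d3]) auto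
        also have "\<dots> \<le> \<rho> * (C * h)" using z2(1) \<rho> C by (intro mult_left_mono) auto
        finally show ?thesis .
      qed
      have "C * h \<le> C * (d / (8 * C\<^sup>2))" using h h0 C by (intro mult_left_mono) auto
      also have "\<dots> = c / 2" using C by (simp add: c_def power2_eq_square)
      finally have "\<rho> * (C * h) \<le> \<rho> * (c / 2)" using \<rho> by (intro mult_left_mono) auto
      then show "c * \<rho> \<le> \<bar>F' x\<bar> + \<bar>F'' x\<bar>" using lower e1 e2 by (simp add: mult.commute)
    qed
    moreover have "t - 1 + 2 = t + 1" by simp
    ultimately have decay: "(norm (integral {t - 1..t + 1} (\<lambda>x. cis (F x))) / 2) ^ 16 * (1 + c' * \<rho>\<^sup>2) \<le> 1"
      using osc[OF \<rho>(1), of "t - 1" F F' F''] by metis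
    have "(CLINT s|lborel. indicator {-1..1} s *\<^sub>R cis (phase t h \<theta> u v s)) = (CLINT s|lborel. indicator {t - 1..t + 1} (t + (-1) * s) *\<^sub>R cis (F (t + (-1) * s)))"
      using h by (intro Bochner_Integration.integral_cong) (auto simp: indicator_def phase_alt F_def w_def)
    also have "\<dots> = (CLINT x|lborel. indicator {t - 1..t + 1} x *\<^sub>R cis (F x))"
      using lborel_integral_real_affine[of "-1" "\<lambda>x. indicator {t - 1..t + 1} x *\<^sub>R cis (F x)" t] by simp
    also have "\<dots> = integral {t - 1..t + 1} (\<lambda>x. cis (F x))"
    proof -
      have cF: "continuous_on {t - 1..t + 1} (\<lambda>x. cis (F x))"
      proof (intro continuous_intros)
        show "continuous_on {t - 1..t + 1} F"
          unfolding F_def using cont(1) h(1) by (intro continuous_intros continuous_on_compose2[OF cont(1)]) auto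
      qed
      show ?thesis
        using set_borel_integral_eq_integral(2)[OF borel_integrable_atLeastAtMost'[OF cF]] by (simp add: set_lebesgue_integral_def)
    qed
    finally have eq: "(CLINT s|lborel. indicator {-1..1} s *\<^sub>R cis (phase t h \<theta> u v s)) = integral {t - 1..t + 1} (\<lambda>x. cis (F x))" .
    have "u\<^sup>2 \<le> \<rho>\<^sup>2" using \<rho> abs_le_square_iff[of u \<rho>] by simp
    then have "(norm (integral {t - 1..t + 1} (\<lambda>x. cis (F x))) / 2) ^ 16 * (1 + c' * u\<^sup>2)
        \<le> (norm (integral {t - 1..t + 1} (\<lambda>x. cis (F x))) / 2) ^ 16 * (1 + c' * \<rho>\<^sup>2)"
      using c' by (intro mult_left_mono add_left_mono) auto
    then show ?thesis unfolding eq using decay by linarith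
  qed
  then show ?thesis using c' h0 by (intro exI[of _ c'] conjI exI[of _ h0]) auto
qed

end

section \<open>Mean crossings of the limit process and of the shot noise\<close>

context poisson_points
begin

lemma shot_noise_eq_point_sum: "shot_noise f \<tau> t \<omega> = point_sum (\<lambda>s. f (t - s)) \<omega>"
  unfolding shot_noise_def point_sum_def by (rule infsum_eq_integral_count_space)

text \<open>The moving integral \<open>W\<close> dominates \<open>f (t - s)\<close> for all
  \<open>t\<close> in the unit interval simultaneously and is integrable. Its sum over the points is
  therefore almost surely finite, and dominated convergence for the counting measure gives
  continuity of the path outside one null set.\<close>

lemma AE_continuous_shot_noise:
  assumes f: "\<And>x. (f has_real_derivative f' x) (at x)" and f': "continuous_on UNIV f'"
    and int: "integrable lborel f" "integrable lborel f'"
  shows "AE \<omega> in M. continuous_on {0..1} (\<lambda>t. shot_noise f \<tau> t \<omega>)"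
proof -
  have cf: "continuous_on UNIV f" by (rule continuous_on_UNIV_deriv[OF f])
  have [measurable]: "f \<in> borel_measurable borel" "f' \<in> borel_measurable borel"
    using cf f' by (auto intro: borel_measurable_continuous_onI)
  define k where "k r = \<bar>f r\<bar> + \<bar>f' r\<bar>" for r
  define W where "W x = (LINT r|lborel. indicator {x..x + 1} r * \<bar>k r\<bar>)" for x
  have [measurable]: "k \<in> borel_measurable borel" unfolding k_def[abs_def] by measurable
  have k: "integrable lborel k" unfolding k_def[abs_def] using int by simp
  have "W = (\<lambda>x. LINT r|lborel. (if x \<le> r \<and> r \<le> x + 1 then 1 else 0) * \<bar>k r\<bar>)"
    unfolding W_def by (intro ext Bochner_Integration.integral_cong) (auto simp: indicator_def)
  then have [measurable]: "W \<in> borel_measurable borel" by simp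
  have W0: "0 \<le> W x" for x unfolding W_def by (rule integral_nonneg_AE) simp
  have W: "integrable lborel W"
    by (rule integral_le_window(1)[OF _ k, of _ 1]) (use W0 in \<open>auto simp: W_def\<close>)
  have fW: "\<bar>f (t - s)\<bar> \<le> W (0 - s)" if "t \<in> {0..1}" for t s
    using bounded_by_window[OF f f' int(1), of "t - s" "0 - s"] that by (simp add: W_def k_def)
  show ?thesis
    using AE_integrable_points[OF integrable_reflect(1)[OF W, of 0]]
  proof eventually_elim
    case (elim \<omega>)
    show ?case
    proof (rule continuous_on_sequentiallyI)
      fix x a assume x: "\<forall>n. x n \<in> {0..1::real}" and lim: "x \<longlonglongrightarrow> a"
      have "(\<lambda>n. point_sum (\<lambda>s. f (x n - s)) \<omega>) \<longlonglongrightarrow> point_sum (\<lambda>s. f (a - s)) \<omega>"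
        unfolding point_sum_def
      proof (rule integral_dominated_convergence[OF _ _ elim])
        show "AE i in count_space UNIV. (\<lambda>n. f (x n - \<tau> i \<omega>)) \<longlonglongrightarrow> f (a - \<tau> i \<omega>)"
        proof (rule AE_I2)
          fix i
          have "isCont f (a - \<tau> i \<omega>)" using f by (rule DERIV_isCont)
          then show "(\<lambda>n. f (x n - \<tau> i \<omega>)) \<longlonglongrightarrow> f (a - \<tau> i \<omega>)"
            by (rule isCont_tendsto_compose) (intro tendsto_intros lim)
        qed
        show "AE i in count_space UNIV. norm (f (x n - \<tau> i \<omega>)) \<le> W (0 - \<tau> i \<omega>)" for n
          using fW x by (intro AE_I2) simp
      qed auto
      then show "(\<lambda>n. shot_noise f \<tau> (x n) \<omega>) \<longlonglongrightarrow> shot_noise f \<tau> a \<omega>"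
        unfolding shot_noise_eq_point_sum .
    qed
  qed
qed

end

section \<open>Conditional expectations and Gaussian characteristic functions\<close>

lemma integral_uniform_measure:
  fixes f :: "'a \<Rightarrow> 'b::{banach, second_countable_topology}"
  assumes A: "A \<in> sets M" "emeasure M A \<noteq> 0" "emeasure M A \<noteq> \<infinity>" and [measurable]: "f \<in> borel_measurable M"
  shows "(\<integral>x. f x \<partial>uniform_measure M A) = (1 / measure M A) *\<^sub>R (\<integral>x. indicator A x *\<^sub>R f x \<partial>M)"
    and "integrable (uniform_measure M A) f \<longleftrightarrow> integrable M (\<lambda>x. indicator A x *\<^sub>R f x)"
proof -
  have [measurable]: "A \<in> sets M" by fact
  have p: "0 < measure M A" using A by (simp add: measure_def enn2real_positive_iff less_top zero_less_iff_neq_zero)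
  have "indicator A x / emeasure M A = ennreal (1 / measure M A * indicator A x)" for x
  proof -
    have "emeasure M A = ennreal (measure M A)" using A by (simp add: emeasure_eq_ennreal_measure)
    then show ?thesis using p by (simp add: indicator_def divide_ennreal flip: ennreal_1)
  qed
  then have eq: "uniform_measure M A = density M (\<lambda>x. ennreal (1 / measure M A * indicator A x))"
    by (simp add: uniform_measure_def)
  have "(\<integral>x. f x \<partial>uniform_measure M A) = (\<integral>x. (1 / measure M A * indicator A x) *\<^sub>R f x \<partial>M)"
    unfolding eq using p by (subst integral_density) auto
  also have "\<dots> = (\<integral>x. (1 / measure M A) *\<^sub>R (indicator A x *\<^sub>R f x) \<partial>M)" by simp
  also have "\<dots> = (1 / measure M A) *\<^sub>R (\<integral>x. indicator A x *\<^sub>R f x \<partial>M)" by (rule integral_scaleR_right)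
  finally show "(\<integral>x. f x \<partial>uniform_measure M A) = (1 / measure M A) *\<^sub>R (\<integral>x. indicator A x *\<^sub>R f x \<partial>M)" .
  have "integrable (uniform_measure M A) f \<longleftrightarrow> integrable M (\<lambda>x. (1 / measure M A * indicator A x) *\<^sub>R f x)"
    unfolding eq using p by (subst integrable_density) auto
  also have "\<dots> \<longleftrightarrow> integrable M (\<lambda>x. (1 / measure M A) *\<^sub>R (indicator A x *\<^sub>R f x))" by simp
  also have "\<dots> \<longleftrightarrow> integrable M (\<lambda>x. indicator A x *\<^sub>R f x)"
  proof
    assume i: "integrable M (\<lambda>x. (1 / measure M A) *\<^sub>R (indicator A x *\<^sub>R f x))"
    have "integrable M (\<lambda>x. measure M A *\<^sub>R (1 / measure M A) *\<^sub>R (indicator A x *\<^sub>R f x))"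
      by (rule integrable_scaleR_right) (rule i)
    moreover have "measure M A *\<^sub>R (1 / measure M A) *\<^sub>R y = y" for y :: 'b using p by simp
    ultimately show "integrable M (\<lambda>x. indicator A x *\<^sub>R f x)" by (simp only:)
  qed (intro integrable_scaleR_right)
  finally show "integrable (uniform_measure M A) f \<longleftrightarrow> integrable M (\<lambda>x. indicator A x *\<^sub>R f x)" .
qed

lemma (in prob_space) char_gaussian_rv:
  assumes X: "gaussian_rv M X" and mean: "expectation X = 0"
  shows "(CLINT \<omega>|M. cis (X \<omega>)) = exp (- expectation (\<lambda>\<omega>. (X \<omega>)\<^sup>2) / 2)"
proof -
  have [measurable]: "X \<in> borel_measurable M" using X by (simp add: gaussian_rv_def)
  consider (const) \<mu> where "AE \<omega> in M. X \<omega> = \<mu>" | (normal) \<mu> \<sigma> where "0 < \<sigma>" "distributed M lborel X (normal_density \<mu> \<sigma>)"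
    using X by (auto simp: gaussian_rv_def)
  then show ?thesis
  proof cases
    case const
    have "expectation X = expectation (\<lambda>_. \<mu>)" using const by (intro integral_cong_AE) auto
    then have \<mu>: "\<mu> = 0" using mean prob_space by simp
    have "expectation (\<lambda>\<omega>. (X \<omega>)\<^sup>2) = expectation (\<lambda>_. 0)"
      using const unfolding \<mu> by (intro integral_cong_AE) (auto elim!: eventually_mono)
    moreover have "(CLINT \<omega>|M. cis (X \<omega>)) = (CLINT \<omega>|M. 1)"
      using const unfolding \<mu> by (intro integral_cong_AE) (auto simp: cis_conv_exp elim!: eventually_mono)
    ultimately show ?thesis using prob_space by simp
  next
    case normal
    have \<mu>: "\<mu> = 0" using normal_distributed_expectation[OF normal(1,2)] mean by simp
    have D: "distr M lborel X = density lborel (\<lambda>x. ennreal (normal_density 0 \<sigma> x))"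
      using normal(2) unfolding \<mu> by (simp add: distributed_def)
    have var: "expectation (\<lambda>\<omega>. (X \<omega>)\<^sup>2) = \<sigma>\<^sup>2"
      using normal_distributed_variance[OF normal(1) normal(2)] mean by simp
    have [measurable]: "cis \<in> borel_measurable borel" by (simp add: cis_conv_exp[abs_def])
    have "(CLINT \<omega>|M. cis (X \<omega>)) = (CLINT x|distr M lborel X. cis x)" by (rule integral_distr[symmetric]) auto
    also have "\<dots> = (CLINT x|lborel. normal_density 0 \<sigma> x *\<^sub>R cis x)" unfolding D by (rule integral_density) auto
    also have "\<dots> = \<sigma> *\<^sub>R (CLINT x|lborel. normal_density 0 \<sigma> (0 + \<sigma> * x) *\<^sub>R cis (0 + \<sigma> * x))"
      using normal(1) by (subst lborel_integral_real_affine[where c=\<sigma> and t=0]) auto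
    also have "\<dots> = (CLINT x|lborel. \<sigma> *\<^sub>R (normal_density 0 \<sigma> (0 + \<sigma> * x) *\<^sub>R cis (0 + \<sigma> * x)))"
      by (rule integral_scaleR_right[symmetric])
    also have "(\<lambda>x. \<sigma> *\<^sub>R (normal_density 0 \<sigma> (0 + \<sigma> * x) *\<^sub>R cis (0 + \<sigma> * x))) = (\<lambda>x. std_normal_density x *\<^sub>R iexp (\<sigma> * x))"
      using normal(1) by (auto simp: normal_density_def std_normal_density_def power_mult_distrib real_sqrt_mult cis_conv_exp)
    also have "(CLINT x|lborel. std_normal_density x *\<^sub>R iexp (\<sigma> * x)) = char std_normal_distribution \<sigma>"
      unfolding char_def by (rule integral_density[symmetric]) auto
    also have "\<dots> = exp (- \<sigma>\<^sup>2 / 2)" by (simp add: char_std_normal_distribution)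
    finally show ?thesis unfolding var .
  qed
qed

lemma abs_exp_diff_le: "\<bar>exp (- a) - exp (- b)\<bar> \<le> \<bar>a - b\<bar>" if "0 \<le> a" "0 \<le> b" for a b :: real
proof -
  have "\<bar>exp (- a) - exp (- b)\<bar> = norm (exp (complex_of_real (- a)) - exp (complex_of_real (- b)))"
    by (simp only: exp_of_real of_real_diff[symmetric] norm_of_real)
  also have "\<dots> \<le> norm (complex_of_real (- a) - complex_of_real (- b))"
    by (rule norm_exp_diff_le) (use that in auto)
  also have "\<dots> = \<bar>a - b\<bar>" by (simp only: of_real_diff[symmetric] norm_of_real)
  finally show ?thesis .
qed

lemma exp_neg_le_power16: "exp (- x) \<le> 1 / (1 + x / 16) ^ 16" if "0 \<le> x" for x :: real
proof -
  have "(1 + x / 16) ^ 16 \<le> exp (x / 16) ^ 16" using that by (intro power_mono exp_ge_add_one_self) auto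
  also have "\<dots> = exp x" using exp_of_nat_mult[of 16 "x / 16"] by simp
  finally have "1 / exp x \<le> 1 / (1 + x / 16) ^ 16"
    using that by (intro divide_left_mono mult_pos_pos zero_less_power) auto
  then show ?thesis by (simp only: exp_minus inverse_eq_divide)
qed

lemma power16_mono: "1 / (1 + a * u\<^sup>2) ^ 16 \<le> 1 / (1 + b * u\<^sup>2) ^ 16" if "0 \<le> b" "b \<le> a" for a b u :: real
proof -
  have "(1 + b * u\<^sup>2) ^ 16 \<le> (1 + a * u\<^sup>2) ^ 16" using that by (intro power_mono add_left_mono mult_right_mono) auto
  moreover have "0 < (1 + b * u\<^sup>2) ^ 16" using that by (intro zero_less_power add_pos_nonneg) auto
  ultimately show ?thesis by (intro divide_left_mono mult_pos_pos) auto
qed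

section \<open>Comparison of both processes with Rice's value\<close>

context smooth_kernel
begin

text \<open>The conclusion of \<open>window_decay\<close> with its two constants fixed: the limit
  process and all the shot noises must share them.\<close>

definition decaying :: "real \<Rightarrow> real \<Rightarrow> bool" where
  "decaying c' h0 \<longleftrightarrow> 0 < c' \<and> 0 < h0 \<and> h0 \<le> 1 \<and> (\<forall>t h \<theta> u v. 0 \<le> t \<longrightarrow> 0 < h \<longrightarrow> h \<le> h0 \<longrightarrow> t + h \<le> 1 \<longrightarrow>
     (norm (CLINT s|lborel. indicator {-1..1} s *\<^sub>R cis (phase t h \<theta> u v s)) / 2) ^ 16 * (1 + c' * u\<^sup>2) \<le> 1)"

lemma phase_scale: "phase t h \<theta> u v s * a = phase t h \<theta> (u * a) (v * a) s"
  by (simp add: phase_def algebra_simps)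

text \<open>Read off the second-order terms of the decay estimate at \<open>(\<epsilon> * u, \<epsilon> * v)\<close> as \<open>\<epsilon>\<close> tends to \<open>0\<close>.\<close>
lemma energy_lower_bound:
  assumes dec: "decaying c' h0" and t: "0 \<le> t" "0 < h" "h \<le> h0" "t + h \<le> 1" and \<theta>: "0 \<le> \<theta>" "\<theta> \<le> 1"
  shows "c' * u\<^sup>2 / 4 \<le> (LINT s|lborel. (phase t h \<theta> u v s)\<^sup>2)"
proof -
  let ?f = "phase t h \<theta> u v"
  define A where "A = (LINT s|lborel. (?f s)\<^sup>2)"
  have A0: "0 \<le> A" unfolding A_def by (rule integral_nonneg_AE) simp
  have c': "0 < c'" using dec by (simp add: decaying_def)
  have i2: "integrable lborel (\<lambda>s. (?f s)\<^sup>2)" by (rule phase_powers(1)[OF t(2) \<theta>])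
  have iI: "integrable lborel (indicator {-1..1} :: real \<Rightarrow> real)" by (intro integrable_real_indicator) auto
  have main: "c' * u\<^sup>2 \<le> 4 * A * (1 + c' * \<epsilon>\<^sup>2 * u\<^sup>2)" if \<epsilon>: "0 < \<epsilon>" "\<epsilon>\<^sup>2 * A \<le> 4" for \<epsilon>
  proof -
    define q where "q = norm (CLINT s|lborel. indicator {-1..1} s *\<^sub>R cis (?f s * \<epsilon>)) / 2"
    define y where "y = \<epsilon>\<^sup>2 * A / 4"
    have y: "0 \<le> y" "y \<le> 1" using A0 \<epsilon> by (auto simp: y_def)
    have ic: "integrable lborel (\<lambda>s. indicator {-1..1} s *\<^sub>R cis (?f s * \<epsilon>))"
      by (rule Bochner_Integration.integrable_bound[OF iI]) (auto simp: cis_conv_exp)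
    have icos: "integrable lborel (\<lambda>s. indicator {-1..1} s * cos (?f s * \<epsilon>))"
      by (rule Bochner_Integration.integrable_bound[OF iI]) (auto simp: abs_mult indicator_def)
    have "2 - \<epsilon>\<^sup>2 / 2 * A = (LINT s|lborel. indicator {-1..1} s - \<epsilon>\<^sup>2 / 2 * (?f s)\<^sup>2)"
      using i2 iI by (simp add: A_def)
    also have "\<dots> \<le> (LINT s|lborel. indicator {-1..1} s * cos (?f s * \<epsilon>))"
    proof (rule integral_mono[OF _ icos])
      show "integrable lborel (\<lambda>s. indicator {-1..1} s - \<epsilon>\<^sup>2 / 2 * (?f s)\<^sup>2)" using i2 iI by simp
      show "indicator {-1..1} s - \<epsilon>\<^sup>2 / 2 * (?f s)\<^sup>2 \<le> indicator {-1..1} s * cos (?f s * \<epsilon>)" for s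
        using one_minus_cos_le[of "?f s * \<epsilon>"] by (auto simp: indicator_def power_mult_distrib mult.commute)
    qed
    also have "\<dots> = Re (CLINT s|lborel. indicator {-1..1} s *\<^sub>R cis (?f s * \<epsilon>))"
      using integral_Re[OF ic] by simp
    also have "\<dots> \<le> 2 * q" using complex_Re_le_cmod by (simp add: q_def)
    \<comment> \<open>The cosine loses at most half the square of its argument. Bernoulli's
      inequality linearizes the 16th power, and the common factor \<open>\<epsilon>\<^sup>2\<close>
      then cancels.\<close>
    finally have "1 - y \<le> q" by (simp add: y_def)
    then have "(1 - y) ^ 16 \<le> q ^ 16" using y by (intro power_mono) auto
    moreover have "1 - 16 * y \<le> (1 - y) ^ 16" using Bernoulli_inequality[of "- y" 16] y by simp
    ultimately have "1 - 16 * y \<le> q ^ 16" by linarith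
    then have "(1 - 16 * y) * (1 + c' * (u * \<epsilon>)\<^sup>2) \<le> q ^ 16 * (1 + c' * (u * \<epsilon>)\<^sup>2)"
      using c' by (intro mult_right_mono) auto
    also have "\<dots> \<le> 1" unfolding q_def phase_scale using dec t by (simp add: decaying_def)
    finally have "c' * (u * \<epsilon>)\<^sup>2 \<le> 16 * y * (1 + c' * (u * \<epsilon>)\<^sup>2)" by (simp add: algebra_simps)
    moreover have "c' * (u * \<epsilon>)\<^sup>2 = \<epsilon>\<^sup>2 * (c' * u\<^sup>2)" "1 + c' * (u * \<epsilon>)\<^sup>2 = 1 + c' * \<epsilon>\<^sup>2 * u\<^sup>2"
      by (simp_all add: power_mult_distrib)
    moreover have "16 * y * Z = \<epsilon>\<^sup>2 * (4 * A * Z)" for Z by (simp add: y_def)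
    ultimately have "\<epsilon>\<^sup>2 * (c' * u\<^sup>2) \<le> \<epsilon>\<^sup>2 * (4 * A * (1 + c' * \<epsilon>\<^sup>2 * u\<^sup>2))"
      by metis
    then show ?thesis using \<epsilon> by simp
  qed
  have "((\<lambda>\<epsilon>. 4 * A * (1 + c' * \<epsilon>\<^sup>2 * u\<^sup>2)) \<longlongrightarrow> 4 * A * (1 + c' * 0\<^sup>2 * u\<^sup>2)) (at_right 0)"
    by (intro tendsto_intros)
  moreover have "\<forall>\<^sub>F \<epsilon> in at_right 0. c' * u\<^sup>2 \<le> 4 * A * (1 + c' * \<epsilon>\<^sup>2 * u\<^sup>2)"
  proof -
    have "((\<lambda>\<epsilon>. \<epsilon>\<^sup>2 * A) \<longlongrightarrow> 0\<^sup>2 * A) (at_right 0)" by (intro tendsto_intros)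
    then have "\<forall>\<^sub>F \<epsilon> in at_right 0. \<epsilon>\<^sup>2 * A < 4" by (rule order_tendstoD) simp
    with eventually_at_right_less[of "0::real"] show ?thesis by eventually_elim (rule main; simp)
  qed
  ultimately have "c' * u\<^sup>2 \<le> 4 * A * (1 + c' * 0\<^sup>2 * u\<^sup>2)" by (intro tendsto_lowerbound) auto
  then show ?thesis by (simp add: A_def)
qed

text \<open>The smallest rate that occurs: \<open>c' / 512\<close> for the conditioned shot noise,
  \<open>c' / 128\<close> for the increments of the limit process, and \<open>m0 / 32\<close> for
  the limiting normal law, where \<open>exp (- x)\<close> is bounded through the 16th power of
  \<open>1 + x / 16\<close>.\<close>

definition decay_const :: "real \<Rightarrow> real" where
  "decay_const c' = min (c' / 512) (m0 / 32)"

lemma decay_const_pos: "0 < decay_const c'" if "0 < c'"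
  using that moments_pos by (simp add: decay_const_def)

lemma exp_neg_decay:
  assumes "0 < c'"
  shows "exp (- (m0 * u\<^sup>2) / 2) \<le> 1 / (1 + decay_const c' * u\<^sup>2) ^ 16"
proof -
  have "exp (- (m0 * u\<^sup>2 / 2)) \<le> 1 / (1 + m0 * u\<^sup>2 / 2 / 16) ^ 16"
    by (rule exp_neg_le_power16) (use moments_pos in simp)
  also have "\<dots> = 1 / (1 + m0 / 32 * u\<^sup>2) ^ 16" by simp
  also have "\<dots> \<le> 1 / (1 + decay_const c' * u\<^sup>2) ^ 16"
    by (rule power16_mono) (use decay_const_pos[OF assms] in \<open>auto simp: decay_const_def\<close>)
  finally show ?thesis by simp
qed

text \<open>The bound \<open>L\<^sup>2\<close> holds as well; the factor 2 is room for the
  conditioned second moment, which is divided by a probability of at least 1/2.\<close>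

lemma m2_le: "m2 \<le> 2 * L\<^sup>2"
proof -
  have "m2 = (LINT x|lborel. \<bar>g1 x * g1 x\<bar>)" by (simp add: m2_def power2_eq_square)
  also have "\<dots> \<le> L * (LINT x|lborel. \<bar>g1 x\<bar>)" by (rule integrable_bounded_mult(2)[OF int1 _ L_bounds(6)]) measurable
  also have "\<dots> \<le> L * L" by (intro mult_left_mono L_bounds)
  finally show ?thesis by (simp add: power2_eq_square) (use zero_le_square[of L] in linarith)
qed

lemma phase_exp_close:
  assumes h: "0 < h" and \<theta>: "0 \<le> \<theta>" "\<theta> \<le> 1"
  shows "\<bar>exp (- (LINT s|lborel. (phase t h \<theta> u v s)\<^sup>2) / 2) - exp (- (m0 * u\<^sup>2 + m2 * v\<^sup>2) / 2)\<bar> \<le> L\<^sup>2 * h * (1 + \<bar>u\<bar> + \<bar>v\<bar>) ^ 3"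
proof -
  let ?E = "LINT s|lborel. (phase t h \<theta> u v s)\<^sup>2" and ?G = "m0 * u\<^sup>2 + m2 * v\<^sup>2"
  have "0 \<le> ?E" by (rule integral_nonneg_AE) simp
  moreover have "0 \<le> ?G" using moments_pos by simp
  ultimately have "\<bar>exp (- (?E / 2)) - exp (- (?G / 2))\<bar> \<le> \<bar>?E / 2 - ?G / 2\<bar>" by (intro abs_exp_diff_le) auto
  also have "\<dots> = \<bar>?E - ?G\<bar> / 2" by (simp flip: diff_divide_distrib)
  also have "\<dots> \<le> L\<^sup>2 * h * (\<bar>u\<bar> + \<bar>v\<bar>)\<^sup>2" using phase_energy[OF h \<theta>, of t u v] by simp
  also have "\<dots> \<le> L\<^sup>2 * h * (1 + \<bar>u\<bar> + \<bar>v\<bar>) ^ 3"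
  proof (intro mult_left_mono)
    have "(\<bar>u\<bar> + \<bar>v\<bar>)\<^sup>2 \<le> (1 + \<bar>u\<bar> + \<bar>v\<bar>)\<^sup>2" by (intro power_mono) auto
    also have "\<dots> \<le> (1 + \<bar>u\<bar> + \<bar>v\<bar>) ^ 3" by (intro power_increasing) auto
    finally show "(\<bar>u\<bar> + \<bar>v\<bar>)\<^sup>2 \<le> (1 + \<bar>u\<bar> + \<bar>v\<bar>) ^ 3" .
  qed (use h in simp)
  finally show ?thesis by (simp only: minus_divide_left[symmetric])
qed

text \<open>The covariance makes the variance of every combination of two values equal to the energy
  of the corresponding phase, so the characteristic function is known exactly. The lower bound for
  the energy, itself extracted from the decay of the window integral, yields the decay in
  \<open>u\<close>. With \<open>\<eta> = 0\<close> the upper and lower estimates coincide.\<close>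

lemma gaussian_mean_crossings:
  assumes B: "limit_gaussian_process P g B" and dec: "decaying c' h0"
  shows "mean_crossings P B \<alpha> {0..1} = ennreal (rice m0 m2 \<alpha>)"
proof -
  interpret P: prob_space P using B by (simp add: limit_gaussian_process_def)
  have gp: "gaussian_process P B" and cp: "centered_process P B" and "as_C1 P B" and ms: "mean_square_C1 P B"
    and cov: "\<And>t t'. covariance P (B t) (B t') = (LINT s|lborel. g (t - s) * g (t' - s))"
    using B by (auto simp: limit_gaussian_process_def)
  have B2: "integrable P (\<lambda>\<omega>. (B t \<omega>)\<^sup>2)" and [measurable]: "B t \<in> borel_measurable P" for t
    using ms by (auto simp: mean_square_C1_def square_integrable_rv_def)
  have B1: "integrable P (B t)" "P.expectation (B t) = 0" for t using cp by (auto simp: centered_process_def)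
  have BB: "integrable P (\<lambda>\<omega>. B t \<omega> * B s \<omega>)" "P.expectation (\<lambda>\<omega>. B t \<omega> * B s \<omega>) = (LINT x|lborel. g (t - x) * g (s - x))" for t s
  proof -
    show i: "integrable P (\<lambda>\<omega>. B t \<omega> * B s \<omega>)"
    proof (rule Bochner_Integration.integrable_bound)
      show "integrable P (\<lambda>\<omega>. (B t \<omega>)\<^sup>2 + (B s \<omega>)\<^sup>2)" by (intro Bochner_Integration.integrable_add B2)
      show "AE \<omega> in P. norm (B t \<omega> * B s \<omega>) \<le> norm ((B t \<omega>)\<^sup>2 + (B s \<omega>)\<^sup>2)"
      proof (rule AE_I2)
        fix \<omega>
        have "2 * \<bar>B t \<omega> * B s \<omega>\<bar> \<le> (B t \<omega>)\<^sup>2 + (B s \<omega>)\<^sup>2"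
          using sum_squares_bound[of "\<bar>B t \<omega>\<bar>" "\<bar>B s \<omega>\<bar>"] by (simp add: abs_mult)
        then show "norm (B t \<omega> * B s \<omega>) \<le> norm ((B t \<omega>)\<^sup>2 + (B s \<omega>)\<^sup>2)" by simp
      qed
    qed measurable
    show "P.expectation (\<lambda>\<omega>. B t \<omega> * B s \<omega>) = (LINT x|lborel. g (t - x) * g (s - x))"
      using cov[of t s] by (simp add: covariance_def B1)
  qed
  have W: "u * (B t \<omega> + \<theta> * (B (t + h) \<omega> - B t \<omega>)) + v * ((B (t + h) \<omega> - B t \<omega>) / h)
     = (u * (1 - \<theta>) - v / h) * B t \<omega> + (u * \<theta> + v / h) * B (t + h) \<omega>" for t h \<theta> u v \<omega>
    by (simp add: algebra_simps diff_divide_distrib)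
  have energy: "integrable P (\<lambda>\<omega>. ((u * (1 - \<theta>) - v / h) * B t \<omega> + (u * \<theta> + v / h) * B (t + h) \<omega>)\<^sup>2)"
     "P.expectation (\<lambda>\<omega>. ((u * (1 - \<theta>) - v / h) * B t \<omega> + (u * \<theta> + v / h) * B (t + h) \<omega>)\<^sup>2) = (LINT s|lborel. (phase t h \<theta> u v s)\<^sup>2)" for t h \<theta> u v
  proof -
    define a b where "a = u * (1 - \<theta>) - v / h" and "b = u * \<theta> + v / h"
    have sq: "(a * x + b * y)\<^sup>2 = a\<^sup>2 * (x * x) + (2 * a * b) * (x * y) + b\<^sup>2 * (y * y)" for x y :: real
      by (simp add: power2_eq_square algebra_simps)
    have gg: "integrable lborel (\<lambda>x. g (t - x) * g (s - x))" for t s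
      by (rule integrable_bounded_mult(1)[OF integrable_reflect(1)[OF int0] _ L_bounds(5)]) measurable
    show "integrable P (\<lambda>\<omega>. ((u * (1 - \<theta>) - v / h) * B t \<omega> + (u * \<theta> + v / h) * B (t + h) \<omega>)\<^sup>2)"
      unfolding a_def[symmetric] b_def[symmetric] sq by (intro Bochner_Integration.integrable_add integrable_mult_right BB)
    show "P.expectation (\<lambda>\<omega>. ((u * (1 - \<theta>) - v / h) * B t \<omega> + (u * \<theta> + v / h) * B (t + h) \<omega>)\<^sup>2) = (LINT s|lborel. (phase t h \<theta> u v s)\<^sup>2)"
      unfolding phase_def a_def[symmetric] b_def[symmetric] sq
      by (simp only: Bochner_Integration.integral_add Bochner_Integration.integrable_add integrable_mult_right integral_mult_right_zero BB gg)
  qed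
  have char: "(CLINT \<omega>|P. cis (u * (B t \<omega> + \<theta> * (B (t + h) \<omega> - B t \<omega>)) + v * ((B (t + h) \<omega> - B t \<omega>) / h)))
     = exp (- (LINT s|lborel. (phase t h \<theta> u v s)\<^sup>2) / 2)" if h: "0 < h" for t h \<theta> u v
  proof -
    let ?X = "\<lambda>\<omega>. (u * (1 - \<theta>) - v / h) * B t \<omega> + (u * \<theta> + v / h) * B (t + h) \<omega>"
    \<comment> \<open>The Gaussian property is stated for coefficients indexed by time;
      \<open>0 < h\<close> makes the two times distinct.\<close>
    let ?c = "\<lambda>s. if s = t then u * (1 - \<theta>) - v / h else u * \<theta> + v / h"
    have eq: "(\<lambda>\<omega>. \<Sum>s\<in>{t, t + h}. ?c s * B s \<omega>) = ?X" using h by simp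
    have "gaussian_rv P ?X"
      unfolding eq[symmetric] by (rule gp[unfolded gaussian_process_def, rule_format]) simp
    moreover have "P.expectation ?X = 0" using B1 by simp
    ultimately show ?thesis unfolding W energy(2)[symmetric] by (rule P.char_gaussian_rv)
  qed
  have D0: "exp (- (m0 * u\<^sup>2) / 2) \<le> 1 / (1 + decay_const c' * u\<^sup>2) ^ 16" for u
    by (rule exp_neg_decay) (use dec in \<open>simp add: decaying_def\<close>)
  \<comment> \<open>The slope is the combination with \<open>u = 0\<close>,
    \<open>\<theta> = 0\<close> and \<open>v = 1\<close>, so its second moment is the energy of that
    phase.\<close>
  have Veq: "(B (t + h) \<omega> - B t \<omega>) / h = (0 * (1 - 0) - 1 / h) * B t \<omega> + (0 * 0 + 1 / h) * B (t + h) \<omega>" for t h \<omega>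
    by (simp add: diff_divide_distrib)
  have h0: "0 < h0" "h0 \<le> 1" and c': "0 < c'" using dec by (auto simp: decaying_def)
  note N = P.mean_crossings_near_rice[where Y=B and K="2 * L\<^sup>2" and c="decay_const c'" and \<eta>=0 and L="L\<^sup>2" and \<alpha>=\<alpha>,
      OF _ _ moments_pos m2_le decay_const_pos[OF c'] order_refl _ h0 D0]
  have cont: "AE \<omega> in P. continuous_on {0..1} (\<lambda>t. B t \<omega>)"
    using \<open>as_C1 P B\<close> unfolding as_C1_def
    by eventually_elim (meson C1_differentiable_imp_continuous_on continuous_on_subset subset_UNIV)
  have V: "integrable P (\<lambda>\<omega>. ((B (t + h) \<omega> - B t \<omega>) / h)\<^sup>2)" "P.expectation (\<lambda>\<omega>. ((B (t + h) \<omega> - B t \<omega>) / h)\<^sup>2) \<le> 2 * L\<^sup>2" if "0 < h" for t h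
  proof -
    show "integrable P (\<lambda>\<omega>. ((B (t + h) \<omega> - B t \<omega>) / h)\<^sup>2)"
      unfolding Veq by (rule energy(1))
    have "P.expectation (\<lambda>\<omega>. ((B (t + h) \<omega> - B t \<omega>) / h)\<^sup>2) = (LINT s|lborel. (phase t h 0 0 1 s)\<^sup>2)"
      unfolding Veq by (rule energy(2))
    also have "\<dots> \<le> L\<^sup>2" using phase_powers(2)[OF that, of 0 t 0 1] by simp
    also have "\<dots> \<le> 2 * L\<^sup>2" by simp
    finally show "P.expectation (\<lambda>\<omega>. ((B (t + h) \<omega> - B t \<omega>) / h)\<^sup>2) \<le> 2 * L\<^sup>2" .
  qed
  have D: "norm (CLINT \<omega>|P. cis (u * (B t \<omega> + \<theta> * (B (t + h) \<omega> - B t \<omega>)) + v * ((B (t + h) \<omega> - B t \<omega>) / h)))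
      \<le> 1 / (1 + decay_const c' * u\<^sup>2) ^ 16"
    if t: "0 \<le> t" "0 < h" "h \<le> h0" "t + h \<le> 1" and \<theta>: "0 \<le> \<theta>" "\<theta> \<le> 1" for t h \<theta> u v
  proof -
    have c': "0 < c'" using dec by (simp add: decaying_def)
    have "norm (CLINT \<omega>|P. cis (u * (B t \<omega> + \<theta> * (B (t + h) \<omega> - B t \<omega>)) + v * ((B (t + h) \<omega> - B t \<omega>) / h)))
       = exp (- (LINT s|lborel. (phase t h \<theta> u v s)\<^sup>2) / 2)"
      unfolding char[OF t(2)] norm_of_real by simp
    also have "\<dots> \<le> exp (- (c' * u\<^sup>2 / 8))" using energy_lower_bound[OF dec t \<theta>, of u v] by simp
    also have "\<dots> \<le> 1 / (1 + c' * u\<^sup>2 / 8 / 16) ^ 16" by (rule exp_neg_le_power16) (use c' in simp)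
    also have "\<dots> = 1 / (1 + (c' / 128) * u\<^sup>2) ^ 16" by simp
    also have "\<dots> \<le> 1 / (1 + decay_const c' * u\<^sup>2) ^ 16"
      by (rule power16_mono) (use c' decay_const_pos[of c'] in \<open>auto simp: decay_const_def\<close>)
    finally show ?thesis .
  qed
  have close: "norm ((CLINT \<omega>|P. cis (u * (B t \<omega> + \<theta> * (B (t + h) \<omega> - B t \<omega>)) + v * ((B (t + h) \<omega> - B t \<omega>) / h)))
       - exp (- (m0 * u\<^sup>2 + m2 * v\<^sup>2) / 2)) \<le> (0 + L\<^sup>2 * h) * (1 + \<bar>u\<bar> + \<bar>v\<bar>) ^ 3"
    if t: "0 < h" and \<theta>: "0 \<le> \<theta>" "\<theta> \<le> 1" for t h \<theta> u v
    unfolding char[OF t] using phase_exp_close[OF t \<theta>, of t u v] by (simp only: of_real_diff[symmetric] norm_of_real add_0)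
  have "mean_crossings P B \<alpha> {0..1} \<le> ennreal (rice m0 m2 \<alpha> + rice_const (decay_const c') (2 * L\<^sup>2) * 0 powr (1/8))"
    by (rule N(2)) (use cont V D close in auto)
  moreover have "ennreal (rice m0 m2 \<alpha> - rice_const (decay_const c') (2 * L\<^sup>2) * 0 powr (1/8)) \<le> mean_crossings P B \<alpha> {0..1}"
    by (rule N(1)) (use cont V D close in auto)
  ultimately show ?thesis by simp
qed

text \<open>The general estimate is applied to the conditioned measure \<open>N\<close>. Decay holds
  because of the conditioning. Closeness is proved for \<open>M\<close> and transferred: with
  \<open>p\<close> the probability of the event, conditioning moves a characteristic function by at
  most \<open>2 * (1 - p)\<close>, which is at most \<open>4 / lam\<close>. Second moments are at
  most doubled.\<close>

lemma shot_noise_mean_crossings: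
  assumes ppp: "poisson_point_process M lam \<tau>" and lam_ge: "512 \<le> lam" and dec: "decaying c' h0"
  defines "E \<equiv> {\<omega> \<in> space M. num_points \<tau> {-1..1} \<omega> \<ge> ennreal lam}"
    and "\<epsilon> \<equiv> rice_const (decay_const c') (2 * L\<^sup>2) * (4 / lam + L ^ 3 / sqrt lam) powr (1/8)"
  shows "ennreal (rice m0 m2 \<alpha> - \<epsilon>) \<le> cond_mean_crossings M E (normalized_shot_noise M lam g \<tau>) \<alpha> {0..1}"
    and "cond_mean_crossings M E (normalized_shot_noise M lam g \<tau>) \<alpha> {0..1} \<le> ennreal (rice m0 m2 \<alpha> + \<epsilon>)"
proof -
  have lam0: "0 < lam" using lam_ge by simp
  interpret poisson_points M lam \<tau> by (unfold_locales) (use ppp lam0 in auto)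
  have E: "E = many_points" by (simp add: E_def many_points_def)
  have E_sets[measurable]: "E \<in> sets M" unfolding E by measurable
  define p where "p = prob E"
  have p: "1 - p \<le> 2 / lam" "1 / 2 \<le> p" "p \<le> 1"
  proof -
    show p1: "1 - p \<le> 2 / lam" using prob_many_points by (simp add: p_def E)
    have "2 / lam \<le> 2 / 4" using lam_ge by (intro divide_left_mono) auto
    then show "1 / 2 \<le> p" using p1 by simp
  qed (simp add: p_def)
  have E0: "emeasure M E \<noteq> 0" "emeasure M E \<noteq> \<infinity>" using p by (auto simp: emeasure_eq_measure p_def)
  define N where "N = uniform_measure M E"
  interpret N: prob_space N unfolding N_def by (rule prob_space_uniform_measure[OF E0])
  have Nm[measurable_cong]: "sets N = sets M" by (simp add: N_def)
  note intN = integral_uniform_measure[OF E_sets E0, folded N_def p_def]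
  have AE_N: "AE \<omega> in N. Q \<omega>" if "AE \<omega> in M. Q \<omega>" for Q
    unfolding N_def by (rule AE_uniform_measureI) (use that in auto)
  define Z where "Z = normalized_shot_noise M lam g \<tau>"
  define I where "I = (LINT s|lborel. g s)"
  have gt: "integrable lborel (\<lambda>s. g (t - s))" "(LINT s|lborel. g (t - s)) = I" for t
    using integrable_reflect[OF int0, of t] by (auto simp: I_def)
  have Zeq: "Z t \<omega> = (point_sum (\<lambda>s. g (t - s)) \<omega> - lam * I) / sqrt lam" for t \<omega>
    using expectation_point_sum(2)[OF gt(1)[of t]]
    by (simp add: Z_def normalized_shot_noise_def shot_noise_eq_point_sum gt)
  have Zm[measurable]: "Z t \<in> borel_measurable M" for t unfolding Zeq[abs_def] by measurable
  have Zm'[measurable]: "Z t \<in> borel_measurable N" for t by (simp add: measurable_cong_sets[OF Nm refl])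
  have lin: "AE \<omega> in M. u * (Z t \<omega> + \<theta> * (Z (t + h) \<omega> - Z t \<omega>)) + v * ((Z (t + h) \<omega> - Z t \<omega>) / h)
      = point_sum (\<lambda>s. phase t h \<theta> u v s / sqrt lam) \<omega> - lam * (LINT s|lborel. phase t h \<theta> u v s / sqrt lam)" if h: "0 < h" for t h \<theta> u v
  proof -
    define a b where "a = (u * (1 - \<theta>) - v / h) / sqrt lam" and "b = (u * \<theta> + v / h) / sqrt lam"
    have ph: "phase t h \<theta> u v s / sqrt lam = a * g (t - s) + b * g (t + h - s)" for s
      unfolding phase_def a_def b_def by (subst add_divide_distrib) (simp only: times_divide_eq_left)
    have Iab: "(LINT s|lborel. a * g (t - s) + b * g (t + h - s)) = (a + b) * I"
      using gt by (simp add: algebra_simps)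
    show ?thesis
      using AE_point_sum_add[OF gt(1)[of t] gt(1)[of "t + h"], of a b]
    proof eventually_elim
      case (elim \<omega>)
      have "u * (Z t \<omega> + \<theta> * (Z (t + h) \<omega> - Z t \<omega>)) + v * ((Z (t + h) \<omega> - Z t \<omega>) / h) = (u * (1 - \<theta>) - v / h) * Z t \<omega> + (u * \<theta> + v / h) * Z (t + h) \<omega>"
        by (simp add: algebra_simps diff_divide_distrib)
      also have "\<dots> = a * (point_sum (\<lambda>s. g (t - s)) \<omega> - lam * I) + b * (point_sum (\<lambda>s. g (t + h - s)) \<omega> - lam * I)"
        unfolding Zeq a_def b_def by simp
      finally show ?case unfolding ph Iab elim by (simp add: algebra_simps)
    qed
  qed
  have phi: "integrable lborel (\<lambda>s. phase t h \<theta> u v s / sqrt lam)" for t h \<theta> u v using phase_integrable(1) by simp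
  have pm: "(\<lambda>s. phase t h \<theta> u v s / sqrt lam) \<in> borel_measurable borel" for t h \<theta> u v by measurable
  have psm[measurable]: "point_sum (\<lambda>s. phase t h \<theta> u v s / sqrt lam) \<in> borel_measurable M" for t h \<theta> u v
    by (rule point_sum_measurable[OF pm])
  let ?W = "\<lambda>t h \<theta> u v \<omega>. u * (Z t \<omega> + \<theta> * (Z (t + h) \<omega> - Z t \<omega>)) + v * ((Z (t + h) \<omega> - Z t \<omega>) / h)"
  have charN: "(CLINT \<omega>|N. cis (?W t h \<theta> u v \<omega>)) = (1 / p) *\<^sub>R (CLINT \<omega>|M. indicator E \<omega> *\<^sub>R cis (?W t h \<theta> u v \<omega>))" for t h \<theta> u v
    by (rule intN(1)) (simp add: cis_conv_exp)
  have D: "norm (CLINT \<omega>|N. cis (?W t h \<theta> u v \<omega>)) \<le> 1 / (1 + decay_const c' * u\<^sup>2) ^ 16"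
    if t: "0 \<le> t" "0 < h" "h \<le> h0" "t + h \<le> 1" for t h \<theta> u v
  proof -
    define r where "r = lam * (LINT s|lborel. phase t h \<theta> u v s / sqrt lam)"
    define q where "q = norm (CLINT s|lborel. indicator {-1..1} s *\<^sub>R cis (phase t h \<theta> u v s / sqrt lam)) / 2"
    define K where "K = nat \<lceil>lam\<rceil>"
    \<comment> \<open>Of the \<open>K\<close> points, blocks of 16 give the factor
      \<open>1 / (1 + x)\<close> each, and 16 groups of \<open>n\<close> blocks are wanted for the
      outer power 16; hence 256. Rounding down costs less than a factor 2 once \<open>lam\<close> is
      at least 512, so \<open>n\<close> is at least \<open>lam / 512\<close>, and Bernoulli's
      inequality restores \<open>u\<^sup>2\<close> without \<open>lam\<close>.\<close>
    define n where "n = K div 256"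
    define x where "x = c' * u\<^sup>2 / lam"
    have c': "0 < c'" using dec by (simp add: decaying_def)
    have x0: "0 \<le> x" using c' lam0 by (simp add: x_def)
    have K: "lam \<le> real K" "real K < lam + 1" unfolding K_def using lam0 by linarith+
    have q0: "0 \<le> q" by (simp add: q_def)
    \<comment> \<open>The normalization by \<open>sqrt lam\<close> is moved into the frequencies,
      where the decay estimate holds uniformly; \<open>u\<^sup>2\<close> becomes
      \<open>u\<^sup>2 / lam\<close>.\<close>
    have q16: "q ^ 16 * (1 + x) \<le> 1"
    proof -
      have "(norm (CLINT s|lborel. indicator {-1..1} s *\<^sub>R cis (phase t h \<theta> (u * (1 / sqrt lam)) (v * (1 / sqrt lam)) s)) / 2) ^ 16 * (1 + c' * (u * (1 / sqrt lam))\<^sup>2) \<le> 1"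
        using dec t by (simp only: decaying_def)
      then show ?thesis using lam0 unfolding phase_scale[symmetric] by (simp add: q_def x_def power_divide)
    qed
    then have q16': "q ^ 16 \<le> 1 / (1 + x)" using x0 by (simp add: pos_le_divide_eq)
    have "1 / (1 + x) \<le> 1" using x0 by simp
    with q16' have "q ^ 16 \<le> 1" by linarith
    then have q1: "q \<le> 1" using q0 by (simp add: power_le_one_iff)
    have "norm (CLINT \<omega>|M. indicator E \<omega> *\<^sub>R cis (?W t h \<theta> u v \<omega>))
        = norm (CLINT \<omega>|M. (indicator E \<omega> *\<^sub>R cis (point_sum (\<lambda>s. phase t h \<theta> u v s / sqrt lam) \<omega>)) * cis (- r))"
    proof (intro arg_cong[where f=norm] integral_cong_AE)
      show "AE \<omega> in M. indicator E \<omega> *\<^sub>R cis (?W t h \<theta> u v \<omega>)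
          = (indicator E \<omega> *\<^sub>R cis (point_sum (\<lambda>s. phase t h \<theta> u v s / sqrt lam) \<omega>)) * cis (- r)"
        using lin[OF t(2), of u t \<theta> v] by eventually_elim (simp add: r_def cis_mult)
    qed (simp_all add: cis_conv_exp)
    also have "\<dots> = norm (CLINT \<omega>|M. indicator E \<omega> *\<^sub>R cis (point_sum (\<lambda>s. phase t h \<theta> u v s / sqrt lam) \<omega>))"
      unfolding integral_mult_left_zero by (simp add: norm_mult)
    also have "\<dots> \<le> p * q ^ K"
      unfolding p_def q_def E by (rule char_point_sum_many_points[OF phi K(2)])
    finally have "norm (CLINT \<omega>|N. cis (?W t h \<theta> u v \<omega>)) \<le> q ^ K"
      unfolding charN norm_scaleR using p by (simp add: field_simps)
    also have "\<dots> \<le> q ^ (16 * (n * 16))" using q0 q1 by (intro power_decreasing) (auto simp: n_def)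
    also have "\<dots> = (q ^ 16) ^ (n * 16)" by (rule power_mult)
    also have "\<dots> \<le> (1 / (1 + x)) ^ (n * 16)" using q16' q0 by (intro power_mono) auto
    also have "\<dots> = 1 / ((1 + x) ^ n) ^ 16" by (simp add: power_divide power_mult)
    also have "\<dots> \<le> 1 / (1 + (c' / 512) * u\<^sup>2) ^ 16"
    proof -
      have "K < 256 * n + 256" unfolding n_def using dividend_less_div_times[of 256 K] by (simp add: mult.commute)
      then have "real K < 256 * real n + 256" by linarith
      then have nl: "lam / 512 \<le> real n" using K lam_ge by simp
      have "1 + (c' / 512) * u\<^sup>2 = 1 + lam / 512 * x" using lam0 by (simp add: x_def)
      also have "\<dots> \<le> 1 + real n * x" using nl x0 by (intro add_left_mono mult_right_mono) auto
      also have "\<dots> \<le> (1 + x) ^ n" by (rule Bernoulli_inequality) (use x0 in simp)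
      finally have "(1 + (c' / 512) * u\<^sup>2) ^ 16 \<le> ((1 + x) ^ n) ^ 16"
        using c' by (intro power_mono) auto
      moreover have "0 < (1 + (c' / 512) * u\<^sup>2) ^ 16" using c' by (intro zero_less_power add_pos_nonneg) auto
      ultimately show ?thesis using x0 by (intro divide_left_mono mult_pos_pos) auto
    qed
    also have "\<dots> \<le> 1 / (1 + decay_const c' * u\<^sup>2) ^ 16"
      by (rule power16_mono) (use c' decay_const_pos[of c'] in \<open>auto simp: decay_const_def\<close>)
    finally show ?thesis .
  qed
  have close: "norm ((CLINT \<omega>|N. cis (?W t h \<theta> u v \<omega>)) - exp (- (m0 * u\<^sup>2 + m2 * v\<^sup>2) / 2))
      \<le> ((4 / lam + L ^ 3 / sqrt lam) + L\<^sup>2 * h) * (1 + \<bar>u\<bar> + \<bar>v\<bar>) ^ 3"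
    if h: "0 < h" and \<theta>: "0 \<le> \<theta>" "\<theta> \<le> 1" for t h \<theta> u v
  proof -
    let ?X = "\<lambda>\<omega>. cis (?W t h \<theta> u v \<omega>)" and ?f = "phase t h \<theta> u v"
    let ?w = "1 + \<bar>u\<bar> + \<bar>v\<bar>"
    have Xm[measurable]: "?X \<in> borel_measurable M" by (simp add: cis_conv_exp)
    have Xi: "integrable M ?X" by (rule integrable_cis) measurable
    have XE: "integrable M (\<lambda>\<omega>. indicator S \<omega> *\<^sub>R ?X \<omega>)" if [measurable]: "S \<in> sets M" for S
      by (rule integrable_mult_indicator[OF that Xi])
    have nXE: "norm (CLINT \<omega>|M. indicator S \<omega> *\<^sub>R ?X \<omega>) \<le> prob S" if S[measurable]: "S \<in> sets M" for S
    proof -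
      have "norm (CLINT \<omega>|M. indicator S \<omega> *\<^sub>R ?X \<omega>) \<le> (LINT \<omega>|M. norm (indicator S \<omega> *\<^sub>R ?X \<omega>))" by (rule integral_norm_bound)
      also have "\<dots> = (LINT \<omega>|M. indicator S \<omega>)" by (intro Bochner_Integration.integral_cong) auto
      finally show ?thesis by simp
    qed
    have split: "(CLINT \<omega>|M. ?X \<omega>) = (CLINT \<omega>|M. indicator E \<omega> *\<^sub>R ?X \<omega>) + (CLINT \<omega>|M. indicator (space M - E) \<omega> *\<^sub>R ?X \<omega>)"
      by (subst Bochner_Integration.integral_add[symmetric, OF XE XE]) (auto intro!: Bochner_Integration.integral_cong simp: indicator_def)
    have 1: "norm ((CLINT \<omega>|N. ?X \<omega>) - (CLINT \<omega>|M. ?X \<omega>)) \<le> 4 / lam"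
    proof -
      \<comment> \<open>On the event the weight changes from 1 to \<open>1 / p\<close>, off the
        event it drops to 0; each change has total mass \<open>1 - p\<close>.\<close>
      have "(CLINT \<omega>|N. ?X \<omega>) - (CLINT \<omega>|M. ?X \<omega>) = (1 / p - 1) *\<^sub>R (CLINT \<omega>|M. indicator E \<omega> *\<^sub>R ?X \<omega>) - (CLINT \<omega>|M. indicator (space M - E) \<omega> *\<^sub>R ?X \<omega>)"
        unfolding charN split by (simp add: scaleR_diff_left)
      also have "norm \<dots> \<le> (1 / p - 1) * p + (1 - p)"
      proof (rule order_trans[OF norm_triangle_ineq4], rule add_mono)
        have "0 \<le> 1 / p - 1" using p by simp
        then show "norm ((1 / p - 1) *\<^sub>R (CLINT \<omega>|M. indicator E \<omega> *\<^sub>R ?X \<omega>)) \<le> (1 / p - 1) * p"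
          using nXE[OF E_sets] by (simp add: p_def mult_left_mono)
        show "norm (CLINT \<omega>|M. indicator (space M - E) \<omega> *\<^sub>R ?X \<omega>) \<le> 1 - p"
          using nXE[of "space M - E"] by (simp add: p_def prob_compl)
      qed
      also have "\<dots> = 2 * (1 - p)" using p by (simp add: field_simps)
      finally show ?thesis using p(1) by simp
    qed
    have 2: "norm ((CLINT \<omega>|M. ?X \<omega>) - exp (- (LINT s|lborel. (?f s)\<^sup>2) / 2)) \<le> L ^ 3 / sqrt lam * ?w ^ 3"
    proof -
      have "(CLINT \<omega>|M. ?X \<omega>) = (CLINT \<omega>|M. cis (point_sum (\<lambda>s. ?f s / sqrt lam) \<omega> - lam * (LINT s|lborel. ?f s / sqrt lam)))"
      proof (rule integral_cong_AE)
        show "AE \<omega> in M. ?X \<omega> = cis (point_sum (\<lambda>s. ?f s / sqrt lam) \<omega> - lam * (LINT s|lborel. ?f s / sqrt lam))"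
          using lin[OF h, of u t \<theta> v] by eventually_elim (simp only:)
      qed (simp_all add: cis_conv_exp)
      then have "norm ((CLINT \<omega>|M. ?X \<omega>) - exp (- (LINT s|lborel. (?f s)\<^sup>2) / 2)) \<le> (LINT s|lborel. \<bar>?f s\<bar> ^ 3) / (6 * sqrt lam)"
        using char_point_sum_normal[OF phase_integrable(1) phase_powers(1)[OF h \<theta>] phase_powers(3)[OF h \<theta>]] by simp
      also have "\<dots> \<le> ((\<bar>u\<bar> + \<bar>v\<bar>) * L) ^ 3 / (1 * sqrt lam)"
        using phase_powers(4)[OF h \<theta>, of t u v] lam0 L_bounds(4) by (intro frac_le) auto
      also have "\<dots> = L ^ 3 / sqrt lam * (\<bar>u\<bar> + \<bar>v\<bar>) ^ 3" by (simp add: power_mult_distrib)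
      also have "\<dots> \<le> L ^ 3 / sqrt lam * ?w ^ 3" using L_bounds(4) lam0 by (intro mult_left_mono power_mono) auto
      finally show ?thesis .
    qed
    have 3: "norm (complex_of_real (exp (- (LINT s|lborel. (?f s)\<^sup>2) / 2)) - complex_of_real (exp (- (m0 * u\<^sup>2 + m2 * v\<^sup>2) / 2))) \<le> L\<^sup>2 * h * ?w ^ 3"
      using phase_exp_close[OF h \<theta>, of t u v] by (simp only: of_real_diff[symmetric] norm_of_real)
    have "1 \<le> ?w ^ 3" by (rule one_le_power) simp
    then have "4 / lam * 1 \<le> 4 / lam * ?w ^ 3" using lam0 by (intro mult_left_mono) auto
    then have 4: "4 / lam \<le> 4 / lam * ?w ^ 3" by simp
    have "norm ((CLINT \<omega>|N. ?X \<omega>) - exp (- (m0 * u\<^sup>2 + m2 * v\<^sup>2) / 2))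
        \<le> 4 / lam * ?w ^ 3 + (L ^ 3 / sqrt lam * ?w ^ 3 + L\<^sup>2 * h * ?w ^ 3)"
    proof -
      let ?a = "CLINT \<omega>|N. ?X \<omega>" and ?b = "CLINT \<omega>|M. ?X \<omega>" and ?c = "complex_of_real (exp (- (LINT s|lborel. (?f s)\<^sup>2) / 2))"
        and ?d = "complex_of_real (exp (- (m0 * u\<^sup>2 + m2 * v\<^sup>2) / 2))"
      have "norm (?a - ?d) \<le> norm (?a - ?b) + (norm (?b - ?c) + norm (?c - ?d))"
        using norm_triangle_ineq[of "?a - ?b" "?b - ?d"] norm_triangle_ineq[of "?b - ?c" "?c - ?d"] by simp
      then show ?thesis using 1 2 3 4 by linarith
    qed
    then show ?thesis by (simp only: distrib_right add.assoc)
  qed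
  have V: "integrable N (\<lambda>\<omega>. ((Z (t + h) \<omega> - Z t \<omega>) / h)\<^sup>2)" "N.expectation (\<lambda>\<omega>. ((Z (t + h) \<omega> - Z t \<omega>) / h)\<^sup>2) \<le> 2 * L\<^sup>2" if h: "0 < h" for t h
  proof -
    let ?V2 = "\<lambda>\<omega>. ((Z (t + h) \<omega> - Z t \<omega>) / h)\<^sup>2" and ?f = "\<lambda>s. phase t h 0 0 1 s / sqrt lam"
    let ?D = "\<lambda>\<omega>. point_sum ?f \<omega> - lam * (LINT s|lborel. ?f s)"
    have f2: "integrable lborel (\<lambda>s. (?f s)\<^sup>2)" using phase_powers(1)[OF h, of 0] by (simp add: power_divide)
    have eq: "AE \<omega> in M. ?V2 \<omega> = (?D \<omega>)\<^sup>2" using lin[OF h, of 0 t 0 1] by eventually_elim simp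
    note sm = second_moment_point_sum[OF phi f2]
    have iV: "integrable M ?V2"
      by (rule integrable_cong_AE_imp[OF sm(1)]) (use eq in auto)
    have "expectation ?V2 = expectation (\<lambda>\<omega>. (?D \<omega>)\<^sup>2)" using eq by (intro integral_cong_AE) auto
    also have "\<dots> \<le> lam * (LINT s|lborel. (?f s)\<^sup>2)" by (rule sm(2))
    also have "\<dots> = (LINT s|lborel. (phase t h 0 0 1 s)\<^sup>2)" using lam0 by (simp add: power_divide)
    also have "\<dots> \<le> L\<^sup>2" using phase_powers(2)[OF h, of 0 t 0 1] by simp
    finally have EV: "expectation ?V2 \<le> L\<^sup>2" .
    have iE: "integrable M (\<lambda>\<omega>. indicator E \<omega> *\<^sub>R ?V2 \<omega>)" by (rule integrable_mult_indicator[OF E_sets iV])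
    then show "integrable N ?V2" by (subst intN(2)) auto
    have "N.expectation ?V2 = (1 / p) *\<^sub>R expectation (\<lambda>\<omega>. indicator E \<omega> *\<^sub>R ?V2 \<omega>)" by (rule intN(1)) simp
    also have "\<dots> \<le> 2 * L\<^sup>2"
    proof -
      have "expectation (\<lambda>\<omega>. indicator E \<omega> *\<^sub>R ?V2 \<omega>) \<le> expectation ?V2"
        by (rule integral_mono[OF iE iV]) (auto simp: indicator_def)
      then have "expectation (\<lambda>\<omega>. indicator E \<omega> *\<^sub>R ?V2 \<omega>) \<le> L\<^sup>2" using EV by linarith
      moreover have "1 / p \<le> 2" using p by (simp add: field_simps)
      ultimately show ?thesis
        using p unfolding real_scaleR_def by (intro mult_mono) (auto intro!: integral_nonneg_AE)
    qed
    finally show "N.expectation ?V2 \<le> 2 * L\<^sup>2" .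
  qed
  have cont: "AE \<omega> in N. continuous_on {0..1} (\<lambda>t. Z t \<omega>)"
  proof (rule AE_N)
    show "AE \<omega> in M. continuous_on {0..1} (\<lambda>t. Z t \<omega>)"
      using AE_continuous_shot_noise[OF d0 cont(2) int0 int1]
    proof eventually_elim
      case (elim \<omega>)
      then show ?case unfolding Zeq shot_noise_eq_point_sum[symmetric] by (intro continuous_intros) (use lam0 in auto)
    qed
  qed
  have h0: "0 < h0" "h0 \<le> 1" and c': "0 < c'" using dec by (auto simp: decaying_def)
  have \<eta>: "0 \<le> 4 / lam + L ^ 3 / sqrt lam" using lam0 L_bounds(4) by simp
  note R = N.mean_crossings_near_rice[where Y=Z and K="2 * L\<^sup>2" and c="decay_const c'" and \<eta>="4 / lam + L ^ 3 / sqrt lam" and L="L\<^sup>2" and \<alpha>=\<alpha>,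
      OF cont Zm' moments_pos m2_le decay_const_pos[OF c'] \<eta> _ h0 exp_neg_decay[OF c']]
  have mc: "cond_mean_crossings M E (normalized_shot_noise M lam g \<tau>) \<alpha> {0..1} = mean_crossings N Z \<alpha> {0..1}"
    by (simp add: cond_mean_crossings_def N_def Z_def)
  show "ennreal (rice m0 m2 \<alpha> - \<epsilon>) \<le> cond_mean_crossings M E (normalized_shot_noise M lam g \<tau>) \<alpha> {0..1}"
    unfolding mc \<epsilon>_def by (rule R(1)) (use V D close in auto)
  show "cond_mean_crossings M E (normalized_shot_noise M lam g \<tau>) \<alpha> {0..1} \<le> ennreal (rice m0 m2 \<alpha> + \<epsilon>)"
    unfolding mc \<epsilon>_def by (rule R(2)) (use V D close in auto)
qed

end

section \<open>Uniform convergence in the level\<close>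

lemma uniform_limit_ennrealI:
  assumes bounds: "\<forall>\<^sub>F n in F. \<forall>x. ennreal (r x - e n) \<le> f n x \<and> f n x \<le> ennreal (r x + e n)"
    and e: "(e \<longlongrightarrow> 0) F" and r: "\<And>x. 0 \<le> r x"
  shows "uniform_limit_ennreal UNIV f (\<lambda>x. ennreal (r x)) F"
proof -
  have close: "f n x < \<infinity> \<and> \<bar>enn2real (f n x) - r x\<bar> \<le> \<bar>e n\<bar>"
    if b: "\<forall>x. ennreal (r x - e n) \<le> f n x \<and> f n x \<le> ennreal (r x + e n)" for n x
  proof -
    have fin: "f n x < \<infinity>" using b by (auto intro: le_less_trans[OF _ ennreal_less_top])
    define z where "z = enn2real (f n x)"
    have z: "f n x = ennreal z" "0 \<le> z" using fin by (simp_all add: z_def)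
    have "ennreal z \<le> ennreal (r x + \<bar>e n\<bar>)"
      unfolding z(1)[symmetric] by (rule order_trans[OF conjunct2[OF b[rule_format]]]) (simp add: ennreal_leI)
    moreover have "ennreal (r x - \<bar>e n\<bar>) \<le> ennreal z"
      unfolding z(1)[symmetric] by (rule order_trans[OF _ conjunct1[OF b[rule_format]]]) (simp add: ennreal_leI)
    moreover have "0 \<le> r x + \<bar>e n\<bar>" using r[of x] by simp
    \<comment> \<open>\<open>ennreal\<close> truncates negative numbers to 0, but a comparison can
      be read back in the reals whenever its larger side is nonnegative; the lower bound itself may
      be negative.\<close>
    ultimately have "z \<le> r x + \<bar>e n\<bar>" "r x - \<bar>e n\<bar> \<le> z" using z(2) by (simp_all only: ennreal_le_iff)
    then have "\<bar>z - r x\<bar> \<le> \<bar>e n\<bar>" by linarith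
    then show ?thesis using fin by (simp add: z_def)
  qed
  have "uniform_limit UNIV (\<lambda>n x. enn2real (f n x)) (\<lambda>x. enn2real (ennreal (r x))) F"
  proof (rule uniform_limitI)
    fix \<epsilon> :: real assume "0 < \<epsilon>"
    then have "\<forall>\<^sub>F n in F. \<bar>e n\<bar> < \<epsilon>" using e by (simp add: tendsto_iff)
    with bounds show "\<forall>\<^sub>F n in F. \<forall>x\<in>UNIV. dist (enn2real (f n x)) (enn2real (ennreal (r x))) < \<epsilon>"
    proof eventually_elim
      case (elim n)
      show ?case
      proof
        fix x
        show "dist (enn2real (f n x)) (enn2real (ennreal (r x))) < \<epsilon>"
          using close[OF elim(1), of x] elim(2) r[of x] by (simp add: dist_real_def)
      qed
    qed
  qed
  moreover have "\<forall>\<^sub>F n in F. \<forall>x. f n x < \<infinity>"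
    using bounds by eventually_elim (use close in blast)
  ultimately show ?thesis by (simp add: uniform_limit_ennreal_def)
qed

theorem theorem3:
  fixes g :: "real \<Rightarrow> real"
    and M :: "real \<Rightarrow> 'a measure" and \<tau> :: "real \<Rightarrow> nat \<Rightarrow> 'a \<Rightarrow> real"
    and P :: "'b measure" and B :: "real \<Rightarrow> 'b \<Rightarrow> real"
  assumes "class_C 4 g"
    and "integrable lborel g"
    and "integrable lborel (deriv g)"
    and "integrable lborel ((deriv ^^ 2) g)"
    and "\<And>s. s \<in> {-1..2} \<Longrightarrow> invertible (Phi g s)"
    and "\<And>s. s \<in> {-1..2} \<Longrightarrow> invertible (Phi' g s)"
    and "\<And>lam. lam > 0 \<Longrightarrow> poisson_point_process (M lam) lam (\<tau> lam)"
    and "limit_gaussian_process P g B"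
  shows "let m0 = (LINT s|lborel. (g s)\<^sup>2); m2 = (LINT s|lborel. (deriv g s)\<^sup>2) in
           uniform_limit_ennreal UNIV
             (\<lambda>lam \<alpha>. cond_mean_crossings (M lam)
                {\<omega> \<in> space (M lam). num_points (\<tau> lam) {-1..1} \<omega> \<ge> ennreal lam}
                (normalized_shot_noise (M lam) lam g (\<tau> lam)) \<alpha> {0..1})
             (\<lambda>\<alpha>. mean_crossings P B \<alpha> {0..1}) at_top \<and>
           (\<forall>\<alpha>. mean_crossings P B \<alpha> {0..1} =
              ennreal (1 / pi * sqrt (m2 / m0) * exp (- (\<alpha>\<^sup>2 / (2 * m0)))))"
proof -
  have d: "((deriv ^^ j) g has_real_derivative (deriv ^^ Suc j) g x) (at x)" if "j < 4" for j x
    using assms(1) that by (simp add: class_C_def DERIV_deriv_iff_field_differentiable)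
  interpret smooth_kernel g "deriv g" "(deriv ^^ 2) g" "(deriv ^^ 3) g" "(deriv ^^ 4) g"
  proof
    fix x
    show "(g has_real_derivative deriv g x) (at x)" using d[of 0] by simp
    show "(deriv g has_real_derivative (deriv ^^ 2) g x) (at x)" using d[of 1] by (simp add: eval_nat_numeral)
    show "((deriv ^^ 2) g has_real_derivative (deriv ^^ 3) g x) (at x)" using d[of 2] by (simp add: eval_nat_numeral)
    show "((deriv ^^ 3) g has_real_derivative (deriv ^^ 4) g x) (at x)" using d[of 3] by (simp add: eval_nat_numeral)
  next
    show "continuous_on UNIV ((deriv ^^ 4) g)" using assms(1) by (simp add: class_C_def)
    fix s :: real assume "s \<in> {-1..2}"
    then have "det (Phi g s) \<noteq> 0" using assms(5) by (simp add: invertible_det_nz)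
    then show "deriv g s * (deriv ^^ 3) g s - ((deriv ^^ 2) g s)\<^sup>2 \<noteq> 0"
      by (simp add: Phi_def det_2 power2_eq_square)
  qed (use assms in auto)
  \<comment> \<open>One pair of constants depending on \<open>g\<close> alone serves every
    \<open>lam\<close> and every \<open>\<alpha>\<close>; this is the source of the
    uniformity.\<close>
  obtain c h0 where dec: "decaying c h0" using window_decay unfolding decaying_def by blast
  have mc: "mean_crossings P B \<alpha> {0..1} = ennreal (rice m0 m2 \<alpha>)" for \<alpha>
    by (rule gaussian_mean_crossings[OF assms(8) dec])
  \<comment> \<open>An error of order \<open>lam\<close> to the power -1/16: the Gaussian
    approximation costs 1 / sqrt lam, the conditioning only 1 / lam, and the interpolation takes the
    eighth root.\<close>
  define e where "e lam = rice_const (decay_const c) (2 * L\<^sup>2) * (4 / lam + L ^ 3 / sqrt lam) powr (1/8)" for lam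
  have "((\<lambda>lam. (4 / lam + L ^ 3 / sqrt lam) powr (1/8)) \<longlongrightarrow> 0) at_top"
  proof (rule tendsto_zero_powrI)
    have "((\<lambda>lam. 4 / lam + L ^ 3 / sqrt lam) \<longlongrightarrow> 0 + 0) at_top"
      by (intro tendsto_add tendsto_divide_0[OF tendsto_const] filterlim_at_top_imp_at_infinity filterlim_ident sqrt_at_top)
    then show "((\<lambda>lam. 4 / lam + L ^ 3 / sqrt lam) \<longlongrightarrow> 0) at_top" by simp
    show "\<forall>\<^sub>F lam in at_top. 0 \<le> 4 / lam + L ^ 3 / sqrt lam"
      using eventually_gt_at_top[of 0] by eventually_elim (use L_bounds(4) in simp)
  qed auto
  then have "(e \<longlongrightarrow> 0) at_top" unfolding e_def[abs_def] by (rule tendsto_mult_right_zero)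
  moreover have "\<forall>\<^sub>F lam in at_top. \<forall>\<alpha>. ennreal (rice m0 m2 \<alpha> - e lam) \<le> cond_mean_crossings (M lam)
                {\<omega> \<in> space (M lam). num_points (\<tau> lam) {-1..1} \<omega> \<ge> ennreal lam}
                (normalized_shot_noise (M lam) lam g (\<tau> lam)) \<alpha> {0..1} \<and> cond_mean_crossings (M lam)
                {\<omega> \<in> space (M lam). num_points (\<tau> lam) {-1..1} \<omega> \<ge> ennreal lam}
                (normalized_shot_noise (M lam) lam g (\<tau> lam)) \<alpha> {0..1} \<le> ennreal (rice m0 m2 \<alpha> + e lam)"
    using eventually_ge_at_top[of 512]
  proof eventually_elim
    case (elim lam)
    then have "poisson_point_process (M lam) lam (\<tau> lam)" by (intro assms(7)) simp
    from shot_noise_mean_crossings[OF this elim dec] show ?case unfolding e_def by blast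
  qed
  moreover have "0 \<le> rice m0 m2 \<alpha>" for \<alpha> using moments_pos by (simp add: rice_def)
  ultimately have "uniform_limit_ennreal UNIV
             (\<lambda>lam \<alpha>. cond_mean_crossings (M lam)
                {\<omega> \<in> space (M lam). num_points (\<tau> lam) {-1..1} \<omega> \<ge> ennreal lam}
                (normalized_shot_noise (M lam) lam g (\<tau> lam)) \<alpha> {0..1})
             (\<lambda>\<alpha>. mean_crossings P B \<alpha> {0..1}) at_top"
    unfolding mc by (intro uniform_limit_ennrealI)
  moreover have "mean_crossings P B \<alpha> {0..1} = ennreal (1 / pi * sqrt (m2 / m0) * exp (- (\<alpha>\<^sup>2 / (2 * m0))))" for \<alpha>
    unfolding mc rice_eq[OF moments_pos] ..
  ultimately show ?thesis unfolding Let_def m0_def m2_def by blast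
qed

end
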